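(* Let $(M,g)$ be a connected, orientable, boundaryless, compact, $C^3$ Riemannian manifold of dimension $m$, and let $f:M\to\mathbb{R}$ be a zero mean, unit variance Gaussian process with a.s. $C^3$ sample paths, satisfying the standing assumptions listed in the context, and inducing the metric $g$, i.e. $g_x(X,Y)=\mathbb{E}\{(Xf)(x)\,(Yf)(x)\}$ for all $x\in M$ and $X,Y\in T_xM$. Let $f_1,f_2,\dots$ be independent copies of $f$, let $h^k(x)=\frac{1}{\sqrt{k}}(f_1(x),\dots,f_k(x))$ for $x\in M$ (a.s. an embedding of $M$ in $\mathbb{R}^k$ for all large enough $k$), and equip $h^k(M)$ with the Riemannian metric $g_E^k$ induced by the Euclidean metric of $\mathbb{R}^k$. Then, for each $0\le j\le m$, the Lipschitz-Killing curvatures satisfy $$\mathcal{L}_j(h^k(M))\ \longrightarrow\ \mathcal{L}_j(M)\qquad\text{almost surely, as } k\to\infty,$$ where $\mathcal{L}_j(M)$ is computed with respect to $g$ and $\mathcal{L}_j(h^k(M))$ with respect to $g_E^k$.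
   Context: Standing assumptions on $f$: the covariance function $C(x,y)=\mathbb{E}\{f(x)f(y)\}$ is positive definite on $M\times M$ (for distinct points $x_1,\dots,x_r$ the matrix $(C(x_a,x_b))_{a,b}$ is positive definite), $C(x,x)=1$ for all $x$, and $C$ is smooth enough that the sample paths of $f$ are a.s. $C^3$ on $M$. The joint distributions of $f$ and its derivatives are non-degenerate (at each $x\in M$, in local coordinates, $f(x)$ together with its first- and second-order partial derivatives at $x$ is a non-degenerate Gaussian vector). Lipschitz-Killing curvatures (LKCs): for a compact boundaryless $m$-dimensional Riemannian manifold $(M,g)$ and $0\le j\le m$, $$\mathcal{L}_j(M)=\begin{cases}\dfrac{(-2\pi)^{-(m-j)/2}}{\left(\frac{m-j}{2}\right)!}\displaystyle\int_M \mathrm{Tr}\big(R^{(m-j)/2}\big)\,\mathrm{Vol}_g & \text{if } m-j \text{ is even},\\[2mm] 0 & \text{if } m-j\text{ is odd.}\end{cases}$$ Here $\mathrm{Vol}_g$ is the volume form and $R$ is the Riemannian curvature tensor viewed as a double form of type $(2,2)$: $R((X,Y),(Z,W))=g(\nabla_X\nabla_YZ-\nabla_Y\nabla_XZ-\nabla_{[X,Y]}Z,\,W)$, with $\nabla$ the Levi-Civita connection (so on the unit sphere $R((e_1,e_2),(e_1,e_2))=-1$ for orthonormal $e_1,e_2$). A double form of type $(p,q)$ is a section of $\Lambda^p T^*M\otimes\Lambda^q T^*M$; products are determined by $(\alpha\otimes\beta)\cdot(\alpha'\otimes\beta')=(\alpha\wedge\alpha')\otimes(\beta\wedge\beta')$,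 where for a $p$-form $\alpha$ and an $r$-form $\alpha'$, $(\alpha\wedge\alpha')(u_1,\dots,u_{p+r})=\frac{1}{p!r!}\sum_\sigma \mathrm{sgn}(\sigma)\,\alpha(u_{\sigma(1)},\dots,u_{\sigma(p)})\,\alpha'(u_{\sigma(p+1)},\dots,u_{\sigma(p+r)})$. Powers are with respect to this product, with $R^0=1$. The trace of a type $(p,p)$ double form is $\mathrm{Tr}(\gamma)=\frac{1}{p!}\sum_{a_1,\dots,a_p=1}^m\gamma((e_{a_1},\dots,e_{a_p}),(e_{a_1},\dots,e_{a_p}))$ for an orthonormal basis $(e_a)$ of $T_xM$ (and $\mathrm{Tr}(\gamma)=\gamma$ if $p=0$). With these conventions $\mathcal{L}_m(M)$ is the volume and $\mathcal{L}_0(M)$ is the Euler characteristic. *)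

theory Defs
  imports "HOL-Analysis.Analysis" "HOL-Probability.Probability" "HOL-Combinatorics.Combinatorics"
begin

section \<open>Local differential calculus\<close>

fun Ck_on :: "nat \<Rightarrow> ('e::real_normed_vector \<Rightarrow> 'b::real_normed_vector) \<Rightarrow> 'e set \<Rightarrow> bool" where
  "Ck_on 0 f S \<longleftrightarrow> continuous_on S f"
| "Ck_on (Suc k) f S \<longleftrightarrow> (\<forall>x\<in>S. f differentiable (at x)) \<and>
     (\<forall>v. Ck_on k (\<lambda>x. frechet_derivative f (at x) v) S)"

definition partial :: "'m::finite \<Rightarrow> (real^'m \<Rightarrow> real) \<Rightarrow> real^'m \<Rightarrow> real" where
  "partial i f u = frechet_derivative f (at u) (axis i 1)"


section \<open>Double forms\<close>

text \<open>A double form of type (p,q) on a vector space is a real function of a p-tuple and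
  a q-tuple of vectors. Tuples are functions on \<open>nat\<close> of which only the
  values below p (respectively q) are used, so indices start at 0.\<close>

type_synonym 'v double_form = "(nat \<Rightarrow> 'v) \<Rightarrow> (nat \<Rightarrow> 'v) \<Rightarrow> real"

text \<open>Product of a form of type (p,q) with one of type (r,s): the wedge product, with factor
  1/(p! r!) resp. 1/(q! s!), in each of the two groups of arguments.\<close>

definition df_mult :: "nat \<Rightarrow> nat \<Rightarrow> nat \<Rightarrow> nat \<Rightarrow> 'v double_form \<Rightarrow> 'v double_form \<Rightarrow> 'v double_form" where
  "df_mult p q r s \<alpha> \<beta> = (\<lambda>u v.
     (\<Sum>\<sigma>\<in>{\<sigma>. \<sigma> permutes {..<p + r}}. \<Sum>\<tau>\<in>{\<tau>. \<tau> permutes {..<q + s}}.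
        of_int (sign \<sigma>) * of_int (sign \<tau>)
        * \<alpha> (\<lambda>i. u (\<sigma> i)) (\<lambda>i. v (\<tau> i))
        * \<beta> (\<lambda>i. u (\<sigma> (p + i))) (\<lambda>i. v (\<tau> (q + i))))
     / (fact p * fact r * fact q * fact s))"

primrec df_power :: "nat \<Rightarrow> 'v double_form \<Rightarrow> nat \<Rightarrow> 'v double_form" where
  "df_power p \<gamma> 0 = (\<lambda>u v. 1)"
| "df_power p \<gamma> (Suc n) = df_mult p p (p * n) (p * n) \<gamma> (df_power p \<gamma> n)"

definition df_trace :: "nat \<Rightarrow> ('m::finite \<Rightarrow> 'v) \<Rightarrow> 'v double_form \<Rightarrow> real" where
  "df_trace p e \<gamma> = (\<Sum>a\<in>{..<p} \<rightarrow>\<^sub>E (UNIV :: 'm set). \<gamma> (\<lambda>i. e (a i)) (\<lambda>i. e (a i))) / fact p"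


section \<open>Levi-Civita connection and curvature in coordinates\<close>

text \<open>Here \<open>G\<close> is the matrix-valued function of the metric coefficients on a coordinate domain.\<close>

definition metric_inner :: "real^'m^'m \<Rightarrow> real^'m \<Rightarrow> real^'m \<Rightarrow> real" where
  "metric_inner B v w = v \<bullet> (B *v w)"

definition christoffel :: "(real^'m \<Rightarrow> real^'m^'m) \<Rightarrow> 'm::finite \<Rightarrow> 'm \<Rightarrow> 'm \<Rightarrow> real^'m \<Rightarrow> real" where
  "christoffel G k i j u = (1/2) * (\<Sum>l\<in>UNIV. matrix_inv (G u) $ k $ l *
     (partial i (\<lambda>w. G w $ j $ l) u + partial j (\<lambda>w. G w $ i $ l) u
      - partial l (\<lambda>w. G w $ i $ j) u))"

definition covariant_deriv :: "(real^'m \<Rightarrow> real^'m^'m) \<Rightarrow> (real^'m \<Rightarrow> real^'m) \<Rightarrow>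
    (real^'m \<Rightarrow> real^'m) \<Rightarrow> real^'m::finite \<Rightarrow> real^'m" where
  "covariant_deriv G X Y u = frechet_derivative Y (at u) (X u)
     + (\<chi> k. \<Sum>i\<in>UNIV. \<Sum>j\<in>UNIV. christoffel G k i j u * X u $ i * Y u $ j)"

definition lie_bracket :: "(real^'m \<Rightarrow> real^'m) \<Rightarrow> (real^'m \<Rightarrow> real^'m) \<Rightarrow> real^'m::finite \<Rightarrow> real^'m" where
  "lie_bracket X Y u = frechet_derivative Y (at u) (X u) - frechet_derivative X (at u) (Y u)"

definition curvature_op :: "(real^'m \<Rightarrow> real^'m^'m) \<Rightarrow> (real^'m \<Rightarrow> real^'m) \<Rightarrow>
    (real^'m \<Rightarrow> real^'m) \<Rightarrow> (real^'m \<Rightarrow> real^'m) \<Rightarrow> real^'m::finite \<Rightarrow> real^'m" where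
  "curvature_op G X Y Z u =
     covariant_deriv G X (covariant_deriv G Y Z) u
     - covariant_deriv G Y (covariant_deriv G X Z) u
     - covariant_deriv G (lie_bracket X Y) Z u"

text \<open>The value of the curvature tensor on vectors at \<open>u\<close> does not depend on the fields extending
  them; the extensions with constant components are used.\<close>

definition riemann_form :: "(real^'m \<Rightarrow> real^'m^'m) \<Rightarrow> real^'m::finite \<Rightarrow> (real^'m) double_form" where
  "riemann_form G u = (\<lambda>X Z. metric_inner (G u)
     (curvature_op G (\<lambda>_. X 0) (\<lambda>_. X 1) (\<lambda>_. Z 0) u) (Z 1))"

definition orthonormal_basis :: "real^'m^'m \<Rightarrow> 'm::finite \<Rightarrow> real^'m" where
  "orthonormal_basis B = (SOME e. \<forall>i j. metric_inner B (e i) (e j) = (if i = j then 1 else 0))"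

definition curvature_trace :: "(real^'m \<Rightarrow> real^'m^'m) \<Rightarrow> nat \<Rightarrow> real^'m::finite \<Rightarrow> real" where
  "curvature_trace G n u =
     df_trace (2 * n) (orthonormal_basis (G u)) (df_power 2 (riemann_form G u) n)"


section \<open>Manifolds\<close>

text \<open>A chart is a domain together with a coordinate map, whose values outside the domain are
  irrelevant. All charts take values in open sets, so manifolds have no boundary.\<close>

type_synonym ('a, 'm) chart = "'a set \<times> ('a \<Rightarrow> real^'m)"

definition chart_of :: "'a topology \<Rightarrow> ('a, 'm::finite) chart \<Rightarrow> bool" where
  "chart_of M c \<longleftrightarrow> openin M (fst c) \<and> open (snd c ` fst c) \<and>
     homeomorphic_map (subtopology M (fst c)) (top_of_set (snd c ` fst c)) (snd c)"

definition param :: "('a, 'm::finite) chart \<Rightarrow> real^'m \<Rightarrow> 'a" where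
  "param c = inv_into (fst c) (snd c)"

definition transition :: "('a, 'm::finite) chart \<Rightarrow> ('a, 'm) chart \<Rightarrow> real^'m \<Rightarrow> real^'m" where
  "transition c c' = snd c' \<circ> param c"

definition C3_atlas :: "'a topology \<Rightarrow> ('a, 'm::finite) chart set \<Rightarrow> bool" where
  "C3_atlas M A \<longleftrightarrow> (\<forall>c\<in>A. chart_of M c) \<and> (\<Union>c\<in>A. fst c) = topspace M \<and>
     (\<forall>c\<in>A. \<forall>c'\<in>A. Ck_on 3 (transition c c') (snd c ` (fst c \<inter> fst c')))"

definition C3_manifold :: "'a topology \<Rightarrow> ('a, 'm::finite) chart set \<Rightarrow> bool" where
  "C3_manifold M A \<longleftrightarrow> Hausdorff_space M \<and> second_countable M \<and> C3_atlas M A"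

definition orientable :: "'a topology \<Rightarrow> ('a, 'm::finite) chart set \<Rightarrow> bool" where
  "orientable M A \<longleftrightarrow> (\<exists>B. C3_atlas M B \<and> C3_atlas M (A \<union> B) \<and>
     (\<forall>c\<in>B. \<forall>c'\<in>B. \<forall>u\<in>snd c ` (fst c \<inter> fst c').
        0 < det (matrix (frechet_derivative (transition c c') (at u)))))"

definition C3_fun :: "('a, 'm::finite) chart set \<Rightarrow> ('a \<Rightarrow> real) \<Rightarrow> bool" where
  "C3_fun A f \<longleftrightarrow> (\<forall>c\<in>A. Ck_on 3 (f \<circ> param c) (snd c ` fst c))"

definition charts_at :: "('a, 'm::finite) chart set \<Rightarrow> 'a \<Rightarrow> ('a, 'm) chart set" where
  "charts_at A x = {c\<in>A. x \<in> fst c}"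

text \<open>A tangent vector at \<open>x\<close> is given by its components in all charts around \<open>x\<close>, related by the
  Jacobians of the transition maps (and extended by 0 to the other charts).\<close>

type_synonym ('a, 'm) tangent = "('a, 'm) chart \<Rightarrow> real^'m"

definition tangent_space :: "('a, 'm::finite) chart set \<Rightarrow> 'a \<Rightarrow> ('a, 'm) tangent set" where
  "tangent_space A x = {X. (\<forall>c. c \<notin> charts_at A x \<longrightarrow> X c = 0) \<and>
     (\<forall>c\<in>charts_at A x. \<forall>c'\<in>charts_at A x.
        X c' = frechet_derivative (transition c c') (at (snd c x)) (X c))}"

definition coord_vector :: "('a, 'm::finite) chart set \<Rightarrow> 'a \<Rightarrow> ('a, 'm) chart \<Rightarrow> 'm \<Rightarrow> ('a, 'm) tangent" where
  "coord_vector A x c i = (\<lambda>c'. if c' \<in> charts_at A x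
     then frechet_derivative (transition c c') (at (snd c x)) (axis i 1) else 0)"

text \<open>The derivative \<open>Xf\<close> at \<open>x\<close> of a function along a tangent vector.\<close>

definition tangent_deriv :: "('a, 'm::finite) chart set \<Rightarrow> 'a \<Rightarrow> ('a, 'm) tangent \<Rightarrow> ('a \<Rightarrow> real) \<Rightarrow> real" where
  "tangent_deriv A x X f = (let c = (SOME c. c \<in> charts_at A x)
     in frechet_derivative (f \<circ> param c) (at (snd c x)) (X c))"


section \<open>Riemannian metrics and Lipschitz-Killing curvatures\<close>

type_synonym ('a, 'm) metric_tensor = "'a \<Rightarrow> ('a, 'm) tangent \<Rightarrow> ('a, 'm) tangent \<Rightarrow> real"

definition metric_coeff :: "('a, 'm::finite) chart set \<Rightarrow> ('a, 'm) metric_tensor \<Rightarrow> ('a, 'm) chart \<Rightarrow>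
    real^'m \<Rightarrow> real^'m^'m" where
  "metric_coeff A g c u = (\<chi> i j.
     g (param c u) (coord_vector A (param c u) c i) (coord_vector A (param c u) c j))"

text \<open>On a manifold with \<open>C\<^sup>3\<close> transition maps the coefficients of a metric can be at most \<open>C\<^sup>2\<close>
  in a chart-independent way.\<close>

definition riemannian_metric :: "'a topology \<Rightarrow> ('a, 'm::finite) chart set \<Rightarrow> ('a, 'm) metric_tensor \<Rightarrow> bool" where
  "riemannian_metric M A g \<longleftrightarrow>
     (\<forall>x\<in>topspace M.
        (\<forall>X\<in>tangent_space A x. \<forall>Y\<in>tangent_space A x. g x X Y = g x Y X) \<and>
        (\<forall>X\<in>tangent_space A x. \<forall>Y\<in>tangent_space A x. \<forall>Z\<in>tangent_space A x. \<forall>a b.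
           g x (\<lambda>c. a *\<^sub>R X c + b *\<^sub>R Y c) Z = a * g x X Z + b * g x Y Z) \<and>
        (\<forall>X\<in>tangent_space A x. X \<noteq> (\<lambda>_. 0) \<longrightarrow> 0 < g x X X)) \<and>
     (\<forall>c\<in>A. \<forall>i j. Ck_on 2 (\<lambda>u. metric_coeff A g c u $ i $ j) (snd c ` fst c))"

text \<open>For either orientation of \<open>M\<close>, integration of a function times the volume form is
  integration against the Borel measure with density \<open>sqrt (det g)\<close> in every chart.\<close>

definition volume_measure :: "'a topology \<Rightarrow> ('a, 'm::finite) chart set \<Rightarrow> ('a, 'm) metric_tensor \<Rightarrow> 'a measure" where
  "volume_measure M A g = (THE \<mu>. space \<mu> = topspace M \<and>
     sets \<mu> = sigma_sets (topspace M) {U. openin M U} \<and>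
     (\<forall>c\<in>A. \<forall>B\<in>sets \<mu>. B \<subseteq> fst c \<longrightarrow>
        emeasure \<mu> B = (\<integral>\<^sup>+ u \<in> snd c ` B. ennreal (sqrt (det (metric_coeff A g c u))) \<partial>lborel)))"

definition trace_curvature_power :: "('a, 'm::finite) chart set \<Rightarrow> ('a, 'm) metric_tensor \<Rightarrow> nat \<Rightarrow> 'a \<Rightarrow> real" where
  "trace_curvature_power A g n x = (let c = (SOME c. c \<in> charts_at A x)
     in curvature_trace (metric_coeff A g c) n (snd c x))"

definition LKC :: "'a topology \<Rightarrow> ('a, 'm::finite) chart set \<Rightarrow> ('a, 'm) metric_tensor \<Rightarrow> nat \<Rightarrow> real" where
  "LKC M A g j = (let m = CARD('m); n = (m - j) div 2 in
     if even (m - j)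
     then inverse ((- 2 * pi) ^ n) / fact n
          * (\<integral>x. trace_curvature_power A g n x \<partial>volume_measure M A g)
     else 0)"


section \<open>Submanifolds of Euclidean space\<close>

text \<open>\<open>R\<^sup>k\<close> is \<open>Euclidean_space k\<close>, the sequences vanishing from index k on. The atlas of an
  m-dimensional embedded \<open>C\<^sup>3\<close> submanifold \<open>S\<close> consists of the inverses of all \<open>C\<^sup>3\<close> immersions
  that are homeomorphisms of an open set of \<open>R\<^sup>m\<close> onto a relatively open subset of \<open>S\<close>.\<close>

definition submanifold_atlas :: "nat \<Rightarrow> (nat \<Rightarrow> real) set \<Rightarrow> (nat \<Rightarrow> real, 'm::finite) chart set" where
  "submanifold_atlas k S = {c. chart_of (subtopology (Euclidean_space k) S) c \<and>
     (\<forall>i<k. Ck_on 3 (\<lambda>u. param c u i) (snd c ` fst c)) \<and>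
     (\<forall>u\<in>snd c ` fst c. \<forall>v. v \<noteq> 0 \<longrightarrow>
        (\<exists>i<k. frechet_derivative (\<lambda>u. param c u i) (at u) v \<noteq> 0))}"

definition induced_metric :: "nat \<Rightarrow> (nat \<Rightarrow> real, 'm::finite) chart set \<Rightarrow> (nat \<Rightarrow> real, 'm) metric_tensor" where
  "induced_metric k A x X Y =
     (\<Sum>i<k. tangent_deriv A x X (\<lambda>y. y i) * tangent_deriv A x Y (\<lambda>y. y i))"

definition LKC_submanifold :: "'m::finite itself \<Rightarrow> nat \<Rightarrow> (nat \<Rightarrow> real) set \<Rightarrow> nat \<Rightarrow> real" where
  "LKC_submanifold _ k S j =
     (let A = (submanifold_atlas k S :: (nat \<Rightarrow> real, 'm) chart set)
      in LKC (subtopology (Euclidean_space k) S) A (induced_metric k A) j)"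

definition C3_embedding :: "'a topology \<Rightarrow> ('a, 'm::finite) chart set \<Rightarrow> nat \<Rightarrow> ('a \<Rightarrow> nat \<Rightarrow> real) \<Rightarrow> bool" where
  "C3_embedding M A k h \<longleftrightarrow> embedding_map M (Euclidean_space k) h \<and>
     (\<forall>i<k. C3_fun A (\<lambda>x. h x i)) \<and>
     (\<forall>x\<in>topspace M. \<forall>X\<in>tangent_space A x. X \<noteq> (\<lambda>_. 0) \<longrightarrow>
        (\<exists>i<k. tangent_deriv A x X (\<lambda>x. h x i) \<noteq> 0))"


section \<open>Gaussian processes\<close>

text \<open>A process is written \<open>f x \<omega>\<close>, with \<open>x\<close> the index.\<close>

definition nondegenerate_normal :: "'w measure \<Rightarrow> ('w \<Rightarrow> real) \<Rightarrow> bool" where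
  "nondegenerate_normal P X \<longleftrightarrow> (\<exists>\<mu> \<sigma>. 0 < \<sigma> \<and> distributed P lborel X (normal_density \<mu> \<sigma>))"

definition gaussian_rv :: "'w measure \<Rightarrow> ('w \<Rightarrow> real) \<Rightarrow> bool" where
  "gaussian_rv P X \<longleftrightarrow> nondegenerate_normal P X \<or>
     (X \<in> borel_measurable P \<and> (\<exists>\<mu>. AE \<omega> in P. X \<omega> = \<mu>))"

definition gaussian_process :: "'w measure \<Rightarrow> 'a set \<Rightarrow> ('a \<Rightarrow> 'w \<Rightarrow> real) \<Rightarrow> bool" where
  "gaussian_process P I f \<longleftrightarrow>
     (\<forall>J a. finite J \<and> J \<subseteq> I \<longrightarrow> gaussian_rv P (\<lambda>\<omega>. \<Sum>x\<in>J. a x * f x \<omega>))"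

definition covariance :: "'w measure \<Rightarrow> ('a \<Rightarrow> 'w \<Rightarrow> real) \<Rightarrow> 'a \<Rightarrow> 'a \<Rightarrow> real" where
  "covariance P f x y = (\<integral>\<omega>. f x \<omega> * f y \<omega> \<partial>P)"

definition positive_definite_kernel :: "'a set \<Rightarrow> ('a \<Rightarrow> 'a \<Rightarrow> real) \<Rightarrow> bool" where
  "positive_definite_kernel I C \<longleftrightarrow>
     (\<forall>J a. finite J \<and> J \<subseteq> I \<and> (\<exists>x\<in>J. a x \<noteq> 0) \<longrightarrow>
        0 < (\<Sum>x\<in>J. \<Sum>y\<in>J. a x * a y * C x y))"

text \<open>Derivatives of the sample paths exist only almost surely, hence are measurable only
  after completion of the probability measure; the functions of derivatives below are
  therefore considered on \<open>completion P\<close>.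

  Non-degeneracy of the vector consisting of \<open>f(x)\<close> and its first and second partial derivatives:
  every non-trivial linear combination is normal with positive variance. Each mixed second
  derivative is to be counted once, so the second-order coefficients form a symmetric matrix.\<close>

definition nondegenerate_jets :: "'w measure \<Rightarrow> ('a, 'm::finite) chart set \<Rightarrow> ('a \<Rightarrow> 'w \<Rightarrow> real) \<Rightarrow> bool" where
  "nondegenerate_jets P A f \<longleftrightarrow> (\<forall>c\<in>A. \<forall>u\<in>snd c ` fst c.
     \<forall>(a0::real) (a1::real^'m) (a2::real^'m^'m).
       transpose a2 = a2 \<and> \<not> (a0 = 0 \<and> a1 = 0 \<and> a2 = 0) \<longrightarrow>
       nondegenerate_normal (completion P) (\<lambda>\<omega>.
         let F = (\<lambda>w. f (param c w) \<omega>) in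
         a0 * F u + (\<Sum>i\<in>UNIV. a1 $ i * partial i F u)
         + (\<Sum>i\<in>UNIV. \<Sum>j\<in>UNIV. a2 $ i $ j * partial i (partial j F) u)))"

definition induces_metric :: "'w measure \<Rightarrow> 'a topology \<Rightarrow> ('a, 'm::finite) chart set \<Rightarrow>
    ('a \<Rightarrow> 'w \<Rightarrow> real) \<Rightarrow> ('a, 'm) metric_tensor \<Rightarrow> bool" where
  "induces_metric P M A f g \<longleftrightarrow>
     (\<forall>x\<in>topspace M. \<forall>X\<in>tangent_space A x. \<forall>Y\<in>tangent_space A x.
        g x X Y = (\<integral>\<omega>. tangent_deriv A x X (\<lambda>y. f y \<omega>) * tangent_deriv A x Y (\<lambda>y. f y \<omega>)
                     \<partial>completion P))"

definition random_path :: "'a set \<Rightarrow> ('a \<Rightarrow> 'w \<Rightarrow> real) \<Rightarrow> 'w \<Rightarrow> 'a \<Rightarrow> real" where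
  "random_path I f \<omega> = (\<lambda>x\<in>I. f x \<omega>)"

text \<open>Independent copies: jointly independent, as random elements of the product space, with
  the law of \<open>f\<close>. Since the law on the product space does not control sample path
  regularity, copies are to have \<open>C\<^sup>3\<close> paths almost surely as well.\<close>

definition independent_copies :: "'v measure \<Rightarrow> ('a \<Rightarrow> 'v \<Rightarrow> real) \<Rightarrow> 'a topology \<Rightarrow> ('a, 'm::finite) chart set \<Rightarrow>
    'w measure \<Rightarrow> (nat \<Rightarrow> 'a \<Rightarrow> 'w \<Rightarrow> real) \<Rightarrow> bool" where
  "independent_copies P f M A Q F \<longleftrightarrow>
     prob_space.indep_vars Q (\<lambda>_. PiM (topspace M) (\<lambda>_. borel))
       (\<lambda>n. random_path (topspace M) (F n)) UNIV \<and>
     (\<forall>n. distr Q (PiM (topspace M) (\<lambda>_. borel)) (random_path (topspace M) (F n))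
          = distr P (PiM (topspace M) (\<lambda>_. borel)) (random_path (topspace M) f)) \<and>
     (\<forall>n. AE \<omega> in Q. C3_fun A (\<lambda>x. F n x \<omega>))"

definition normalized_map :: "(nat \<Rightarrow> 'a \<Rightarrow> 'w \<Rightarrow> real) \<Rightarrow> nat \<Rightarrow> 'w \<Rightarrow> 'a \<Rightarrow> nat \<Rightarrow> real" where
  "normalized_map F k \<omega> x = (\<lambda>i. if i < k then F i x \<omega> / sqrt (real k) else 0)"

end

theory Submission
  imports Defs
begin

text \<open>The map \<open>x \<mapsto> f x\<close> is an isometric immersion of \<open>(M,g)\<close> into \<open>L\<^sup>2(P)\<close>, as the inclusion of \<open>h\<^sup>k(M)\<close> is
  one into \<open>R\<^sup>k = L\<^sup>2\<close> of counting measure. By the Gauss equation, in a chart the curvature is a continuous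
  function of the inner products of the first and second partial derivatives of the parametrisation, so
  the Lipschitz-Killing curvatures of both manifolds are integrals over the same subsets of \<open>R\<^sup>m\<close> of one
  continuous function of these inner products. The inner products for \<open>h\<^sup>k(M)\<close> are the averages
  of the products of derivatives of \<open>f\<^sub>1,\<dots>,f\<^sub>k\<close>, those for \<open>M\<close> are their expectations. The strong law of
  large numbers, made uniform on coordinate cubes by dyadic chaining, lets the integrands converge uniformly.
  The maps \<open>h\<^sup>k\<close> are eventually immersive and locally injective because their first derivatives are
  uniformly non-degenerate and their second derivatives uniformly bounded; distant points are separated
  because the covariance is positive definite.\<close>

section \<open>Curvature traces as functions of the Gauss equation data\<close>

text \<open>The copies share with \<open>f\<close> only its law on the product space, where
  derivatives of paths are not measurable. Limits of difference quotients are, and they agree with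
  the derivatives almost surely, up to completion of the measure. Differentiating expectations of
  products of derivatives of \<open>f\<close> would ordinarily call for domination; here an almost
  sure limit of variables from one Gaussian space is also a mean square limit. Functions on
  \<open>k\<close> points share this closure property, so a single calculus
  (\<open>L2_space\<close>) serves both manifolds.

  Curvature computed from the metric involves third derivatives of the parametrisation, but they
  cancel by antisymmetry, and the Gauss equation leaves products of derivatives of order at most
  two. The third derivatives then remain available as Lipschitz bounds in the chaining argument.

  Charts and orthonormal bases are picked by \<open>SOME\<close>, and the atlas of the image
  consists of all immersed charts. Traces and volumes must therefore be shown invariant under
  coordinate changes, for which mere twice differentiability has to suffice.\<close>

lemma metric_inner_eq: "metric_inner B v w = (\<Sum>i\<in>UNIV. \<Sum>j\<in>UNIV. v $ i * B $ i $ j * w $ j)"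
  by (simp add: metric_inner_def inner_vec_def matrix_vector_mult_def sum_distrib_left mult.assoc)

lemma bilinear_metric_inner: "bilinear (metric_inner B)"
  unfolding bilinear_def metric_inner_def
  by (auto intro!: linearI simp: inner_add_left inner_add_right matrix_vector_right_distrib
      matrix_vector_mult_scaleR)

definition pos_def :: "real^'m^'m \<Rightarrow> bool" where
  "pos_def B \<longleftrightarrow> transpose B = B \<and> (\<forall>v. v \<noteq> 0 \<longrightarrow> 0 < metric_inner B v v)"

lemma metric_inner_sym: "transpose B = B \<Longrightarrow> metric_inner B v w = metric_inner B w v"
  unfolding metric_inner_def
  by (metis dot_lmul_matrix inner_commute transpose_matrix_vector)

text \<open>Gram-Schmidt for \<open>metric_inner B\<close>, by induction on the index set. As long
  as an index is missing, the vectors found so far cannot span, and a vector outside their span has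
  a nonzero residual orthogonal to all of them.\<close>

lemma pos_def_orthonormal_subset:
  fixes B :: "real^'m^'m::finite" and I :: "'m set"
  assumes B: "pos_def B" and I: "finite I"
  shows "\<exists>e. \<forall>i\<in>I. \<forall>j\<in>I. metric_inner B (e i) (e j) = (if i = j then 1 else (0::real))"
  using I
proof (induction I rule: finite_induct)
  case empty
  then show ?case by simp
next
  case (insert k I)
  then obtain e where e: "\<And>i j. i \<in> I \<Longrightarrow> j \<in> I \<Longrightarrow> metric_inner B (e i) (e j) = (if i = j then 1 else 0)"
    by blast
  have "dim (e ` I) \<le> card (e ` I)"
    using insert by (intro dim_le_card') auto
  also have "\<dots> \<le> card I" using insert by (intro card_image_le) auto
  also have "\<dots> < CARD('m)"
    by (rule psubset_card_mono) (use insert in auto)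
  finally have "dim (span (e ` I)) < DIM(real^'m)" by simp
  then have "span (e ` I) \<noteq> UNIV" by (metis dim_UNIV less_irrefl)
  then obtain v where v: "v \<notin> span (e ` I)" by blast
  define w where "w = v - (\<Sum>i\<in>I. metric_inner B (e i) v *\<^sub>R e i)"
  have "w \<noteq> 0"
  proof
    assume "w = 0"
    then have "v = (\<Sum>i\<in>I. metric_inner B (e i) v *\<^sub>R e i)" by (simp add: w_def)
    also have "\<dots> \<in> span (e ` I)" by (intro span_sum span_scale span_base) auto
    finally show False using v by simp
  qed
  then have pos: "0 < metric_inner B w w" using B by (simp add: pos_def_def)
  have sym: "metric_inner B x y = metric_inner B y x" for x y
    using B by (intro metric_inner_sym) (simp add: pos_def_def)
  have lin: "linear (metric_inner B x)" for x
    using bilinear_metric_inner[of B] by (simp add: bilinear_def)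
  have linl: "linear (\<lambda>x. metric_inner B x y)" for y
    using bilinear_metric_inner[of B] by (simp add: bilinear_def)
  have orth: "metric_inner B (e j) w = 0" if "j \<in> I" for j
  proof -
    have "metric_inner B (e j) w = metric_inner B (e j) v
        - (\<Sum>i\<in>I. metric_inner B (e i) v * metric_inner B (e j) (e i))"
      by (simp add: w_def linear_diff[OF lin] linear_sum[OF lin] linear_scale[OF lin])
    also have "(\<Sum>i\<in>I. metric_inner B (e i) v * metric_inner B (e j) (e i))
        = (\<Sum>i\<in>I. if j = i then metric_inner B (e i) v else 0)"
      using that by (intro sum.cong) (auto simp: e)
    also have "\<dots> = metric_inner B (e j) v" using that insert by simp
    finally show ?thesis by simp
  qed
  define z where "z = (1 / sqrt (metric_inner B w w)) *\<^sub>R w"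
  have z1: "metric_inner B z z = 1"
    using pos by (simp add: z_def linear_scale[OF lin] linear_scale[OF linl])
  have z2: "metric_inner B (e j) z = 0" "metric_inner B z (e j) = 0" if "j \<in> I" for j
    using orth[OF that] sym[of w "e j"] by (simp_all add: z_def linear_scale[OF lin] linear_scale[OF linl])
  show ?case
    by (rule exI[of _ "e(k := z)"]) (use z1 z2 e insert.hyps in auto)
qed

lemma orthonormal_basis_works:
  fixes B :: "real^'m^'m::finite"
  assumes "pos_def B"
  shows "metric_inner B (orthonormal_basis B i) (orthonormal_basis B j) = (if i = j then 1 else 0)"
  using someI_ex[OF pos_def_orthonormal_subset[OF assms finite[of UNIV], simplified]]
  unfolding orthonormal_basis_def by blast

lemma orthonormal_matrix:
  fixes B :: "real^'m^'m::finite" and e :: "'m \<Rightarrow> real^'m"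
  assumes "\<And>i j. metric_inner B (e i) (e j) = (if i = j then 1 else 0)"
  defines "E \<equiv> (\<chi> i a. e a $ i)"
  shows "transpose E ** B ** E = mat 1"
proof -
  have "(\<Sum>k\<in>UNIV. \<Sum>n\<in>UNIV. e i $ n * B $ n $ k * e j $ k) = (if i = j then 1 else 0)" for i j
    by (subst sum.swap) (use assms(1)[of i j] in \<open>simp add: metric_inner_eq\<close>)
  then show ?thesis
    by (simp add: E_def vec_eq_iff matrix_matrix_mult_def transpose_def mat_def sum_distrib_right)
qed

lemma matrix_inv_eq:
  fixes A :: "real^'n^'n::finite"
  assumes "A ** B = mat 1"
  shows "matrix_inv A = B"
proof -
  have BA: "B ** A = mat 1" using assms by (simp add: matrix_left_right_inverse)
  then have "A ** matrix_inv A = mat 1"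
    unfolding matrix_inv_def using assms by (metis (mono_tags, lifting) someI_ex)
  then have "B ** A ** matrix_inv A = B" by (metis matrix_mul_assoc matrix_mul_rid)
  then show ?thesis by (simp add: BA matrix_mul_lid)
qed

lemma
  fixes A :: "real^'n^'n::finite"
  assumes "det A \<noteq> 0"
  shows matrix_inv_right_det: "A ** matrix_inv A = mat 1"
    and matrix_inv_left_det: "matrix_inv A ** A = mat 1"
proof -
  obtain B where "A ** B = mat 1"
    using assms invertible_det_nz[of A] unfolding invertible_def by blast
  then show "A ** matrix_inv A = mat 1" using matrix_inv_eq by metis
  then show "matrix_inv A ** A = mat 1" by (simp add: matrix_left_right_inverse)
qed

lemma orthonormal_det_pos:
  fixes B :: "real^'m^'m::finite"
  assumes "pos_def B"
  shows "0 < det B"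
proof -
  define E where "E = (\<chi> i a. orthonormal_basis B a $ i)"
  have "transpose E ** B ** E = mat 1"
    unfolding E_def by (rule orthonormal_matrix[OF orthonormal_basis_works[OF assms]])
  then have "det E * det B * det E = 1"
    by (metis det_I det_mul det_transpose)
  then have "(det E)\<^sup>2 * det B = 1" by (simp add: power2_eq_square mult_ac)
  then show ?thesis
    by (metis not_one_less_zero zero_le_power2 zero_less_mult_pos zero_less_one
        mult_zero_left le_less)
qed

text \<open>With the basis vectors as columns of \<open>E\<close>, orthonormality reads
  \<open>transpose E ** B ** E = mat 1\<close>; square factors may be rotated cyclically, so
  \<open>E ** transpose E\<close> inverts \<open>B\<close>. This is what removes the chosen basis
  from the trace.\<close>

lemma orthonormal_sum_matrix_inv:
  fixes B :: "real^'m^'m::finite" and e :: "'m \<Rightarrow> real^'m"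
  assumes "\<And>i j. metric_inner B (e i) (e j) = (if i = j then 1 else 0)"
  shows "(\<Sum>a\<in>UNIV. e a $ i * e a $ j) = matrix_inv B $ i $ j"
proof -
  define E where "E = (\<chi> i a. e a $ i)"
  have 1: "transpose E ** B ** E = mat 1"
    unfolding E_def by (rule orthonormal_matrix[OF assms])
  then have "E ** (transpose E ** B) = mat 1" by (simp add: matrix_left_right_inverse)
  then have "(E ** transpose E) ** B = mat 1" by (simp add: matrix_mul_assoc)
  then have "B ** (E ** transpose E) = mat 1" by (simp add: matrix_left_right_inverse)
  then have "matrix_inv B = E ** transpose E" by (rule matrix_inv_eq)
  then show ?thesis by (simp add: E_def matrix_matrix_mult_def transpose_def)
qed

section \<open>Multilinear forms and their traces in coordinates\<close>

definition multilinear :: "nat \<Rightarrow> ((nat \<Rightarrow> 'v::real_vector) \<Rightarrow> real) \<Rightarrow> bool" where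
  "multilinear p \<gamma> \<longleftrightarrow> (\<forall>s<p. \<forall>u. linear (\<lambda>x. \<gamma> (u(s := x)))) \<and>
     (\<forall>u u'. (\<forall>i<p. u i = u' i) \<longrightarrow> \<gamma> u = \<gamma> u')"

lemma multilinearD:
  "multilinear p \<gamma> \<Longrightarrow> s < p \<Longrightarrow> linear (\<lambda>x. \<gamma> (u(s := x)))"
  "multilinear p \<gamma> \<Longrightarrow> (\<And>i. i < p \<Longrightarrow> u i = u' i) \<Longrightarrow> \<gamma> u = \<gamma> u'"
  unfolding multilinear_def by blast+

lemma sum_PiE_lessThan_Suc:
  fixes F :: "(nat \<Rightarrow> 'm::finite) \<Rightarrow> real"
  shows "(\<Sum>b\<in>{..<Suc q} \<rightarrow>\<^sub>E UNIV. F b) = (\<Sum>b\<in>{..<q} \<rightarrow>\<^sub>E UNIV. \<Sum>x\<in>UNIV. F (b(q := x)))"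
proof -
  have "{..<Suc q} \<rightarrow>\<^sub>E (UNIV::'m set) = (\<lambda>(y, g). g(q := y)) ` (UNIV \<times> ({..<q} \<rightarrow>\<^sub>E UNIV))"
    by (simp add: lessThan_Suc PiE_insert_eq)
  moreover have "inj_on (\<lambda>(y, g). g(q := y)) (UNIV \<times> ({..<q} \<rightarrow>\<^sub>E (UNIV::'m set)))"
    using inj_combinator[of q "{..<q}" "\<lambda>_. UNIV::'m set"] by simp
  ultimately have "(\<Sum>b\<in>{..<Suc q} \<rightarrow>\<^sub>E UNIV. F b)
      = (\<Sum>z\<in>(UNIV::'m set) \<times> ({..<q} \<rightarrow>\<^sub>E UNIV). F ((snd z)(q := fst z)))"
    by (simp add: sum.reindex comp_def case_prod_unfold)
  also have "\<dots> = (\<Sum>x\<in>UNIV. \<Sum>b\<in>{..<q} \<rightarrow>\<^sub>E UNIV. F (b(q := x)))"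
    by (simp add: sum.cartesian_product case_prod_beta)
  also have "\<dots> = (\<Sum>b\<in>{..<q} \<rightarrow>\<^sub>E UNIV. \<Sum>x\<in>UNIV. F (b(q := x)))"
    by (rule sum.swap)
  finally show ?thesis .
qed

text \<open>Induction on \<open>q\<close>: the first \<open>q\<close> arguments have been expanded
  in the standard basis, the others are still those of \<open>u\<close>. At \<open>q = p\<close> the
  entries of the tuple from \<open>p\<close> on are irrelevant by the second clause of
  \<open>multilinear\<close>.\<close>

lemma multilinear_expand:
  fixes \<gamma> :: "(nat \<Rightarrow> real^'m::finite) \<Rightarrow> real"
  assumes "multilinear p \<gamma>"
  shows "\<gamma> u = (\<Sum>b\<in>{..<p} \<rightarrow>\<^sub>E UNIV. (\<Prod>s<p. u s $ b s) * \<gamma> (\<lambda>s. axis (b s) 1))"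
proof -
  have "q \<le> p \<Longrightarrow> \<gamma> u = (\<Sum>b\<in>{..<q} \<rightarrow>\<^sub>E UNIV. (\<Prod>s<q. u s $ b s) *
      \<gamma> (\<lambda>s. if s < q then axis (b s) 1 else u s))" for q
  proof (induction q)
    case 0
    then show ?case by simp
  next
    case (Suc q)
    have "\<gamma> (\<lambda>s. if s < q then axis (b s) 1 else u s) =
       (\<Sum>x\<in>UNIV. u q $ x * \<gamma> (\<lambda>s. if s < Suc q then axis ((b(q := x)) s) 1 else u s))" for b
    proof -
      let ?w = "\<lambda>s. if s < q then axis (b s) 1 else u s"
      have lin: "linear (\<lambda>x. \<gamma> (?w(q := x)))"
        using multilinearD(1)[OF assms, of q] Suc by simp
      have "\<gamma> ?w = \<gamma> (?w(q := u q))"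
        by (rule arg_cong[where f = \<gamma>]) auto
      also have "u q = (\<Sum>x\<in>UNIV. u q $ x *\<^sub>R axis x 1)"
        using basis_expansion[of "u q"] by (simp add: scalar_mult_eq_scaleR)
      also have "\<gamma> (?w(q := \<dots>)) = (\<Sum>x\<in>UNIV. u q $ x * \<gamma> (?w(q := axis x 1)))"
        by (simp add: linear_sum[OF lin] linear_scale[OF lin])
      also have "(\<lambda>x. \<gamma> (?w(q := axis x 1)))
          = (\<lambda>x. \<gamma> (\<lambda>s. if s < Suc q then axis ((b(q := x)) s) 1 else u s))"
        by (intro ext arg_cong[where f = \<gamma>]) (auto simp: less_Suc_eq)
      finally show ?thesis .
    qed
    note step = this
    have "\<gamma> u = (\<Sum>b\<in>{..<q} \<rightarrow>\<^sub>E UNIV. (\<Prod>s<q. u s $ b s) *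
      \<gamma> (\<lambda>s. if s < q then axis (b s) 1 else u s))"
      using Suc by simp
    also have "\<dots> = (\<Sum>b\<in>{..<q} \<rightarrow>\<^sub>E UNIV. \<Sum>x\<in>UNIV. (\<Prod>s<Suc q. u s $ ((b(q := x)) s)) *
      \<gamma> (\<lambda>s. if s < Suc q then axis ((b(q := x)) s) 1 else u s))"
      by (subst step) (simp add: sum_distrib_left mult_ac)
    also have "\<dots> = (\<Sum>b\<in>{..<Suc q} \<rightarrow>\<^sub>E UNIV. (\<Prod>s<Suc q. u s $ b s) *
      \<gamma> (\<lambda>s. if s < Suc q then axis (b s) 1 else u s))"
      by (rule sum_PiE_lessThan_Suc[symmetric])
    finally show ?case .
  qed
  from this[of p] have "\<gamma> u = (\<Sum>b\<in>{..<p} \<rightarrow>\<^sub>E UNIV. (\<Prod>s<p. u s $ b s) *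
      \<gamma> (\<lambda>s. if s < p then axis (b s) 1 else u s))" by simp
  also have "\<dots> = (\<Sum>b\<in>{..<p} \<rightarrow>\<^sub>E UNIV. (\<Prod>s<p. u s $ b s) * \<gamma> (\<lambda>s. axis (b s) 1))"
    by (intro sum.cong refl arg_cong2[where f = "(*)"] multilinearD(2)[OF assms]) auto
  finally show ?thesis .
qed

lemma multilinear_mult:
  assumes "multilinear p \<alpha>" "multilinear r \<beta>"
  shows "multilinear (p + r) (\<lambda>u. \<alpha> u * \<beta> (\<lambda>i. u (p + i)))"
  unfolding multilinear_def
proof (intro conjI allI impI)
  fix s u assume s: "s < p + r"
  show "linear (\<lambda>x. \<alpha> (u(s := x)) * \<beta> (\<lambda>i. (u(s := x)) (p + i)))"
  proof (cases "s < p")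
    case True
    then have "(\<lambda>x. \<alpha> (u(s := x)) * \<beta> (\<lambda>i. (u(s := x)) (p + i))) =
       (\<lambda>x. \<beta> (\<lambda>i. u (p + i)) *\<^sub>R \<alpha> (u(s := x)))" by auto
    then show ?thesis
      using linear_compose_scale_right[OF multilinearD(1)[OF assms(1) True]] by (simp only:)
  next
    case False
    then obtain t where t: "s = p + t" "t < r"
      using s by (metis add_diff_inverse_nat nat_add_left_cancel_less)
    have "\<alpha> (u(s := x)) = \<alpha> u" for x by (rule multilinearD(2)[OF assms(1)]) (use t in auto)
    moreover have "(\<lambda>i. (u(s := x)) (p + i)) = (\<lambda>i. u (p + i))(t := x)" for x
      using t by auto
    ultimately have "(\<lambda>x. \<alpha> (u(s := x)) * \<beta> (\<lambda>i. (u(s := x)) (p + i)))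
       = (\<lambda>x. \<alpha> u *\<^sub>R \<beta> ((\<lambda>i. u (p + i))(t := x)))" by (simp only: real_scaleR_def)
    then show ?thesis
      using linear_compose_scale_right[OF multilinearD(1)[OF assms(2) t(2)]] by (simp only:)
  qed
next
  fix u u' :: "nat \<Rightarrow> 'a" assume "\<forall>i<p + r. u i = u' i"
  then have "\<alpha> u = \<alpha> u'" "\<beta> (\<lambda>i. u (p + i)) = \<beta> (\<lambda>i. u' (p + i))"
    by (auto intro!: multilinearD(2)[OF assms(1)] multilinearD(2)[OF assms(2)])
  then show "\<alpha> u * \<beta> (\<lambda>i. u (p + i)) = \<alpha> u' * \<beta> (\<lambda>i. u' (p + i))" by simp
qed

lemma multilinear_permute:
  fixes \<gamma> :: "(nat \<Rightarrow> 'v::real_vector) \<Rightarrow> real"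
  assumes "multilinear n \<gamma>" "\<sigma> permutes {..<n}"
  shows "multilinear n (\<lambda>u. \<gamma> (\<lambda>i. u (\<sigma> i)))"
  unfolding multilinear_def
proof (intro conjI allI impI)
  fix s and u :: "nat \<Rightarrow> 'v" assume s: "s < n"
  have "(\<lambda>i. (u(s := x)) (\<sigma> i)) = (\<lambda>i. u (\<sigma> i))(inv \<sigma> s := x)" for x
    using permutes_inverses[OF assms(2)] by (auto simp: fun_eq_iff)
  moreover have "inv \<sigma> s < n" using s permutes_in_image[OF permutes_inv[OF assms(2)], of s] by simp
  ultimately show "linear (\<lambda>x. \<gamma> (\<lambda>i. (u(s := x)) (\<sigma> i)))"
    using multilinearD(1)[OF assms(1)] by simp
next
  fix u u' :: "nat \<Rightarrow> 'v" assume u: "\<forall>i<n. u i = u' i"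
  show "\<gamma> (\<lambda>i. u (\<sigma> i)) = \<gamma> (\<lambda>i. u' (\<sigma> i))"
    by (rule multilinearD(2)[OF assms(1)]) (use u permutes_in_image[OF assms(2)] in auto)
qed

lemma multilinear_sum:
  assumes "\<And>i. i \<in> I \<Longrightarrow> multilinear n (\<gamma> i)"
  shows "multilinear n (\<lambda>u. \<Sum>i\<in>I. \<gamma> i u)"
  unfolding multilinear_def
proof (intro conjI allI impI)
  fix s u assume s: "s < n"
  show "linear (\<lambda>x. \<Sum>i\<in>I. \<gamma> i (u(s := x)))"
    using multilinearD(1)[OF assms s] by (intro linear_compose_sum) auto
qed (auto intro!: sum.cong multilinearD(2)[OF assms])

lemma multilinear_cmult:
  assumes "multilinear n \<gamma>"
  shows "multilinear n (\<lambda>u. c * \<gamma> u)"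
  unfolding multilinear_def
proof (intro conjI allI impI)
  fix s u assume s: "s < n"
  show "linear (\<lambda>x. c * \<gamma> (u(s := x)))"
    using linear_compose_scale_right[OF multilinearD(1)[OF assms s], of c] by simp
qed (auto intro!: multilinearD(2)[OF assms])

definition multilinear2 :: "nat \<Rightarrow> nat \<Rightarrow> ('v::real_vector) double_form \<Rightarrow> bool" where
  "multilinear2 p q \<gamma> \<longleftrightarrow> (\<forall>v. multilinear p (\<lambda>u. \<gamma> u v)) \<and> (\<forall>u. multilinear q (\<gamma> u))"

lemma multilinear2_mult:
  assumes "multilinear2 p q \<alpha>" "multilinear2 r s \<beta>"
  shows "multilinear2 (p + r) (q + s) (df_mult p q r s \<alpha> \<beta>)"
  unfolding multilinear2_def
proof (intro conjI allI)
  fix v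
  have "multilinear (p + r) (\<lambda>u. (1 / (fact p * fact r * fact q * fact s)) *
     (\<Sum>\<sigma>\<in>{\<sigma>. \<sigma> permutes {..<p + r}}. \<Sum>\<tau>\<in>{\<tau>. \<tau> permutes {..<q + s}}.
        (of_int (sign \<sigma>) * of_int (sign \<tau>))
        * (\<alpha> (\<lambda>i. u (\<sigma> i)) (\<lambda>i. v (\<tau> i))
        * \<beta> (\<lambda>i. u (\<sigma> (p + i))) (\<lambda>i. v (\<tau> (q + i))))))"
    using assms unfolding multilinear2_def
    by (intro multilinear_cmult multilinear_sum)
      (auto intro!: multilinear_permute[OF multilinear_mult[of p "\<lambda>u. \<alpha> u (\<lambda>i. v (\<tau> i))" r
         "\<lambda>u. \<beta> u (\<lambda>i. v (\<tau> (q + i)))" for \<tau>]])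
  then show "multilinear (p + r) (\<lambda>u. df_mult p q r s \<alpha> \<beta> u v)"
    by (simp add: df_mult_def mult.assoc divide_simps)
next
  fix u
  have "multilinear (q + s) (\<lambda>v. (1 / (fact p * fact r * fact q * fact s)) *
     (\<Sum>\<sigma>\<in>{\<sigma>. \<sigma> permutes {..<p + r}}. \<Sum>\<tau>\<in>{\<tau>. \<tau> permutes {..<q + s}}.
        (of_int (sign \<sigma>) * of_int (sign \<tau>))
        * (\<alpha> (\<lambda>i. u (\<sigma> i)) (\<lambda>i. v (\<tau> i))
        * \<beta> (\<lambda>i. u (\<sigma> (p + i))) (\<lambda>i. v (\<tau> (q + i))))))"
    using assms unfolding multilinear2_def
    by (intro multilinear_cmult multilinear_sum)
      (auto intro!: multilinear_permute[OF multilinear_mult[of q "\<lambda>v. \<alpha> (\<lambda>i. u (\<sigma> i)) v" s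
         "\<lambda>v. \<beta> (\<lambda>i. u (\<sigma> (p + i))) v" for \<sigma>]])
  then show "multilinear (q + s) (df_mult p q r s \<alpha> \<beta> u)"
    by (simp add: df_mult_def[abs_def] mult.assoc divide_simps)
qed

lemma multilinear2_power:
  assumes "multilinear2 p p \<gamma>"
  shows "multilinear2 (p * n) (p * n) (df_power p \<gamma> n)"
proof (induction n)
  case 0
  then show ?case by (simp add: multilinear2_def multilinear_def)
next
  case (Suc n)
  then show ?case using multilinear2_mult[OF assms Suc] by simp
qed

text \<open>After expanding both groups of arguments, the basis occurs only in sums of
  \<open>e a $ i * e a $ j\<close> over \<open>a\<close>, which are entries of
  \<open>matrix_inv B\<close>. Hence the value does not depend on which orthonormal basis
  \<open>SOME\<close> returns.\<close>

lemma df_trace_eq: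
  fixes \<gamma> :: "(real^'m::finite) double_form" and e :: "'m \<Rightarrow> real^'m"
  assumes "multilinear2 p p \<gamma>"
    and "\<And>i j. metric_inner B (e i) (e j) = (if i = j then 1 else 0)"
  shows "df_trace p e \<gamma> = (\<Sum>b\<in>{..<p} \<rightarrow>\<^sub>E UNIV. \<Sum>c\<in>{..<p} \<rightarrow>\<^sub>E UNIV.
     (\<Prod>s<p. matrix_inv B $ b s $ c s) * \<gamma> (\<lambda>s. axis (b s) 1) (\<lambda>s. axis (c s) 1)) / fact p"
proof -
  have m1: "multilinear p (\<lambda>u. \<gamma> u v)" and m2: "multilinear p (\<gamma> u)" for u v
    using assms(1) by (auto simp: multilinear2_def)
  let ?P = "{..<p} \<rightarrow>\<^sub>E (UNIV::'m set)"
  have ex: "\<gamma> u v = (\<Sum>b\<in>?P. \<Sum>c\<in>?P. (\<Prod>s<p. u s $ b s * v s $ c s) *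
        \<gamma> (\<lambda>s. axis (b s) 1) (\<lambda>s. axis (c s) 1))" for u v
    apply (subst multilinear_expand[OF m1])
    apply (subst multilinear_expand[OF m2])
    apply (simp add: sum_distrib_left prod.distrib mult_ac)
    done
  have "(\<Sum>a\<in>?P. \<gamma> (\<lambda>i. e (a i)) (\<lambda>i. e (a i))) =
    (\<Sum>a\<in>?P. \<Sum>b\<in>?P. \<Sum>c\<in>?P. (\<Prod>s<p. e (a s) $ b s * e (a s) $ c s) *
        \<gamma> (\<lambda>s. axis (b s) 1) (\<lambda>s. axis (c s) 1))"
    by (intro sum.cong refl ex)
  also have "\<dots> = (\<Sum>b\<in>?P. \<Sum>c\<in>?P. \<Sum>a\<in>?P. (\<Prod>s<p. e (a s) $ b s * e (a s) $ c s) *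
        \<gamma> (\<lambda>s. axis (b s) 1) (\<lambda>s. axis (c s) 1))"
    by (subst sum.swap) (intro sum.cong refl sum.swap)
  also have "\<dots> = (\<Sum>b\<in>?P. \<Sum>c\<in>?P. (\<Prod>s<p. \<Sum>a\<in>UNIV. e a $ b s * e a $ c s) *
        \<gamma> (\<lambda>s. axis (b s) 1) (\<lambda>s. axis (c s) 1))"
    by (subst prod_sum_PiE) (simp_all add: sum_distrib_right)
  finally show ?thesis
    by (simp add: df_trace_def orthonormal_sum_matrix_inv[OF assms(2)])
qed

text \<open>Naturality of products under pullback; it will be applied with \<open>L\<close> the
  Jacobian of a coordinate change.\<close>

lemma df_power_compose:
  "df_power p (\<lambda>u v. \<gamma> (\<lambda>i. L (u i)) (\<lambda>i. L (v i))) n u v = df_power p \<gamma> n (\<lambda>i. L (u i)) (\<lambda>i. L (v i))"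
  by (induction n arbitrary: u v) (simp_all add: df_mult_def)

definition coeff_form :: "('m \<Rightarrow> 'm \<Rightarrow> 'm \<Rightarrow> 'm \<Rightarrow> real) \<Rightarrow> (real^'m::finite) double_form" where
  "coeff_form r = (\<lambda>X Z. \<Sum>a\<in>UNIV. \<Sum>i\<in>UNIV. \<Sum>j\<in>UNIV. \<Sum>l\<in>UNIV.
     r a i j l * X 0 $ a * X 1 $ i * Z 0 $ j * Z 1 $ l)"

lemma multilinear2_coeff_form: "multilinear2 2 2 (coeff_form r)"
proof -
  have "linear (\<lambda>x. coeff_form r (u(s := x)) v)" "linear (\<lambda>x. coeff_form r v (u(s := x)))"
    if "s < 2" for s u v
  proof -
    have s: "s = 0 \<or> s = 1" using that by auto
    show "linear (\<lambda>x. coeff_form r (u(s := x)) v)" "linear (\<lambda>x. coeff_form r v (u(s := x)))"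
      using s unfolding coeff_form_def
      by (elim disjE; simp; intro linear_compose_sum ballI; intro linearI; simp add: algebra_simps)+
  qed
  then show ?thesis
    by (auto simp: multilinear2_def multilinear_def coeff_form_def)
qed

text \<open>Components \<open>R(e\<^sub>a, e\<^sub>i, e\<^sub>j, e\<^sub>l)\<close> by the Gauss equation, for
  \<open>T a b l = \<langle>\<partial>\<^sub>a\<partial>\<^sub>b\<phi>, \<partial>\<^sub>l\<phi>\<rangle>\<close> and \<open>S a b c d = \<langle>\<partial>\<^sub>a\<partial>\<^sub>b\<phi>, \<partial>\<^sub>c\<partial>\<^sub>d\<phi>\<rangle>\<close>.\<close>

definition gauss_coeff :: "real^'m^'m \<Rightarrow> real^'m^'m^'m \<Rightarrow> real^'m^'m^'m^'m \<Rightarrow>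
    'm \<Rightarrow> 'm \<Rightarrow> 'm \<Rightarrow> 'm::finite \<Rightarrow> real" where
  "gauss_coeff G T S a i j l = S $ i $ j $ a $ l - S $ a $ j $ i $ l
     - (\<Sum>p\<in>UNIV. \<Sum>q\<in>UNIV. matrix_inv G $ p $ q * T $ i $ j $ p * T $ a $ l $ q)
     + (\<Sum>p\<in>UNIV. \<Sum>q\<in>UNIV. matrix_inv G $ p $ q * T $ a $ j $ p * T $ i $ l $ q)"

text \<open>The trace written with the inverse metric in place of an orthonormal basis. In this form
  it is visibly a rational function of the entries of \<open>G\<close>, \<open>T\<close>,
  \<open>S\<close> whose only denominators are powers of \<open>det G\<close>.\<close>

definition gauss_trace :: "nat \<Rightarrow> (real^'m^'m) \<times> (real^'m^'m^'m) \<times> (real^'m^'m^'m^'m::finite) \<Rightarrow> real" where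
  "gauss_trace n \<theta> = (case \<theta> of (G, T, S) \<Rightarrow>
     (\<Sum>b\<in>{..<2 * n} \<rightarrow>\<^sub>E UNIV. \<Sum>c\<in>{..<2 * n} \<rightarrow>\<^sub>E UNIV.
        (\<Prod>s<2 * n. matrix_inv G $ b s $ c s) *
        df_power 2 (coeff_form (gauss_coeff G T S)) n (\<lambda>s. axis (b s) 1) (\<lambda>s. axis (c s) 1)) / fact (2 * n))"

lemma df_trace_gauss:
  fixes e :: "'m::finite \<Rightarrow> real^'m"
  assumes "\<And>i j. metric_inner G (e i) (e j) = (if i = j then 1 else 0)"
  shows "df_trace (2 * n) e (df_power 2 (coeff_form (gauss_coeff G T S)) n) = gauss_trace n (G, T, S)"
  by (subst df_trace_eq[OF multilinear2_power[OF multilinear2_coeff_form] assms]) (simp_all add: gauss_trace_def)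

text \<open>Turns the entries of an inverse, defined by choice, into quotients of determinants, from
  which continuity and differentiability are read off.\<close>

lemma matrix_inv_cramer:
  fixes A :: "real^'n^'n::finite"
  assumes "det A \<noteq> 0"
  shows "matrix_inv A $ k $ l = det (\<chi> i j. if j = k then axis l 1 $ i else A $ i $ j) / det A"
proof -
  have "A *v (matrix_inv A *v axis l 1) = axis l 1"
    by (simp add: matrix_vector_mul_assoc matrix_inv_right_det[OF assms])
  then have "matrix_inv A *v axis l 1 = (\<chi> k. det (\<chi> i j. if j = k then axis l 1 $ i else A $ i $ j) / det A)"
    using cramer[OF assms] by blast
  then have "(matrix_inv A *v axis l 1) $ k = det (\<chi> i j. if j = k then axis l 1 $ i else A $ i $ j) / det A"
    by simp
  then show ?thesis by (simp add: matrix_vector_mul_component inner_axis)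
qed

lemma continuous_on_det:
  fixes A :: "'a::topological_space \<Rightarrow> real^'n^'n::finite"
  assumes "\<And>i j. continuous_on S (\<lambda>x. A x $ i $ j)"
  shows "continuous_on S (\<lambda>x. det (A x))"
  unfolding det_def by (intro continuous_intros assms)

lemma continuous_on_matrix_inv:
  fixes A :: "'a::topological_space \<Rightarrow> real^'n^'n::finite"
  assumes "\<And>i j. continuous_on S (\<lambda>x. A x $ i $ j)" and "\<And>x. x \<in> S \<Longrightarrow> det (A x) \<noteq> 0"
  shows "continuous_on S (\<lambda>x. matrix_inv (A x) $ k $ l)"
proof -
  have c: "continuous_on S (\<lambda>x. (\<chi> i j. if j = k then axis l 1 $ i else A x $ i $ j) $ i $ j)" for i j
    by (cases "j = k") (auto intro: assms)
  have "continuous_on S (\<lambda>x. det (\<chi> i j. if j = k then axis l 1 $ i else A x $ i $ j) / det (A x))"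
    by (rule continuous_on_divide[OF continuous_on_det[OF c] continuous_on_det[OF assms(1)]])
      (use assms in auto)
  then show ?thesis
    by (rule continuous_on_eq) (simp add: matrix_inv_cramer[OF assms(2)])
qed

lemma continuous_on_df_power:
  assumes "\<And>u v. continuous_on S (\<lambda>x. \<gamma> x u v)"
  shows "continuous_on S (\<lambda>x. df_power p (\<gamma> x) n u v)"
proof (induction n arbitrary: u v)
  case (Suc n)
  show ?case unfolding df_power.simps df_mult_def
    by (intro continuous_on_divide continuous_on_sum continuous_on_mult continuous_on_const assms Suc) simp
qed simp

lemma continuous_on_gauss_trace:
  "continuous_on {\<theta>::(real^'m^'m) \<times> (real^'m^'m^'m) \<times> (real^'m^'m^'m^'m::finite). det (fst \<theta>) \<noteq> 0}
     (gauss_trace n)"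
proof -
  let ?D = "{\<theta>::(real^'m^'m) \<times> (real^'m^'m^'m) \<times> (real^'m^'m^'m^'m). det (fst \<theta>) \<noteq> 0}"
  have inv: "continuous_on ?D (\<lambda>\<theta>. matrix_inv (fst \<theta>) $ k $ l)" for k l
  proof (rule continuous_on_matrix_inv)
    show "continuous_on ?D (\<lambda>\<theta>. fst \<theta> $ i $ j)" for i j
      by (intro continuous_intros)
  qed simp
  have "continuous_on ?D (\<lambda>\<theta>. gauss_coeff (fst \<theta>) (fst (snd \<theta>)) (snd (snd \<theta>)) a i j l)" for a i j l
    unfolding gauss_coeff_def by (intro continuous_intros inv)
  then have "continuous_on ?D (\<lambda>\<theta>. coeff_form (gauss_coeff (fst \<theta>) (fst (snd \<theta>)) (snd (snd \<theta>))) X Z)" for X Z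
    unfolding coeff_form_def by (intro continuous_intros)
  then have "continuous_on ?D (\<lambda>\<theta>. df_power 2 (coeff_form (gauss_coeff (fst \<theta>) (fst (snd \<theta>)) (snd (snd \<theta>)))) n X Z)" for X Z
    by (rule continuous_on_df_power)
  then show ?thesis
    unfolding gauss_trace_def case_prod_beta
    by (intro continuous_on_divide continuous_on_sum continuous_on_mult continuous_on_prod inv) auto
qed

section \<open>Partial derivatives and coordinate changes\<close>

lemma Ck_on_Suc_imp: "Ck_on (Suc k) f S \<Longrightarrow> Ck_on k f S"
proof (induction k arbitrary: f)
  case 0
  then show ?case
    by (auto intro!: continuous_at_imp_continuous_on differentiable_imp_continuous_within)
next
  case (Suc k)
  then show ?case by (metis Ck_on.simps(2))
qed

lemma Ck_on_mono: "Ck_on l f S \<Longrightarrow> k \<le> l \<Longrightarrow> Ck_on k f S"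
  proof (induction l)
  case (Suc l)
  then show ?case using Ck_on_Suc_imp[of l f S] by (auto simp: le_Suc_eq simp del: Ck_on.simps)
qed simp

lemma Ck_on_partial: "Ck_on (Suc k) f S \<Longrightarrow> Ck_on k (partial i f) S"
  unfolding partial_def[abs_def] by simp

lemma Ck_on_differentiable: "Ck_on k f S \<Longrightarrow> 0 < k \<Longrightarrow> u \<in> S \<Longrightarrow> f differentiable (at u)"
  by (cases k) auto

lemma Ck_on_continuous: "Ck_on k f S \<Longrightarrow> continuous_on S f"
  using Ck_on_mono[of k f S 0] by simp

lemma frechet_derivative_linear: "f differentiable (at u) \<Longrightarrow> linear (frechet_derivative f (at u))"
  by (metis frechet_derivative_works has_derivative_linear)

lemma frechet_derivative_cong_open:
  assumes "open W" "u \<in> W" "\<And>w. w \<in> W \<Longrightarrow> f w = g w"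
  shows "frechet_derivative f (at u) = frechet_derivative g (at u)"
proof -
  have "(f has_derivative D) (at u) \<longleftrightarrow> (g has_derivative D) (at u)" for D
    using assms by (metis has_derivative_transform_within_open)
  then show ?thesis unfolding frechet_derivative_def by simp
qed

lemma Ck_on_cong:
  assumes "open S" "\<And>w. w \<in> S \<Longrightarrow> f w = g w"
  shows "Ck_on k f S \<longleftrightarrow> Ck_on k g S"
  using assms(2)
proof (induction k arbitrary: f g)
  case 0
  then show ?case by (simp cong: continuous_on_cong)
next
  case (Suc k)
  have "f differentiable (at x) \<longleftrightarrow> g differentiable (at x)" if "x \<in> S" for x
    using Suc.prems assms(1) that unfolding differentiable_def
    by (metis has_derivative_transform_within_open)
  moreover have "Ck_on k (\<lambda>x. frechet_derivative f (at x) v) S \<longleftrightarrow> Ck_on k (\<lambda>x. frechet_derivative g (at x) v) S" for v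
    by (rule Suc.IH) (metis Suc.prems assms(1) frechet_derivative_cong_open)
  ultimately show ?case by auto
qed

lemma partial_cong_open:
  "open W \<Longrightarrow> u \<in> W \<Longrightarrow> (\<And>w. w \<in> W \<Longrightarrow> f w = g w) \<Longrightarrow> partial i f u = partial i g u"
  unfolding partial_def by (metis frechet_derivative_cong_open)

lemma has_derivative_partial: "(f has_derivative D) (at u) \<Longrightarrow> partial i f u = D (axis i 1)"
  unfolding partial_def by (metis frechet_derivative_at)

lemma linear_axis_sum:
  fixes D :: "real^'m::finite \<Rightarrow> 'b::real_vector"
  assumes "linear D"
  shows "D v = (\<Sum>i\<in>UNIV. v $ i *\<^sub>R D (axis i 1))"
proof -
  have "v = (\<Sum>i\<in>UNIV. v $ i *\<^sub>R axis i 1)"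
    using basis_expansion[of v] by (simp add: scalar_mult_eq_scaleR)
  then have "D v = D (\<Sum>i\<in>UNIV. v $ i *\<^sub>R axis i 1)" by (rule arg_cong)
  also have "\<dots> = (\<Sum>i\<in>UNIV. v $ i *\<^sub>R D (axis i 1))"
    by (simp add: linear_sum[OF assms] linear_scale[OF assms])
  finally show ?thesis .
qed

lemma frechet_derivative_partial_sum:
  fixes f :: "real^'m::finite \<Rightarrow> real"
  assumes "f differentiable (at u)"
  shows "frechet_derivative f (at u) v = (\<Sum>i\<in>UNIV. v $ i * partial i f u)"
  by (subst linear_axis_sum[OF frechet_derivative_linear[OF assms]]) (simp add: partial_def)

lemma has_derivative_partials:
  fixes f :: "real^'m::finite \<Rightarrow> real"
  assumes "f differentiable (at u)"
  shows "(f has_derivative (\<lambda>v. \<Sum>i\<in>UNIV. v $ i * partial i f u)) (at u)"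
  using assms by (simp add: frechet_derivative_works frechet_derivative_partial_sum[OF assms, abs_def, symmetric])

lemma partial_along_line:
  fixes f :: "real^'m::finite \<Rightarrow> real"
  assumes "f differentiable (at (w + s *\<^sub>R axis i 1))"
  shows "((\<lambda>s. f (w + s *\<^sub>R axis i 1)) has_real_derivative partial i f (w + s *\<^sub>R axis i 1)) (at s)"
proof -
  have "((\<lambda>s. w + s *\<^sub>R axis i 1) has_derivative (\<lambda>t. t *\<^sub>R axis i 1)) (at s)"
    by (auto intro!: derivative_eq_intros)
  then have "((\<lambda>s. f (w + s *\<^sub>R axis i 1)) has_derivative
     (\<lambda>t. frechet_derivative f (at (w + s *\<^sub>R axis i 1)) (t *\<^sub>R axis i 1))) (at s)"
    using assms unfolding frechet_derivative_works by (rule has_derivative_compose)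
  moreover have "frechet_derivative f (at (w + s *\<^sub>R axis i 1)) (t *\<^sub>R axis i 1)
      = partial i f (w + s *\<^sub>R axis i 1) * t" for t
    using frechet_derivative_linear[OF assms] by (simp add: linear_scale partial_def)
  ultimately show ?thesis by (simp add: has_field_derivative_def)
qed

text \<open>The mean value theorem twice: first in direction \<open>i\<close> for the increment of
  \<open>f\<close> in direction \<open>j\<close>, then in direction \<open>j\<close> for
  \<open>partial i f\<close>.\<close>

lemma second_difference:
  fixes f :: "real^'m::finite \<Rightarrow> real"
  assumes h: "0 < h"
    and d1: "\<And>s t. 0 \<le> s \<Longrightarrow> s \<le> h \<Longrightarrow> 0 \<le> t \<Longrightarrow> t \<le> h \<Longrightarrow>
          f differentiable (at (u + s *\<^sub>R axis i 1 + t *\<^sub>R axis j 1))"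
    and d2: "\<And>s t. 0 \<le> s \<Longrightarrow> s \<le> h \<Longrightarrow> 0 \<le> t \<Longrightarrow> t \<le> h \<Longrightarrow>
          partial i f differentiable (at (u + s *\<^sub>R axis i 1 + t *\<^sub>R axis j 1))"
  shows "\<exists>s t. 0 \<le> s \<and> s \<le> h \<and> 0 \<le> t \<and> t \<le> h \<and>
    f (u + h *\<^sub>R axis i 1 + h *\<^sub>R axis j 1) - f (u + h *\<^sub>R axis i 1) - f (u + h *\<^sub>R axis j 1) + f u
      = h\<^sup>2 * partial j (partial i f) (u + s *\<^sub>R axis i 1 + t *\<^sub>R axis j 1)"
proof -
  let ?a = "axis i 1 :: real^'m" and ?b = "axis j 1 :: real^'m"
  have D: "((\<lambda>s. f (u + s *\<^sub>R ?a + t *\<^sub>R ?b)) has_real_derivative partial i f (u + s *\<^sub>R ?a + t *\<^sub>R ?b)) (at s)"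
    if "0 \<le> s" "s \<le> h" "0 \<le> t" "t \<le> h" for s t
    using partial_along_line[of f "u + t *\<^sub>R ?b" s i] d1[OF that] by (simp add: algebra_simps)
  have "\<exists>s>0. s < h \<and> (f (u + h *\<^sub>R ?a + h *\<^sub>R ?b) - f (u + h *\<^sub>R ?a + 0 *\<^sub>R ?b))
      - (f (u + 0 *\<^sub>R ?a + h *\<^sub>R ?b) - f (u + 0 *\<^sub>R ?a + 0 *\<^sub>R ?b))
      = (h - 0) * (partial i f (u + s *\<^sub>R ?a + h *\<^sub>R ?b) - partial i f (u + s *\<^sub>R ?a + 0 *\<^sub>R ?b))"
    by (rule MVT2[OF h]) (use h in \<open>auto intro!: DERIV_diff D simp del: scaleR_zero_left\<close>)
  then obtain s where s: "0 < s" "s < h" and e1: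
     "f (u + h *\<^sub>R ?a + h *\<^sub>R ?b) - f (u + h *\<^sub>R ?a) - f (u + h *\<^sub>R ?b) + f u
      = h * (partial i f (u + s *\<^sub>R ?a + h *\<^sub>R ?b) - partial i f (u + s *\<^sub>R ?a + 0 *\<^sub>R ?b))" by auto
  have "\<exists>t>0. t < h \<and> partial i f (u + s *\<^sub>R ?a + h *\<^sub>R ?b) - partial i f (u + s *\<^sub>R ?a + 0 *\<^sub>R ?b)
      = (h - 0) * partial j (partial i f) (u + s *\<^sub>R ?a + t *\<^sub>R ?b)"
    by (rule MVT2[OF h]) (use h s in \<open>auto intro!: partial_along_line d2\<close>)
  then obtain t where "0 < t" "t < h" and
     "partial i f (u + s *\<^sub>R ?a + h *\<^sub>R ?b) - partial i f (u + s *\<^sub>R ?a + 0 *\<^sub>R ?b)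
      = h * partial j (partial i f) (u + s *\<^sub>R ?a + t *\<^sub>R ?b)" by auto
  with s e1 show ?thesis by (intro exI[of _ s] exI[of _ t]) (simp add: power2_eq_square)
qed

text \<open>The second difference over a square of side \<open>h\<close> is symmetric in the two
  directions, so it equals \<open>h\<close> squared times either mixed partial, each taken at some
  point within \<open>2 * h\<close> of \<open>u\<close>. Continuity of both at \<open>u\<close>
  forbids a gap of \<open>2 * e\<close>.\<close>

lemma partial_commute:
  fixes f :: "real^'m::finite \<Rightarrow> real"
  assumes "open S" "u \<in> S" "Ck_on 2 f S"
  shows "partial i (partial j f) u = partial j (partial i f) u"
proof (rule ccontr)
  let ?p = "\<lambda>i j. partial i (partial j f)"
  assume ne: "?p i j u \<noteq> ?p j i u"
  define e where "e = \<bar>?p i j u - ?p j i u\<bar> / 2"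
  have e: "e > 0" using ne by (simp add: e_def)
  have d1: "f differentiable (at w)" and d2: "partial k f differentiable (at w)" if "w \<in> S" for w k
    using assms(3) that Ck_on_partial[of 1 f S k] by (auto simp: numeral_2_eq_2)
  have "continuous_on S (?p k l)" for k l
    using Ck_on_partial[OF Ck_on_partial[OF assms(3)[unfolded numeral_2_eq_2]]] by simp
  then have "isCont (?p k l) u" for k l
    using assms by (simp add: continuous_on_eq_continuous_at)
  then have "\<exists>d>0. \<forall>w. dist w u < d \<longrightarrow> dist (?p k l w) (?p k l u) < e" for k l
    using e by (simp add: continuous_within_eps_delta)
  then obtain d1' d2' where d': "d1' > 0" "d2' > 0" "\<And>w. dist w u < d1' \<Longrightarrow> dist (?p i j w) (?p i j u) < e"
     "\<And>w. dist w u < d2' \<Longrightarrow> dist (?p j i w) (?p j i u) < e" by metis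
  obtain d0 where d0: "d0 > 0" "ball u d0 \<subseteq> S" using assms by (meson openE)
  define h where "h = min d0 (min d1' d2') / 3"
  have h: "0 < h" "2 * h < d0" "2 * h < d1'" "2 * h < d2'" using d' d0 by (auto simp: h_def)
  have near: "dist (u + s *\<^sub>R axis k 1 + t *\<^sub>R axis l 1) u \<le> 2 * h"
    if "0 \<le> s" "s \<le> h" "0 \<le> t" "t \<le> h" for s t k l
  proof -
    have "norm (s *\<^sub>R axis k 1 + t *\<^sub>R axis l (1::real)) \<le> s + t"
      by (rule order_trans[OF norm_triangle_ineq]) (use that in \<open>simp add: norm_axis_1\<close>)
    then show ?thesis using that by (simp add: dist_norm add.assoc)
  qed
  have inS: "u + s *\<^sub>R axis k 1 + t *\<^sub>R axis l 1 \<in> S"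
    if "0 \<le> s" "s \<le> h" "0 \<le> t" "t \<le> h" for s t k l
    using near[OF that, of k l] h d0 by (intro subsetD[OF d0(2)]) (simp add: dist_commute)
  obtain s t where st: "0 \<le> s" "s \<le> h" "0 \<le> t" "t \<le> h"
    and e1: "f (u + h *\<^sub>R axis i 1 + h *\<^sub>R axis j 1) - f (u + h *\<^sub>R axis i 1) - f (u + h *\<^sub>R axis j 1) + f u
      = h\<^sup>2 * ?p j i (u + s *\<^sub>R axis i 1 + t *\<^sub>R axis j 1)"
    using second_difference[OF h(1) d1[OF inS] d2[OF inS], of i j] by blast
  obtain s' t' where st': "0 \<le> s'" "s' \<le> h" "0 \<le> t'" "t' \<le> h"
    and e2: "f (u + h *\<^sub>R axis j 1 + h *\<^sub>R axis i 1) - f (u + h *\<^sub>R axis j 1) - f (u + h *\<^sub>R axis i 1) + f u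
      = h\<^sup>2 * ?p i j (u + s' *\<^sub>R axis j 1 + t' *\<^sub>R axis i 1)"
    using second_difference[OF h(1) d1[OF inS] d2[OF inS], of j i] by blast
  have "h\<^sup>2 * ?p j i (u + s *\<^sub>R axis i 1 + t *\<^sub>R axis j 1) = h\<^sup>2 * ?p i j (u + s' *\<^sub>R axis j 1 + t' *\<^sub>R axis i 1)"
    using e1 e2 unfolding add.assoc[of u] add.commute[of "h *\<^sub>R axis j 1"] by linarith
  then have "?p j i (u + s *\<^sub>R axis i 1 + t *\<^sub>R axis j 1) = ?p i j (u + s' *\<^sub>R axis j 1 + t' *\<^sub>R axis i 1)"
    using h by simp
  moreover have "dist (?p j i (u + s *\<^sub>R axis i 1 + t *\<^sub>R axis j 1)) (?p j i u) < e"
    using near[OF st, of i j] h by (intro d'(4)) simp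
  moreover have "dist (?p i j (u + s' *\<^sub>R axis j 1 + t' *\<^sub>R axis i 1)) (?p i j u) < e"
    using near[OF st', of j i] h by (intro d'(3)) simp
  moreover have "dist (?p i j u) (?p j i u) = 2 * e" by (simp add: e_def dist_real_def)
  ultimately show False using dist_triangle3[of "?p i j u" "?p j i u"] by (smt (verit))
qed

definition jac :: "(real^'m::finite \<Rightarrow> real^'m) \<Rightarrow> real^'m \<Rightarrow> real^'m^'m" where
  "jac \<tau> u = matrix (frechet_derivative \<tau> (at u))"

lemma jac_component: "jac \<tau> u $ a $ i = frechet_derivative \<tau> (at u) (axis i 1) $ a"
  by (simp add: jac_def matrix_def)

lemma jac_works:
  fixes \<tau> :: "real^'m::finite \<Rightarrow> real^'m"
  assumes "\<tau> differentiable (at u)"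
  shows "(\<tau> has_derivative (*v) (jac \<tau> u)) (at u)"
    and "frechet_derivative \<tau> (at u) v = jac \<tau> u *v v"
proof -
  show "frechet_derivative \<tau> (at u) v = jac \<tau> u *v v" for v
    unfolding jac_def using frechet_derivative_linear[OF assms] by (simp add: matrix_works)
  then show "(\<tau> has_derivative (*v) (jac \<tau> u)) (at u)"
    using assms unfolding frechet_derivative_works by presburger
qed

lemma partial_chain:
  fixes \<psi> :: "real^'m::finite \<Rightarrow> real"
  assumes "\<tau> differentiable (at u)" "\<psi> differentiable (at (\<tau> u))"
    and "open W" "u \<in> W" "\<And>w. w \<in> W \<Longrightarrow> \<phi> w = \<psi> (\<tau> w)"
  shows "\<phi> differentiable (at u)"
    and "partial i \<phi> u = (\<Sum>a\<in>UNIV. jac \<tau> u $ a $ i * partial a \<psi> (\<tau> u))"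
proof -
  have "((\<lambda>w. \<psi> (\<tau> w)) has_derivative
      (\<lambda>v. frechet_derivative \<psi> (at (\<tau> u)) (frechet_derivative \<tau> (at u) v))) (at u)"
    using assms(1,2) unfolding frechet_derivative_works by (rule has_derivative_compose)
  then have D: "(\<phi> has_derivative
      (\<lambda>v. frechet_derivative \<psi> (at (\<tau> u)) (frechet_derivative \<tau> (at u) v))) (at u)"
    using assms(3-5) by (metis has_derivative_transform_within_open)
  then show "\<phi> differentiable (at u)" by (rule differentiableI)
  show "partial i \<phi> u = (\<Sum>a\<in>UNIV. jac \<tau> u $ a $ i * partial a \<psi> (\<tau> u))"
    by (simp add: has_derivative_partial[OF D] frechet_derivative_partial_sum[OF assms(2)] jac_component)
qed

lemma partial_mult:
  assumes "f differentiable (at u)" "g differentiable (at u)"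
  shows "partial i (\<lambda>w. f w * g w) u = partial i f u * g u + f u * partial i g u"
proof -
  have "((\<lambda>w. f w * g w) has_derivative (\<lambda>v. f u * frechet_derivative g (at u) v + frechet_derivative f (at u) v * g u)) (at u)"
    using assms unfolding frechet_derivative_works by (rule has_derivative_mult)
  from has_derivative_partial[OF this] show ?thesis by (simp add: partial_def)
qed

lemma partial_sum:
  assumes "\<And>k. k \<in> K \<Longrightarrow> f k differentiable (at u)"
  shows "partial i (\<lambda>w. \<Sum>k\<in>K. f k w) u = (\<Sum>k\<in>K. partial i (f k) u)"
proof -
  have "((\<lambda>w. \<Sum>k\<in>K. f k w) has_derivative (\<lambda>v. \<Sum>k\<in>K. frechet_derivative (f k) (at u) v)) (at u)"
    using assms unfolding frechet_derivative_works by (intro has_derivative_sum) auto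
  from has_derivative_partial[OF this] show ?thesis by (simp add: partial_def)
qed

text \<open>Weaker than C2: the second derivatives need not be continuous. This is all that the
  second-order chain rule uses, and it is the property established later for changes between
  arbitrary immersed charts of a submanifold.\<close>

definition twice_differentiable_on :: "(real^'m::finite \<Rightarrow> real^'m) \<Rightarrow> (real^'m) set \<Rightarrow> bool" where
  "twice_differentiable_on \<tau> W \<longleftrightarrow> (\<forall>u\<in>W. \<tau> differentiable (at u) \<and>
     (\<forall>a i. (\<lambda>w. jac \<tau> w $ a $ i) differentiable (at u)))"

text \<open>The last sum, which stems from the second derivatives of \<open>\<tau>\<close>, involves
  only first partials of \<open>\<psi>\<close>. It is therefore tangential, and will drop out of
  normal components.\<close>

lemma partial_chain2:
  fixes \<psi> :: "real^'m::finite \<Rightarrow> real"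
  assumes W: "open W" "u \<in> W" and tw: "twice_differentiable_on \<tau> W"
    and V: "open V" "\<tau> ` W \<subseteq> V" "Ck_on 2 \<psi> V"
    and eq: "\<And>w. w \<in> W \<Longrightarrow> \<phi> w = \<psi> (\<tau> w)"
  shows "partial i (partial j \<phi>) u = (\<Sum>a\<in>UNIV. \<Sum>b\<in>UNIV. jac \<tau> u $ a $ i * jac \<tau> u $ b $ j * partial a (partial b \<psi>) (\<tau> u))
     + (\<Sum>b\<in>UNIV. partial i (\<lambda>w. jac \<tau> w $ b $ j) u * partial b \<psi> (\<tau> u))"
proof -
  have tau: "\<tau> differentiable (at w)" and J: "(\<lambda>w. jac \<tau> w $ a $ k) differentiable (at w)" if "w \<in> W" for w a k
    using tw that by (auto simp: twice_differentiable_on_def)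
  have psi: "\<psi> differentiable (at (\<tau> w))" and dpsi: "partial b \<psi> differentiable (at (\<tau> w))" if "w \<in> W" for w b
    using V(2,3) that Ck_on_partial[of 1 \<psi> V b] by (auto simp: numeral_2_eq_2)
  have c: "(\<lambda>w. partial b \<psi> (\<tau> w)) differentiable (at u)"
    "partial i (\<lambda>w. partial b \<psi> (\<tau> w)) u = (\<Sum>a\<in>UNIV. jac \<tau> u $ a $ i * partial a (partial b \<psi>) (\<tau> u))" for b
    using partial_chain[OF tau[OF W(2)] dpsi[OF W(2)] W refl] by auto
  have "partial i (partial j \<phi>) u = partial i (\<lambda>w. \<Sum>b\<in>UNIV. jac \<tau> w $ b $ j * partial b \<psi> (\<tau> w)) u"
    by (rule partial_cong_open[OF W]) (use partial_chain(2)[OF tau psi W(1) _ eq] in auto)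
  also have "\<dots> = (\<Sum>b\<in>UNIV. partial i (\<lambda>w. jac \<tau> w $ b $ j) u * partial b \<psi> (\<tau> u)
      + jac \<tau> u $ b $ j * (\<Sum>a\<in>UNIV. jac \<tau> u $ a $ i * partial a (partial b \<psi>) (\<tau> u)))"
    by (subst partial_sum) (auto intro!: differentiable_mult J W c simp: partial_mult J[OF W(2)] c)
  finally show ?thesis
    by (subst sum.swap) (simp add: sum.distrib sum_distrib_left mult_ac add.commute)
qed

lemma Ck_on_twice_differentiable:
  assumes "Ck_on 2 \<tau> W"
  shows "twice_differentiable_on \<tau> W"
proof -
  have "(\<lambda>w. jac \<tau> w $ a $ i) differentiable (at u)" if "u \<in> W" for a i u
  proof -
    have "(\<lambda>w. frechet_derivative \<tau> (at w) (axis i 1)) differentiable (at u)"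
      using assms that by (auto simp: numeral_2_eq_2)
    then show ?thesis unfolding jac_component
      by (metis differentiableI frechet_derivative_works bounded_linear.has_derivative[OF bounded_linear_vec_nth])
  qed
  then show ?thesis using assms by (auto simp: twice_differentiable_on_def numeral_2_eq_2)
qed

lemma differentiable_prod:
  fixes f :: "'i \<Rightarrow> 'e::real_normed_vector \<Rightarrow> real"
  assumes "\<And>i. i \<in> I \<Longrightarrow> f i differentiable (at x)"
  shows "(\<lambda>x. \<Prod>i\<in>I. f i x) differentiable (at x)"
  using assms by (induction I rule: infinite_finite_induct) (auto intro!: differentiable_mult)

lemma differentiable_det:
  fixes A :: "'e::real_normed_vector \<Rightarrow> real^'n^'n::finite"
  assumes "\<And>i j. (\<lambda>x. A x $ i $ j) differentiable (at x)"
  shows "(\<lambda>x. det (A x)) differentiable (at x)"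
  unfolding det_def
  by (auto intro!: differentiable_sum differentiable_mult assms
      differentiable_prod[where f = "\<lambda>i x. A x $ i $ p i" for p])

lemma differentiable_matrix_inv:
  fixes A :: "'e::real_normed_vector \<Rightarrow> real^'n^'n::finite"
  assumes "\<And>i j. (\<lambda>x. A x $ i $ j) differentiable (at u)"
    and "open U" "u \<in> U" "\<And>w. w \<in> U \<Longrightarrow> det (A w) \<noteq> 0"
  shows "(\<lambda>x. matrix_inv (A x) $ k $ l) differentiable (at u)"
proof -
  have c: "(\<lambda>x. (\<chi> i j. if j = k then axis l 1 $ i else A x $ i $ j) $ i $ j) differentiable (at u)" for i j
    by (cases "j = k") (auto intro: assms)
  have "(\<lambda>x. det (\<chi> i j. if j = k then axis l 1 $ i else A x $ i $ j) / det (A x)) differentiable (at u)"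
    by (rule differentiable_divide[OF differentiable_det[OF c] differentiable_det[OF assms(1)]])
      (use assms in auto)
  then obtain D where D: "((\<lambda>x. det (\<chi> i j. if j = k then axis l 1 $ i else A x $ i $ j) / det (A x))
      has_derivative D) (at u)"
    unfolding differentiable_def by blast
  have "((\<lambda>x. matrix_inv (A x) $ k $ l) has_derivative D) (at u)"
    by (rule has_derivative_transform_within_open[OF D assms(2,3)]) (simp add: matrix_inv_cramer[OF assms(4)])
  then show ?thesis by (rule differentiableI)
qed

section \<open>The Gauss equation\<close>

lemma has_derivative_vecI:
  fixes V :: "'e::real_normed_vector \<Rightarrow> real^'n::finite"
  assumes "\<And>k. ((\<lambda>w. V w $ k) has_derivative (\<lambda>v. D v $ k)) (at u)"
  shows "(V has_derivative D) (at u)"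
  by (subst has_derivative_componentwise_within) (auto simp: Basis_vec_def inner_axis assms)

lemma frechet_derivative_vec:
  fixes V :: "real^'m::finite \<Rightarrow> real^'n::finite"
  assumes "\<And>k. (\<lambda>w. V w $ k) differentiable (at u)"
  shows "V differentiable (at u)"
    and "frechet_derivative V (at u) x $ k = (\<Sum>a\<in>UNIV. x $ a * partial a (\<lambda>w. V w $ k) u)"
proof -
  have D: "(V has_derivative (\<lambda>v. \<chi> k. \<Sum>a\<in>UNIV. v $ a * partial a (\<lambda>w. V w $ k) u)) (at u)"
    by (rule has_derivative_vecI) (simp add: has_derivative_partials[OF assms])
  then show "V differentiable (at u)" by (rule differentiableI)
  show "frechet_derivative V (at u) x $ k = (\<Sum>a\<in>UNIV. x $ a * partial a (\<lambda>w. V w $ k) u)"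
    by (simp add: frechet_derivative_at[OF D, symmetric])
qed

lemma partial_cmult:
  assumes "f differentiable (at u)"
  shows "partial i (\<lambda>w. f w * c) u = partial i f u * c"
  using partial_mult[OF assms differentiable_const, of i c] by (simp add: partial_def)

lemma covariant_deriv_const:
  "covariant_deriv G (\<lambda>_. y) (\<lambda>_. z) w = (\<chi> k. \<Sum>i\<in>UNIV. \<Sum>j\<in>UNIV. christoffel G k i j w * y $ i * z $ j)"
  by (simp add: covariant_deriv_def)

text \<open>Constant coordinate fields have vanishing bracket, so curvature is the commutator of two
  covariant derivatives. \<open>D k a i j\<close> is the coefficient of
  \<open>x $ a * y $ i * z $ j\<close> in the \<open>k\<close>-th component of the iterated
  derivative of \<open>z\<close> along \<open>y\<close> and then \<open>x\<close>.\<close>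

lemma curvature_op_const:
  fixes G :: "real^'m \<Rightarrow> real^'m^'m::finite"
  assumes U: "open U" "u \<in> U"
    and ch: "\<And>w k i j. w \<in> U \<Longrightarrow> christoffel G k i j w = Gam w k i j"
    and dGam: "\<And>k i j. (\<lambda>w. Gam w k i j) differentiable (at u)"
  defines "D \<equiv> \<lambda>k a i j. partial a (\<lambda>w. Gam w k i j) u + (\<Sum>b\<in>UNIV. Gam u k a b * Gam u b i j)"
  shows "curvature_op G (\<lambda>_. x) (\<lambda>_. y) (\<lambda>_. z) u $ k
    = (\<Sum>a\<in>UNIV. \<Sum>i\<in>UNIV. \<Sum>j\<in>UNIV. x $ a * y $ i * z $ j * (D k a i j - D k i a j))"
proof -
  have cc: "covariant_deriv G (\<lambda>_. x) (covariant_deriv G (\<lambda>_. y) (\<lambda>_. z)) u $ k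
     = (\<Sum>a\<in>UNIV. \<Sum>i\<in>UNIV. \<Sum>j\<in>UNIV. x $ a * y $ i * z $ j * D k a i j)" for x y
  proof -
    let ?V = "\<lambda>w. \<chi> k. \<Sum>i\<in>UNIV. \<Sum>j\<in>UNIV. Gam w k i j * (y $ i * z $ j)"
    have V: "covariant_deriv G (\<lambda>_. y) (\<lambda>_. z) w = ?V w" if "w \<in> U" for w
      using ch[OF that] by (simp add: covariant_deriv_const mult.assoc)
    have dV: "(\<lambda>w. ?V w $ k) differentiable (at u)" for k
      by (auto intro!: differentiable_sum differentiable_mult dGam)
    have pV: "partial a (\<lambda>w. ?V w $ k) u = (\<Sum>i\<in>UNIV. \<Sum>j\<in>UNIV. partial a (\<lambda>w. Gam w k i j) u * (y $ i * z $ j))" for a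
    proof -
      have "partial a (\<lambda>w. \<Sum>i\<in>UNIV. \<Sum>j\<in>UNIV. Gam w k i j * (y $ i * z $ j)) u
        = (\<Sum>i\<in>UNIV. partial a (\<lambda>w. \<Sum>j\<in>UNIV. Gam w k i j * (y $ i * z $ j)) u)"
        by (rule partial_sum) (auto intro!: differentiable_sum differentiable_mult dGam)
      also have "\<dots> = (\<Sum>i\<in>UNIV. \<Sum>j\<in>UNIV. partial a (\<lambda>w. Gam w k i j * (y $ i * z $ j)) u)"
        by (rule sum.cong[OF refl], rule partial_sum) (auto intro!: differentiable_mult dGam)
      finally show ?thesis by (simp add: partial_cmult[OF dGam])
    qed
    have fd: "frechet_derivative (covariant_deriv G (\<lambda>_. y) (\<lambda>_. z)) (at u) x $ k
        = (\<Sum>a\<in>UNIV. x $ a * (\<Sum>i\<in>UNIV. \<Sum>j\<in>UNIV. partial a (\<lambda>w. Gam w k i j) u * (y $ i * z $ j)))"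
    proof -
      have e1: "frechet_derivative (covariant_deriv G (\<lambda>_. y) (\<lambda>_. z)) (at u) = frechet_derivative ?V (at u)"
        by (rule frechet_derivative_cong_open[OF U V])
      have e2: "frechet_derivative ?V (at u) x $ k = (\<Sum>a\<in>UNIV. x $ a * partial a (\<lambda>w. ?V w $ k) u)"
        by (rule frechet_derivative_vec(2)[OF dV])
      show ?thesis unfolding e1 e2 pV ..
    qed
    have "covariant_deriv G (\<lambda>_. x) (covariant_deriv G (\<lambda>_. y) (\<lambda>_. z)) u $ k
       = (\<Sum>a\<in>UNIV. x $ a * (\<Sum>i\<in>UNIV. \<Sum>j\<in>UNIV. partial a (\<lambda>w. Gam w k i j) u * (y $ i * z $ j)))
         + (\<Sum>a\<in>UNIV. \<Sum>b\<in>UNIV. Gam u k a b * x $ a * (\<Sum>i\<in>UNIV. \<Sum>j\<in>UNIV. Gam u b i j * (y $ i * z $ j)))"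
      unfolding covariant_deriv_def[of G "\<lambda>_. x"] vector_add_component fd V[OF U(2)]
      by (simp add: ch[OF U(2)])
    also have "(\<Sum>a\<in>UNIV. \<Sum>b\<in>UNIV. Gam u k a b * x $ a * (\<Sum>i\<in>UNIV. \<Sum>j\<in>UNIV. Gam u b i j * (y $ i * z $ j)))
       = (\<Sum>a\<in>UNIV. \<Sum>i\<in>UNIV. \<Sum>j\<in>UNIV. \<Sum>b\<in>UNIV. Gam u k a b * x $ a * (Gam u b i j * (y $ i * z $ j)))"
      unfolding sum_distrib_left
      by (rule sum.cong[OF refl], subst sum.swap, rule sum.cong[OF refl], rule sum.swap)
    finally show ?thesis
      by (simp add: D_def distrib_left sum.distrib sum_distrib_left mult_ac)
  qed
  have sw: "(\<Sum>a\<in>UNIV. \<Sum>i\<in>UNIV. \<Sum>j\<in>UNIV. y $ a * x $ i * z $ j * D k a i j)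
     = (\<Sum>a\<in>UNIV. \<Sum>i\<in>UNIV. \<Sum>j\<in>UNIV. x $ a * y $ i * z $ j * D k i a j)"
    by (subst sum.swap) (simp add: mult_ac)
  have lb: "covariant_deriv G (lie_bracket (\<lambda>_. x) (\<lambda>_. y)) (\<lambda>_. z) u = 0"
    by (simp add: covariant_deriv_def lie_bracket_def vec_eq_iff)
  show ?thesis
    unfolding curvature_op_def vector_minus_component lb cc sw
    by (simp add: right_diff_distrib sum_subtractf)
qed

text \<open>The Gauss equation, isolated from where \<open>T\<close> and \<open>S\<close> come from.
  \<open>GT\<close> and \<open>Tsym\<close> make \<open>T\<close> the Christoffel symbols of the
  first kind; \<open>TS\<close> says that in the antisymmetrised derivative of \<open>T\<close> the
  third derivatives of the parametrisation have cancelled.\<close>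

lemma riemann_form_gauss:
  fixes G :: "real^'m \<Rightarrow> real^'m^'m::finite" and T :: "real^'m \<Rightarrow> real^'m^'m^'m"
  assumes U: "open U" "u \<in> U"
    and Gsym: "\<And>w i j. w \<in> U \<Longrightarrow> G w $ i $ j = G w $ j $ i"
    and Gdet: "\<And>w. w \<in> U \<Longrightarrow> det (G w) \<noteq> 0"
    and dG: "\<And>w i j. w \<in> U \<Longrightarrow> (\<lambda>w. G w $ i $ j) differentiable (at w)"
    and GT: "\<And>w a i j. w \<in> U \<Longrightarrow> partial a (\<lambda>w. G w $ i $ j) w = T w $ a $ i $ j + T w $ a $ j $ i"
    and Tsym: "\<And>w a b l. w \<in> U \<Longrightarrow> T w $ a $ b $ l = T w $ b $ a $ l"
    and dT: "\<And>a b l. (\<lambda>w. T w $ a $ b $ l) differentiable (at u)"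
    and TS: "\<And>a b c l. partial a (\<lambda>w. T w $ b $ c $ l) u - partial b (\<lambda>w. T w $ a $ c $ l) u
       = S $ b $ c $ a $ l - S $ a $ c $ b $ l"
  shows "riemann_form G u = coeff_form (gauss_coeff (G u) (T u) S)"
proof -
  define Gam where "Gam w k i j = (\<Sum>l\<in>UNIV. matrix_inv (G w) $ k $ l * T w $ i $ j $ l)" for w k i j
  have ch: "christoffel G k i j w = Gam w k i j" if "w \<in> U" for w k i j
    unfolding christoffel_def Gam_def GT[OF that] sum_distrib_left
  proof (rule sum.cong[OF refl])
    fix l
    \<comment> \<open>The Koszul combination: by the symmetry in the first two indices, four of the
      six terms cancel in pairs.\<close>
    have "T w $ i $ j $ l + T w $ i $ l $ j + (T w $ j $ i $ l + T w $ j $ l $ i)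
        - (T w $ l $ i $ j + T w $ l $ j $ i) = 2 * T w $ i $ j $ l"
      using Tsym[OF that, of j i] Tsym[OF that, of l i] Tsym[OF that, of l j] by simp
    then show "1 / 2 * (matrix_inv (G w) $ k $ l * (T w $ i $ j $ l + T w $ i $ l $ j + (T w $ j $ i $ l + T w $ j $ l $ i)
        - (T w $ l $ i $ j + T w $ l $ j $ i))) = matrix_inv (G w) $ k $ l * T w $ i $ j $ l"
      by simp
  qed
  have dinv: "(\<lambda>w. matrix_inv (G w) $ k $ l) differentiable (at u)" for k l
    by (rule differentiable_matrix_inv[OF dG[OF U(2)] U Gdet])
  have dGam: "(\<lambda>w. Gam w k i j) differentiable (at u)" for k i j
    unfolding Gam_def by (auto intro!: differentiable_sum differentiable_mult dinv dT)
  have low: "(\<Sum>k\<in>UNIV. G w $ k $ l * Gam w k i j) = T w $ i $ j $ l" if "w \<in> U" for w i j l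
  proof -
    have "(\<Sum>k\<in>UNIV. G w $ k $ l * Gam w k i j)
       = (\<Sum>p\<in>UNIV. (\<Sum>k\<in>UNIV. G w $ l $ k * matrix_inv (G w) $ k $ p) * T w $ i $ j $ p)"
      unfolding Gam_def sum_distrib_left sum_distrib_right
      by (subst sum.swap) (simp add: Gsym[OF that, of _ l] mult_ac)
    also have "\<dots> = (\<Sum>p\<in>UNIV. (if l = p then 1 else 0) * T w $ i $ j $ p)"
      using matrix_inv_right_det[OF Gdet[OF that]]
      by (simp add: vec_eq_iff matrix_matrix_mult_def mat_def)
    also have "\<dots> = (\<Sum>p\<in>UNIV. (if l = p then T w $ i $ j $ p else 0))"
      by (intro sum.cong) auto
    also have "\<dots> = T w $ i $ j $ l" by simp
    finally show ?thesis .
  qed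
  define D where "D = (\<lambda>k a i j. partial a (\<lambda>w. Gam w k i j) u + (\<Sum>b\<in>UNIV. Gam u k a b * Gam u b i j))"
  \<comment> \<open>The identity \<open>low\<close> is differentiated by the product rule, so the
    derivative of the inverse matrix never has to be computed.\<close>
  have dlow: "(\<Sum>k\<in>UNIV. G u $ k $ l * partial a (\<lambda>w. Gam w k i j) u)
     = partial a (\<lambda>w. T w $ i $ j $ l) u - (\<Sum>k\<in>UNIV. (T u $ a $ k $ l + T u $ a $ l $ k) * Gam u k i j)" for a i j l
  proof -
    have "partial a (\<lambda>w. T w $ i $ j $ l) u = partial a (\<lambda>w. \<Sum>k\<in>UNIV. G w $ k $ l * Gam w k i j) u"
      by (rule partial_cong_open[OF U]) (simp add: low)
    also have "\<dots> = (\<Sum>k\<in>UNIV. partial a (\<lambda>w. G w $ k $ l * Gam w k i j) u)"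
      by (rule partial_sum) (auto intro!: differentiable_mult dG[OF U(2)] dGam)
    also have "\<dots> = (\<Sum>k\<in>UNIV. (T u $ a $ k $ l + T u $ a $ l $ k) * Gam u k i j)
        + (\<Sum>k\<in>UNIV. G u $ k $ l * partial a (\<lambda>w. Gam w k i j) u)"
      by (simp add: partial_mult[OF dG[OF U(2)] dGam] GT[OF U(2)] sum.distrib)
    finally show ?thesis by simp
  qed
  \<comment> \<open>The quadratic term of \<open>D\<close>, with its index lowered, cancels the
    first of the two sums subtracted in \<open>dlow\<close>.\<close>
  have Dlow: "(\<Sum>k\<in>UNIV. G u $ k $ l * D k a i j)
     = partial a (\<lambda>w. T w $ i $ j $ l) u - (\<Sum>k\<in>UNIV. T u $ a $ l $ k * Gam u k i j)" for a i j l
  proof -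
    have "(\<Sum>k\<in>UNIV. \<Sum>b\<in>UNIV. G u $ k $ l * (Gam u k a b * Gam u b i j))
        = (\<Sum>b\<in>UNIV. (\<Sum>k\<in>UNIV. G u $ k $ l * Gam u k a b) * Gam u b i j)"
      unfolding sum_distrib_right by (subst sum.swap) (simp add: mult_ac)
    also have "\<dots> = (\<Sum>b\<in>UNIV. T u $ a $ b $ l * Gam u b i j)" by (simp add: low[OF U(2)])
    finally show ?thesis
      by (simp add: D_def distrib_left sum.distrib dlow sum_distrib_left distrib_right)
  qed
  have gc: "(\<Sum>k\<in>UNIV. G u $ k $ l * (D k a i j - D k i a j)) = gauss_coeff (G u) (T u) S a i j l" for a i j l
  proof -
    have "(\<Sum>k\<in>UNIV. T u $ a $ l $ k * Gam u k i j)
       = (\<Sum>p\<in>UNIV. \<Sum>q\<in>UNIV. matrix_inv (G u) $ p $ q * T u $ i $ j $ p * T u $ a $ l $ q)" for a i j l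
    proof -
      have s: "matrix_inv (G u) $ p $ q = matrix_inv (G u) $ q $ p" for p q
      proof -
        have tr: "transpose (G u) = G u" using Gsym[OF U(2)] by (simp add: vec_eq_iff transpose_def)
        have "transpose (matrix_inv (G u) ** G u) = mat 1"
          by (simp add: matrix_inv_left_det[OF Gdet[OF U(2)]])
        then have "G u ** transpose (matrix_inv (G u)) = mat 1" by (simp add: matrix_transpose_mul tr)
        then have "matrix_inv (G u) = transpose (matrix_inv (G u))" by (rule matrix_inv_eq)
        then show ?thesis by (metis (no_types, lifting) transpose_def vec_lambda_beta)
      qed
      show ?thesis unfolding Gam_def sum_distrib_left
        by (rule trans[OF sum.swap], intro sum.cong refl, subst s) (simp only: mult_ac)
    qed
    then show ?thesis
      unfolding right_diff_distrib sum_subtractf Dlow gauss_coeff_def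
      using TS[of a i j l] by simp
  qed
  show ?thesis
  proof (intro ext)
    fix X Z :: "nat \<Rightarrow> real^'m"
    let ?R = "curvature_op G (\<lambda>_. X 0) (\<lambda>_. X 1) (\<lambda>_. Z 0) u"
    have Rl: "(\<Sum>k\<in>UNIV. G u $ k $ l * ?R $ k) = (\<Sum>a\<in>UNIV. \<Sum>i\<in>UNIV. \<Sum>j\<in>UNIV.
         X 0 $ a * X 1 $ i * Z 0 $ j * gauss_coeff (G u) (T u) S a i j l)" for l
    proof -
      have R: "?R $ k = (\<Sum>a\<in>UNIV. \<Sum>i\<in>UNIV. \<Sum>j\<in>UNIV. X 0 $ a * X 1 $ i * Z 0 $ j * (D k a i j - D k i a j))" for k
        unfolding D_def by (rule curvature_op_const[OF U ch dGam])
      have "(\<Sum>k\<in>UNIV. G u $ k $ l * ?R $ k) = (\<Sum>k\<in>UNIV. \<Sum>a\<in>UNIV. \<Sum>i\<in>UNIV. \<Sum>j\<in>UNIV.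
          X 0 $ a * X 1 $ i * Z 0 $ j * (G u $ k $ l * (D k a i j - D k i a j)))"
        unfolding R sum_distrib_left by (simp add: mult_ac)
      also have "\<dots> = (\<Sum>a\<in>UNIV. \<Sum>i\<in>UNIV. \<Sum>j\<in>UNIV. \<Sum>k\<in>UNIV.
          X 0 $ a * X 1 $ i * Z 0 $ j * (G u $ k $ l * (D k a i j - D k i a j)))"
        by (subst sum.swap, rule sum.cong[OF refl], subst sum.swap, rule sum.cong[OF refl], rule sum.swap)
      finally show ?thesis by (simp add: sum_distrib_left[symmetric] gc)
    qed
    have "riemann_form G u X Z = (\<Sum>l\<in>UNIV. (\<Sum>k\<in>UNIV. G u $ k $ l * ?R $ k) * Z 1 $ l)"
      unfolding riemann_form_def metric_inner_eq sum_distrib_right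
      by (subst sum.swap) (simp add: mult_ac)
    also have "\<dots> = (\<Sum>l\<in>UNIV. (\<Sum>a\<in>UNIV. \<Sum>i\<in>UNIV. \<Sum>j\<in>UNIV.
         X 0 $ a * X 1 $ i * Z 0 $ j * gauss_coeff (G u) (T u) S a i j l) * Z 1 $ l)"
      by (simp only: Rl)
    also have "\<dots> = coeff_form (gauss_coeff (G u) (T u) S) X Z"
      unfolding coeff_form_def sum_distrib_right
      by (rule trans[OF sum.swap], rule sum.cong[OF refl], rule trans[OF sum.swap], rule sum.cong[OF refl],
          rule trans[OF sum.swap]) (simp add: mult_ac)
    finally show "riemann_form G u X Z = coeff_form (gauss_coeff (G u) (T u) S) X Z" .
  qed
qed

text \<open>Under a change of parametrisation with Jacobian \<open>J\<close>, second derivatives change by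
  tangential terms \<open>K\<close>; these drop out of the normal part
  \<open>S - T G\<^sup>-\<^sup>1 T\<close> of the product of second derivatives.\<close>

lemma normal_product_transform:
  fixes J :: "real^'m^'m::finite" and G G' :: "real^'m^'m"
  assumes G: "G = transpose J ** G' ** J" and J: "J ** J' = mat 1"
    and G'sym: "transpose G' = G'" and G'det: "det G' \<noteq> 0"
    and t1: "t1 = transpose J *v (s1 + G' *v k1)" and t2: "t2 = transpose J *v (s2 + G' *v k2)"
  shows "t1 \<bullet> (matrix_inv G *v t2) = s1 \<bullet> (matrix_inv G' *v s2) + s1 \<bullet> k2 + k1 \<bullet> s2 + k1 \<bullet> (G' *v k2)"
proof -
  have J2: "J' ** J = mat 1" using J by (simp add: matrix_left_right_inverse)
  have Jt: "transpose J ** transpose J' = mat 1" "transpose J' ** transpose J = mat 1"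
    using J J2 by (metis matrix_transpose_mul transpose_mat)+
  have "G ** (J' ** matrix_inv G' ** transpose J') = transpose J ** G' ** (J ** J') ** matrix_inv G' ** transpose J'"
    by (simp add: G matrix_mul_assoc)
  also have "\<dots> = transpose J ** (G' ** matrix_inv G') ** transpose J'"
    by (simp add: J matrix_mul_assoc)
  also have "\<dots> = mat 1" by (simp add: matrix_inv_right_det[OF G'det] Jt)
  finally have inv: "matrix_inv G = J' ** matrix_inv G' ** transpose J'" by (rule matrix_inv_eq)
  have "matrix_inv G *v t2 = J' *v (matrix_inv G' *v ((transpose J' ** transpose J) *v (s2 + G' *v k2)))"
    by (simp only: inv t2 matrix_vector_mul_assoc matrix_mul_assoc)
  also have "\<dots> = J' *v (matrix_inv G' *v s2 + (matrix_inv G' ** G') *v k2)"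
    by (simp add: Jt matrix_vector_right_distrib matrix_vector_mul_assoc)
  finally have r: "matrix_inv G *v t2 = J' *v (matrix_inv G' *v s2 + k2)"
    by (simp add: matrix_inv_left_det[OF G'det])
  have "t1 \<bullet> (matrix_inv G *v t2) = (s1 + G' *v k1) \<bullet> (J *v (J' *v (matrix_inv G' *v s2 + k2)))"
    unfolding r t1 by (metis dot_lmul_matrix transpose_matrix_vector)
  also have "\<dots> = (s1 + G' *v k1) \<bullet> (matrix_inv G' *v s2 + k2)"
    by (simp add: matrix_vector_mul_assoc J)
  also have "\<dots> = s1 \<bullet> (matrix_inv G' *v s2) + s1 \<bullet> k2 + (G' *v k1) \<bullet> (matrix_inv G' *v s2) + (G' *v k1) \<bullet> k2"
    by (simp add: inner_add_left inner_add_right)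
  also have "\<dots> = s1 \<bullet> (matrix_inv G' *v s2) + s1 \<bullet> k2 + k1 \<bullet> s2 + k1 \<bullet> (G' *v k2)"
  proof -
    have sym: "(G' *v k1) \<bullet> w = k1 \<bullet> (G' *v w)" for w
      by (metis G'sym dot_lmul_matrix transpose_matrix_vector)
    have "G' *v (matrix_inv G' *v s2) = s2"
      by (simp add: matrix_vector_mul_assoc matrix_inv_right_det[OF G'det])
    then show ?thesis by (simp add: sym)
  qed
  finally show ?thesis .
qed

section \<open>Parametrised fields in a closed space of square integrable functions\<close>

text \<open>The decisive assumption is \<open>L_lim\<close>: almost everywhere convergence of a
  sequence in \<open>L\<close> forces mean square convergence, and the limit stays in
  \<open>L\<close>. It fails for general square integrable functions, but holds for all functions on
  finitely many points and for closed Gaussian spaces. It turns pathwise derivatives into mean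
  square derivatives.\<close>

locale L2_space =
  fixes M :: "'w measure" and L :: "('w \<Rightarrow> real) set"
  assumes L_zero: "(\<lambda>_. 0) \<in> L"
    and L_lin: "\<And>X Y a b. X \<in> L \<Longrightarrow> Y \<in> L \<Longrightarrow> (\<lambda>w. a * X w + b * Y w) \<in> L"
    and L_meas: "\<And>X. X \<in> L \<Longrightarrow> X \<in> borel_measurable M"
    and L_square: "\<And>X. X \<in> L \<Longrightarrow> integrable M (\<lambda>w. (X w)\<^sup>2)"
    and L_lim: "\<And>Xs X. (\<And>n::nat. Xs n \<in> L) \<Longrightarrow> (AE w in M. (\<lambda>n. Xs n w) \<longlonglongrightarrow> X w) \<Longrightarrow>
       X \<in> L \<and> (\<lambda>n. \<integral>w. (Xs n w - X w)\<^sup>2 \<partial>M) \<longlonglongrightarrow> 0"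
begin

definition ip :: "('w \<Rightarrow> real) \<Rightarrow> ('w \<Rightarrow> real) \<Rightarrow> real" where
  "ip X Y = (\<integral>w. X w * Y w \<partial>M)"

lemma L_diff: "X \<in> L \<Longrightarrow> Y \<in> L \<Longrightarrow> (\<lambda>w. X w - Y w) \<in> L"
  using L_lin[of X Y 1 "-1"] by simp

lemma L_cmult: "X \<in> L \<Longrightarrow> (\<lambda>w. c * X w) \<in> L"
  using L_lin[of X X c 0] by simp

lemma L_sum: "(\<And>i. i \<in> I \<Longrightarrow> X i \<in> L) \<Longrightarrow> (\<lambda>w. \<Sum>i\<in>I. X i w) \<in> L"
proof (induction I rule: infinite_finite_induct)
  case (insert i I)
  then show ?case using L_lin[of "X i" "\<lambda>w. \<Sum>i\<in>I. X i w" 1 1] by simp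
qed (simp_all add: L_zero)

lemma integrable_ip:
  assumes "X \<in> L" "Y \<in> L"
  shows "integrable M (\<lambda>w. X w * Y w)"
proof (rule Bochner_Integration.integrable_bound)
  show "integrable M (\<lambda>w. (X w)\<^sup>2 + (Y w)\<^sup>2)" using assms by (intro Bochner_Integration.integrable_add L_square)
  show "(\<lambda>w. X w * Y w) \<in> borel_measurable M" using assms[THEN L_meas] by measurable
  have "\<bar>x * y\<bar> \<le> \<bar>x\<^sup>2 + y\<^sup>2\<bar>" for x y :: real
  proof -
    have a: "0 \<le> \<bar>x\<bar> * \<bar>y\<bar>" by simp
    have "2 * (\<bar>x\<bar> * \<bar>y\<bar>) \<le> x\<^sup>2 + y\<^sup>2" using sum_squares_bound[of "\<bar>x\<bar>" "\<bar>y\<bar>"] by simp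
    then have "\<bar>x * y\<bar> \<le> x\<^sup>2 + y\<^sup>2" unfolding abs_mult using a by linarith
    then show ?thesis by simp
  qed
  then show "AE w in M. norm (X w * Y w) \<le> norm ((X w)\<^sup>2 + (Y w)\<^sup>2)" by simp
qed

lemma ip_commute: "ip X Y = ip Y X"
  by (simp add: ip_def mult.commute)

lemma ip_lin:
  assumes "X \<in> L" "Y \<in> L" "Z \<in> L"
  shows "ip (\<lambda>w. a * X w + b * Y w) Z = a * ip X Z + b * ip Y Z"
proof -
  have "ip (\<lambda>w. a * X w + b * Y w) Z = (\<integral>w. a * (X w * Z w) + b * (Y w * Z w) \<partial>M)"
    by (simp add: ip_def algebra_simps)
  also have "\<dots> = a * ip X Z + b * ip Y Z"
    using assms by (simp add: ip_def integrable_ip)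
  finally show ?thesis .
qed

lemma ip_diff: "X \<in> L \<Longrightarrow> Y \<in> L \<Longrightarrow> Z \<in> L \<Longrightarrow> ip (\<lambda>w. X w - Y w) Z = ip X Z - ip Y Z"
  using ip_lin[of X Y Z 1 "-1"] by simp

lemma ip_diff_right: "X \<in> L \<Longrightarrow> Y \<in> L \<Longrightarrow> Z \<in> L \<Longrightarrow> ip Z (\<lambda>w. X w - Y w) = ip Z X - ip Z Y"
  using ip_diff[of X Y Z] by (simp add: ip_commute[of Z])

lemma ip_cmult: "X \<in> L \<Longrightarrow> Z \<in> L \<Longrightarrow> ip (\<lambda>w. c * X w) Z = c * ip X Z"
  using ip_lin[of X X Z c 0] by simp

lemma ip_sum:
  assumes "\<And>i. i \<in> I \<Longrightarrow> X i \<in> L" "Z \<in> L"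
  shows "ip (\<lambda>w. \<Sum>i\<in>I. X i w) Z = (\<Sum>i\<in>I. ip (X i) Z)"
  using assms by (simp add: ip_def sum_distrib_right integrable_ip Bochner_Integration.integral_sum)

lemma ip_cong_AE:
  assumes "X \<in> L" "Y \<in> L" "X' \<in> L" "Y' \<in> L" "AE w in M. X w = X' w" "AE w in M. Y w = Y' w"
  shows "ip X Y = ip X' Y'"
  unfolding ip_def
proof (rule integral_cong_AE)
  show "AE w in M. X w * Y w = X' w * Y' w" using assms(5,6) by eventually_elim simp
qed (use assms(1-4)[THEN L_meas] in measurable)

lemma ip_nonneg: "0 \<le> ip X X"
  unfolding ip_def by (rule integral_nonneg_AE) simp

lemma ip_Cauchy_Schwarz_square:
  assumes X: "X \<in> L" and Y: "Y \<in> L"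
  shows "(ip X Y)\<^sup>2 \<le> ip X X * ip Y Y"
proof -
  have q: "0 \<le> ip X X - 2 * t * ip X Y + t\<^sup>2 * ip Y Y" for t
  proof -
    let ?Z = "\<lambda>w. 1 * X w + (- t) * Y w"
    have Z: "?Z \<in> L" using L_lin[OF X Y] .
    have "ip ?Z ?Z = 1 * ip X ?Z + (-t) * ip Y ?Z" by (rule ip_lin[OF X Y Z])
    also have "ip X ?Z = 1 * ip X X + (-t) * ip Y X" using ip_lin[OF X Y X, of 1 "-t"] by (simp add: ip_commute)
    also have "ip Y ?Z = 1 * ip X Y + (-t) * ip Y Y" using ip_lin[OF X Y Y, of 1 "-t"] by (simp add: ip_commute)
    finally show ?thesis
      using ip_nonneg[of ?Z] by (simp add: ip_commute[of Y X] power2_eq_square algebra_simps)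
  qed
  show ?thesis
  proof (cases "ip Y Y = 0")
    case True
    have "ip X Y = 0"
    proof (rule ccontr)
      assume "ip X Y \<noteq> 0"
      \<comment> \<open>With this \<open>t\<close> and \<open>ip Y Y = 0\<close>, the nonnegative
        quadratic in \<open>q\<close> would equal -1.\<close>
      then show False using q[of "(ip X X + 1) / (2 * ip X Y)"] True by simp
    qed
    then show ?thesis using True by simp
  next
    case False
    then have p: "ip Y Y > 0" using ip_nonneg[of Y] by simp
    have "0 \<le> ip X X - (ip X Y)\<^sup>2 / ip Y Y"
      using q[of "ip X Y / ip Y Y"] p by (simp add: power2_eq_square field_simps)
    then show ?thesis using p by (simp add: field_simps)
  qed
qed

lemma ip_Cauchy_Schwarz:
  assumes "X \<in> L" "Y \<in> L"
  shows "\<bar>ip X Y\<bar> \<le> sqrt (ip X X) * sqrt (ip Y Y)"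
  using real_sqrt_le_mono[OF ip_Cauchy_Schwarz_square[OF assms]] by (simp add: real_sqrt_mult)

lemma ip_tendsto:
  assumes X: "\<And>n::nat. Xs n \<in> L" "AE w in M. (\<lambda>n. Xs n w) \<longlonglongrightarrow> X w"
    and Y: "\<And>n. Ys n \<in> L" "AE w in M. (\<lambda>n. Ys n w) \<longlonglongrightarrow> Y w"
  shows "(\<lambda>n. ip (Xs n) (Ys n)) \<longlonglongrightarrow> ip X Y"
proof -
  have XL: "X \<in> L" and YL: "Y \<in> L" using L_lim[OF X] L_lim[OF Y] by auto
  let ?dX = "\<lambda>n w. Xs n w - X w" and ?dY = "\<lambda>n w. Ys n w - Y w"
  have dL: "?dX n \<in> L" "?dY n \<in> L" for n using X Y XL YL by (auto intro: L_diff)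
  have "(\<lambda>n. ip (?dX n) (?dX n)) \<longlonglongrightarrow> 0" "(\<lambda>n. ip (?dY n) (?dY n)) \<longlonglongrightarrow> 0"
    using L_lim[OF X] L_lim[OF Y] by (simp_all add: ip_def power2_eq_square)
  then have s: "(\<lambda>n. sqrt (ip (?dX n) (?dX n))) \<longlonglongrightarrow> 0" "(\<lambda>n. sqrt (ip (?dY n) (?dY n))) \<longlonglongrightarrow> 0"
    using tendsto_real_sqrt by fastforce+
  let ?b = "\<lambda>n. sqrt (ip (?dX n) (?dX n)) * sqrt (ip (?dY n) (?dY n))
     + sqrt (ip (?dX n) (?dX n)) * sqrt (ip Y Y) + sqrt (ip X X) * sqrt (ip (?dY n) (?dY n))"
  have "?b \<longlonglongrightarrow> 0 * 0 + 0 * sqrt (ip Y Y) + sqrt (ip X X) * 0"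
    by (intro tendsto_intros s)
  then have b: "?b \<longlonglongrightarrow> 0" by simp
  have "norm (ip (Xs n) (Ys n) - ip X Y) \<le> ?b n" for n
  proof -
    have "ip (Xs n) (Ys n) - ip X Y = ip (?dX n) (?dY n) + ip (?dX n) Y + ip X (?dY n)"
      using X Y XL YL dL by (simp add: ip_diff ip_diff_right)
    then show ?thesis
      using ip_Cauchy_Schwarz[OF dL(1) dL(2), of n n] ip_Cauchy_Schwarz[OF dL(1) YL, of n]
        ip_Cauchy_Schwarz[OF XL dL(2), of n] by simp
  qed
  then have "(\<lambda>n. ip (Xs n) (Ys n) - ip X Y) \<longlonglongrightarrow> 0"
    by (intro Lim_null_comparison[OF _ b]) simp
  then show ?thesis by (simp add: LIM_zero_iff)
qed

text \<open>Membership in \<open>L\<close> is required at every point, smoothness only almost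
  everywhere, but with one null set for all of \<open>U\<close>. This is the form in which sample
  path regularity is given.\<close>

definition field :: "nat \<Rightarrow> (real^'m::finite) set \<Rightarrow> (real^'m \<Rightarrow> 'w \<Rightarrow> real) \<Rightarrow> bool" where
  "field k U X \<longleftrightarrow> (\<forall>u\<in>U. X u \<in> L) \<and> (AE w in M. Ck_on k (\<lambda>u. X u w) U)"

definition fpartial :: "'m \<Rightarrow> (real^'m::finite \<Rightarrow> 'w \<Rightarrow> real) \<Rightarrow> real^'m \<Rightarrow> 'w \<Rightarrow> real" where
  "fpartial i X u w = partial i (\<lambda>v. X v w) u"

lemma field_L: "field k U X \<Longrightarrow> u \<in> U \<Longrightarrow> X u \<in> L"
  by (simp add: field_def)

lemma field_mono: "field l U X \<Longrightarrow> k \<le> l \<Longrightarrow> field k U X"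
  unfolding field_def by (auto elim!: eventually_mono intro: Ck_on_mono)

lemma field_const:
  fixes U :: "(real^'m::finite) set"
  assumes "Z \<in> L" shows "field k U (\<lambda>_. Z)"
proof -
  have "Ck_on k (\<lambda>_. c) S" for c :: real and S :: "(real^'m) set"
    by (induction k arbitrary: c) simp_all
  then show ?thesis using assms by (simp add: field_def)
qed

lemma field_tendsto:
  assumes "field k U X" "a \<in> U" "\<And>n. x n \<in> U" "x \<longlonglongrightarrow> a"
  shows "AE w in M. (\<lambda>n. X (x n) w) \<longlonglongrightarrow> X a w"
proof -
  have "AE w in M. Ck_on k (\<lambda>u. X u w) U" using assms(1) by (simp add: field_def)
  then show ?thesis
  proof eventually_elim
    fix w assume "Ck_on k (\<lambda>u. X u w) U"
    then have "continuous_on U (\<lambda>u. X u w)" by (rule Ck_on_continuous)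
    then show "(\<lambda>n. X (x n) w) \<longlonglongrightarrow> X a w"
      using assms(2-4) by (auto simp: continuous_on_sequentially comp_def)
  qed
qed

lemma ip_continuous_on:
  assumes "field k U X" "field l U Y"
  shows "continuous_on U (\<lambda>u. ip (X u) (Y u))"
  unfolding continuous_on_sequentially comp_def
proof (intro allI impI ballI, elim conjE)
  fix x a assume a: "a \<in> U" "\<forall>n. x n \<in> U" "x \<longlonglongrightarrow> a"
  have "AE w in M. (\<lambda>n. Z (x n) w) \<longlonglongrightarrow> Z a w" if "field j U Z" for j Z
    using field_tendsto[OF that] a by blast
  then show "(\<lambda>n. ip (X (x n)) (Y (x n))) \<longlonglongrightarrow> ip (X a) (Y a)"
    using assms a by (intro ip_tendsto) (auto intro: field_L)
qed

text \<open>\<open>L_lim\<close> concerns sequences, so differentiability at \<open>a\<close> is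
  phrased along sequences approaching \<open>a\<close> inside \<open>U\<close>.\<close>

lemma field_remainder:
  fixes X :: "real^'m::finite \<Rightarrow> 'w \<Rightarrow> real"
  assumes "open U" "field (Suc k) U X" "a \<in> U" "\<And>n. x n \<in> U - {a}" "x \<longlonglongrightarrow> a"
  shows "AE w in M. (\<lambda>n. (X (x n) w - X a w - (\<Sum>i\<in>UNIV. (x n - a) $ i * fpartial i X a w)) / norm (x n - a)) \<longlonglongrightarrow> 0"
proof -
  have "AE w in M. Ck_on (Suc k) (\<lambda>u. X u w) U" using assms by (simp add: field_def)
  then show ?thesis
  proof eventually_elim
    fix w assume *: "Ck_on (Suc k) (\<lambda>u. X u w) U"
    have d: "((\<lambda>u. X u w) has_derivative (\<lambda>v. \<Sum>i\<in>UNIV. v $ i * fpartial i X a w)) (at a within U)"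
      unfolding fpartial_def
      by (rule has_derivative_at_withinI, rule has_derivative_partials, rule Ck_on_differentiable[OF * _ assms(3)]) simp
    from d[unfolded has_derivative_within, THEN conjunct2, unfolded tendsto_at_iff_sequentially, rule_format, of x]
    have "(\<lambda>n. (1 / norm (x n - a)) *\<^sub>R (X (x n) w - (X a w + (\<Sum>i\<in>UNIV. (x n - a) $ i * fpartial i X a w)))) \<longlonglongrightarrow> 0"
      using assms(4,5) unfolding comp_def by blast
    moreover have "(1 / norm (x n - a)) *\<^sub>R (X (x n) w - (X a w + (\<Sum>i\<in>UNIV. (x n - a) $ i * fpartial i X a w)))
      = (X (x n) w - X a w - (\<Sum>i\<in>UNIV. (x n - a) $ i * fpartial i X a w)) / norm (x n - a)" for n
      unfolding diff_diff_eq real_scaleR_def by (simp only: times_divide_eq_left mult_1_left)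
    ultimately show "(\<lambda>n. (X (x n) w - X a w - (\<Sum>i\<in>UNIV. (x n - a) $ i * fpartial i X a w)) / norm (x n - a)) \<longlonglongrightarrow> 0"
      by (simp only:)
  qed
qed

text \<open>The difference quotients along the \<open>i\<close>-th axis lie in the linear space
  \<open>L\<close> and converge almost everywhere, so their limit lies in \<open>L\<close> by
  \<open>L_lim\<close>.\<close>

lemma field_fpartial:
  fixes X :: "real^'m::finite \<Rightarrow> 'w \<Rightarrow> real"
  assumes U: "open U" and X: "field (Suc k) U X"
  shows "field k U (fpartial i X)"
  unfolding field_def
proof (intro conjI ballI)
  show "AE w in M. Ck_on k (\<lambda>u. fpartial i X u w) U"
    using X unfolding field_def fpartial_def
    by (auto elim!: eventually_mono dest!: Ck_on_partial[of k _ U i] simp del: Ck_on.simps)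
  fix a assume a: "a \<in> U"
  obtain d where d: "d > 0" "ball a d \<subseteq> U" using U a by (meson openE)
  define t where "t n = d / 2 / real (Suc n)" for n
  define x where "x n = a + t n *\<^sub>R axis i 1" for n
  have t: "t n > 0" "t n < d" for n
  proof -
    show "t n > 0" using d by (simp add: t_def)
    have "t n \<le> d / 2" using d by (simp add: t_def divide_le_eq)
    then show "t n < d" using d by simp
  qed
  have nx: "norm (x n - a) = t n" for n using t(1)[of n] by (simp add: x_def norm_axis_1)
  have xU: "x n \<in> U - {a}" for n
    using nx[of n] t[of n] d by (auto simp: subset_iff dist_norm norm_minus_commute)
  have "(\<lambda>n. d / 2 * (1 / real (Suc n))) \<longlonglongrightarrow> d / 2 * 0"
    by (intro tendsto_intros LIMSEQ_Suc[OF lim_1_over_n])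
  then have t0: "t \<longlonglongrightarrow> 0" by (simp add: t_def[abs_def])
  then have "(\<lambda>n. a + t n *\<^sub>R axis i 1) \<longlonglongrightarrow> a + 0 *\<^sub>R axis i 1" by (intro tendsto_intros)
  then have xa: "x \<longlonglongrightarrow> a" by (simp add: x_def[abs_def])
  let ?q = "\<lambda>n w. (1 / t n) * X (x n) w + (- 1 / t n) * X a w"
  have qL: "?q n \<in> L" for n using X xU[of n] a by (intro L_lin) (auto intro: field_L)
  have "AE w in M. (\<lambda>n. ?q n w) \<longlonglongrightarrow> fpartial i X a w"
    using field_remainder[OF U X a xU xa]
  proof eventually_elim
    fix w assume *: "(\<lambda>n. (X (x n) w - X a w - (\<Sum>j\<in>UNIV. (x n - a) $ j * fpartial j X a w)) / norm (x n - a)) \<longlonglongrightarrow> 0"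
    have "(\<Sum>j\<in>UNIV. (x n - a) $ j * fpartial j X a w) = t n * fpartial i X a w" for n
      by (simp add: x_def axis_def if_distrib[where f = "\<lambda>z. _ * z"] if_distrib[where f = "\<lambda>z. z * _"] cong: if_cong)
    then have "(X (x n) w - X a w - (\<Sum>j\<in>UNIV. (x n - a) $ j * fpartial j X a w)) / norm (x n - a)
       = ?q n w - fpartial i X a w" for n
      using t(1)[of n] by (simp add: nx diff_divide_distrib)
    then show "(\<lambda>n. ?q n w) \<longlonglongrightarrow> fpartial i X a w" using * by (simp add: LIM_zero_iff)
  qed
  from L_lim[OF qL this] show "fpartial i X a \<in> L" by blast
qed

text \<open>The product rule under the integral. The first-order remainder of the product splits
  into \<open>R X\<close> against \<open>Y (x n)\<close>, \<open>X a\<close> against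
  \<open>R Y\<close>, and the increment of \<open>Y\<close> against the partials of
  \<open>X\<close>; each vanishes by \<open>ip_tendsto\<close>, so almost everywhere convergence of
  the factors is enough.\<close>

lemma ip_has_derivative:
  fixes X Y :: "real^'m::finite \<Rightarrow> 'w \<Rightarrow> real"
  assumes U: "open U" and X: "field (Suc k) U X" and Y: "field (Suc l) U Y" and a: "a \<in> U"
  shows "((\<lambda>u. ip (X u) (Y u)) has_derivative
     (\<lambda>v. \<Sum>i\<in>UNIV. v $ i * (ip (fpartial i X a) (Y a) + ip (X a) (fpartial i Y a)))) (at a)"
    (is "(?f has_derivative ?D) (at a)")
proof -
  have dX: "fpartial i X a \<in> L" and dY: "fpartial i Y a \<in> L" for i
    using field_fpartial[OF U X] field_fpartial[OF U Y] a by (auto intro: field_L)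
  have XL: "X u \<in> L" and YL: "Y u \<in> L" if "u \<in> U" for u using X Y that by (auto intro: field_L)
  have "((\<lambda>y. (1 / norm (y - a)) *\<^sub>R (?f y - (?f a + ?D (y - a)))) \<longlongrightarrow> 0) (at a within U)"
    unfolding tendsto_at_iff_sequentially comp_def
  proof (intro allI impI)
    fix x assume x: "\<forall>n. x n \<in> U - {a}" "x \<longlonglongrightarrow> a"
    define R where "R Z n w = (Z (x n) w - Z a w - (\<Sum>i\<in>UNIV. (x n - a) $ i * fpartial i Z a w)) / norm (x n - a)"
      for Z :: "real^'m \<Rightarrow> 'w \<Rightarrow> real" and n w
    have RL: "R X n \<in> L" "R Y n \<in> L" for n
      unfolding R_def[abs_def] divide_inverse mult.commute[of _ "inverse _"]
      using x a XL YL dX dY by (auto intro!: L_cmult L_diff L_sum)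
    have R0: "AE w in M. (\<lambda>n. R X n w) \<longlonglongrightarrow> 0" "AE w in M. (\<lambda>n. R Y n w) \<longlonglongrightarrow> 0"
      unfolding R_def using field_remainder[OF U X a _ x(2)] field_remainder[OF U Y a _ x(2)] x(1) by auto
    have Yx: "AE w in M. (\<lambda>n. Y (x n) w) \<longlonglongrightarrow> Y a w"
      using field_tendsto[OF Y a _ x(2)] x(1) by blast
    let ?N = "\<lambda>n. norm (x n - a)"
    have N: "?N n > 0" for n using x(1) by (auto simp: )
    have "(\<lambda>n. ip (R X n) (Y (x n))) \<longlonglongrightarrow> ip (\<lambda>_. 0) (Y a)"
      by (rule ip_tendsto[OF RL(1) R0(1) _ Yx]) (use x YL in auto)
    then have l1: "(\<lambda>n. ip (R X n) (Y (x n))) \<longlonglongrightarrow> 0" by (simp add: ip_def)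
    have "(\<lambda>n. ip (X a) (R Y n)) \<longlonglongrightarrow> ip (X a) (\<lambda>_. 0)"
      by (rule ip_tendsto[OF _ _ RL(2) R0(2)]) (use XL a in auto)
    then have l2: "(\<lambda>n. ip (X a) (R Y n)) \<longlonglongrightarrow> 0" by (simp add: ip_def)
    have l3: "(\<lambda>n. (x n - a) $ i / ?N n * (ip (fpartial i X a) (Y (x n)) - ip (fpartial i X a) (Y a))) \<longlonglongrightarrow> 0" for i
    proof (rule Lim_null_comparison)
      have "(\<lambda>n. ip (fpartial i X a) (Y (x n))) \<longlonglongrightarrow> ip (fpartial i X a) (Y a)"
        by (rule ip_tendsto[OF dX _ _ Yx]) (use x YL in auto)
      then show "(\<lambda>n. \<bar>ip (fpartial i X a) (Y (x n)) - ip (fpartial i X a) (Y a)\<bar>) \<longlonglongrightarrow> 0"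
        by (simp add: LIM_zero_iff tendsto_rabs_zero)
      show "\<forall>\<^sub>F n in sequentially. norm ((x n - a) $ i / ?N n * (ip (fpartial i X a) (Y (x n)) - ip (fpartial i X a) (Y a)))
          \<le> \<bar>ip (fpartial i X a) (Y (x n)) - ip (fpartial i X a) (Y a)\<bar>"
      proof (rule always_eventually, rule allI)
        fix n
        have "\<bar>(x n - a) $ i / ?N n\<bar> \<le> 1" using component_le_norm_cart[of "x n - a" i] N[of n] by (simp add: abs_divide)
        then show "norm ((x n - a) $ i / ?N n * (ip (fpartial i X a) (Y (x n)) - ip (fpartial i X a) (Y a)))
          \<le> \<bar>ip (fpartial i X a) (Y (x n)) - ip (fpartial i X a) (Y a)\<bar>"
          using mult_right_mono[of "\<bar>(x n - a) $ i / ?N n\<bar>" 1] by (simp add: abs_mult)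
      qed
    qed
    have "(1 / ?N n) *\<^sub>R (?f (x n) - (?f a + ?D (x n - a)))
       = ip (R X n) (Y (x n)) + ip (X a) (R Y n)
         + (\<Sum>i\<in>UNIV. (x n - a) $ i / ?N n * (ip (fpartial i X a) (Y (x n)) - ip (fpartial i X a) (Y a)))" for n
    proof -
      have xn: "x n \<in> U" using x by auto
      have e1: "ip (R X n) (Y (x n)) = (ip (X (x n)) (Y (x n)) - ip (X a) (Y (x n))
          - (\<Sum>i\<in>UNIV. (x n - a) $ i * ip (fpartial i X a) (Y (x n)))) / ?N n"
        unfolding R_def[abs_def] divide_inverse mult.commute[of _ "inverse _"]
        using XL[OF xn] XL[OF a] YL[OF xn] dX
        by (simp add: ip_cmult ip_diff ip_sum L_diff L_sum L_cmult)
      have e2: "ip (X a) (R Y n) = (ip (X a) (Y (x n)) - ip (X a) (Y a)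
          - (\<Sum>i\<in>UNIV. (x n - a) $ i * ip (X a) (fpartial i Y a))) / ?N n"
        unfolding R_def[abs_def] divide_inverse mult.commute[of _ "inverse _"] ip_commute[of "X a"]
        using YL[OF xn] XL[OF a] YL[OF a] dY
        by (simp add: ip_cmult ip_diff ip_sum L_diff L_sum L_cmult)
      show ?thesis unfolding e1 e2 using N[of n]
        by (simp add: field_simps sum_divide_distrib[symmetric] sum.distrib sum_subtractf)
    qed
    moreover have "(\<lambda>n. ip (R X n) (Y (x n)) + ip (X a) (R Y n)
         + (\<Sum>i\<in>UNIV. (x n - a) $ i / ?N n * (ip (fpartial i X a) (Y (x n)) - ip (fpartial i X a) (Y a))))
        \<longlonglongrightarrow> 0 + 0 + (\<Sum>i\<in>(UNIV::'m set). 0)"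
      by (intro tendsto_add tendsto_sum l1 l2 l3)
    ultimately show "(\<lambda>n. (1 / ?N n) *\<^sub>R (?f (x n) - (?f a + ?D (x n - a)))) \<longlonglongrightarrow> 0" by simp
  qed
  moreover have "bounded_linear ?D"
    by (rule linear_conv_bounded_linear[THEN iffD1])
      (auto intro!: linearI simp: algebra_simps sum.distrib sum_distrib_left)
  ultimately have "(?f has_derivative ?D) (at a within U)" unfolding has_derivative_within by simp
  then show ?thesis by (simp only: at_within_open[OF a U])
qed

lemma ip_partial:
  assumes "open U" "field (Suc k) U X" "field (Suc l) U Y" "a \<in> U"
  shows "(\<lambda>u. ip (X u) (Y u)) differentiable (at a)"
    and "partial i (\<lambda>u. ip (X u) (Y u)) a = ip (fpartial i X a) (Y a) + ip (X a) (fpartial i Y a)"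
proof -
  note D = ip_has_derivative[OF assms]
  show "(\<lambda>u. ip (X u) (Y u)) differentiable (at a)" using D by (rule differentiableI)
  show "partial i (\<lambda>u. ip (X u) (Y u)) a = ip (fpartial i X a) (Y a) + ip (X a) (fpartial i Y a)"
    unfolding has_derivative_partial[OF D]
    by (simp add: axis_def if_distrib[where f = "\<lambda>z. z * _"] cong: if_cong)
qed

text \<open>The mean value inequality for the real function \<open>ip (X y) Z\<close> of
  \<open>y\<close>, with the fixed vector \<open>Z = X v - X u\<close>. The total increment is the
  squared norm of \<open>Z\<close>, and one factor of that norm cancels. \<open>CARD('m)\<close>
  counts the partial derivatives.\<close>

lemma field_Lipschitz:
  fixes X :: "real^'m::finite \<Rightarrow> 'w \<Rightarrow> real"
  assumes U: "open U" and X: "field (Suc k) U X" and K: "convex K" "K \<subseteq> U"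
    and C: "0 \<le> C" "\<And>u i. u \<in> K \<Longrightarrow> ip (fpartial i X u) (fpartial i X u) \<le> C\<^sup>2"
    and uv: "u \<in> K" "v \<in> K"
  shows "ip (\<lambda>w. X v w - X u w) (\<lambda>w. X v w - X u w) \<le> (real CARD('m) * C * norm (v - u))\<^sup>2"
proof -
  let ?Z = "\<lambda>w. X v w - X u w"
  have XL: "X u \<in> L" if "u \<in> U" for u using X that by (auto intro: field_L)
  have ZL: "?Z \<in> L" using K uv by (intro L_diff XL) auto
  define N where "N = sqrt (ip ?Z ?Z)"
  have N: "0 \<le> N" "N\<^sup>2 = ip ?Z ?Z" using ip_nonneg[of ?Z] by (simp_all add: N_def)
  have dL: "fpartial i X u \<in> L" if "u \<in> U" for u i using field_fpartial[OF U X] that by (auto intro: field_L)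
  have z: "fpartial i (\<lambda>_. ?Z) u = (\<lambda>_. 0)" for i and u :: "real^'m"
    by (simp add: fpartial_def[abs_def] partial_def)
  let ?D = "\<lambda>y h. \<Sum>i\<in>UNIV. h $ i * ip (fpartial i X y) ?Z"
  have D: "((\<lambda>y. ip (X y) ?Z) has_derivative ?D y) (at y within K)" if "y \<in> K" for y
  proof -
    have D0: "((\<lambda>y. ip (X y) ?Z) has_derivative (\<lambda>h. \<Sum>i\<in>UNIV. h $ i *
        (ip (fpartial i X y) ?Z + ip (X y) (fpartial i (\<lambda>_. ?Z) y)))) (at y)"
      by (rule ip_has_derivative[OF U X field_const[OF ZL, of "Suc 0"]]) (use that K in blast)
    have e0: "ip W (\<lambda>_. 0) = 0" for W by (simp add: ip_def)
    show ?thesis by (rule has_derivative_at_withinI) (use D0 in \<open>simp only: z e0 add_0_right\<close>)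
  qed
  have on: "onorm (?D y) \<le> real CARD('m) * C * N" if "y \<in> K" for y
  proof (rule onorm_le)
    fix h
    have b: "\<bar>ip (fpartial i X y) ?Z\<bar> \<le> C * N" for i
    proof -
      have "sqrt (ip (fpartial i X y) (fpartial i X y)) \<le> C"
        using C(1) C(2)[OF that, of i] by (simp add: real_le_lsqrt ip_nonneg)
      then show ?thesis
        using ip_Cauchy_Schwarz[OF dL ZL, of y i] that K mult_right_mono[OF _ N(1)]
        by (force simp: N_def)
    qed
    have "norm (?D y h) \<le> (\<Sum>i\<in>UNIV. \<bar>h $ i * ip (fpartial i X y) ?Z\<bar>)" by simp
    also have "\<dots> \<le> (\<Sum>i\<in>(UNIV::'m set). norm h * (C * N))"
      unfolding abs_mult by (intro sum_mono mult_mono b component_le_norm_cart) auto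
    finally show "norm (?D y h) \<le> real CARD('m) * C * N * norm h" by (simp add: mult_ac)
  qed
  have "norm (ip (X v) ?Z - ip (X u) ?Z) \<le> real CARD('m) * C * N * norm (v - u)"
    by (rule differentiable_bound[OF K(1) D on uv(2,1)])
  moreover have "ip (X v) ?Z - ip (X u) ?Z = N\<^sup>2"
    unfolding N using K uv by (intro ip_diff[symmetric] XL ZL) auto
  ultimately have "N * N \<le> (real CARD('m) * C * norm (v - u)) * N" by (simp add: power2_eq_square mult_ac)
  then have "N \<le> real CARD('m) * C * norm (v - u)"
    using N(1) C(1) by (cases "N = 0") auto
  then show ?thesis unfolding N(2)[symmetric] using N(1) by (intro power_mono)
qed

section \<open>The second-order jet of a field and its curvature form\<close>

definition G_of :: "(real^'m::finite \<Rightarrow> 'w \<Rightarrow> real) \<Rightarrow> real^'m \<Rightarrow> real^'m^'m" where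
  "G_of \<phi> u = (\<chi> i j. ip (fpartial i \<phi> u) (fpartial j \<phi> u))"

definition T_of :: "(real^'m::finite \<Rightarrow> 'w \<Rightarrow> real) \<Rightarrow> real^'m \<Rightarrow> real^'m^'m^'m" where
  "T_of \<phi> u = (\<chi> a b l. ip (fpartial a (fpartial b \<phi>) u) (fpartial l \<phi> u))"

definition S_of :: "(real^'m::finite \<Rightarrow> 'w \<Rightarrow> real) \<Rightarrow> real^'m \<Rightarrow> real^'m^'m^'m^'m" where
  "S_of \<phi> u = (\<chi> a b c d. ip (fpartial a (fpartial b \<phi>) u) (fpartial c (fpartial d \<phi>) u))"

lemma fpartial_commute_AE:
  fixes X :: "real^'m::finite \<Rightarrow> 'w \<Rightarrow> real"
  assumes "open U" "field 2 U X" "u \<in> U"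
  shows "AE w in M. fpartial i (fpartial j X) u w = fpartial j (fpartial i X) u w"
  using assms unfolding field_def fpartial_def
  by (auto elim!: eventually_mono intro: partial_commute)

text \<open>Order 3 is needed because the derivative of \<open>T_of\<close> contains third partials.
  They are only almost everywhere symmetric, which \<open>ip_cong_AE\<close> shows to be enough for
  the cancellation demanded by \<open>riemann_form_gauss\<close>.\<close>

lemma riemann_form_field:
  fixes \<phi> :: "real^'m::finite \<Rightarrow> 'w \<Rightarrow> real"
  assumes U: "open U" "u \<in> U" and phi: "field 3 U \<phi>"
    and G: "\<And>w. w \<in> U \<Longrightarrow> G w = G_of \<phi> w" and det: "\<And>w. w \<in> U \<Longrightarrow> det (G w) \<noteq> 0"
  shows "riemann_form G u = coeff_form (gauss_coeff (G_of \<phi> u) (T_of \<phi> u) (S_of \<phi> u))"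
proof -
  have f3: "field (Suc (Suc (Suc 0))) U \<phi>" using phi by (simp add: numeral_3_eq_3)
  note f2 = field_fpartial[OF U(1) f3]
  note f1 = field_fpartial[OF U(1) f2]
  note f0 = field_fpartial[OF U(1) f1]
  have pG: "(\<lambda>w. G w $ i $ j) differentiable (at w)"
     "partial a (\<lambda>w. G w $ i $ j) w = T_of \<phi> w $ a $ i $ j + T_of \<phi> w $ a $ j $ i" if "w \<in> U" for w i j a
  proof -
    note p = ip_partial(1)[OF U(1) f2[of i] f2[of j] that] ip_partial(2)[OF U(1) f2[of i] f2[of j] that, of a]
    have eq: "G v $ i $ j = ip (fpartial i \<phi> v) (fpartial j \<phi> v)" if "v \<in> U" for v
      using G[OF that] by (simp add: G_of_def)
    show "(\<lambda>w. G w $ i $ j) differentiable (at w)"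
    proof -
      obtain D where D: "((\<lambda>v. ip (fpartial i \<phi> v) (fpartial j \<phi> v)) has_derivative D) (at w)"
        using p(1) unfolding differentiable_def by blast
      have "((\<lambda>w. G w $ i $ j) has_derivative D) (at w)"
        by (rule has_derivative_transform_within_open[OF D U(1) that]) (rule eq[symmetric])
      then show ?thesis by (rule differentiableI)
    qed
    have "partial a (\<lambda>w. G w $ i $ j) w = partial a (\<lambda>v. ip (fpartial i \<phi> v) (fpartial j \<phi> v)) w"
      by (rule partial_cong_open[OF U(1) that eq])
    then show "partial a (\<lambda>w. G w $ i $ j) w = T_of \<phi> w $ a $ i $ j + T_of \<phi> w $ a $ j $ i"
      using p(2) by (simp add: T_of_def ip_commute[of "fpartial i \<phi> w"])
  qed
  have pT: "(\<lambda>w. T_of \<phi> w $ b $ c $ l) differentiable (at u)"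
     "partial a (\<lambda>w. T_of \<phi> w $ b $ c $ l) u
       = ip (fpartial a (fpartial b (fpartial c \<phi>)) u) (fpartial l \<phi> u) + S_of \<phi> u $ b $ c $ a $ l" for a b c l
  proof -
    have T: "(\<lambda>w. T_of \<phi> w $ b $ c $ l) = (\<lambda>w. ip (fpartial b (fpartial c \<phi>) w) (fpartial l \<phi> w))"
      by (simp add: T_of_def)
    show "(\<lambda>w. T_of \<phi> w $ b $ c $ l) differentiable (at u)"
      unfolding T by (rule ip_partial(1)[OF U(1) f1 f2 U(2)])
    show "partial a (\<lambda>w. T_of \<phi> w $ b $ c $ l) u
       = ip (fpartial a (fpartial b (fpartial c \<phi>)) u) (fpartial l \<phi> u) + S_of \<phi> u $ b $ c $ a $ l"
      unfolding T ip_partial(2)[OF U(1) f1 f2 U(2)] by (simp add: S_of_def)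
  qed
  show ?thesis
    unfolding G[OF U(2), symmetric]
  proof (rule riemann_form_gauss[OF U, where T = "T_of \<phi>"])
    show "G w $ i $ j = G w $ j $ i" if "w \<in> U" for w i j
      unfolding G[OF that] G_of_def by (simp add: ip_commute)
    show "T_of \<phi> w $ a $ b $ l = T_of \<phi> w $ b $ a $ l" if "w \<in> U" for w a b l
      unfolding T_of_def using f1 f2 that
      by (auto intro!: ip_cong_AE field_L fpartial_commute_AE[OF U(1) field_mono[OF phi]])
    show "partial a (\<lambda>w. T_of \<phi> w $ b $ c $ l) u - partial b (\<lambda>w. T_of \<phi> w $ a $ c $ l) u
       = S_of \<phi> u $ b $ c $ a $ l - S_of \<phi> u $ a $ c $ b $ l" for a b c l
    proof -
      have "ip (fpartial a (fpartial b (fpartial c \<phi>)) u) (fpartial l \<phi> u)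
        = ip (fpartial b (fpartial a (fpartial c \<phi>)) u) (fpartial l \<phi> u)"
        using f0 f2 U f2[of c, unfolded numeral_2_eq_2[symmetric]]
        by (auto intro!: ip_cong_AE field_L fpartial_commute_AE[OF U(1)])
      then show ?thesis unfolding pT by simp
    qed
  qed (use det pG pT in auto)
qed

end

section \<open>Gaussian closures\<close>

text \<open>\<open>X\<close> agrees almost everywhere with the measurable function
  \<open>lim\<close>; completeness makes the preimages under \<open>X\<close> measurable as well.
  With a constant sequence this also transfers measurability between almost everywhere equal
  functions.\<close>

lemma (in complete_measure) borel_measurable_AE_lim:
  fixes X :: "'a \<Rightarrow> real"
  assumes Xs: "\<And>n::nat. Xs n \<in> borel_measurable M" and lim: "AE w in M. (\<lambda>n. Xs n w) \<longlonglongrightarrow> X w"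
  shows "X \<in> borel_measurable M"
proof (rule measurableI)
  fix B :: "real set" assume B: "B \<in> sets borel"
  let ?Y = "\<lambda>w. lim (\<lambda>n. Xs n w)"
  have Y: "?Y \<in> borel_measurable M" using Xs by (rule borel_measurable_lim_metric)
  show "X -` B \<inter> space M \<in> sets M"
  proof (rule in_sets_AE[OF _ measurable_sets[OF Y B]])
    show "AE w in M. w \<in> ?Y -` B \<inter> space M \<longleftrightarrow> w \<in> X -` B \<inter> space M"
      using lim by eventually_elim (simp add: limI)
  qed simp
qed simp

lemma (in prob_space) AE_summable:
  fixes Z :: "nat \<Rightarrow> 'a \<Rightarrow> real"
  assumes int: "\<And>k. integrable M (Z k)" and nn: "\<And>k w. 0 \<le> Z k w"
    and sm: "summable (\<lambda>k. \<integral>w. Z k w \<partial>M)"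
  shows "AE w in M. summable (\<lambda>k. Z k w)"
proof -
  have m: "\<And>k. Z k \<in> borel_measurable M" using int by auto
  have "(\<integral>\<^sup>+w. (\<Sum>k. ennreal (Z k w)) \<partial>M) = (\<Sum>k. \<integral>\<^sup>+w. ennreal (Z k w) \<partial>M)"
    by (rule nn_integral_suminf) (use m in measurable)
  also have "\<dots> = (\<Sum>k. ennreal (\<integral>w. Z k w \<partial>M))"
    by (intro suminf_cong nn_integral_eq_integral int) (use nn in auto)
  also have "\<dots> = ennreal (\<Sum>k. \<integral>w. Z k w \<partial>M)"
    by (rule suminf_ennreal2) (use nn sm in \<open>auto intro!: integral_nonneg_AE\<close>)
  finally have "(\<integral>\<^sup>+w. (\<Sum>k. ennreal (Z k w)) \<partial>M) \<noteq> \<infinity>" by simp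
  then have "AE w in M. (\<Sum>k. ennreal (Z k w)) \<noteq> \<infinity>"
    by (intro nn_integral_PInf_AE) (use m in measurable)
  then show ?thesis
    by eventually_elim (use nn in \<open>auto intro!: summable_suminf_not_top\<close>)
qed

text \<open>Stated by characteristic functions so that the degenerate variance 0 is included and
  closure under almost sure limits becomes dominated convergence.\<close>

definition centered_normal :: "'w measure \<Rightarrow> real \<Rightarrow> ('w \<Rightarrow> real) \<Rightarrow> bool" where
  "centered_normal M s X \<longleftrightarrow> 0 \<le> s \<and> X \<in> borel_measurable M \<and>
     (\<forall>t. (CLINT w|M. iexp (t * X w)) = complex_of_real (exp (- s * t\<^sup>2 / 2)))"

lemma (in prob_space) centered_normal_scale_std:
  assumes Z: "distr M borel Z = std_normal_distribution" "Z \<in> borel_measurable M"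
  shows "centered_normal M (c\<^sup>2) (\<lambda>w. c * Z w)"
  unfolding centered_normal_def
proof (intro conjI allI)
  fix t
  have "(CLINT w|M. iexp (t * (c * Z w))) = (CLINT w|M. iexp ((t * c) * Z w))" by (simp add: mult.assoc)
  also have "\<dots> = char (distr M borel Z) (t * c)"
    unfolding char_def by (subst integral_distr[OF Z(2)]) auto
  also have "\<dots> = complex_of_real (exp (- c\<^sup>2 * t\<^sup>2 / 2))"
    by (simp add: Z(1) char_std_normal_distribution power_mult_distrib mult.commute)
  finally show "(CLINT w|M. iexp (t * (c * Z w))) = complex_of_real (exp (- c\<^sup>2 * t\<^sup>2 / 2))" .
qed (use Z in auto)

lemma (in prob_space) gaussian_rv_centered_normal:
  assumes "gaussian_rv M X" "expectation X = 0"
  shows "integrable M X" "\<exists>s. centered_normal M s X"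
proof -
  have "integrable M X \<and> (\<exists>s. centered_normal M s X)"
    using assms(1) unfolding gaussian_rv_def
  proof (elim disjE)
    assume "nondegenerate_normal M X"
    then obtain \<mu> \<sigma> where sigma: "0 < \<sigma>" and D: "distributed M lborel X (normal_density \<mu> \<sigma>)"
      unfolding nondegenerate_normal_def by blast
    have "\<mu> = 0" using normal_distributed_expectation[OF sigma D] assms(2) by simp
    have int: "integrable M X"
      using distributed_integrable[OF D, of "\<lambda>x. x"] integrable_normal_moment_nz_1[OF sigma] by simp
    let ?Z = "\<lambda>w. (X w - \<mu>) / \<sigma>"
    have DZ: "distributed M lborel ?Z std_normal_density"
      using D normal_standard_normal_convert[OF sigma] by simp
    have "?Z \<in> borel_measurable M" using distributed_measurable[OF DZ] by simp
    moreover have "distr M borel ?Z = std_normal_distribution"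
      using distributed_distr_eq_density[OF DZ] by (simp cong: distr_cong)
    ultimately have "centered_normal M (\<sigma>\<^sup>2) (\<lambda>w. \<sigma> * ?Z w)" by (intro centered_normal_scale_std)
    then show ?thesis using int sigma \<open>\<mu> = 0\<close> by auto
  next
    assume *: "X \<in> borel_measurable M \<and> (\<exists>\<mu>. AE w in M. X w = \<mu>)"
    then obtain \<mu> where mu: "AE w in M. X w = \<mu>" by blast
    have "integrable M X \<longleftrightarrow> integrable M (\<lambda>_. \<mu>)" by (rule integrable_cong_AE) (use * mu in auto)
    then have int: "integrable M X" by simp
    have "expectation X = expectation (\<lambda>_. \<mu>)" by (rule integral_cong_AE) (use * mu in auto)
    then have "\<mu> = 0" using assms(2) by (simp add: prob_space)
    have "(CLINT w|M. iexp (t * X w)) = (CLINT w|M. 1)" for t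
      by (rule integral_cong_AE) (use * mu \<open>\<mu> = 0\<close> in \<open>auto elim!: eventually_mono\<close>)
    then have "centered_normal M 0 X" using * by (simp add: centered_normal_def prob_space)
    then show ?thesis using int by blast
  qed
  then show "integrable M X" "\<exists>s. centered_normal M s X" by auto
qed

text \<open>Equal characteristic functions give equal laws by Levy uniqueness, so all moments can be
  read off from the standard normal distribution, in the degenerate case too.\<close>

lemma (in prob_space) centered_normal_distr:
  assumes X: "centered_normal M s X"
  shows "distr M borel X = distr std_normal_distribution borel (\<lambda>x. sqrt s * x)"
proof (rule Levy_uniqueness)
  interpret S: prob_space std_normal_distribution by (rule prob_space_normal_density) simp
  have m: "X \<in> borel_measurable M" and s: "0 \<le> s" using X by (auto simp: centered_normal_def)
  show "real_distribution (distr M borel X)" using m by (rule real_distribution_distr)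
  show "real_distribution (distr std_normal_distribution borel (\<lambda>x. sqrt s * x))"
    by (rule S.real_distribution_distr) simp
  have id: "distr std_normal_distribution borel (\<lambda>x. x) = std_normal_distribution"
    by (rule distr_id2) simp
  have "centered_normal std_normal_distribution ((sqrt s)\<^sup>2) (\<lambda>x. sqrt s * x)"
    by (rule S.centered_normal_scale_std[OF id]) simp
  then have "centered_normal std_normal_distribution s (\<lambda>x. sqrt s * x)" using s by simp
  then show "char (distr M borel X) = char (distr std_normal_distribution borel (\<lambda>x. sqrt s * x))"
    using X unfolding centered_normal_def char_def by (intro ext) (simp add: integral_distr)
qed

lemma (in prob_space) centered_normal_moment:
  assumes X: "centered_normal M s X"
  shows "integrable M (\<lambda>w. X w ^ k)"
    and "(\<integral>w. X w ^ (2 * q) \<partial>M) = s ^ q * (fact (2 * q) / (2 ^ q * fact q))"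
    and "(\<integral>w. (X w)\<^sup>2 \<partial>M) = s"
proof -
  have m[measurable]: "X \<in> borel_measurable M" and s: "0 \<le> s" using X by (auto simp: centered_normal_def)
  have "integrable std_normal_distribution (\<lambda>x. (sqrt s * x) ^ k)"
    unfolding power_mult_distrib by (intro integrable_mult_right integrable_std_normal_distribution_moment)
  then have "integrable (distr M borel X) (\<lambda>x. x ^ k)"
    unfolding centered_normal_distr[OF X] by (subst integrable_distr_eq) auto
  then show "integrable M (\<lambda>w. X w ^ k)" by (subst (asm) integrable_distr_eq) auto
  show "(\<integral>w. X w ^ (2 * q) \<partial>M) = s ^ q * (fact (2 * q) / (2 ^ q * fact q))" for q
  proof -
    have "(\<integral>w. X w ^ (2 * q) \<partial>M) = (\<integral>x. x ^ (2 * q) \<partial>distr M borel X)"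
      by (subst integral_distr) auto
    also have "\<dots> = (\<integral>x. (sqrt s * x) ^ (2 * q) \<partial>std_normal_distribution)"
      unfolding centered_normal_distr[OF X] by (subst integral_distr) auto
    also have "\<dots> = sqrt s ^ (2 * q) * (fact (2 * q) / (2 ^ q * fact q))"
      unfolding power_mult_distrib integral_mult_right_zero std_normal_distribution_even_moments(1) ..
    also have "sqrt s ^ (2 * q) = s ^ q" using s by (simp add: power_mult)
    finally show ?thesis .
  qed
  from this[of 1] show "(\<integral>w. (X w)\<^sup>2 \<partial>M) = s" by simp
qed

locale complete_prob_space = prob_space + complete_measure

text \<open>Convergence of the variances is a conclusion here. Characteristic functions converge by
  dominated convergence, and the limit tends to 1 along arguments \<open>1 / Suc k\<close>; hence it
  is positive at some \<open>t\<close> different from 0, and taking logarithms at that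
  \<open>t\<close> shows that \<open>s\<close> converges.\<close>

lemma (in complete_prob_space) centered_normal_lim:
  assumes X: "\<And>n::nat. centered_normal M (s n) (Xs n)" and lim: "AE w in M. (\<lambda>n. Xs n w) \<longlonglongrightarrow> X w"
  shows "\<exists>s'. s \<longlonglongrightarrow> s' \<and> centered_normal M s' X"
proof -
  have m[measurable]: "Xs n \<in> borel_measurable M" and s: "0 \<le> s n" for n
    using X by (auto simp: centered_normal_def)
  have mX[measurable]: "X \<in> borel_measurable M" by (rule borel_measurable_AE_lim[OF m lim])
  have conv: "(\<lambda>n. CLINT w|M. iexp (t * Xs n w)) \<longlonglongrightarrow> (CLINT w|M. iexp (t * X w))" for t
  proof (rule integral_dominated_convergence[where w = "\<lambda>_. 1"])
    show "AE w in M. (\<lambda>n. iexp (t * Xs n w)) \<longlonglongrightarrow> iexp (t * X w)"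
      using lim by eventually_elim (intro tendsto_intros)
  qed auto
  define \<phi> where "\<phi> t = (CLINT w|M. iexp (t * X w))" for t
  have phi: "(\<lambda>n. complex_of_real (exp (- s n * t\<^sup>2 / 2))) \<longlonglongrightarrow> \<phi> t" for t
    using conv[of t] X unfolding \<phi>_def centered_normal_def by simp
  then have phiR: "(\<lambda>n. exp (- s n * t\<^sup>2 / 2)) \<longlonglongrightarrow> Re (\<phi> t)" for t
    using tendsto_Re[OF phi[of t]] by simp
  have phi_of: "\<phi> t = complex_of_real (Re (\<phi> t))" for t
    using LIMSEQ_unique[OF phi[of t] tendsto_of_real[OF phiR[of t]]] .
  have "(\<lambda>k. \<phi> (1 / real (Suc k))) \<longlonglongrightarrow> (CLINT w|M. 1)"
    unfolding \<phi>_def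
  proof (rule integral_dominated_convergence[where w = "\<lambda>_. 1"])
    show "AE w in M. (\<lambda>k. iexp (1 / real (Suc k) * X w)) \<longlonglongrightarrow> 1"
    proof (rule AE_I2)
      fix w
      have "(\<lambda>k. 1 / real (Suc k) * X w) \<longlonglongrightarrow> 0 * X w"
        by (intro tendsto_intros LIMSEQ_Suc[OF lim_1_over_n])
      from isCont_tendsto_compose[OF isCont_iexp this]
      show "(\<lambda>k. iexp (1 / real (Suc k) * X w)) \<longlonglongrightarrow> 1" by simp
    qed
  qed auto
  then have "(\<lambda>k. Re (\<phi> (1 / real (Suc k)))) \<longlonglongrightarrow> 1"
    using tendsto_Re by (fastforce simp: prob_space)
  then have "\<forall>\<^sub>F k in sequentially. 0 < Re (\<phi> (1 / real (Suc k)))" by (rule order_tendstoD) simp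
  then obtain k where k: "0 < Re (\<phi> (1 / real (Suc k)))" by (auto simp: eventually_sequentially)
  define t where "t = 1 / real (Suc k)"
  have t: "t \<noteq> 0" "0 < Re (\<phi> t)" using k by (auto simp: t_def)
  define s' where "s' = - 2 * ln (Re (\<phi> t)) / t\<^sup>2"
  have "(\<lambda>n. - 2 * ln (exp (- s n * t\<^sup>2 / 2)) / t\<^sup>2) \<longlonglongrightarrow> s'"
    unfolding s'_def using t by (intro tendsto_intros phiR) auto
  moreover have "- 2 * ln (exp (- s n * t\<^sup>2 / 2)) / t\<^sup>2 = s n" for n using t by simp
  ultimately have s': "s \<longlonglongrightarrow> s'" by simp
  have "(CLINT w|M. iexp (r * X w)) = complex_of_real (exp (- s' * r\<^sup>2 / 2))" for r
  proof -
    have "(\<lambda>n. complex_of_real (exp (- s n * r\<^sup>2 / 2))) \<longlonglongrightarrow> complex_of_real (exp (- s' * r\<^sup>2 / 2))"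
      by (intro tendsto_intros s') simp
    from LIMSEQ_unique[OF phi[of r] this] show ?thesis by (simp add: \<phi>_def)
  qed
  moreover have "0 \<le> s'" using s by (intro LIMSEQ_le_const[OF s']) auto
  ultimately show ?thesis using s' mX by (auto simp: centered_normal_def)
qed

locale gaussian_family = complete_prob_space +
  fixes L0 :: "('a \<Rightarrow> real) set"
  assumes L0_zero: "(\<lambda>_. 0) \<in> L0"
    and L0_lin: "\<And>X Y a b. X \<in> L0 \<Longrightarrow> Y \<in> L0 \<Longrightarrow> (\<lambda>w. a * X w + b * Y w) \<in> L0"
    and L0_normal: "\<And>X. X \<in> L0 \<Longrightarrow> \<exists>s. centered_normal M s X"
begin

text \<open>Only one round of sequential limits; that a second round adds nothing is the content of
  \<open>gclosure_lim\<close>.\<close>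

definition gclosure :: "('a \<Rightarrow> real) set" where
  "gclosure = {X. \<exists>Y. (\<forall>n::nat. Y n \<in> L0) \<and> (AE w in M. (\<lambda>n. Y n w) \<longlonglongrightarrow> X w)}"

lemma L0_gclosure: "X \<in> L0 \<Longrightarrow> X \<in> gclosure"
  unfolding gclosure_def by (auto intro!: exI[of _ "\<lambda>_. X"])

lemma gclosure_normal:
  assumes "X \<in> gclosure"
  shows "\<exists>s. centered_normal M s X"
proof -
  obtain Y where Y: "\<And>n::nat. Y n \<in> L0" "AE w in M. (\<lambda>n. Y n w) \<longlonglongrightarrow> X w"
    using assms unfolding gclosure_def by auto
  obtain s where s: "\<And>n. centered_normal M (s n) (Y n)" using L0_normal[OF Y(1)] by metis
  from centered_normal_lim[OF s Y(2)] show ?thesis by blast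
qed

lemma gclosure_lin:
  assumes "X \<in> gclosure" "Y \<in> gclosure"
  shows "(\<lambda>w. a * X w + b * Y w) \<in> gclosure"
proof -
  obtain Xs Ys where *: "\<And>n::nat. Xs n \<in> L0" "\<And>n::nat. Ys n \<in> L0"
    "AE w in M. (\<lambda>n. Xs n w) \<longlonglongrightarrow> X w" "AE w in M. (\<lambda>n. Ys n w) \<longlonglongrightarrow> Y w"
    using assms unfolding gclosure_def by auto
  have "AE w in M. (\<lambda>n. a * Xs n w + b * Ys n w) \<longlonglongrightarrow> a * X w + b * Y w"
    using *(3,4) by eventually_elim (intro tendsto_intros)
  then show ?thesis unfolding gclosure_def
    using L0_lin[OF *(1,2)] by (auto intro!: exI[of _ "\<lambda>n w. a * Xs n w + b * Ys n w"])
qed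

text \<open>The difference from the limit is again centered normal, and its variance converges by
  \<open>centered_normal_lim\<close> to the variance of the limit variable 0.\<close>

lemma gclosure_L2_lim:
  assumes X: "\<And>n::nat. Xs n \<in> gclosure" and lim: "AE w in M. (\<lambda>n. Xs n w) \<longlonglongrightarrow> X w"
  shows "(\<lambda>n. \<integral>w. (Xs n w - X w)\<^sup>2 \<partial>M) \<longlonglongrightarrow> 0" "\<And>n. \<exists>s. centered_normal M s (\<lambda>w. Xs n w - X w)"
proof -
  \<comment> \<open>Since \<open>X\<close> is not yet known to lie in \<open>gclosure\<close>, the
    difference is itself obtained as the limit of \<open>Xs n - Xs k\<close> in
    \<open>k\<close>.\<close>
  show d: "\<exists>s. centered_normal M s (\<lambda>w. Xs n w - X w)" for n
  proof -
    have "\<exists>s. centered_normal M s (\<lambda>w. Xs n w - Xs k w)" for k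
      using gclosure_normal[OF gclosure_lin[OF X X, of 1 n "-1" k]] by simp
    then obtain s where s: "\<And>k. centered_normal M (s k) (\<lambda>w. Xs n w - Xs k w)" by metis
    have "AE w in M. (\<lambda>k. Xs n w - Xs k w) \<longlonglongrightarrow> Xs n w - X w"
      using lim by eventually_elim (intro tendsto_intros)
    from centered_normal_lim[OF s this] show ?thesis by blast
  qed
  then obtain s where s: "\<And>n. centered_normal M (s n) (\<lambda>w. Xs n w - X w)" by metis
  have "AE w in M. (\<lambda>n. Xs n w - X w) \<longlonglongrightarrow> 0" using lim by eventually_elim (simp add: LIM_zero)
  from centered_normal_lim[OF s this] obtain s' where s': "s \<longlonglongrightarrow> s'" "centered_normal M s' (\<lambda>_. 0)"
    by blast
  have "s' = 0" using centered_normal_moment(3)[OF s'(2)] by simp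
  then show "(\<lambda>n. \<integral>w. (Xs n w - X w)\<^sup>2 \<partial>M) \<longlonglongrightarrow> 0"
    using s' centered_normal_moment(3)[OF s] by simp
qed

text \<open>A diagonal argument: each \<open>Xs k\<close> is approximated from \<open>L0\<close>
  with mean square error below \<open>(1/2) ^ k\<close>. The summable errors make the squared
  differences summable almost surely, so the approximants have the same almost sure limit.\<close>

lemma gclosure_lim:
  assumes X: "\<And>n::nat. Xs n \<in> gclosure" and lim: "AE w in M. (\<lambda>n. Xs n w) \<longlonglongrightarrow> X w"
  shows "X \<in> gclosure"
proof -
  have "\<exists>Y\<in>L0. (\<integral>w. (Y w - Xs k w)\<^sup>2 \<partial>M) < (1/2) ^ k \<and> integrable M (\<lambda>w. (Y w - Xs k w)\<^sup>2)" for k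
  proof -
    obtain Y where Y: "\<And>n::nat. Y n \<in> L0" "AE w in M. (\<lambda>n. Y n w) \<longlonglongrightarrow> Xs k w"
      using X[of k] unfolding gclosure_def by auto
    note l = gclosure_L2_lim[OF L0_gclosure[OF Y(1)] Y(2)]
    have "\<forall>\<^sub>F n in sequentially. (\<integral>w. (Y n w - Xs k w)\<^sup>2 \<partial>M) < (1/2) ^ k"
      using l(1) by (rule order_tendstoD) simp
    then obtain n where "(\<integral>w. (Y n w - Xs k w)\<^sup>2 \<partial>M) < (1/2) ^ k" by (auto simp: eventually_sequentially)
    moreover obtain s where "centered_normal M s (\<lambda>w. Y n w - Xs k w)" using l(2) by blast
    ultimately show ?thesis using Y(1) centered_normal_moment(1) by blast
  qed
  then obtain Y where Y: "\<And>k. Y k \<in> L0" "\<And>k. (\<integral>w. (Y k w - Xs k w)\<^sup>2 \<partial>M) < (1/2) ^ k"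
     "\<And>k. integrable M (\<lambda>w. (Y k w - Xs k w)\<^sup>2)" by metis
  have "summable (\<lambda>k. \<integral>w. (Y k w - Xs k w)\<^sup>2 \<partial>M)"
    by (rule summable_comparison_test'[OF summable_geometric[of "1/2::real"], of 0])
      (use Y(2) less_imp_le in \<open>auto simp: integral_nonneg_AE\<close>)
  from AE_summable[OF Y(3) _ this] have "AE w in M. summable (\<lambda>k. (Y k w - Xs k w)\<^sup>2)" by simp
  then have "AE w in M. (\<lambda>k. Y k w) \<longlonglongrightarrow> X w" using lim
  proof eventually_elim
    fix w assume "summable (\<lambda>k. (Y k w - Xs k w)\<^sup>2)" and l: "(\<lambda>n. Xs n w) \<longlonglongrightarrow> X w"
    then have "(\<lambda>k. (Y k w - Xs k w)\<^sup>2) \<longlonglongrightarrow> 0" by (intro summable_LIMSEQ_zero)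
    then have "(\<lambda>k. sqrt ((Y k w - Xs k w)\<^sup>2)) \<longlonglongrightarrow> sqrt 0" by (intro tendsto_intros)
    then have "(\<lambda>k. Y k w - Xs k w) \<longlonglongrightarrow> 0" by (simp add: tendsto_rabs_zero_iff)
    from tendsto_add[OF this l] show "(\<lambda>k. Y k w) \<longlonglongrightarrow> X w" by simp
  qed
  then show ?thesis using Y(1) unfolding gclosure_def by blast
qed

sublocale L2_space M gclosure
proof
  show "(\<lambda>_. 0) \<in> gclosure" using L0_gclosure[OF L0_zero] .
  show "\<And>X. X \<in> gclosure \<Longrightarrow> X \<in> borel_measurable M" using gclosure_normal by (auto simp: centered_normal_def)
  show "\<And>X. X \<in> gclosure \<Longrightarrow> integrable M (\<lambda>w. (X w)\<^sup>2)" using gclosure_normal centered_normal_moment(1) by blast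
  show "X \<in> gclosure \<and> (\<lambda>n. \<integral>w. (Xs n w - X w)\<^sup>2 \<partial>M) \<longlonglongrightarrow> 0"
    if "\<And>n::nat. Xs n \<in> gclosure" "AE w in M. (\<lambda>n. Xs n w) \<longlonglongrightarrow> X w" for Xs X
    using gclosure_lim[OF that] gclosure_L2_lim(1)[OF that] by blast
qed (rule gclosure_lin)

lemma gclosure_moment:
  assumes "X \<in> gclosure"
  shows "integrable M (\<lambda>w. X w ^ k)"
    and "(\<integral>w. X w ^ (2 * q) \<partial>M) = ip X X ^ q * (fact (2 * q) / (2 ^ q * fact q))"
proof -
  obtain s where s: "centered_normal M s X" using gclosure_normal[OF assms] by blast
  show "integrable M (\<lambda>w. X w ^ k)" by (rule centered_normal_moment(1)[OF s])
  show "(\<integral>w. X w ^ (2 * q) \<partial>M) = ip X X ^ q * (fact (2 * q) / (2 ^ q * fact q))"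
    using centered_normal_moment(2,3)[OF s] by (simp add: ip_def power2_eq_square)
qed

end

section \<open>Laws of large numbers\<close>

lemma power_le_fourth: "j \<le> 4 \<Longrightarrow> \<bar>x ^ j\<bar> \<le> 1 + (x::real) ^ 4"
proof (cases "\<bar>x\<bar> \<le> 1")
  case True
  then have "\<bar>x\<bar> ^ j \<le> 1" by (simp add: power_le_one)
  moreover have "0 \<le> x ^ 4" by (simp add: zero_le_even_power)
  ultimately show ?thesis unfolding power_abs by linarith
next
  case False
  assume "j \<le> 4"
  then have "\<bar>x\<bar> ^ j \<le> \<bar>x\<bar> ^ 4" using False by (intro power_increasing) auto
  then show ?thesis by (simp add: power_abs power_even_abs)
qed

lemma (in prob_space) integrable_power_le_fourth:
  assumes "Z \<in> borel_measurable M" "integrable M (\<lambda>w. (Z w :: real) ^ 4)" "j \<le> 4"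
  shows "integrable M (\<lambda>w. Z w ^ j)"
proof (rule Bochner_Integration.integrable_bound)
  show "integrable M (\<lambda>w. 1 + Z w ^ 4)" using assms by simp
  show "(\<lambda>w. Z w ^ j) \<in> borel_measurable M" using assms(1) by measurable
  have "0 \<le> 1 + x ^ 4" for x :: real using power_le_fourth[of 0 x] by simp
  then show "AE w in M. norm (Z w ^ j) \<le> norm (1 + Z w ^ 4)" using power_le_fourth[OF assms(3)] by simp
qed

text \<open>By independence and zero means the terms with an odd power vanish, leaving the fourth
  moments and six times the product of the second moments. \<open>C = B + 1\<close> bounds second
  and fourth moments at once, since a square is at most one plus the fourth power. The induction
  closes because \<open>C + 6 * C^2 * k <= 3 * C^2 * (2 * k + 1)\<close>.\<close>

lemma (in prob_space) fourth_moment_sum: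
  fixes Z :: "nat \<Rightarrow> 'a \<Rightarrow> real"
  assumes indep: "indep_vars (\<lambda>_. borel) Z UNIV"
    and mean: "\<And>n. expectation (Z n) = 0"
    and int: "\<And>n. integrable M (\<lambda>w. Z n w ^ 4)" and bd: "\<And>n. expectation (\<lambda>w. Z n w ^ 4) \<le> B"
  defines "S \<equiv> \<lambda>k w. \<Sum>n<k. Z n w" and "C \<equiv> B + 1"
  shows "integrable M (\<lambda>w. S k w ^ 4) \<and> expectation (\<lambda>w. S k w ^ 2) \<le> real k * C
     \<and> expectation (S k) = 0 \<and> expectation (\<lambda>w. S k w ^ 4) \<le> 3 * C\<^sup>2 * (real k)\<^sup>2"
proof (induction k)
  case 0
  then show ?case by (simp add: S_def)
next
  case (Suc k)
  have mZ[measurable]: "Z n \<in> borel_measurable M" for n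
    using indep unfolding indep_vars_def by auto
  have mS[measurable]: "S k \<in> borel_measurable M" for k unfolding S_def by measurable
  \<comment> \<open>\<open>B\<close> bounds the nonnegative fourth moment of \<open>Z 0\<close>, so
    it is itself nonnegative.\<close>
  have C1: "C \<ge> 1" using bd[of 0] by (simp add: C_def) (smt (verit) integral_nonneg_AE AE_I2 zero_le_even_power even_numeral)
  have ind: "indep_var borel (Z k) borel (S k)"
    unfolding S_def by (rule indep_vars_sum) (auto intro: indep_vars_subset[OF indep])
  have indp: "indep_var borel (\<lambda>w. Z k w ^ i) borel (\<lambda>w. S k w ^ j)" for i j
    using indep_var_compose[OF ind, of "\<lambda>x. x ^ i" borel "\<lambda>x. x ^ j" borel] by (simp add: comp_def)
  have iZ: "integrable M (\<lambda>w. Z k w ^ j)" if "j \<le> 4" for j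
    using integrable_power_le_fourth[OF mZ int that] .
  have iS: "integrable M (\<lambda>w. S k w ^ j)" if "j \<le> 4" for j
    using integrable_power_le_fourth[OF mS _ that] Suc by blast
  have iZS: "integrable M (\<lambda>w. Z k w ^ i * S k w ^ j)"
    and eZS: "expectation (\<lambda>w. Z k w ^ i * S k w ^ j) = expectation (\<lambda>w. Z k w ^ i) * expectation (\<lambda>w. S k w ^ j)"
    if "i \<le> 4" "j \<le> 4" for i j
    using indep_var_integrable[OF indp iZ[OF that(1)] iS[OF that(2)]]
      indep_var_lebesgue_integral[OF indp iZ[OF that(1)] iS[OF that(2)]] by auto
  have SS: "S (Suc k) w = Z k w + S k w" for w by (simp add: S_def)
  have EZ2: "expectation (\<lambda>w. Z k w ^ 2) \<le> C"
  proof -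
    have "expectation (\<lambda>w. Z k w ^ 2) \<le> expectation (\<lambda>w. 1 + Z k w ^ 4)"
      using iZ[of 2] int[of k] power_le_fourth[of 2] by (intro integral_mono) auto
    also have "\<dots> \<le> C" using int[of k] bd[of k] by (simp add: prob_space C_def)
    finally show ?thesis .
  qed
  have EZ4: "expectation (\<lambda>w. Z k w ^ 4) \<le> C" using bd[of k] by (simp add: C_def)
  have EZ0: "expectation (\<lambda>w. Z k w ^ 1) = 0" using mean by simp
  have ES0: "expectation (\<lambda>w. S k w ^ 1) = 0" using Suc by simp
  have q4: "(z + s) ^ 4 = z ^ 4 * s ^ 0 + (4 * (z ^ 3 * s ^ 1) + (6 * (z ^ 2 * s ^ 2) + (4 * (z ^ 1 * s ^ 3) + z ^ 0 * s ^ 4)))" for z s :: real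
    by (simp add: power4_eq_xxxx power3_eq_cube power2_eq_square algebra_simps)
  have q2: "(z + s) ^ 2 = z ^ 2 * s ^ 0 + (2 * (z ^ 1 * s ^ 1) + z ^ 0 * s ^ 2)" for z s :: real
    by (simp add: power2_eq_square algebra_simps)
  have "integrable M (\<lambda>w. S (Suc k) w ^ 4)"
    unfolding SS q4 by (intro Bochner_Integration.integrable_add integrable_mult_right iZS) auto
  moreover have "expectation (S (Suc k)) = 0"
    unfolding SS using iZ[of 1] iS[of 1] mean[of k] Suc by simp
  moreover have "expectation (\<lambda>w. S (Suc k) w ^ 2) \<le> real (Suc k) * C"
  proof -
    have "expectation (\<lambda>w. S (Suc k) w ^ 2) = expectation (\<lambda>w. Z k w ^ 2) + expectation (\<lambda>w. S k w ^ 2)"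
    proof -
      have "expectation (\<lambda>w. S (Suc k) w ^ 2) = expectation (\<lambda>w. Z k w ^ 2 * S k w ^ 0) +
         (2 * expectation (\<lambda>w. Z k w ^ 1 * S k w ^ 1) + expectation (\<lambda>w. Z k w ^ 0 * S k w ^ 2))"
        unfolding SS q2 using iZS[of 2 0] iZS[of 1 1] iZS[of 0 2] by simp
      then show ?thesis unfolding eZS[of 1 1, simplified] eZS[of 2 0, simplified] using mean[of k] eZS[of 1 1]
        by (simp add: prob_space)
    qed
    then show ?thesis using EZ2 Suc by (simp add: algebra_simps)
  qed
  moreover have "expectation (\<lambda>w. S (Suc k) w ^ 4) \<le> 3 * C\<^sup>2 * (real (Suc k))\<^sup>2"
  proof -
    have "expectation (\<lambda>w. S (Suc k) w ^ 4) = expectation (\<lambda>w. Z k w ^ 4)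
        + 6 * (expectation (\<lambda>w. Z k w ^ 2) * expectation (\<lambda>w. S k w ^ 2)) + expectation (\<lambda>w. S k w ^ 4)"
    proof -
      have "expectation (\<lambda>w. S (Suc k) w ^ 4) = expectation (\<lambda>w. Z k w ^ 4 * S k w ^ 0) +
         (4 * expectation (\<lambda>w. Z k w ^ 3 * S k w ^ 1) + (6 * expectation (\<lambda>w. Z k w ^ 2 * S k w ^ 2)
         + (4 * expectation (\<lambda>w. Z k w ^ 1 * S k w ^ 3) + expectation (\<lambda>w. Z k w ^ 0 * S k w ^ 4))))"
        unfolding SS q4 using iZS[of 4 0] iZS[of 3 1] iZS[of 2 2] iZS[of 1 3] iZS[of 0 4] by simp
      moreover have "expectation (\<lambda>w. Z k w ^ 3 * S k w ^ 1) = 0" using eZS[of 3 1] ES0 by simp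
      moreover have "expectation (\<lambda>w. Z k w ^ 1 * S k w ^ 3) = 0" using eZS[of 1 3] EZ0 by simp
      ultimately show ?thesis by (simp add: eZS[of 2 2])
    qed
    also have "expectation (\<lambda>w. Z k w ^ 2) * expectation (\<lambda>w. S k w ^ 2) \<le> C * (real k * C)"
      using EZ2 Suc C1 by (intro mult_mono) (auto intro!: integral_nonneg_AE)
    finally have "expectation (\<lambda>w. S (Suc k) w ^ 4) \<le> C + 6 * (C * (real k * C)) + 3 * C\<^sup>2 * (real k)\<^sup>2"
      using EZ4 Suc by linarith
    moreover have "C \<le> 3 * C\<^sup>2" using C1 mult_right_mono[of 1 C C] by (simp add: power2_eq_square)
    ultimately show ?thesis by (simp add: power2_eq_square algebra_simps)
  qed
  ultimately show ?case by blast
qed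

text \<open>The fourth moment of the \<open>k\<close>-th average is of order \<open>1 / k^2\<close>,
  hence summable; so the fourth powers of the averages are almost surely summable and tend to
  0.\<close>

lemma (in prob_space) strong_law_centered:
  fixes Z :: "nat \<Rightarrow> 'a \<Rightarrow> real"
  assumes indep: "indep_vars (\<lambda>_. borel) Z UNIV"
    and mean: "\<And>n. expectation (Z n) = 0"
    and int: "\<And>n. integrable M (\<lambda>w. Z n w ^ 4)" and bd: "\<And>n. expectation (\<lambda>w. Z n w ^ 4) \<le> B"
  shows "AE w in M. (\<lambda>k. (\<Sum>n<k. Z n w) / real k) \<longlonglongrightarrow> 0"
proof -
  let ?S = "\<lambda>k w. \<Sum>n<k. Z n w" and ?C = "3 * (B + 1)\<^sup>2"
  note f = fourth_moment_sum[OF assms]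
  have int: "integrable M (\<lambda>w. (?S k w / real k) ^ 4)" for k
    unfolding power_divide using f by (intro integrable_divide_zero) auto
  have le: "expectation (\<lambda>w. (?S k w / real k) ^ 4) \<le> ?C * (1 / real k ^ 2)" for k
  proof (cases "k = 0")
    case False
    have "expectation (\<lambda>w. (?S k w / real k) ^ 4) = expectation (\<lambda>w. ?S k w ^ 4) / real k ^ 4"
      unfolding power_divide by (rule integral_divide_zero)
    also have "\<dots> \<le> (?C * (real k)\<^sup>2) / real k ^ 4" using f[of k] by (intro divide_right_mono) auto
    also have "\<dots> = ?C * (1 / real k ^ 2)" using False by (simp add: field_simps power4_eq_xxxx power2_eq_square)
    finally show ?thesis .
  qed simp
  have sm: "summable (\<lambda>k. ?C * (1 / real k ^ 2))"
    using inverse_power_summable[of 2, where ?'a = real] by (intro summable_mult) (simp add: inverse_eq_divide)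
  have "summable (\<lambda>k. expectation (\<lambda>w. (?S k w / real k) ^ 4))"
    by (rule summable_comparison_test'[OF sm, of 0]) (use le in \<open>auto simp: integral_nonneg_AE zero_le_even_power\<close>)
  from AE_summable[OF int _ this] have "AE w in M. summable (\<lambda>k. (?S k w / real k) ^ 4)"
    by (simp add: zero_le_even_power)
  then show ?thesis
  proof eventually_elim
    fix w assume "summable (\<lambda>k. (?S k w / real k) ^ 4)"
    then have "(\<lambda>k. (?S k w / real k) ^ 4) \<longlonglongrightarrow> 0" by (rule summable_LIMSEQ_zero)
    then have "(\<lambda>k. root 4 ((?S k w / real k) ^ 4)) \<longlonglongrightarrow> root 4 0" by (intro tendsto_intros)
    moreover have "root 4 (x ^ 4) = \<bar>x\<bar>" for x :: real
      using real_root_power_cancel[of 4 "\<bar>x\<bar>"] by (simp add: power_even_abs)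
    ultimately have "(\<lambda>k. \<bar>?S k w / real k\<bar>) \<longlonglongrightarrow> 0" by (simp only: real_root_zero)
    then show "(\<lambda>k. ?S k w / real k) \<longlonglongrightarrow> 0" by (rule tendsto_rabs_zero_cancel)
  qed
qed

lemma (in prob_space) strong_law:
  fixes Y :: "nat \<Rightarrow> 'a \<Rightarrow> real"
  assumes indep: "indep_vars (\<lambda>_. borel) Y UNIV"
    and mean: "\<And>n. expectation (Y n) = \<mu>"
    and int: "\<And>n. integrable M (\<lambda>w. Y n w ^ 4)" and bd: "\<And>n. expectation (\<lambda>w. Y n w ^ 4) \<le> B"
  shows "AE w in M. (\<lambda>k. (\<Sum>n<k. Y n w) / real k) \<longlonglongrightarrow> \<mu>"
proof -
  have m[measurable]: "Y n \<in> borel_measurable M" for n using indep unfolding indep_vars_def by auto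
  have iY: "integrable M (Y n)" for n using integrable_power_le_fourth[OF m[of n] int[of n], of 1] by simp
  have q: "(y - \<mu>) ^ 4 \<le> 8 * y ^ 4 + 8 * \<mu> ^ 4" for y :: real
  proof -
    have 1: "(y - \<mu>)\<^sup>2 \<le> 2 * y\<^sup>2 + 2 * \<mu>\<^sup>2" using zero_le_power2[of "y + \<mu>"] by (simp add: power2_eq_square algebra_simps)
    have "((y - \<mu>)\<^sup>2)\<^sup>2 \<le> (2 * y\<^sup>2 + 2 * \<mu>\<^sup>2)\<^sup>2" by (rule power_mono[OF 1]) simp
    also have "\<dots> \<le> 8 * (y\<^sup>2)\<^sup>2 + 8 * (\<mu>\<^sup>2)\<^sup>2"
      using zero_le_power2[of "y\<^sup>2 - \<mu>\<^sup>2"] by (simp add: power2_eq_square algebra_simps)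
    finally show ?thesis by (simp add: power_mult[symmetric])
  qed
  have "AE w in M. (\<lambda>k. (\<Sum>n<k. Y n w - \<mu>) / real k) \<longlonglongrightarrow> 0"
  proof (rule strong_law_centered)
    show "indep_vars (\<lambda>_. borel) (\<lambda>n w. Y n w - \<mu>) UNIV"
      by (rule indep_vars_compose2[OF indep, of "\<lambda>_ x. x - \<mu>"]) simp
    show "expectation (\<lambda>w. Y n w - \<mu>) = 0" for n using iY[of n] mean[of n] by (simp add: prob_space)
    show i: "integrable M (\<lambda>w. (Y n w - \<mu>) ^ 4)" for n
    proof (rule Bochner_Integration.integrable_bound)
      show "integrable M (\<lambda>w. 8 * Y n w ^ 4 + 8 * \<mu> ^ 4)" using int by simp
      show "AE w in M. norm ((Y n w - \<mu>) ^ 4) \<le> norm (8 * Y n w ^ 4 + 8 * \<mu> ^ 4)"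
        using q by (simp add: zero_le_even_power)
    qed measurable
    show "expectation (\<lambda>w. (Y n w - \<mu>) ^ 4) \<le> 8 * B + 8 * \<mu> ^ 4" for n
    proof -
      have "expectation (\<lambda>w. (Y n w - \<mu>) ^ 4) \<le> expectation (\<lambda>w. 8 * Y n w ^ 4 + 8 * \<mu> ^ 4)"
        using i int q by (intro integral_mono) auto
      also have "\<dots> \<le> 8 * B + 8 * \<mu> ^ 4" using int[of n] bd[of n] by (simp add: prob_space)
      finally show ?thesis .
    qed
  qed
  then show ?thesis
  proof eventually_elim
    fix w assume *: "(\<lambda>k. (\<Sum>n<k. Y n w - \<mu>) / real k) \<longlonglongrightarrow> 0"
    have "\<forall>\<^sub>F k in sequentially. (\<Sum>n<k. Y n w - \<mu>) / real k = (\<Sum>n<k. Y n w) / real k - \<mu>"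
      using eventually_gt_at_top[of 0]
      by eventually_elim (simp add: sum_subtractf field_simps)
    from Lim_transform_eventually[OF * this] have "(\<lambda>k. (\<Sum>n<k. Y n w) / real k - \<mu>) \<longlonglongrightarrow> 0" .
    then show "(\<lambda>k. (\<Sum>n<k. Y n w) / real k) \<longlonglongrightarrow> \<mu>" by (simp add: LIM_zero_iff)
  qed
qed

section \<open>Dyadic grids and chaining in a cube\<close>

definition half_open_cube :: "real^'m::finite \<Rightarrow> real \<Rightarrow> (real^'m) set" where
  "half_open_cube a s = {u. \<forall>i. a $ i \<le> u $ i \<and> u $ i < a $ i + s}"

definition dyadic_floor :: "real^'m::finite \<Rightarrow> real \<Rightarrow> nat \<Rightarrow> real^'m \<Rightarrow> real^'m" where
  "dyadic_floor a s l u = (\<chi> i. a $ i + s * (real_of_int \<lfloor>2 ^ l * ((u $ i - a $ i) / s)\<rfloor> / 2 ^ l))"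

lemma dyadic_floor_bounds:
  fixes x :: real and l :: nat
  defines "y \<equiv> real_of_int \<lfloor>2 ^ l * x\<rfloor> / 2 ^ l"
  shows "y \<le> x" "x < y + 1 / 2 ^ l"
proof -
  show "y \<le> x" unfolding y_def by (simp add: divide_le_eq mult.commute)
  have "2 ^ l * x < real_of_int \<lfloor>2 ^ l * x\<rfloor> + 1" by (rule real_of_int_floor_add_one_gt)
  then show "x < y + 1 / 2 ^ l" unfolding y_def by (simp add: field_simps)
qed

text \<open>The cube contains its lower faces but not its upper ones, so rounding coordinates down
  cannot leave it, and the grid of level \<open>l\<close> has at most \<open>2 ^ l\<close> points
  along each axis.\<close>

lemma dyadic_floor_in_cube:
  fixes u a :: "real^'m::finite"
  assumes s: "0 < s" and u: "u \<in> half_open_cube a s"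
  shows "dyadic_floor a s l u \<in> half_open_cube a s"
    and "norm (dyadic_floor a s l u - u) \<le> real CARD('m) * s / 2 ^ l"
proof -
  have ui: "a $ i \<le> u $ i" "u $ i < a $ i + s" for i using u by (auto simp: half_open_cube_def)
  let ?x = "\<lambda>i. (u $ i - a $ i) / s" and ?y = "\<lambda>i. real_of_int \<lfloor>2 ^ l * ((u $ i - a $ i) / s)\<rfloor> / 2 ^ l"
  have b: "?y i \<le> ?x i" "?x i < ?y i + 1 / 2 ^ l" for i using dyadic_floor_bounds[where x = "?x i" and l = l] by auto
  have x: "u $ i = a $ i + s * ?x i" for i using s by simp
  have y0: "0 \<le> ?y i" for i using ui[of i] s by simp
  have sx: "s * ?y i \<le> s * ?x i" for i using b(1) s by (intro mult_left_mono) auto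
  have "s * ?x i < s * (?y i + 1 / 2 ^ l)" for i using b(2) s by (intro mult_strict_left_mono) auto
  then have sx2: "s * ?x i < s * ?y i + s / 2 ^ l" for i by (simp add: distrib_left)
  show "dyadic_floor a s l u \<in> half_open_cube a s"
    unfolding half_open_cube_def dyadic_floor_def
  proof (intro CollectI allI conjI)
    fix i
    show "a $ i \<le> (\<chi> i. a $ i + s * ?y i) $ i" using mult_nonneg_nonneg[OF less_imp_le[OF s] y0[of i]] by simp
    show "(\<chi> i. a $ i + s * ?y i) $ i < a $ i + s" using sx[of i] ui[of i] x[of i] by simp
  qed
  have "norm (dyadic_floor a s l u - u) \<le> (\<Sum>i\<in>UNIV. \<bar>(dyadic_floor a s l u - u) $ i\<bar>)" by (rule norm_le_l1_cart)
  also have "\<dots> \<le> (\<Sum>i\<in>(UNIV::'m set). s / 2 ^ l)"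
  proof (rule sum_mono)
    fix i
    have "(dyadic_floor a s l u - u) $ i = s * ?y i - s * ?x i" unfolding dyadic_floor_def using x[of i] by simp
    then show "\<bar>(dyadic_floor a s l u - u) $ i\<bar> \<le> s / 2 ^ l" using sx[of i] sx2[of i] by linarith
  qed
  finally show "norm (dyadic_floor a s l u - u) \<le> real CARD('m) * s / 2 ^ l" by simp
qed

text \<open>The grids are nested. Hence the step of any point between two consecutive levels is
  determined by its grid point on the finer level, and only finitely many increments occur per
  level.\<close>

lemma dyadic_floor_Suc:
  assumes "0 < s"
  shows "dyadic_floor a s l (dyadic_floor a s (Suc l) u) = dyadic_floor a s l u"
proof -
  have fl: "\<lfloor>2 ^ l * (real_of_int \<lfloor>2 ^ Suc l * x\<rfloor> / 2 ^ Suc l)\<rfloor> = \<lfloor>2 ^ l * x\<rfloor>" for x :: real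
  proof -
    have "\<lfloor>2 ^ l * (real_of_int \<lfloor>2 ^ Suc l * x\<rfloor> / 2 ^ Suc l)\<rfloor> = \<lfloor>real_of_int \<lfloor>2 ^ Suc l * x\<rfloor> / real_of_int 2\<rfloor>"
      by simp
    also have "\<dots> = \<lfloor>2 ^ Suc l * x\<rfloor> div 2" by (rule floor_divide_of_int_eq)
    also have "\<dots> = \<lfloor>2 ^ l * x\<rfloor>"
    proof -
      have "\<lfloor>2 ^ Suc l * x / real_of_int 2\<rfloor> = \<lfloor>2 ^ Suc l * x\<rfloor> div 2" by (rule floor_divide_real_eq_div) simp
      then show ?thesis by simp
    qed
    finally show ?thesis .
  qed
  have e: "(b + s * y - b) / s = y" for b y using assms by simp
  show ?thesis by (simp only: dyadic_floor_def vec_lambda_beta e fl)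
qed

lemma card_dyadic:
  assumes s: "0 < s"
  shows "finite (dyadic_floor a s l ` half_open_cube a s)"
    and "card (dyadic_floor a s l ` half_open_cube (a::real^'m::finite) s) \<le> (2 ^ l) ^ CARD('m)"
proof -
  let ?g = "\<lambda>z. \<chi> i. a $ i + s * (real (z i) / 2 ^ l)" and ?Z = "(UNIV::'m set) \<rightarrow>\<^sub>E {..<2 ^ l :: nat}"
  have sub: "dyadic_floor a s l ` half_open_cube a s \<subseteq> ?g ` ?Z"
  proof (rule image_subsetI)
    fix u assume u: "u \<in> half_open_cube a s"
    let ?z = "\<lambda>i. nat \<lfloor>2 ^ l * ((u $ i - a $ i) / s)\<rfloor>"
    have x: "0 \<le> (u $ i - a $ i) / s" "(u $ i - a $ i) / s < 1" for i
      using u s by (auto simp: half_open_cube_def divide_less_eq) (smt (verit))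
    have "?z i < 2 ^ l" for i
    proof -
      have "2 ^ l * ((u $ i - a $ i) / s) < 2 ^ l * 1" by (rule mult_strict_left_mono[OF x(2)]) simp
      then have "\<lfloor>2 ^ l * ((u $ i - a $ i) / s)\<rfloor> < 2 ^ l" by (simp add: floor_less_iff)
      then show ?thesis by (simp add: nat_less_iff)
    qed
    then have zZ: "?z \<in> ?Z" by auto
    have eq: "dyadic_floor a s l u = ?g ?z"
    proof -
      have "0 \<le> \<lfloor>2 ^ l * ((u $ i - a $ i) / s)\<rfloor>" for i
        by (subst zero_le_floor) (intro mult_nonneg_nonneg x(1), simp)
      from of_nat_nat[OF this, where 'a = real] show ?thesis by (simp only: dyadic_floor_def)
    qed
    show "dyadic_floor a s l u \<in> ?g ` ?Z" by (rule image_eqI[of _ ?g ?z, OF eq zZ])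
  qed
  have fin: "finite ?Z" by (intro finite_PiE) auto
  then show f: "finite (dyadic_floor a s l ` half_open_cube a s)" using sub finite_subset by blast
  have "card (dyadic_floor a s l ` half_open_cube a s) \<le> card (?g ` ?Z)"
    using fin sub by (intro card_mono) auto
  also have "\<dots> \<le> card ?Z" using fin by (rule card_image_le)
  also have "\<dots> = (2 ^ l) ^ CARD('m)" by (simp add: card_PiE)
  finally show "card (dyadic_floor a s l ` half_open_cube a s) \<le> (2 ^ l) ^ CARD('m)" .
qed

text \<open>A Kolmogorov-Chentsov condition: the \<open>p\<close>-th moment of an increment is of
  order the distance to the power \<open>p\<close>. The choice \<open>p = CARD('m) + 4\<close> beats
  the number of dyadic points with room to spare, and \<open>4 <= p\<close> gives
  \<open>modulus\<close> the fourth moment that the strong law requires.\<close>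

locale chaining = prob_space \<nu> for \<nu> :: "'x measure" +
  fixes H :: "real^'m::finite \<Rightarrow> 'x \<Rightarrow> real" and a :: "real^'m" and s B C :: real and p :: nat
  assumes s: "0 < s"
    and p: "p = CARD('m) + 4"
    and H_meas: "\<And>u. H u \<in> borel_measurable \<nu>"
    and H4_int: "\<And>u. u \<in> half_open_cube a s \<Longrightarrow> integrable \<nu> (\<lambda>x. H u x ^ 4)"
    and H4: "\<And>u. u \<in> half_open_cube a s \<Longrightarrow> (\<integral>x. H u x ^ 4 \<partial>\<nu>) \<le> B"
    and Hp_int: "\<And>u v. u \<in> half_open_cube a s \<Longrightarrow> v \<in> half_open_cube a s \<Longrightarrow>
          integrable \<nu> (\<lambda>x. \<bar>H u x - H v x\<bar> ^ p)"
    and Hp: "\<And>u v. u \<in> half_open_cube a s \<Longrightarrow> v \<in> half_open_cube a s \<Longrightarrow>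
          (\<integral>x. \<bar>H u x - H v x\<bar> ^ p \<partial>\<nu>) \<le> C * norm (u - v) ^ p"
    and C: "0 \<le> C"
begin

abbreviation "cube \<equiv> half_open_cube a s"
abbreviation "dyad \<equiv> dyadic_floor a s"

text \<open>The weight \<open>2 ^ l\<close> is what makes increments decay: if the sum over all
  \<open>l\<close> is finite, a single increment on level \<open>l\<close> is at most
  \<open>modulus\<close> times the \<open>l\<close>-th power of \<open>ratio\<close>, that is of two
  to the power \<open>-1/p\<close>.\<close>

definition level :: "nat \<Rightarrow> 'x \<Rightarrow> real" where
  "level l x = 2 ^ l * (\<Sum>w\<in>dyad (Suc l) ` cube. \<bar>H w x - H (dyad l w) x\<bar> ^ p)"

definition modulus :: "'x \<Rightarrow> real" where
  "modulus x = root p (\<Sum>l. level l x)"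

definition ratio :: real where "ratio = root p (1 / 2)"

lemma p_pos: "0 < p" "4 \<le> p" by (simp_all add: p)

lemma ratio: "0 < ratio" "ratio < 1"
  using p_pos by (simp_all add: ratio_def)

lemma level_measurable[measurable]: "level l \<in> borel_measurable \<nu>"
  unfolding level_def[abs_def] using H_meas by measurable

lemma modulus_measurable[measurable]: "modulus \<in> borel_measurable \<nu>"
  unfolding modulus_def[abs_def] by measurable

lemma level_nonneg: "0 \<le> level l x"
  unfolding level_def by (intro mult_nonneg_nonneg sum_nonneg) auto

lemma dyad_cube: "w \<in> dyad l ` cube \<Longrightarrow> w \<in> cube"
  using dyadic_floor_in_cube(1)[OF s] by blast

lemma level_integrable: "integrable \<nu> (level l)"
  unfolding level_def[abs_def]
  by (intro integrable_mult_right Bochner_Integration.integrable_sum Hp_int)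
    (auto intro: dyadic_floor_in_cube(1)[OF s])

lemma level_integral: "(\<integral>x. level l x \<partial>\<nu>) \<le> (C * (real CARD('m) * s) ^ p * 2 ^ CARD('m)) * (1 / 2) ^ l"
proof -
  let ?m = "CARD('m)"
  define z where "z = (2::real) ^ l"
  have z: "1 \<le> z" by (simp add: z_def)
  have "(\<integral>x. level l x \<partial>\<nu>) = z * (\<Sum>w\<in>dyad (Suc l) ` cube. \<integral>x. \<bar>H w x - H (dyad l w) x\<bar> ^ p \<partial>\<nu>)"
    unfolding level_def z_def
    by (subst integral_mult_right_zero, subst Bochner_Integration.integral_sum)
      (auto intro: Hp_int dyadic_floor_in_cube(1)[OF s])
  also have "\<dots> \<le> z * (\<Sum>w\<in>dyad (Suc l) ` cube. C * (real ?m * s / z) ^ p)"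
  proof (intro mult_left_mono sum_mono)
    fix w assume "w \<in> dyad (Suc l) ` cube"
    then have w: "w \<in> cube" by (rule dyad_cube)
    have "(\<integral>x. \<bar>H w x - H (dyad l w) x\<bar> ^ p \<partial>\<nu>) \<le> C * norm (w - dyad l w) ^ p"
      by (rule Hp[OF w dyadic_floor_in_cube(1)[OF s w]])
    also have "\<dots> \<le> C * (real ?m * s / z) ^ p"
      using dyadic_floor_in_cube(2)[OF s w, of l] C
      by (intro mult_left_mono power_mono) (auto simp: z_def norm_minus_commute)
    finally show "(\<integral>x. \<bar>H w x - H (dyad l w) x\<bar> ^ p \<partial>\<nu>) \<le> C * (real ?m * s / z) ^ p" .
  qed (use z in auto)
  also have "\<dots> = z * (real (card (dyad (Suc l) ` cube)) * (C * (real ?m * s / z) ^ p))" by simp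
  also have "\<dots> \<le> z * ((2 * z) ^ ?m * (C * (real ?m * s / z) ^ p))"
  proof (intro mult_left_mono mult_right_mono)
    have "real (card (dyad (Suc l) ` cube)) \<le> real ((2 ^ Suc l) ^ ?m)"
      using card_dyadic(2)[OF s, where l = "Suc l" and a = a] by (simp only: of_nat_le_iff)
    then show "real (card (dyad (Suc l) ` cube)) \<le> (2 * z) ^ ?m" by (simp add: z_def)
  qed (use z C s in auto)
  \<comment> \<open>The exponents of \<open>z\<close> add up to
    \<open>1 + CARD('m) - p = -3\<close>: weight, number of grid points, and moment of one
    increment.\<close>
  also have "\<dots> = (C * (real ?m * s) ^ p * 2 ^ ?m) * (1 / z ^ 3)"
    using z by (simp add: p power_add power_mult_distrib power_divide power4_eq_xxxx power3_eq_cube field_simps)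
  also have "\<dots> \<le> (C * (real ?m * s) ^ p * 2 ^ ?m) * (1 / z)"
  proof (intro mult_left_mono)
    have "z ^ 1 \<le> z ^ 3" by (rule power_increasing) (use z in auto)
    then show "1 / z ^ 3 \<le> 1 / z" using z by (intro divide_left_mono) auto
  qed (use C s in auto)
  finally show ?thesis by (simp add: z_def power_one_over)
qed

lemma level_summable_integral: "summable (\<lambda>l. \<integral>x. level l x \<partial>\<nu>)"
proof (rule summable_comparison_test')
  show "summable (\<lambda>l. (C * (real CARD('m) * s) ^ p * 2 ^ CARD('m)) * (1 / 2) ^ l)"
    by (intro summable_mult summable_geometric) simp
  show "norm (\<integral>x. level l x \<partial>\<nu>) \<le> (C * (real CARD('m) * s) ^ p * 2 ^ CARD('m)) * (1 / 2) ^ l"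
    if "0 \<le> l" for l
    using level_integral[of l] by (simp add: integral_nonneg_AE level_nonneg)
qed

lemma level_summable: "AE x in \<nu>. summable (\<lambda>l. level l x)"
  by (rule AE_summable[OF level_integrable level_nonneg level_summable_integral])

lemma modulus_nonneg: "summable (\<lambda>l. level l x) \<Longrightarrow> 0 \<le> modulus x"
  unfolding modulus_def using level_nonneg p_pos by (intro real_root_ge_zero suminf_nonneg)

text \<open>Where \<open>modulus\<close> exceeds 1, its fourth power is at most its
  \<open>p\<close>-th power, which is the integrable sum of the levels.\<close>

lemma modulus_fourth: "integrable \<nu> (\<lambda>x. modulus x ^ 4)"
proof -
  have int: "integrable \<nu> (\<lambda>x. \<Sum>l. level l x)"
    by (rule integrable_suminf[OF level_integrable])
      (use level_summable level_summable_integral level_nonneg in auto)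
  show ?thesis
  proof (rule Bochner_Integration.integrable_bound)
    show "integrable \<nu> (\<lambda>x. 1 + (\<Sum>l. level l x))" using int by simp
    show "AE x in \<nu>. norm (modulus x ^ 4) \<le> norm (1 + (\<Sum>l. level l x))"
      using level_summable
    proof eventually_elim
      fix x assume sm: "summable (\<lambda>l. level l x)"
      let ?W = "\<Sum>l. level l x"
      have W: "0 \<le> ?W" using sm level_nonneg by (rule suminf_nonneg)
      have "modulus x ^ 4 \<le> 1 + ?W"
      proof (cases "modulus x \<le> 1")
        case True
        then have "modulus x ^ 4 \<le> 1" using modulus_nonneg[OF sm] by (intro power_le_one)
        then show ?thesis using W by simp
      next
        case False
        then have "modulus x ^ 4 \<le> modulus x ^ p" using p_pos by (intro power_increasing) auto
        also have "\<dots> = ?W" unfolding modulus_def using W p_pos by (simp add: real_root_pow_pos2)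
        finally show ?thesis by simp
      qed
      then show "norm (modulus x ^ 4) \<le> norm (1 + ?W)" using W modulus_nonneg[OF sm] by simp
    qed
  qed measurable
qed

lemma dyad_increment:
  assumes sm: "summable (\<lambda>l. level l x)" and u: "u \<in> cube"
  shows "\<bar>H (dyad (Suc j) u) x - H (dyad j u) x\<bar> \<le> ratio ^ j * modulus x"
proof -
  let ?W = "\<Sum>l. level l x" and ?d = "\<bar>H (dyad (Suc j) u) x - H (dyad j u) x\<bar>"
  have fin: "finite (dyad (Suc j) ` cube)" by (rule card_dyadic(1)[OF s])
  have "?d ^ p = \<bar>H (dyad (Suc j) u) x - H (dyad j (dyad (Suc j) u)) x\<bar> ^ p"
    unfolding dyadic_floor_Suc[OF s] ..
  also have "\<dots> \<le> (\<Sum>w\<in>dyad (Suc j) ` cube. \<bar>H w x - H (dyad j w) x\<bar> ^ p)"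
    by (rule member_le_sum[OF _ _ fin]) (use u in auto)
  finally have "2 ^ j * ?d ^ p \<le> level j x" unfolding level_def by (intro mult_left_mono) auto
  also have "\<dots> \<le> ?W"
    using sum_le_suminf[OF sm, of "{j}"] level_nonneg by simp
  finally have "?d ^ p \<le> (1 / 2) ^ j * ?W" by (simp add: field_simps power_one_over)
  then have "root p (?d ^ p) \<le> root p ((1 / 2) ^ j * ?W)" using p_pos by (simp add: real_root_le_iff)
  then show ?thesis
    using p_pos by (simp add: real_root_power_cancel real_root_mult real_root_power ratio_def modulus_def)
qed

text \<open>The increments telescope into a geometric series along the dyadic approximations of
  \<open>u\<close>; continuity of the path lets these approximations reach \<open>H u x\<close>
  itself. The bound is uniform in \<open>u\<close>.\<close>

lemma dyad_approx:
  assumes sm: "summable (\<lambda>l. level l x)" and u: "u \<in> cube" and cont: "continuous_on cube (\<lambda>u. H u x)"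
  shows "\<bar>H u x - H (dyad l u) x\<bar> \<le> ratio ^ l / (1 - ratio) * modulus x"
proof -
  have step: "\<bar>H (dyad (l + n) u) x - H (dyad l u) x\<bar> \<le> (ratio ^ l - ratio ^ (l + n)) / (1 - ratio) * modulus x" for n
  proof (induction n)
    case (Suc n)
    have "(ratio ^ l - ratio ^ (l + Suc n)) / (1 - ratio) = (ratio ^ l - ratio ^ (l + n)) / (1 - ratio) + ratio ^ (l + n)"
      using ratio by (simp add: field_simps)
    then have "(ratio ^ l - ratio ^ (l + Suc n)) / (1 - ratio) * modulus x
        = (ratio ^ l - ratio ^ (l + n)) / (1 - ratio) * modulus x + ratio ^ (l + n) * modulus x"
      by (simp only: distrib_right)
    then show ?case using Suc dyad_increment[OF sm u, of "l + n"] by simp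
  qed simp
  have bd: "\<bar>H (dyad (l + n) u) x - H (dyad l u) x\<bar> \<le> ratio ^ l / (1 - ratio) * modulus x" for n
  proof (rule order_trans[OF step], rule mult_right_mono[OF _ modulus_nonneg[OF sm]])
    show "(ratio ^ l - ratio ^ (l + n)) / (1 - ratio) \<le> ratio ^ l / (1 - ratio)"
      using ratio by (intro divide_right_mono) auto
  qed
  have "(\<lambda>n. dyad (l + n) u - u) \<longlonglongrightarrow> 0"
  proof (rule Lim_null_comparison)
    show "\<forall>\<^sub>F n in sequentially. norm (dyad (l + n) u - u) \<le> (real CARD('m) * s) * (1 / 2) ^ (l + n)"
    proof (rule always_eventually, rule allI)
      show "norm (dyad (l + n) u - u) \<le> (real CARD('m) * s) * (1 / 2) ^ (l + n)" for n
        using dyadic_floor_in_cube(2)[OF s u, of "l + n"]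
        by (simp only: power_one_over times_divide_eq_right mult_1_right)
    qed
    have "(\<lambda>n. (real CARD('m) * s) * (1 / 2) ^ (n + l)) \<longlonglongrightarrow> (real CARD('m) * s) * 0"
      by (intro tendsto_intros LIMSEQ_ignore_initial_segment LIMSEQ_realpow_zero) auto
    then show "(\<lambda>n. (real CARD('m) * s) * (1 / 2) ^ (l + n)) \<longlonglongrightarrow> 0" by (simp add: add.commute)
  qed
  then have "(\<lambda>n. dyad (l + n) u) \<longlonglongrightarrow> u" by (simp add: LIM_zero_iff)
  with spec[OF cont[unfolded continuous_on_sequentially comp_def], of "\<lambda>n. dyad (l + n) u"]
  have "(\<lambda>n. H (dyad (l + n) u) x) \<longlonglongrightarrow> H u x"
    using u dyadic_floor_in_cube(1)[OF s u] by blast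
  then have "(\<lambda>n. \<bar>H (dyad (l + n) u) x - H (dyad l u) x\<bar>) \<longlonglongrightarrow> \<bar>H u x - H (dyad l u) x\<bar>"
    by (intro tendsto_intros)
  then show ?thesis by (rule LIMSEQ_le_const2) (use bd in auto)
qed

lemma H_integrable: "u \<in> cube \<Longrightarrow> integrable \<nu> (H u)"
  using integrable_power_le_fourth[OF H_meas H4_int, of u 1] by simp

lemma mean_Lipschitz:
  assumes u: "u \<in> cube" and v: "v \<in> cube"
  shows "\<bar>(\<integral>x. H u x \<partial>\<nu>) - (\<integral>x. H v x \<partial>\<nu>)\<bar> \<le> (1 + C) * norm (u - v)"
proof (cases "u = v")
  case False
  define d where "d = norm (u - v)"
  have d: "0 < d" using False by (simp add: d_def)
  \<comment> \<open>A substitute for the Lp norm inequality: either \<open>y\<close> is at most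
    \<open>d\<close> in size, or the second term dominates it. Taking \<open>d\<close> to be the
    distance of the two points makes both terms of order \<open>d\<close> after integration.\<close>
  have young: "\<bar>y\<bar> \<le> d + \<bar>y\<bar> ^ p / d ^ (p - 1)" for y
  proof (cases "\<bar>y\<bar> \<le> d")
    case True
    then show ?thesis using d by (simp add: add_increasing2)
  next
    case False
    then have "d ^ (p - 1) \<le> \<bar>y\<bar> ^ (p - 1)" using d by (intro power_mono) auto
    then have "\<bar>y\<bar> * d ^ (p - 1) \<le> \<bar>y\<bar> * \<bar>y\<bar> ^ (p - 1)" by (intro mult_left_mono) auto
    also have "\<dots> = \<bar>y\<bar> ^ p" using p_pos by (cases p) auto
    finally have "\<bar>y\<bar> \<le> \<bar>y\<bar> ^ p / d ^ (p - 1)" using d by (simp add: le_divide_eq)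
    then show ?thesis using d by simp
  qed
  have "\<bar>(\<integral>x. H u x \<partial>\<nu>) - (\<integral>x. H v x \<partial>\<nu>)\<bar> = \<bar>\<integral>x. H u x - H v x \<partial>\<nu>\<bar>"
    using H_integrable u v by simp
  also have "\<dots> \<le> (\<integral>x. \<bar>H u x - H v x\<bar> \<partial>\<nu>)" by (rule integral_abs_bound)
  also have "\<dots> \<le> (\<integral>x. d + \<bar>H u x - H v x\<bar> ^ p / d ^ (p - 1) \<partial>\<nu>)"
    using H_integrable u v Hp_int[OF u v] young by (intro integral_mono) auto
  also have "\<dots> = d + (\<integral>x. \<bar>H u x - H v x\<bar> ^ p \<partial>\<nu>) / d ^ (p - 1)"
    using Hp_int[OF u v] by (simp add: prob_space)
  also have "\<dots> \<le> d + C * d ^ p / d ^ (p - 1)"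
    using Hp[OF u v] d by (intro add_left_mono divide_right_mono) (auto simp: d_def)
  also have "\<dots> = (1 + C) * d" using d p_pos by (cases p) (auto simp: field_simps)
  finally show ?thesis by (simp add: d_def)
qed simp

end

lemma (in prob_space) strong_law_distr:
  fixes \<phi> :: "'x \<Rightarrow> real"
  assumes indep: "indep_vars (\<lambda>_. N) \<xi> UNIV" and distr: "\<And>n::nat. distr M N (\<xi> n) = \<nu>"
    and phi: "\<phi> \<in> borel_measurable N" and int: "integrable \<nu> (\<lambda>x. \<phi> x ^ 4)"
  shows "AE w in M. (\<lambda>k. (\<Sum>n<k. \<phi> (\<xi> n w)) / real k) \<longlonglongrightarrow> (\<integral>x. \<phi> x \<partial>\<nu>)"
proof -
  have m[measurable]: "\<xi> n \<in> M \<rightarrow>\<^sub>M N" for n using indep unfolding indep_vars_def by auto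
  note phi[measurable]
  show ?thesis
  proof (rule strong_law)
    show "indep_vars (\<lambda>_. borel) (\<lambda>n w. \<phi> (\<xi> n w)) UNIV"
      by (rule indep_vars_compose2[OF indep]) (rule phi)
    show "expectation (\<lambda>w. \<phi> (\<xi> n w)) = (\<integral>x. \<phi> x \<partial>\<nu>)" for n
      unfolding distr[of n, symmetric] by (subst integral_distr) auto
    show "integrable M (\<lambda>w. \<phi> (\<xi> n w) ^ 4)" for n
      using int unfolding distr[of n, symmetric] by (subst (asm) integrable_distr_eq) auto
    show "expectation (\<lambda>w. \<phi> (\<xi> n w) ^ 4) \<le> (\<integral>x. \<phi> x ^ 4 \<partial>\<nu>)" for n
      unfolding distr[of n, symmetric] by (subst integral_distr) auto
  qed
qed

text \<open>The error at \<open>u\<close> is compared with the error at its grid point. The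
  oscillation of the sample average is at most a small factor times the average of
  \<open>modulus\<close>, which converges and so is bounded in \<open>k\<close>; the mean is
  Lipschitz; and on the finitely many points of a fixed grid the ordinary strong law holds
  simultaneously. Each contributes \<open>e / 3\<close>.\<close>

theorem (in prob_space) uniform_strong_law:
  fixes H :: "real^'m::finite \<Rightarrow> 'x \<Rightarrow> real"
  assumes indep: "indep_vars (\<lambda>_. N) \<xi> UNIV" and distr: "\<And>n::nat. distr M N (\<xi> n) = \<nu>"
    and chain: "chaining \<nu> H a s B C p"
    and cont: "AE w in M. \<forall>n. continuous_on (half_open_cube a s) (\<lambda>u. H u (\<xi> n w))"
  shows "AE w in M. uniform_limit (half_open_cube a s)
     (\<lambda>k u. (\<Sum>n<k. H u (\<xi> n w)) / real k) (\<lambda>u. \<integral>x. H u x \<partial>\<nu>) sequentially"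
proof -
  interpret c: chaining \<nu> H a s B C p by (rule chain)
  have m[measurable]: "\<xi> n \<in> M \<rightarrow>\<^sub>M N" for n using indep unfolding indep_vars_def by auto
  have sets: "sets \<nu> = sets N" using distr[of 0] by (metis sets_distr)
  have mN: "\<phi> \<in> borel_measurable N" if "\<phi> \<in> borel_measurable \<nu>" for \<phi> :: "'x \<Rightarrow> real"
    using that by (simp add: measurable_cong_sets[OF sets refl])
  let ?D = "\<Union>l. c.dyad l ` c.cube"
  have D: "countable ?D" by (rule countable_UN, simp, rule countable_finite, rule card_dyadic(1)[OF c.s])
  have law_H: "AE w in M. \<forall>u\<in>?D. (\<lambda>k. (\<Sum>n<k. H u (\<xi> n w)) / real k) \<longlonglongrightarrow> (\<integral>x. H u x \<partial>\<nu>)"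
    unfolding AE_ball_countable[OF D]
  proof
    fix u assume "u \<in> ?D"
    then have "u \<in> c.cube" using c.dyad_cube by blast
    then show "AE w in M. (\<lambda>k. (\<Sum>n<k. H u (\<xi> n w)) / real k) \<longlonglongrightarrow> (\<integral>x. H u x \<partial>\<nu>)"
      by (intro strong_law_distr[OF indep distr mN[OF c.H_meas]] c.H4_int)
  qed
  have law_V: "AE w in M. (\<lambda>k. (\<Sum>n<k. c.modulus (\<xi> n w)) / real k) \<longlonglongrightarrow> (\<integral>x. c.modulus x \<partial>\<nu>)"
    by (rule strong_law_distr[OF indep distr mN[OF c.modulus_measurable] c.modulus_fourth])
  have sm: "AE w in M. \<forall>n. summable (\<lambda>l. c.level l (\<xi> n w))"
    unfolding AE_all_countable
  proof
    fix n
    have "AE x in distr M N (\<xi> n). summable (\<lambda>l. c.level l x)" unfolding distr by (rule c.level_summable)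
    then show "AE w in M. summable (\<lambda>l. c.level l (\<xi> n w))" by (rule AE_distrD[OF m])
  qed
  show ?thesis using law_H law_V sm cont
  proof eventually_elim
    fix w assume lH: "\<forall>u\<in>?D. (\<lambda>k. (\<Sum>n<k. H u (\<xi> n w)) / real k) \<longlonglongrightarrow> (\<integral>x. H u x \<partial>\<nu>)"
      and lV: "(\<lambda>k. (\<Sum>n<k. c.modulus (\<xi> n w)) / real k) \<longlonglongrightarrow> (\<integral>x. c.modulus x \<partial>\<nu>)"
      and sm: "\<forall>n. summable (\<lambda>l. c.level l (\<xi> n w))"
      and cont: "\<forall>n. continuous_on c.cube (\<lambda>u. H u (\<xi> n w))"
    let ?A = "\<lambda>k u. (\<Sum>n<k. H u (\<xi> n w)) / real k" and ?y = "\<lambda>u. \<integral>x. H u x \<partial>\<nu>"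
    have "Bseq (\<lambda>k. (\<Sum>n<k. c.modulus (\<xi> n w)) / real k)" using lV by (rule convergent_imp_Bseq[OF convergentI])
    then obtain K where K: "0 < K" "\<And>k. \<bar>(\<Sum>n<k. c.modulus (\<xi> n w)) / real k\<bar> \<le> K"
      unfolding Bseq_def by auto
    have A: "\<bar>?A k u - ?A k (c.dyad l u)\<bar> \<le> c.ratio ^ l / (1 - c.ratio) * K" if u: "u \<in> c.cube" for k u l
    proof -
      have "\<bar>?A k u - ?A k (c.dyad l u)\<bar> = \<bar>\<Sum>n<k. H u (\<xi> n w) - H (c.dyad l u) (\<xi> n w)\<bar> / real k"
        by (simp add: diff_divide_distrib[symmetric] sum_subtractf[symmetric] abs_divide)
      also have "\<dots> \<le> (\<Sum>n<k. c.ratio ^ l / (1 - c.ratio) * c.modulus (\<xi> n w)) / real k"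
        using sm cont u
        by (intro divide_right_mono order_trans[OF sum_abs] sum_mono c.dyad_approx) auto
      also have "\<dots> = c.ratio ^ l / (1 - c.ratio) * ((\<Sum>n<k. c.modulus (\<xi> n w)) / real k)"
        by (simp add: sum_distrib_left)
      also have "\<dots> \<le> c.ratio ^ l / (1 - c.ratio) * K"
        using abs_le_D1[OF K(2)[of k]] c.ratio by (intro mult_left_mono) auto
      finally show ?thesis .
    qed
    show "uniform_limit c.cube ?A ?y sequentially"
    proof (rule uniform_limitI)
      fix e :: real assume e: "0 < e"
      have "(\<lambda>l. c.ratio ^ l / (1 - c.ratio) * K) \<longlonglongrightarrow> 0 / (1 - c.ratio) * K"
        using c.ratio by (intro tendsto_intros LIMSEQ_realpow_zero) auto
      then have ev1: "\<forall>\<^sub>F l in sequentially. c.ratio ^ l / (1 - c.ratio) * K < e / 3"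
        by (rule order_tendstoD) (use e in simp)
      have "(\<lambda>l. (1 + C) * (real CARD('m) * s * (1 / 2) ^ l)) \<longlonglongrightarrow> (1 + C) * (real CARD('m) * s * 0)"
        by (intro tendsto_intros LIMSEQ_realpow_zero) auto
      then have ev2: "\<forall>\<^sub>F l in sequentially. (1 + C) * (real CARD('m) * s * (1 / 2) ^ l) < e / 3"
        by (rule order_tendstoD) (use e in simp)
      obtain l where l1: "c.ratio ^ l / (1 - c.ratio) * K < e / 3"
        and l2: "(1 + C) * (real CARD('m) * s * (1 / 2) ^ l) < e / 3"
        using eventually_happens'[OF _ eventually_conj[OF ev1 ev2]] by auto
      have "\<forall>u\<in>c.dyad l ` c.cube. \<forall>\<^sub>F k in sequentially. dist (?A k u) (?y u) < e / 3"
        using lH e by (intro ballI tendstoD) auto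
      then have "\<forall>\<^sub>F k in sequentially. \<forall>u\<in>c.dyad l ` c.cube. dist (?A k u) (?y u) < e / 3"
        using card_dyadic(1)[OF c.s] by (intro eventually_ball_finite) auto
      then show "\<forall>\<^sub>F k in sequentially. \<forall>u\<in>c.cube. dist (?A k u) (?y u) < e"
      proof eventually_elim
        fix k assume k: "\<forall>u\<in>c.dyad l ` c.cube. dist (?A k u) (?y u) < e / 3"
        show "\<forall>u\<in>c.cube. dist (?A k u) (?y u) < e"
        proof
          fix u assume u: "u \<in> c.cube"
          have du: "c.dyad l u \<in> c.cube" by (rule dyadic_floor_in_cube(1)[OF c.s u])
          have "\<bar>?A k u - ?A k (c.dyad l u)\<bar> < e / 3" using A[OF u, of k l] l1 by linarith
          moreover have "\<bar>?A k (c.dyad l u) - ?y (c.dyad l u)\<bar> < e / 3" using k u by (auto simp: dist_real_def)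
          moreover have "\<bar>?y (c.dyad l u) - ?y u\<bar> < e / 3"
          proof -
            have "\<bar>?y (c.dyad l u) - ?y u\<bar> \<le> (1 + C) * norm (c.dyad l u - u)"
              by (rule c.mean_Lipschitz[OF du u])
            also have "\<dots> \<le> (1 + C) * (real CARD('m) * s * (1 / 2) ^ l)"
              using dyadic_floor_in_cube(2)[OF c.s u, of l] c.C
              by (intro mult_left_mono) (simp_all add: power_one_over)
            finally show ?thesis using l2 by linarith
          qed
          ultimately show "dist (?A k u) (?y u) < e" unfolding dist_real_def by linarith
        qed
      qed
    qed
  qed
qed

section \<open>Invariance under reparametrisation\<close>

lemma jac_inverse:
  fixes \<tau> \<sigma> :: "real^'m::finite \<Rightarrow> real^'m"
  assumes "\<sigma> differentiable (at v)" "\<tau> differentiable (at (\<sigma> v))"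
    and "open V" "v \<in> V" "\<And>w. w \<in> V \<Longrightarrow> \<tau> (\<sigma> w) = w"
  shows "jac \<tau> (\<sigma> v) ** jac \<sigma> v = mat 1"
proof -
  have "((\<lambda>w. \<tau> (\<sigma> w)) has_derivative (\<lambda>h. jac \<tau> (\<sigma> v) *v (jac \<sigma> v *v h))) (at v)"
    by (rule has_derivative_compose[OF jac_works(1)[OF assms(1)] jac_works(1)[OF assms(2)]])
  then have "((\<lambda>w. w) has_derivative (\<lambda>h. jac \<tau> (\<sigma> v) *v (jac \<sigma> v *v h))) (at v)"
    by (rule has_derivative_transform_within_open[OF _ assms(3,4)]) (rule assms(5))
  from has_derivative_unique[OF this has_derivative_ident]
  have "(jac \<tau> (\<sigma> v) ** jac \<sigma> v) *v h = mat 1 *v h" for h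
    by (metis matrix_vector_mul_assoc matrix_vector_mul_lid)
  then show ?thesis by (simp add: matrix_eq)
qed

section \<open>The second fundamental form under a change of parametrisation\<close>

context L2_space
begin

definition hess :: "(real^'m::finite \<Rightarrow> 'w \<Rightarrow> real) \<Rightarrow> real^'m \<Rightarrow> real^'m \<Rightarrow> real^'m \<Rightarrow> 'w \<Rightarrow> real" where
  "hess \<phi> u x y w = (\<Sum>i\<in>UNIV. \<Sum>j\<in>UNIV. x $ i * y $ j * fpartial i (fpartial j \<phi>) u w)"

definition tang :: "(real^'m::finite \<Rightarrow> 'w \<Rightarrow> real) \<Rightarrow> real^'m \<Rightarrow> real^'m \<Rightarrow> 'w \<Rightarrow> real" where
  "tang \<phi> u x w = (\<Sum>i\<in>UNIV. x $ i * fpartial i \<phi> u w)"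

definition hess_tang :: "(real^'m::finite \<Rightarrow> 'w \<Rightarrow> real) \<Rightarrow> real^'m \<Rightarrow> real^'m \<Rightarrow> real^'m \<Rightarrow> real^'m" where
  "hess_tang \<phi> u x y = (\<chi> p. ip (hess \<phi> u x y) (fpartial p \<phi> u))"

text \<open>The inner product of two values of the second fundamental form: the product of the
  second derivatives minus that of their tangential projections.\<close>

definition normal_product where
  "normal_product \<phi> u x y z w = ip (hess \<phi> u x y) (hess \<phi> u z w)
     - hess_tang \<phi> u x y \<bullet> (matrix_inv (G_of \<phi> u) *v hess_tang \<phi> u z w)"

context
  fixes \<phi> :: "real^'m::finite \<Rightarrow> 'w \<Rightarrow> real" and U u
  assumes U: "open U" "u \<in> U" and phi: "field 3 U \<phi>"
begin

lemma first_partial_L: "fpartial i \<phi> u \<in> L"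
  using field_fpartial[OF U(1), of 2 \<phi> i] phi U(2) by (auto simp: numeral_3_eq_3 numeral_2_eq_2 intro: field_L)

lemma second_partial_L: "fpartial i (fpartial j \<phi>) u \<in> L"
proof -
  have "field (Suc (Suc (Suc 0))) U \<phi>" using phi by (simp add: numeral_3_eq_3)
  from field_fpartial[OF U(1) field_fpartial[OF U(1) this]] U(2) show ?thesis by (rule field_L)
qed

lemma hess_L: "hess \<phi> u x y \<in> L"
  unfolding hess_def[abs_def] by (intro L_sum L_cmult second_partial_L)

lemma tang_L: "tang \<phi> u x \<in> L"
  unfolding tang_def[abs_def] by (intro L_sum L_cmult first_partial_L)

lemma ip_hess: "Z \<in> L \<Longrightarrow> ip (hess \<phi> u x y) Z = (\<Sum>i\<in>UNIV. \<Sum>j\<in>UNIV. x $ i * y $ j * ip (fpartial i (fpartial j \<phi>) u) Z)"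
  unfolding hess_def[abs_def] by (simp add: ip_sum ip_cmult L_sum L_cmult second_partial_L)

lemma ip_tang: "Z \<in> L \<Longrightarrow> ip (tang \<phi> u x) Z = (\<Sum>i\<in>UNIV. x $ i * ip (fpartial i \<phi> u) Z)"
  unfolding tang_def[abs_def] by (simp add: ip_sum ip_cmult L_sum L_cmult first_partial_L)

lemma normal_product_expand:
  "normal_product \<phi> u x y z w = (\<Sum>i\<in>UNIV. \<Sum>j\<in>UNIV. \<Sum>k\<in>UNIV. \<Sum>l\<in>UNIV. x $ i * y $ j * (z $ k * w $ l) *
     (S_of \<phi> u $ i $ j $ k $ l
       - (\<Sum>p\<in>UNIV. \<Sum>q\<in>UNIV. matrix_inv (G_of \<phi> u) $ p $ q * T_of \<phi> u $ i $ j $ p * T_of \<phi> u $ k $ l $ q)))"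
proof -
  have t: "hess_tang \<phi> u x y $ p = (\<Sum>i\<in>UNIV. \<Sum>j\<in>UNIV. x $ i * y $ j * T_of \<phi> u $ i $ j $ p)" for x y p
    by (simp add: hess_tang_def ip_hess first_partial_L T_of_def)
  have 1: "ip (hess \<phi> u x y) (hess \<phi> u z w) = (\<Sum>i\<in>UNIV. \<Sum>j\<in>UNIV. \<Sum>k\<in>UNIV. \<Sum>l\<in>UNIV.
      x $ i * y $ j * (z $ k * w $ l) * S_of \<phi> u $ i $ j $ k $ l)"
    unfolding ip_hess[OF hess_L]
    by (subst ip_commute, subst ip_hess[OF second_partial_L])
      (simp add: sum_distrib_left S_of_def ip_commute mult.assoc)
  have "hess_tang \<phi> u x y \<bullet> (matrix_inv (G_of \<phi> u) *v hess_tang \<phi> u z w)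
     = (\<Sum>p\<in>UNIV. \<Sum>q\<in>UNIV. \<Sum>i\<in>UNIV. \<Sum>j\<in>UNIV. \<Sum>k\<in>UNIV. \<Sum>l\<in>UNIV. x $ i * y $ j * (z $ k * w $ l) *
        (matrix_inv (G_of \<phi> u) $ p $ q * T_of \<phi> u $ i $ j $ p * T_of \<phi> u $ k $ l $ q))"
  proof -
    have q: "(\<Sum>i\<in>UNIV. \<Sum>j\<in>UNIV. A i j) * (c * (\<Sum>k\<in>UNIV. \<Sum>l\<in>UNIV. B k l))
      = (\<Sum>i\<in>UNIV. \<Sum>j\<in>UNIV. \<Sum>k\<in>UNIV. \<Sum>l\<in>UNIV. A i j * (c * B k l))" for A B :: "'m \<Rightarrow> 'm \<Rightarrow> real" and c
      unfolding sum_distrib_right unfolding sum_distrib_left ..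
    have "hess_tang \<phi> u x y \<bullet> (matrix_inv (G_of \<phi> u) *v hess_tang \<phi> u z w)
      = (\<Sum>p\<in>UNIV. \<Sum>q\<in>UNIV. hess_tang \<phi> u x y $ p * (matrix_inv (G_of \<phi> u) $ p $ q * hess_tang \<phi> u z w $ q))"
      by (simp add: inner_vec_def matrix_vector_mult_def sum_distrib_left)
    also have "\<dots> = (\<Sum>p\<in>UNIV. \<Sum>q\<in>UNIV. \<Sum>i\<in>UNIV. \<Sum>j\<in>UNIV. \<Sum>k\<in>UNIV. \<Sum>l\<in>UNIV.
        x $ i * y $ j * T_of \<phi> u $ i $ j $ p * (matrix_inv (G_of \<phi> u) $ p $ q * (z $ k * w $ l * T_of \<phi> u $ k $ l $ q)))"
      unfolding t q ..
    finally show ?thesis by (simp add: mult_ac)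
  qed
  also have "\<dots> = (\<Sum>i\<in>UNIV. \<Sum>j\<in>UNIV. \<Sum>k\<in>UNIV. \<Sum>l\<in>UNIV. \<Sum>p\<in>UNIV. \<Sum>q\<in>UNIV. x $ i * y $ j * (z $ k * w $ l) *
        (matrix_inv (G_of \<phi> u) $ p $ q * T_of \<phi> u $ i $ j $ p * T_of \<phi> u $ k $ l $ q))"
  proof -
    have sw: "(\<Sum>p\<in>UNIV. \<Sum>q\<in>UNIV. \<Sum>i\<in>UNIV. f p q i) = (\<Sum>i\<in>UNIV. \<Sum>p\<in>UNIV. \<Sum>q\<in>UNIV. f p q i)"
      for f :: "'m \<Rightarrow> 'm \<Rightarrow> 'm \<Rightarrow> real"
      by (rule trans[OF sum.cong[OF refl sum.swap] sum.swap])
    show ?thesis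
      by (rule trans[OF sw], rule sum.cong[OF refl], rule trans[OF sw], rule sum.cong[OF refl],
          rule trans[OF sw], rule sum.cong[OF refl], rule sw)
  qed
  finally show ?thesis
    unfolding normal_product_def 1 by (simp add: right_diff_distrib sum_subtractf sum_distrib_left)
qed

text \<open>The Gauss equation in terms of the second fundamental form. Unlike the components of
  \<open>T\<close> and \<open>S\<close>, the normal products transform as tensors, and with them the
  curvature form.\<close>

lemma gauss_form_normal_product:
  "coeff_form (gauss_coeff (G_of \<phi> u) (T_of \<phi> u) (S_of \<phi> u)) X Z =
     normal_product \<phi> u (X 1) (Z 0) (X 0) (Z 1) - normal_product \<phi> u (X 0) (Z 0) (X 1) (Z 1)"
proof -
  define N where "N i j k l = S_of \<phi> u $ i $ j $ k $ l
       - (\<Sum>p\<in>UNIV. \<Sum>q\<in>UNIV. matrix_inv (G_of \<phi> u) $ p $ q * T_of \<phi> u $ i $ j $ p * T_of \<phi> u $ k $ l $ q)" for i j k l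
  have np: "normal_product \<phi> u x y z w = (\<Sum>i\<in>UNIV. \<Sum>j\<in>UNIV. \<Sum>k\<in>UNIV. \<Sum>l\<in>UNIV.
      x $ i * y $ j * (z $ k * w $ l) * N i j k l)" for x y z w
    unfolding normal_product_expand N_def ..
  have g: "gauss_coeff (G_of \<phi> u) (T_of \<phi> u) (S_of \<phi> u) a i j l = N i j a l - N a j i l" for a i j l
    by (simp add: gauss_coeff_def N_def)
  have A: "normal_product \<phi> u (X 0) (Z 0) (X 1) (Z 1) = (\<Sum>a\<in>UNIV. \<Sum>i\<in>UNIV. \<Sum>j\<in>UNIV. \<Sum>l\<in>UNIV.
      X 0 $ a * X 1 $ i * Z 0 $ j * Z 1 $ l * N a j i l)"
    unfolding np by (rule sum.cong[OF refl], subst sum.swap) (simp add: mult_ac)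
  have B: "normal_product \<phi> u (X 1) (Z 0) (X 0) (Z 1) = (\<Sum>a\<in>UNIV. \<Sum>i\<in>UNIV. \<Sum>j\<in>UNIV. \<Sum>l\<in>UNIV.
      X 0 $ a * X 1 $ i * Z 0 $ j * Z 1 $ l * N i j a l)"
    unfolding np
    by (rule trans[OF sum.cong[OF refl sum.swap]], subst sum.swap) (simp add: mult_ac)
  show ?thesis unfolding A B coeff_form_def g
    by (simp add: sum_subtractf[symmetric] left_diff_distrib right_diff_distrib mult_ac)
qed

end

context
  fixes \<phi> \<psi> :: "real^'m::finite \<Rightarrow> 'w \<Rightarrow> real" and \<tau> :: "real^'m \<Rightarrow> real^'m" and U V W u
  assumes U: "open U" "W \<subseteq> U" and phi: "field 3 U \<phi>" and V: "open V" "\<tau> ` W \<subseteq> V" and psi: "field 3 V \<psi>"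
    and W: "open W" "u \<in> W" and tau: "twice_differentiable_on \<tau> W"
    and eq: "\<And>v. v \<in> W \<Longrightarrow> \<phi> v = \<psi> (\<tau> v)"
begin

lemma uU: "u \<in> U" and tuV: "\<tau> u \<in> V" using U V W by auto

lemma tang_transform_AE: "AE w in M. tang \<phi> u x w = tang \<psi> (\<tau> u) (jac \<tau> u *v x) w"
proof -
  have "AE w in M. Ck_on 3 (\<lambda>v. \<psi> v w) V" using psi by (simp add: field_def)
  then show ?thesis
  proof eventually_elim
    fix w assume "Ck_on 3 (\<lambda>v. \<psi> v w) V"
    then have d: "(\<lambda>v. \<psi> v w) differentiable (at (\<tau> u))" by (rule Ck_on_differentiable[OF _ _ tuV]) simp
    have dt: "\<tau> differentiable (at u)" using tau W by (auto simp: twice_differentiable_on_def)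
    have "fpartial i \<phi> u w = (\<Sum>a\<in>UNIV. jac \<tau> u $ a $ i * fpartial a \<psi> (\<tau> u) w)" for i
      unfolding fpartial_def by (rule partial_chain(2)[OF dt d W]) (simp add: eq)
    then have "tang \<phi> u x w = (\<Sum>i\<in>UNIV. \<Sum>a\<in>UNIV. x $ i * (jac \<tau> u $ a $ i * fpartial a \<psi> (\<tau> u) w))"
      by (simp add: tang_def sum_distrib_left)
    also have "\<dots> = (\<Sum>a\<in>UNIV. \<Sum>i\<in>UNIV. x $ i * (jac \<tau> u $ a $ i * fpartial a \<psi> (\<tau> u) w))" by (rule sum.swap)
    also have "\<dots> = tang \<psi> (\<tau> u) (jac \<tau> u *v x) w"
      by (simp add: tang_def matrix_vector_mult_def sum_distrib_right sum_distrib_left mult_ac)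
    finally show "tang \<phi> u x w = tang \<psi> (\<tau> u) (jac \<tau> u *v x) w" .
  qed
qed

text \<open>The vector \<open>k\<close> is the second derivative of \<open>\<tau>\<close> in the
  directions \<open>x\<close> and \<open>y\<close>; it comes from the last sum of
  \<open>partial_chain2\<close> and does not depend on the sample point.\<close>

lemma hess_transform_AE: "\<exists>k. AE w in M. hess \<phi> u x y w
   = hess \<psi> (\<tau> u) (jac \<tau> u *v x) (jac \<tau> u *v y) w + tang \<psi> (\<tau> u) k w"
proof -
  define k where "k = (\<chi> b. \<Sum>i\<in>UNIV. \<Sum>j\<in>UNIV. x $ i * y $ j * partial i (\<lambda>w. jac \<tau> w $ b $ j) u)"
  have "AE w in M. Ck_on 3 (\<lambda>v. \<psi> v w) V" using psi by (simp add: field_def)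
  then have "AE w in M. hess \<phi> u x y w
   = hess \<psi> (\<tau> u) (jac \<tau> u *v x) (jac \<tau> u *v y) w + tang \<psi> (\<tau> u) k w"
  proof eventually_elim
    fix w assume "Ck_on 3 (\<lambda>v. \<psi> v w) V"
    then have C2: "Ck_on 2 (\<lambda>v. \<psi> v w) V" by (rule Ck_on_mono) simp
    let ?J = "jac \<tau> u"
    define E where "E a b = fpartial a (fpartial b \<psi>) (\<tau> u) w" for a b
    have "fpartial i (fpartial j \<phi>) u w = (\<Sum>a\<in>UNIV. \<Sum>b\<in>UNIV. ?J $ a $ i * ?J $ b $ j * E a b)
       + (\<Sum>b\<in>UNIV. partial i (\<lambda>w. jac \<tau> w $ b $ j) u * fpartial b \<psi> (\<tau> u) w)" for i j
      unfolding fpartial_def E_def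
      by (rule partial_chain2[OF W tau V C2]) (simp add: eq)
    then have "hess \<phi> u x y w = (\<Sum>i\<in>UNIV. \<Sum>j\<in>UNIV. \<Sum>a\<in>UNIV. \<Sum>b\<in>UNIV. x $ i * y $ j * (?J $ a $ i * ?J $ b $ j * E a b))
       + (\<Sum>i\<in>UNIV. \<Sum>j\<in>UNIV. \<Sum>b\<in>UNIV. x $ i * y $ j * (partial i (\<lambda>w. jac \<tau> w $ b $ j) u * fpartial b \<psi> (\<tau> u) w))"
      by (simp add: hess_def distrib_left sum.distrib sum_distrib_left)
    also have "(\<Sum>i\<in>UNIV. \<Sum>j\<in>UNIV. \<Sum>b\<in>UNIV. x $ i * y $ j * (partial i (\<lambda>w. jac \<tau> w $ b $ j) u * fpartial b \<psi> (\<tau> u) w))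
       = tang \<psi> (\<tau> u) k w"
    proof -
      have "(\<Sum>i\<in>UNIV. \<Sum>j\<in>UNIV. \<Sum>b\<in>UNIV. f i j b) = (\<Sum>b\<in>UNIV. \<Sum>i\<in>UNIV. \<Sum>j\<in>UNIV. f i j b)"
        for f :: "'m \<Rightarrow> 'm \<Rightarrow> 'm \<Rightarrow> real"
        by (rule trans[OF sum.cong[OF refl sum.swap] sum.swap])
      then show ?thesis by (simp add: tang_def k_def sum_distrib_right mult.assoc)
    qed
    also have "(\<Sum>i\<in>UNIV. \<Sum>j\<in>UNIV. \<Sum>a\<in>UNIV. \<Sum>b\<in>UNIV. x $ i * y $ j * (?J $ a $ i * ?J $ b $ j * E a b))
      = (\<Sum>a\<in>UNIV. \<Sum>b\<in>UNIV. \<Sum>i\<in>UNIV. \<Sum>j\<in>UNIV. x $ i * y $ j * (?J $ a $ i * ?J $ b $ j * E a b))"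
    proof -
      have sw: "(\<Sum>i\<in>UNIV. \<Sum>j\<in>UNIV. \<Sum>b\<in>UNIV. f i j b) = (\<Sum>b\<in>UNIV. \<Sum>i\<in>UNIV. \<Sum>j\<in>UNIV. f i j b)"
        for f :: "'m \<Rightarrow> 'm \<Rightarrow> 'm \<Rightarrow> real"
        by (rule trans[OF sum.cong[OF refl sum.swap] sum.swap])
      show ?thesis by (rule trans[OF sw], rule sum.cong[OF refl], rule sw)
    qed
    also have "\<dots> = hess \<psi> (\<tau> u) (?J *v x) (?J *v y) w"
    proof -
      have "(\<Sum>i\<in>UNIV. \<Sum>j\<in>UNIV. x $ i * y $ j * (?J $ a $ i * ?J $ b $ j * E a b))
         = (?J *v x) $ a * (?J *v y) $ b * E a b" for a b
        by (subst sum.swap) (simp add: matrix_vector_mult_def sum_product sum_distrib_right sum_distrib_left mult_ac)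
      then show ?thesis by (simp add: hess_def E_def)
    qed
    finally show "hess \<phi> u x y w = hess \<psi> (\<tau> u) (?J *v x) (?J *v y) w + tang \<psi> (\<tau> u) k w" .
  qed
  then show ?thesis by blast
qed

lemma G_of_tang:
  fixes \<theta> :: "real^'m \<Rightarrow> 'w \<Rightarrow> real"
  assumes "field 3 U' \<theta>" "open U'" "v \<in> U'"
  shows "ip (tang \<theta> v x) (tang \<theta> v y) = x \<bullet> (G_of \<theta> v *v y)"
proof -
  note L = first_partial_L[OF assms(2,3,1)] tang_L[OF assms(2,3,1)]
  have "ip (fpartial i \<theta> v) (tang \<theta> v y) = (G_of \<theta> v *v y) $ i" for i
    by (subst ip_commute, subst ip_tang[OF assms(2,3,1) L(1)])
      (simp add: matrix_vector_mult_def G_of_def ip_commute[of "fpartial i \<theta> v"] mult.commute)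
  then show ?thesis by (subst ip_tang[OF assms(2,3,1) L(2)]) (simp add: inner_vec_def)
qed

text \<open>Both matrices represent the same bilinear form, namely inner products of derivatives
  along vectors, and these derivatives correspond almost everywhere under the Jacobian.\<close>

lemma G_of_transform: "G_of \<phi> u = transpose (jac \<tau> u) ** G_of \<psi> (\<tau> u) ** jac \<tau> u"
proof -
  have "x \<bullet> (G_of \<phi> u *v y) = x \<bullet> ((transpose (jac \<tau> u) ** G_of \<psi> (\<tau> u) ** jac \<tau> u) *v y)" for x y
  proof -
    have "x \<bullet> (G_of \<phi> u *v y) = ip (tang \<phi> u x) (tang \<phi> u y)" using G_of_tang[OF phi U(1) uU] by simp
    also have "\<dots> = ip (tang \<psi> (\<tau> u) (jac \<tau> u *v x)) (tang \<psi> (\<tau> u) (jac \<tau> u *v y))"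
      by (rule ip_cong_AE) (intro tang_transform_AE tang_L[OF U(1) uU phi] tang_L[OF V(1) tuV psi])+
    also have "\<dots> = (jac \<tau> u *v x) \<bullet> (G_of \<psi> (\<tau> u) *v (jac \<tau> u *v y))" using G_of_tang[OF psi V(1) tuV] by simp
    also have "\<dots> = x \<bullet> (transpose (jac \<tau> u) *v (G_of \<psi> (\<tau> u) *v (jac \<tau> u *v y)))"
      by (metis dot_lmul_matrix transpose_matrix_vector transpose_transpose)
    finally show ?thesis by (simp only: matrix_vector_mul_assoc matrix_mul_assoc)
  qed
  then have "G_of \<phi> u *v y = (transpose (jac \<tau> u) ** G_of \<psi> (\<tau> u) ** jac \<tau> u) *v y" for y
    using vector_eq_ldot by blast
  then show ?thesis by (simp add: matrix_eq)
qed

lemma hess_tang_transform: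
  assumes k: "AE w in M. hess \<phi> u x y w = hess \<psi> (\<tau> u) (jac \<tau> u *v x) (jac \<tau> u *v y) w + tang \<psi> (\<tau> u) k w"
  shows "hess_tang \<phi> u x y = transpose (jac \<tau> u) *v
     (hess_tang \<psi> (\<tau> u) (jac \<tau> u *v x) (jac \<tau> u *v y) + G_of \<psi> (\<tau> u) *v k)"
proof -
  note pl = first_partial_L[OF V(1) tuV psi] hess_L[OF V(1) tuV psi] tang_L[OF V(1) tuV psi]
  let ?h = "hess \<psi> (\<tau> u) (jac \<tau> u *v x) (jac \<tau> u *v y)"
  have L: "(\<lambda>w. ?h w + tang \<psi> (\<tau> u) k w) \<in> L" using L_lin[OF pl(2) pl(3), of 1 _ _ 1] by simp
  have "hess_tang \<phi> u x y $ p = (transpose (jac \<tau> u) *v (hess_tang \<psi> (\<tau> u) (jac \<tau> u *v x) (jac \<tau> u *v y) + G_of \<psi> (\<tau> u) *v k)) $ p" for p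
  proof -
    have tp: "fpartial p \<phi> u = tang \<phi> u (axis p 1)"
      by (rule ext) (simp add: tang_def axis_def if_distrib[where f = "\<lambda>z. z * _"] cong: if_cong)
    have "hess_tang \<phi> u x y $ p = ip (hess \<phi> u x y) (tang \<phi> u (axis p 1))" by (simp add: hess_tang_def tp)
    also have "\<dots> = ip (\<lambda>w. ?h w + tang \<psi> (\<tau> u) k w) (tang \<psi> (\<tau> u) (jac \<tau> u *v axis p 1))"
      by (rule ip_cong_AE) (intro k tang_transform_AE tang_L[OF U(1) uU phi] hess_L[OF U(1) uU phi] L pl(3))+
    also have "\<dots> = ip ?h (tang \<psi> (\<tau> u) (jac \<tau> u *v axis p 1)) + ip (tang \<psi> (\<tau> u) k) (tang \<psi> (\<tau> u) (jac \<tau> u *v axis p 1))"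
      using ip_lin[OF pl(2) pl(3) pl(3), of 1 _ _ 1] by simp
    also have "ip (tang \<psi> (\<tau> u) k) (tang \<psi> (\<tau> u) (jac \<tau> u *v axis p 1)) = (jac \<tau> u *v axis p 1) \<bullet> (G_of \<psi> (\<tau> u) *v k)"
      by (subst ip_commute) (rule G_of_tang[OF psi V(1) tuV])
    also have "ip ?h (tang \<psi> (\<tau> u) (jac \<tau> u *v axis p 1)) = (jac \<tau> u *v axis p 1) \<bullet> hess_tang \<psi> (\<tau> u) (jac \<tau> u *v x) (jac \<tau> u *v y)"
      by (subst ip_commute, subst ip_tang[OF V(1) tuV psi pl(2)])
        (simp add: inner_vec_def hess_tang_def ip_commute)
    finally have "hess_tang \<phi> u x y $ p = (jac \<tau> u *v axis p 1) \<bullet>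
       (hess_tang \<psi> (\<tau> u) (jac \<tau> u *v x) (jac \<tau> u *v y) + G_of \<psi> (\<tau> u) *v k)" by (simp add: inner_add_right)
    also have "\<dots> = axis p 1 \<bullet> (transpose (jac \<tau> u) *v (hess_tang \<psi> (\<tau> u) (jac \<tau> u *v x) (jac \<tau> u *v y) + G_of \<psi> (\<tau> u) *v k))"
      by (metis dot_lmul_matrix transpose_matrix_vector transpose_transpose)
    finally show ?thesis by (simp only: inner_axis' inner_real_def mult_1_left)
  qed
  then show ?thesis by (simp add: vec_eq_iff)
qed

text \<open>The terms in \<open>k1\<close> and \<open>k2\<close> change the product of the second
  derivatives and the product of their tangential parts by the same amount, the latter by
  \<open>normal_product_transform\<close>.\<close>

lemma normal_product_invariant:
  assumes J: "jac \<tau> u ** J' = mat 1" and det: "det (G_of \<psi> (\<tau> u)) \<noteq> 0"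
  shows "normal_product \<phi> u x y z w = normal_product \<psi> (\<tau> u) (jac \<tau> u *v x) (jac \<tau> u *v y) (jac \<tau> u *v z) (jac \<tau> u *v w)"
proof -
  let ?J = "jac \<tau> u"
  obtain k1 where k1: "AE v in M. hess \<phi> u x y v = hess \<psi> (\<tau> u) (?J *v x) (?J *v y) v + tang \<psi> (\<tau> u) k1 v"
    using hess_transform_AE by blast
  obtain k2 where k2: "AE v in M. hess \<phi> u z w v = hess \<psi> (\<tau> u) (?J *v z) (?J *v w) v + tang \<psi> (\<tau> u) k2 v"
    using hess_transform_AE by blast
  note pl = hess_L[OF V(1) tuV psi] tang_L[OF V(1) tuV psi]
  let ?h1 = "hess \<psi> (\<tau> u) (?J *v x) (?J *v y)" and ?h2 = "hess \<psi> (\<tau> u) (?J *v z) (?J *v w)"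
  let ?t1 = "tang \<psi> (\<tau> u) k1" and ?t2 = "tang \<psi> (\<tau> u) k2"
  have L: "(\<lambda>v. ?h1 v + ?t1 v) \<in> L" "(\<lambda>v. ?h2 v + ?t2 v) \<in> L"
    using L_lin[OF pl(1) pl(2), of 1 _ _ 1] by auto
  have tr: "transpose (G_of \<psi> (\<tau> u)) = G_of \<psi> (\<tau> u)"
    by (simp add: G_of_def transpose_def vec_eq_iff ip_commute)
  have ht: "ip (hess \<psi> (\<tau> u) a b) (tang \<psi> (\<tau> u) k) = hess_tang \<psi> (\<tau> u) a b \<bullet> k" for a b k
    by (subst ip_commute, subst ip_tang[OF V(1) tuV psi pl(1)])
      (simp add: inner_vec_def hess_tang_def ip_commute mult.commute)
  have "ip (hess \<phi> u x y) (hess \<phi> u z w) = ip (\<lambda>v. ?h1 v + ?t1 v) (\<lambda>v. ?h2 v + ?t2 v)"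
    by (rule ip_cong_AE) (intro k1 k2 hess_L[OF U(1) uU phi] L)+
  also have "\<dots> = ip ?h1 ?h2 + ip ?h1 ?t2 + ip ?t1 ?h2 + ip ?t1 ?t2"
    using ip_lin[OF pl(1) pl(2) L(2), of 1 _ _ 1] ip_lin[OF pl(1) pl(2) pl(1), of 1 _ _ 1] ip_lin[OF pl(1) pl(2) pl(2), of 1 _ _ 1]
    by (simp add: ip_commute[of _ "\<lambda>v. ?h2 v + ?t2 v"]) (simp add: ip_commute)
  also have "\<dots> = ip ?h1 ?h2 + hess_tang \<psi> (\<tau> u) (?J *v x) (?J *v y) \<bullet> k2
      + k1 \<bullet> hess_tang \<psi> (\<tau> u) (?J *v z) (?J *v w) + k1 \<bullet> (G_of \<psi> (\<tau> u) *v k2)"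
    by (simp add: ht ip_commute[of ?t1 ?h2] G_of_tang[OF psi V(1) tuV] inner_commute)
  finally show ?thesis
    unfolding normal_product_def
      normal_product_transform[OF G_of_transform J tr det hess_tang_transform[OF k1] hess_tang_transform[OF k2]]
    by simp
qed

text \<open>The Jacobian carries an orthonormal basis for one metric to an orthonormal basis for the
  other and pulls one curvature form back to the other; the traces over these two bases agree term
  by term, and neither depends on the basis.\<close>

lemma gauss_trace_invariant:
  assumes J: "jac \<tau> u ** J' = mat 1" and pd: "pos_def (G_of \<phi> u)" and det: "det (G_of \<psi> (\<tau> u)) \<noteq> 0"
  shows "gauss_trace n (G_of \<phi> u, T_of \<phi> u, S_of \<phi> u) = gauss_trace n (G_of \<psi> (\<tau> u), T_of \<psi> (\<tau> u), S_of \<psi> (\<tau> u))"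
proof -
  let ?J = "jac \<tau> u"
  let ?R = "coeff_form (gauss_coeff (G_of \<phi> u) (T_of \<phi> u) (S_of \<phi> u))"
    and ?R' = "coeff_form (gauss_coeff (G_of \<psi> (\<tau> u)) (T_of \<psi> (\<tau> u)) (S_of \<psi> (\<tau> u)))"
  define e where "e = orthonormal_basis (G_of \<phi> u)"
  have e: "metric_inner (G_of \<phi> u) (e i) (e j) = (if i = j then 1 else 0)" for i j
    unfolding e_def by (rule orthonormal_basis_works[OF pd])
  have e': "metric_inner (G_of \<psi> (\<tau> u)) (?J *v e i) (?J *v e j) = (if i = j then 1 else 0)" for i j
  proof -
    have "metric_inner (G_of \<phi> u) (e i) (e j) = e i \<bullet> (transpose ?J *v (G_of \<psi> (\<tau> u) *v (?J *v e j)))"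
      unfolding metric_inner_def G_of_transform by (simp only: matrix_vector_mul_assoc matrix_mul_assoc)
    also have "\<dots> = metric_inner (G_of \<psi> (\<tau> u)) (?J *v e i) (?J *v e j)"
      unfolding metric_inner_def by (metis dot_lmul_matrix transpose_matrix_vector transpose_transpose)
    finally show ?thesis using e by simp
  qed
  have R: "?R = (\<lambda>X Z. ?R' (\<lambda>i. ?J *v X i) (\<lambda>i. ?J *v Z i))"
    by (intro ext) (simp only: gauss_form_normal_product[OF U(1) uU phi] gauss_form_normal_product[OF V(1) tuV psi]
        normal_product_invariant[OF J det])
  have "gauss_trace n (G_of \<phi> u, T_of \<phi> u, S_of \<phi> u) = df_trace (2 * n) e (df_power 2 ?R n)"
    by (rule df_trace_gauss[OF e, symmetric])
  also have "\<dots> = df_trace (2 * n) (\<lambda>i. ?J *v e i) (df_power 2 ?R' n)"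
    unfolding df_trace_def R df_power_compose[where L = "\<lambda>v. ?J *v v"] ..
  also have "\<dots> = gauss_trace n (G_of \<psi> (\<tau> u), T_of \<psi> (\<tau> u), S_of \<psi> (\<tau> u))"
    by (rule df_trace_gauss[OF e'])
  finally show ?thesis .
qed

end

end

section \<open>Change of variables on arbitrary finite index types\<close>

text \<open>The change of variables theorem of the library is stated for well-ordered index types; this
  copy of a finite type supplies one.\<close>

datatype 'a wo = Wo (unwo: 'a)

lemma UNIV_wo: "UNIV = range Wo"
  by (metis surjI wo.collapse)

instance wo :: (finite) finite
  by standard (simp add: UNIV_wo)

text \<open>Any injection into \<open>nat\<close> will do; the order of \<open>'a wo\<close> is
  pulled back along it.\<close>

definition wo_rank :: "'a::finite \<Rightarrow> nat" where
  "wo_rank = (SOME f. inj f)"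

lemma inj_wo_rank: "inj (wo_rank :: 'a::finite \<Rightarrow> nat)"
proof -
  have "\<exists>f :: 'a \<Rightarrow> nat. inj f" using finite_imp_inj_to_nat_seg[of "UNIV :: 'a set"] by auto
  then show ?thesis unfolding wo_rank_def by (rule someI_ex)
qed

instantiation wo :: (finite) wellorder
begin

definition "x \<le> y \<longleftrightarrow> wo_rank (unwo x) \<le> wo_rank (unwo y)"
definition "x < y \<longleftrightarrow> wo_rank (unwo x) < wo_rank (unwo y)"

instance
proof
  fix x y z :: "'a wo"
  show "x < y \<longleftrightarrow> x \<le> y \<and> \<not> y \<le> x" by (auto simp: less_wo_def less_eq_wo_def)
  show "x \<le> x" by (simp add: less_eq_wo_def)
  show "x \<le> y \<Longrightarrow> y \<le> z \<Longrightarrow> x \<le> z" by (simp add: less_eq_wo_def)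
  show "x \<le> y \<Longrightarrow> y \<le> x \<Longrightarrow> x = y"
    using inj_wo_rank by (auto simp: less_eq_wo_def wo.expand dest!: injD)
  show "x \<le> y \<or> y \<le> x" by (auto simp: less_eq_wo_def)
next
  fix P :: "'a wo \<Rightarrow> bool" and a :: "'a wo"
  assume step: "\<And>x. (\<And>y. y < x \<Longrightarrow> P y) \<Longrightarrow> P x"
  show "P a"
    by (induction a rule: measure_induct_rule[where f = "\<lambda>x. wo_rank (unwo x)"])
      (auto intro: step simp: less_wo_def)
qed

end

section \<open>Lebesgue measure and determinants under relabelling of coordinates\<close>

definition relabel :: "real^'m::finite \<Rightarrow> real^'m wo" where
  "relabel v = (\<chi> i. v $ unwo i)"

definition unlabel :: "real^'m wo \<Rightarrow> real^'m::finite" where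
  "unlabel v = (\<chi> i. v $ Wo i)"

lemma relabel_unlabel[simp]: "relabel (unlabel v) = v" "unlabel (relabel w) = w"
  by (simp_all add: relabel_def unlabel_def vec_eq_iff)

lemma linear_relabel: "linear relabel" "linear unlabel"
  by (auto intro!: linearI simp: relabel_def unlabel_def vec_eq_iff)

lemma bounded_linear_relabel: "bounded_linear relabel" "bounded_linear unlabel"
  using linear_relabel by (auto simp: linear_conv_bounded_linear)

lemma measurable_relabel[measurable]: "relabel \<in> borel_measurable borel" "unlabel \<in> borel_measurable borel"
  by (auto intro!: borel_measurable_continuous_onI linear_continuous_on bounded_linear_relabel)

lemma bij_Wo: "bij Wo"
  by (metis bijI injI surjI wo.collapse wo.inject)

lemma prod_Basis_vec:
  fixes w :: "real^'n::finite"
  shows "(\<Prod>b\<in>Basis. w \<bullet> b) = (\<Prod>i\<in>UNIV. w $ i)"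
proof -
  have inj: "inj (\<lambda>i. axis i (1::real) :: real^'n)" by (auto simp: inj_on_def axis_eq_axis)
  have "(Basis :: (real^'n) set) = range (\<lambda>i. axis i 1)" by (auto simp: Basis_vec_def)
  then have "(\<Prod>b\<in>Basis. w \<bullet> b) = (\<Prod>b\<in>range (\<lambda>i. axis i 1). w \<bullet> b)" by (rule arg_cong)
  also have "\<dots> = (\<Prod>i\<in>UNIV. w \<bullet> axis i 1)" using prod.reindex[OF inj, of "\<lambda>b. w \<bullet> b"] by (simp add: comp_def)
  finally show ?thesis by (simp add: inner_axis)
qed

lemma bij_unwo: "bij unwo"
  by (metis bijI injI surjI wo.sel wo.expand)

text \<open>Lebesgue measure is determined by boxes, and the preimage of a box under
  \<open>relabel\<close> is the box with the same sides.\<close>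

lemma lborel_relabel: "lborel = distr lborel borel (relabel :: real^'m::finite \<Rightarrow> _)"
proof (rule lborel_eqI)
  fix l u :: "real^'m wo"
  assume le: "\<And>b. b \<in> Basis \<Longrightarrow> l \<bullet> b \<le> u \<bullet> b"
  have le': "unlabel l \<bullet> b \<le> unlabel u \<bullet> b" if b: "b \<in> Basis" for b :: "real^'m"
  proof -
    obtain i where i: "b = axis i 1" using b by (auto simp: Basis_vec_def)
    have "axis (Wo i) 1 \<in> (Basis :: (real^'m wo) set)" by (auto simp: Basis_vec_def)
    from le[OF this] show ?thesis by (simp add: i inner_axis unlabel_def)
  qed
  have pre: "relabel -` box l u = box (unlabel l) (unlabel u)"
  proof -
    have "(\<forall>i. l $ i < v $ unwo i \<and> v $ unwo i < u $ i) \<longleftrightarrow> (\<forall>i. l $ Wo i < v $ i \<and> v $ i < u $ Wo i)" for v :: "real^'m"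
      by (metis wo.collapse wo.sel)
    then show ?thesis by (auto simp: set_eq_iff mem_box_cart relabel_def unlabel_def)
  qed
  have "emeasure (distr lborel borel (relabel :: real^'m \<Rightarrow> _)) (box l u) = emeasure lborel (box (unlabel l) (unlabel u))"
    by (subst emeasure_distr) (auto simp: pre)
  also have "\<dots> = ennreal (\<Prod>i\<in>UNIV. (unlabel u - unlabel l) $ i)"
    by (simp only: emeasure_lborel_box[OF le'] prod_Basis_vec)
  also have "(\<Prod>i\<in>UNIV. (unlabel u - unlabel l) $ i) = (\<Prod>i\<in>UNIV. (u - l) $ i)"
    using prod.reindex_bij_betw[OF bij_Wo, of "\<lambda>i. (u - l) $ i"] by (simp add: unlabel_def)
  finally show "emeasure (distr lborel borel (relabel :: real^'m \<Rightarrow> _)) (box l u) = ennreal (\<Prod>b\<in>Basis. (u - l) \<bullet> b)"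
    by (simp only: prod_Basis_vec)
qed simp

text \<open>Conjugation by a bijection turns each transposition into a transposition, so the parity
  of a factorisation is preserved.\<close>

lemma sign_conj:
  fixes f :: "'a \<Rightarrow> 'b" and p :: "'a \<Rightarrow> 'a"
  assumes f: "bij f" and p: "permutation p"
  shows "sign (f \<circ> p \<circ> inv f) = sign p"
proof -
  have "swapidseq n p \<Longrightarrow> swapidseq n (f \<circ> p \<circ> inv f)" for n
  proof (induction rule: swapidseq.induct)
    case id
    have "f \<circ> id \<circ> inv f = id" using f by (auto simp: fun_eq_iff bij_is_surj surj_f_inv_f)
    then show ?case by (simp only: swapidseq.id)
  next
    case (comp_Suc n p a b)
    have "f \<circ> (Transposition.transpose a b \<circ> p) \<circ> inv f = Transposition.transpose (f a) (f b) \<circ> (f \<circ> p \<circ> inv f)"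
      using f by (auto simp: fun_eq_iff Transposition.transpose_def bij_is_inj inj_eq)
    moreover have "f a \<noteq> f b" using comp_Suc f by (simp add: bij_is_inj inj_eq)
    ultimately show ?case using swapidseq.comp_Suc[OF comp_Suc.IH] by metis
  qed
  moreover obtain n where n: "swapidseq n p" using p by (auto simp: permutation_def)
  ultimately have "evenperm (f \<circ> p \<circ> inv f) = even n" "evenperm p = even n"
    using evenperm_unique by blast+
  then show ?thesis by (simp add: sign_def)
qed

lemma det_relabel:
  fixes A :: "real^'m^'m::finite"
  shows "det (\<chi> i j. A $ unwo i $ unwo j) = det A"
proof -
  let ?c = "\<lambda>p. Wo \<circ> p \<circ> inv Wo"
  have iW: "inv Wo = unwo" by (rule inv_equality) auto
  have bij: "bij_betw ?c {p. p permutes (UNIV :: 'm set)} {p. p permutes (UNIV :: 'm wo set)}"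
  proof (rule bij_betwI[where g = "\<lambda>p. unwo \<circ> p \<circ> Wo"])
    show "?c \<in> {p. p permutes UNIV} \<rightarrow> {p. p permutes UNIV}"
      unfolding iW by (auto intro!: bij_imp_permutes bij_comp bij_Wo bij_unwo dest!: permutes_bij)
    show "(\<lambda>p. unwo \<circ> p \<circ> Wo) \<in> {p. p permutes UNIV} \<rightarrow> {p. p permutes UNIV}"
      by (auto intro!: bij_imp_permutes bij_comp bij_Wo bij_unwo dest!: permutes_bij)
  qed (auto simp: iW fun_eq_iff)
  have "det (\<chi> i j. A $ unwo i $ unwo j) = (\<Sum>p\<in>{p. p permutes (UNIV :: 'm set)}. of_int (sign (?c p)) *
      (\<Prod>i\<in>UNIV. (\<chi> i j. A $ unwo i $ unwo j) $ i $ ?c p i))"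
    unfolding det_def by (rule sum.reindex_bij_betw[OF bij, symmetric])
  also have "\<dots> = (\<Sum>p\<in>{p. p permutes (UNIV :: 'm set)}. of_int (sign p) * (\<Prod>i\<in>UNIV. A $ i $ p i))"
  proof (rule sum.cong[OF refl])
    fix p :: "'m \<Rightarrow> 'm" assume "p \<in> {p. p permutes UNIV}"
    then have "permutation p" using finite_class.finite_UNIV permutation_permutes by blast
    then have "sign (?c p) = sign p" by (rule sign_conj[OF bij_Wo])
    moreover have "(\<Prod>i\<in>UNIV. A $ unwo i $ unwo (?c p i)) = (\<Prod>i\<in>UNIV. A $ unwo (Wo i) $ unwo (?c p (Wo i)))"
      by (rule prod.reindex_bij_betw[OF bij_Wo, symmetric])
    ultimately show "of_int (sign (?c p)) * (\<Prod>i\<in>UNIV. (\<chi> i j. A $ unwo i $ unwo j) $ i $ ?c p i)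
       = of_int (sign p) * (\<Prod>i\<in>UNIV. A $ i $ p i)" by (simp add: iW)
  qed
  finally show ?thesis by (simp add: det_def)
qed

text \<open>An inequality, since \<open>g\<close> may fail to be injective. Used in both directions
  between two charts, it yields the equality that is wanted.\<close>

lemma nn_integral_image_le_wo:
  fixes f :: "real^'n::{finite,wellorder} \<Rightarrow> real"
  assumes S: "S \<in> sets borel"
    and D: "\<And>x. x \<in> S \<Longrightarrow> (g has_derivative (*v) (J x)) (at x)"
    and f0: "\<And>x. 0 \<le> f x"
    and meas: "(\<lambda>x. \<bar>det (J x)\<bar> * f (g x)) \<in> borel_measurable (restrict_space borel S)"
  shows "(\<integral>\<^sup>+ y \<in> g ` S. ennreal (f y) \<partial>lborel) \<le> (\<integral>\<^sup>+ x \<in> S. ennreal (\<bar>det (J x)\<bar> * f (g x)) \<partial>lborel)"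
proof (cases "(\<integral>\<^sup>+ x \<in> S. ennreal (\<bar>det (J x)\<bar> * f (g x)) \<partial>lborel) = \<infinity>")
  \<comment> \<open>Only a finite right-hand side has to be treated; finiteness supplies the
    integrability of \<open>?h\<close> on \<open>S\<close>.\<close>
  case False
  let ?h = "\<lambda>x. \<bar>det (J x)\<bar> * f (g x)"
  have m: "(\<lambda>x. indicator S x *\<^sub>R ?h x) \<in> borel_measurable borel"
    using meas S by (subst (asm) borel_measurable_restrict_space_iff) auto
  have "(\<integral>\<^sup>+ x \<in> S. ennreal (?h x) \<partial>lborel) = (\<integral>\<^sup>+ x. ennreal (indicator S x *\<^sub>R ?h x) \<partial>lborel)"
    by (rule nn_integral_cong) (simp add: indicator_def)
  with False have fin: "(\<integral>\<^sup>+ x. ennreal (indicator S x *\<^sub>R ?h x) \<partial>lborel) < \<infinity>" by (simp add: top.not_eq_extremum)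
  have nn: "0 \<le> indicator S x *\<^sub>R ?h x" for x using f0 by simp
  have int: "integrable lborel (\<lambda>x. indicator S x *\<^sub>R ?h x)"
    using m fin nn by (intro integrableI_nonneg) auto
  then have int2: "set_integrable lebesgue S ?h"
    unfolding set_integrable_def using integrable_completion[of "\<lambda>x. indicator S x *\<^sub>R ?h x" lborel] m by simp
  have hS: "?h integrable_on S" and hI: "(LINT x:S|lebesgue. ?h x) = integral S ?h"
    using set_lebesgue_integral_eq_integral[OF int2] by auto
  have mat: "matrix ((*v) (J x)) = J x" for x by (rule matrix_of_matrix_vector_mul)
  have ub: "f integrable_on (g ` S)" "integral (g ` S) f \<le> integral S ?h"
    using integral_on_image_ubound_nonneg[of S f g "\<lambda>x. (*v) (J x)"] f0 D hS
    by (auto simp: mat intro: has_derivative_at_withinI)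
  have "(\<integral>\<^sup>+ y \<in> g ` S. ennreal (f y) \<partial>lborel) = ennreal (integral (g ` S) f)"
    by (rule nn_integral_has_integral_lebesgue'[OF _ integrable_integral[OF ub(1)]]) (rule f0)
  also have "\<dots> \<le> ennreal (integral S ?h)" by (rule ennreal_leI[OF ub(2)])
  also have "\<dots> = (\<integral>\<^sup>+ x \<in> S. ennreal (?h x) \<partial>lborel)"
    by (rule nn_integral_has_integral_lebesgue'[OF _ integrable_integral[OF hS], symmetric]) (use f0 in simp)
  finally show ?thesis .
qed simp

lemma nn_integral_image_le:
  fixes f :: "real^'m::finite \<Rightarrow> real"
  assumes S: "S \<in> sets borel"
    and D: "\<And>x. x \<in> S \<Longrightarrow> (g has_derivative (*v) (J x)) (at x)"
    and f0: "\<And>x. 0 \<le> f x"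
    and meas: "(\<lambda>x. \<bar>det (J x)\<bar> * f (g x)) \<in> borel_measurable (restrict_space borel S)"
    and gS: "g ` S \<in> sets borel" and measf: "f \<in> borel_measurable (restrict_space borel (g ` S))"
  shows "(\<integral>\<^sup>+ y \<in> g ` S. ennreal (f y) \<partial>lborel) \<le> (\<integral>\<^sup>+ x \<in> S. ennreal (\<bar>det (J x)\<bar> * f (g x)) \<partial>lborel)"
proof -
  let ?S = "unlabel -` S" and ?g = "\<lambda>v. relabel (g (unlabel v))" and ?f = "\<lambda>v. f (unlabel v)"
    and ?J = "\<lambda>v. \<chi> i j. J (unlabel v) $ unwo i $ unwo j"
  have im: "?g ` ?S = unlabel -` (g ` S)"
  proof (intro equalityI subsetI)
    fix y assume "y \<in> unlabel -` (g ` S)"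
    then obtain x where x: "x \<in> S" "unlabel y = g x" by auto
    then have "y = ?g (relabel x)" by (metis relabel_unlabel)
    then show "y \<in> ?g ` ?S" by (rule image_eqI) (use x in simp)
  qed auto
  have tr: "(\<integral>\<^sup>+ y \<in> unlabel -` E. h (unlabel y) \<partial>lborel) = (\<integral>\<^sup>+ y \<in> E. h y \<partial>lborel)"
    if "E \<in> sets borel" "h \<in> borel_measurable (restrict_space borel E)"
    for E :: "(real^'m) set" and h :: "real^'m \<Rightarrow> ennreal"
  proof -
    have m: "(\<lambda>y. h y * indicator E y) \<in> borel_measurable borel"
      using that by (subst (asm) borel_measurable_restrict_space_iff_ennreal) auto
    have "(\<integral>\<^sup>+ y. h (unlabel y) * indicator (unlabel -` E) y \<partial>lborel)
       = (\<integral>\<^sup>+ y. (h (unlabel y) * indicator E (unlabel y)) \<partial>distr lborel borel (relabel :: real^'m \<Rightarrow> _))"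
      by (subst lborel_relabel[symmetric]) (simp add: indicator_def)
    also have "\<dots> = (\<integral>\<^sup>+ y. h y * indicator E y \<partial>lborel)"
      using m by (subst nn_integral_distr) auto
    finally show ?thesis .
  qed
  have D': "(?g has_derivative (*v) (?J x)) (at x)" if "x \<in> ?S" for x
  proof -
    have "(?g has_derivative (\<lambda>h. relabel (J (unlabel x) *v unlabel h))) (at x)"
      by (rule has_derivative_compose[OF has_derivative_compose[OF
            bounded_linear_imp_has_derivative[OF bounded_linear_relabel(2)] D]
            bounded_linear_imp_has_derivative[OF bounded_linear_relabel(1)]]) (use that in auto)
    moreover have "relabel (J (unlabel x) *v unlabel h) = ?J x *v h" for h
    proof -
      have "(\<Sum>j\<in>UNIV. J (unlabel x) $ unwo i $ j * h $ Wo j) = (\<Sum>j\<in>UNIV. J (unlabel x) $ unwo i $ unwo j * h $ j)" for i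
        using sum.reindex_bij_betw[OF bij_Wo, of "\<lambda>j. J (unlabel x) $ unwo i $ unwo j * h $ j"] by simp
      then show ?thesis by (simp add: relabel_def unlabel_def matrix_vector_mult_def vec_eq_iff)
    qed
    ultimately show ?thesis by simp
  qed
  have SB: "?S \<in> sets borel" using measurable_sets[OF measurable_relabel(2) S] by simp
  have "(\<integral>\<^sup>+ y \<in> ?g ` ?S. ennreal (?f y) \<partial>lborel) \<le> (\<integral>\<^sup>+ x \<in> ?S. ennreal (\<bar>det (?J x)\<bar> * ?f (?g x)) \<partial>lborel)"
  proof (rule nn_integral_image_le_wo[OF SB D'])
    have "(\<lambda>x. \<bar>det (J (unlabel x))\<bar> * f (g (unlabel x))) \<in> borel_measurable (restrict_space borel ?S)"
      using measurable_compose[OF measurable_restrict_space3[OF measurable_relabel(2), of ?S S] meas] by auto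
    then show "(\<lambda>x. \<bar>det (?J x)\<bar> * ?f (?g x)) \<in> borel_measurable (restrict_space borel ?S)"
      by (simp add: det_relabel)
  qed (use f0 in auto)
  moreover have "(\<integral>\<^sup>+ y \<in> unlabel -` (g ` S). ennreal (f (unlabel y)) \<partial>lborel) = (\<integral>\<^sup>+ y \<in> g ` S. ennreal (f y) \<partial>lborel)"
    by (rule tr[OF gS]) (use measf in measurable)
  moreover have "(\<integral>\<^sup>+ x \<in> ?S. ennreal (\<bar>det (J (unlabel x))\<bar> * f (g (unlabel x))) \<partial>lborel)
     = (\<integral>\<^sup>+ x \<in> S. ennreal (\<bar>det (J x)\<bar> * f (g x)) \<partial>lborel)"
    by (rule tr[OF S]) (use meas in measurable)
  ultimately show ?thesis unfolding im by (simp only: det_relabel relabel_unlabel)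
qed

section \<open>Volume measures\<close>

context
  fixes X :: "'a topology" and c :: "('a, 'm::finite) chart"
  assumes c: "chart_of X c"
begin

lemma chart_openin: "openin X (fst c)" and chart_open_range: "open (snd c ` fst c)"
  using c by (auto simp: chart_of_def)

lemma chart_subset: "fst c \<subseteq> topspace X"
  by (rule openin_subset[OF chart_openin])

lemma chart_homeo: "homeomorphic_map (subtopology X (fst c)) (top_of_set (snd c ` fst c)) (snd c)"
  using c by (simp add: chart_of_def)

lemma chart_topspace: "topspace (subtopology X (fst c)) = fst c"
  using chart_subset by auto

lemma chart_inj: "inj_on (snd c) (fst c)"
  using homeomorphic_imp_injective_map[OF chart_homeo] unfolding chart_topspace .

lemma param_chart: "x \<in> fst c \<Longrightarrow> param c (snd c x) = x"
  unfolding param_def by (rule inv_into_f_f[OF chart_inj])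

lemma chart_param: "u \<in> snd c ` fst c \<Longrightarrow> snd c (param c u) = u"
  unfolding param_def by (rule f_inv_into_f)

lemma param_in: "u \<in> snd c ` fst c \<Longrightarrow> param c u \<in> fst c"
  unfolding param_def by (rule inv_into_into)

lemma chart_open_image:
  assumes "openin X V" shows "open (snd c ` (V \<inter> fst c))"
proof -
  have "openin (subtopology X (fst c)) (V \<inter> fst c)"
    using assms by (auto simp: openin_subtopology)
  then have "openin (top_of_set (snd c ` fst c)) (snd c ` (V \<inter> fst c))"
    using homeomorphic_imp_open_map[OF chart_homeo] by (auto simp: open_map_def)
  then show ?thesis using chart_open_range openin_open_eq by blast
qed

lemma chart_preimage_openin:
  assumes "open W" shows "openin X {x \<in> fst c. snd c x \<in> W}"
proof -
  have "openin (top_of_set (snd c ` fst c)) (snd c ` fst c \<inter> W)" using assms by (auto simp: openin_open)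
  then have "openin (subtopology X (fst c)) {x \<in> topspace (subtopology X (fst c)). snd c x \<in> snd c ` fst c \<inter> W}"
    using homeomorphic_imp_continuous_map[OF chart_homeo] by (auto simp: continuous_map_def)
  then have "openin (subtopology X (fst c)) {x \<in> fst c. snd c x \<in> W}"
    unfolding chart_topspace by (rule back_subst[where P = "openin (subtopology X (fst c))"]) auto
  then show ?thesis using chart_openin openin_open_subtopology by blast
qed

end

context
  fixes X :: "'a topology" and c c' :: "('a, 'm::finite) chart"
  assumes c: "chart_of X c" and c': "chart_of X c'"
begin

lemma transition_chart: "x \<in> fst c \<Longrightarrow> transition c c' (snd c x) = snd c' x"
  by (simp add: transition_def param_chart[OF c])

lemma param_transition: "u \<in> snd c ` (fst c \<inter> fst c') \<Longrightarrow> param c' (transition c c' u) = param c u"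
  using param_chart[OF c] param_chart[OF c'] by (auto simp: transition_def)

lemma transition_in: "u \<in> snd c ` (fst c \<inter> fst c') \<Longrightarrow> transition c c' u \<in> snd c' ` (fst c' \<inter> fst c)"
  using transition_chart by auto

lemma transition_domain_open: "open (snd c ` (fst c \<inter> fst c'))"
  using chart_open_image[OF c chart_openin[OF c']] by (simp add: Int_commute)

end

lemma transition_transition:
  assumes "chart_of X c" "chart_of X c'" "u \<in> snd c ` (fst c \<inter> fst c')"
  shows "transition c' c (transition c c' u) = u"
  using assms param_chart[OF assms(1)] param_chart[OF assms(2)] by (auto simp: transition_def)

lemma disjoint_family_image:
  assumes "inj_on f D" "disjoint_family_on F I" "\<And>i. i \<in> I \<Longrightarrow> F i \<subseteq> D"
  shows "disjoint_family_on (\<lambda>i. f ` F i) I"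
  unfolding disjoint_family_on_def
proof (intro ballI impI)
  fix i j assume "i \<in> I" "j \<in> I" "i \<noteq> j"
  then have "f ` F i \<inter> f ` F j = f ` (F i \<inter> F j)"
    using assms(3) by (intro inj_on_image_Int[OF assms(1), symmetric]) auto
  also have "F i \<inter> F j = {}" using assms(2) \<open>i \<in> I\<close> \<open>j \<in> I\<close> \<open>i \<noteq> j\<close> by (auto simp: disjoint_family_on_def)
  finally show "f ` F i \<inter> f ` F j = {}" by simp
qed

text \<open>Finitely many open sets \<open>V i\<close>, each inside a chart of the possibly infinite
  atlas \<open>A\<close>, cover the space. They serve to construct the volume measure and to
  integrate against it; compatibility with all other charts of \<open>A\<close> is proved from the
  transformation law of the metric.\<close>

locale volume_atlas =
  fixes X :: "'a topology" and A :: "('a, 'm::finite) chart set" and g :: "('a, 'm) metric_tensor"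
    and N :: nat and C :: "nat \<Rightarrow> ('a, 'm) chart" and V :: "nat \<Rightarrow> 'a set"
  assumes charts: "\<And>c. c \<in> A \<Longrightarrow> chart_of X c"
    and trans_diff: "\<And>c c' u. c \<in> A \<Longrightarrow> c' \<in> A \<Longrightarrow> u \<in> snd c ` (fst c \<inter> fst c') \<Longrightarrow>
          transition c c' differentiable (at u)"
    and metric_trans: "\<And>c c' u. c \<in> A \<Longrightarrow> c' \<in> A \<Longrightarrow> u \<in> snd c ` (fst c \<inter> fst c') \<Longrightarrow>
          metric_coeff A g c u = transpose (jac (transition c c') u) **
            metric_coeff A g c' (transition c c' u) ** jac (transition c c') u"
    and det_cont: "\<And>c. c \<in> A \<Longrightarrow> continuous_on (snd c ` fst c) (\<lambda>u. det (metric_coeff A g c u))"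
    and det_nonneg: "\<And>c u. c \<in> A \<Longrightarrow> u \<in> snd c ` fst c \<Longrightarrow> 0 \<le> det (metric_coeff A g c u)"
    and C: "\<And>i. i < N \<Longrightarrow> C i \<in> A"
    and V: "\<And>i. i < N \<Longrightarrow> openin X (V i)" "\<And>i. i < N \<Longrightarrow> V i \<subseteq> fst (C i)"
    and cover: "(\<Union>i<N. V i) = topspace X"
begin

text \<open>Removing the earlier sets makes the cover disjoint, so that integrals over pieces add up
  without a partition of unity.\<close>

definition piece :: "nat \<Rightarrow> 'a set" where
  "piece i = V i - (\<Union>j<i. V j)"

definition borels :: "'a set set" where
  "borels = sigma_sets (topspace X) {U. openin X U}"

text \<open>Extended by 0 beyond the coordinate domain, the density is Borel on the whole of
  \<open>real^'m\<close>.\<close>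

definition dens :: "('a, 'm) chart \<Rightarrow> real^'m \<Rightarrow> real" where
  "dens c u = (if u \<in> snd c ` fst c then sqrt (det (metric_coeff A g c u)) else 0)"

lemma borels_sa: "sigma_algebra (topspace X) borels"
  unfolding borels_def by (rule sigma_algebra_sigma_sets) (auto dest: openin_subset)

lemma openin_borels: "openin X U \<Longrightarrow> U \<in> borels"
  unfolding borels_def by (auto intro: sigma_sets.Basic)

lemma borels_subset: "B \<in> borels \<Longrightarrow> B \<subseteq> topspace X"
  using sigma_algebra.sigma_sets_subset sigma_sets_into_sp unfolding borels_def
  by (metis (no_types, lifting) Pow_iff mem_Collect_eq openin_subset subsetI sigma_sets_into_sp)

lemma borels_Int: "B \<in> borels \<Longrightarrow> B' \<in> borels \<Longrightarrow> B \<inter> B' \<in> borels"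
  and borels_Diff: "B \<in> borels \<Longrightarrow> B' \<in> borels \<Longrightarrow> B - B' \<in> borels"
proof -
  interpret sigma_algebra "topspace X" borels by (rule borels_sa)
  show "B \<in> borels \<Longrightarrow> B' \<in> borels \<Longrightarrow> B \<inter> B' \<in> borels"
    "B \<in> borels \<Longrightarrow> B' \<in> borels \<Longrightarrow> B - B' \<in> borels" by auto
qed

lemma borels_finite_UN: "finite I \<Longrightarrow> (\<And>i. i \<in> I \<Longrightarrow> F i \<in> borels) \<Longrightarrow> (\<Union>i\<in>I. F i) \<in> borels"
proof -
  interpret sigma_algebra "topspace X" borels by (rule borels_sa)
  show "finite I \<Longrightarrow> (\<And>i. i \<in> I \<Longrightarrow> F i \<in> borels) \<Longrightarrow> (\<Union>i\<in>I. F i) \<in> borels" by (rule finite_UN)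
qed

lemma piece_borels: "i < N \<Longrightarrow> piece i \<in> borels"
  unfolding piece_def by (intro borels_Diff openin_borels V borels_finite_UN) auto

lemma piece_subset: "i < N \<Longrightarrow> piece i \<subseteq> fst (C i)"
  using V by (auto simp: piece_def)

lemma disjoint_piece: "disjoint_family_on piece {..<N}"
proof -
  have "piece i \<inter> piece j = {}" if "i < j" for i j using that by (auto simp: piece_def)
  then show ?thesis unfolding disjoint_family_on_def by (metis Int_commute linorder_neqE_nat)
qed

lemma UN_piece: "(\<Union>i<N. piece i) = topspace X"
proof
  show "topspace X \<subseteq> (\<Union>i<N. piece i)"
  proof
    fix x assume "x \<in> topspace X"
    then have ex: "\<exists>i. i < N \<and> x \<in> V i" using cover by auto
    define i where "i = (LEAST i. i < N \<and> x \<in> V i)"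
    have i: "i < N" "x \<in> V i" using LeastI_ex[OF ex] by (auto simp: i_def)
    have "x \<notin> V j" if "j < i" for j
      using not_less_Least[OF that[unfolded i_def]] that i by auto
    then show "x \<in> (\<Union>i<N. piece i)" using i by (auto simp: piece_def)
  qed
qed (auto simp: cover[symmetric] piece_def)

lemma image_borel:
  assumes c: "c \<in> A" and B: "B \<in> borels"
  shows "snd c ` (B \<inter> fst c) \<in> sets borel"
  using B unfolding borels_def
proof induction
  case (Basic a)
  then show ?case using chart_open_image[OF charts[OF c]] by auto
next
  case (Compl a)
  have "snd c ` ((topspace X - a) \<inter> fst c) = snd c ` fst c - snd c ` (a \<inter> fst c)"
    using chart_inj[OF charts[OF c]] chart_subset[OF charts[OF c]] by (auto simp: inj_on_def)
  then show ?case using Compl chart_open_range[OF charts[OF c]] by auto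
next
  case (Union a)
  have "snd c ` ((\<Union>i. a i) \<inter> fst c) = (\<Union>i. snd c ` (a i \<inter> fst c))" by auto
  then show ?case using Union by auto
qed simp

lemma image_borel': "c \<in> A \<Longrightarrow> B \<in> borels \<Longrightarrow> B \<subseteq> fst c \<Longrightarrow> snd c ` B \<in> sets borel"
  using image_borel[of c B] by (simp add: Int_absorb2)

lemma dens_measurable[measurable]: "c \<in> A \<Longrightarrow> dens c \<in> borel_measurable borel"
  unfolding dens_def[abs_def]
  by (rule borel_measurable_continuous_on_if)
    (auto intro!: continuous_intros det_cont borel_open chart_open_range[OF charts])

lemma dens_nonneg: "c \<in> A \<Longrightarrow> 0 \<le> dens c u"
  by (auto simp: dens_def intro: det_nonneg)

lemma dens_transition:
  assumes c: "c \<in> A" "c' \<in> A" and u: "u \<in> snd c ` (fst c \<inter> fst c')"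
  shows "dens c u = \<bar>det (jac (transition c c') u)\<bar> * dens c' (transition c c' u)"
proof -
  have u': "transition c c' u \<in> snd c' ` fst c'" "u \<in> snd c ` fst c"
    using transition_in[OF charts[OF c(1)] charts[OF c(2)] u] u by auto
  have "det (metric_coeff A g c u) = (det (jac (transition c c') u))\<^sup>2 * det (metric_coeff A g c' (transition c c' u))"
    unfolding metric_trans[OF c u] by (simp add: det_mul power2_eq_square)
  then show ?thesis using u' by (simp add: dens_def real_sqrt_mult)
qed

text \<open>The Jacobian determinant of the transition map is exactly the quotient of the two
  densities by \<open>dens_transition\<close>, so the change of variables inequality compares the
  two chart measures. Exchanging the charts gives the reverse inequality.\<close>

lemma chart_measure_le:
  assumes c: "c \<in> A" "c' \<in> A" and B: "B \<in> borels" "B \<subseteq> fst c" "B \<subseteq> fst c'"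
  shows "(\<integral>\<^sup>+ u \<in> snd c' ` B. ennreal (dens c' u) \<partial>lborel) \<le> (\<integral>\<^sup>+ u \<in> snd c ` B. ennreal (dens c u) \<partial>lborel)"
proof -
  let ?S = "snd c ` B" and ?t = "transition c c'"
  have S: "?S \<in> sets borel" by (rule image_borel'[OF c(1) B(1,2)])
  have sub: "u \<in> snd c ` (fst c \<inter> fst c')" if "u \<in> ?S" for u using that B by auto
  have im: "?t ` ?S = snd c' ` B"
    using B transition_chart[OF charts[OF c(1)] charts[OF c(2)]] by (force simp: image_image)
  have d: "dens c u = \<bar>det (jac ?t u)\<bar> * dens c' (?t u)" if "u \<in> ?S" for u
    by (rule dens_transition[OF c sub[OF that]])
  have "(\<integral>\<^sup>+ u \<in> ?t ` ?S. ennreal (dens c' u) \<partial>lborel) \<le> (\<integral>\<^sup>+ u \<in> ?S. ennreal (\<bar>det (jac ?t u)\<bar> * dens c' (?t u)) \<partial>lborel)"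
  proof (rule nn_integral_image_le[OF S])
    show "(?t has_derivative (*v) (jac ?t u)) (at u)" if "u \<in> ?S" for u
      by (rule jac_works(1)[OF trans_diff[OF c sub[OF that]]])
    have "dens c \<in> borel_measurable (restrict_space borel ?S)"
      by (rule measurable_restrict_space1[OF dens_measurable[OF c(1)]])
    then show "(\<lambda>u. \<bar>det (jac ?t u)\<bar> * dens c' (?t u)) \<in> borel_measurable (restrict_space borel ?S)"
      by (rule measurable_cong[THEN iffD1, rotated]) (auto simp: space_restrict_space d)
    show "?t ` ?S \<in> sets borel" unfolding im by (rule image_borel'[OF c(2) B(1,3)])
    show "dens c' \<in> borel_measurable (restrict_space borel (?t ` ?S))"
      by (rule measurable_restrict_space1[OF dens_measurable[OF c(2)]])
  qed (rule dens_nonneg[OF c(2)])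
  also have "\<dots> = (\<integral>\<^sup>+ u \<in> ?S. ennreal (dens c u) \<partial>lborel)"
    by (rule nn_integral_cong) (auto simp: indicator_def d)
  finally show ?thesis unfolding im .
qed

lemma chart_measure_eq:
  assumes "c \<in> A" "c' \<in> A" "B \<in> borels" "B \<subseteq> fst c" "B \<subseteq> fst c'"
  shows "(\<integral>\<^sup>+ u \<in> snd c' ` B. ennreal (dens c' u) \<partial>lborel) = (\<integral>\<^sup>+ u \<in> snd c ` B. ennreal (dens c u) \<partial>lborel)"
  by (rule antisym; rule chart_measure_le) (use assms in auto)

section \<open>Gluing the chart measures\<close>

definition chart_measure :: "('a, 'm) chart \<Rightarrow> (real^'m) measure" where
  "chart_measure c = density lborel (\<lambda>u. ennreal (dens c u))"

lemma emeasure_chart_measure: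
  "c \<in> A \<Longrightarrow> E \<in> sets borel \<Longrightarrow> emeasure (chart_measure c) E = (\<integral>\<^sup>+ u \<in> E. ennreal (dens c u) \<partial>lborel)"
  unfolding chart_measure_def by (subst emeasure_density) auto

definition vol :: "'a measure" where
  "vol = measure_of (topspace X) borels (\<lambda>B. \<Sum>i<N. emeasure (chart_measure (C i)) (snd (C i) ` (B \<inter> piece i)))"

lemma space_vol: "space vol = topspace X" and sets_vol: "sets vol = borels"
proof -
  have "borels \<subseteq> Pow (topspace X)" using borels_subset by auto
  then show "space vol = topspace X" "sets vol = borels"
    unfolding vol_def using sigma_algebra.sigma_sets_eq[OF borels_sa] by (auto simp: space_measure_of sets_measure_of)
qed

lemma image_piece_borel: "i < N \<Longrightarrow> B \<in> borels \<Longrightarrow> snd (C i) ` (B \<inter> piece i) \<in> sets borel"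
  by (rule image_borel'[OF C borels_Int[OF _ piece_borels]]) (use piece_subset in auto)

lemma emeasure_vol:
  assumes "B \<in> borels"
  shows "emeasure vol B = (\<Sum>i<N. emeasure (chart_measure (C i)) (snd (C i) ` (B \<inter> piece i)))"
proof (rule emeasure_measure_of[OF vol_def])
  show "borels \<subseteq> Pow (topspace X)" using borels_subset by auto
  show "B \<in> sets vol" using assms by (simp add: sets_vol)
  show "positive (sets vol) (\<lambda>B. \<Sum>i<N. emeasure (chart_measure (C i)) (snd (C i) ` (B \<inter> piece i)))"
    by (simp add: positive_def)
  show "countably_additive (sets vol) (\<lambda>B. \<Sum>i<N. emeasure (chart_measure (C i)) (snd (C i) ` (B \<inter> piece i)))"
  proof (rule countably_additiveI)
    fix F :: "nat \<Rightarrow> 'a set"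
    assume F: "range F \<subseteq> sets vol" "disjoint_family F"
    have Fb: "F n \<in> borels" for n using F sets_vol by auto
    have "(\<Sum>n. \<Sum>i<N. emeasure (chart_measure (C i)) (snd (C i) ` (F n \<inter> piece i)))
      = (\<Sum>i<N. \<Sum>n. emeasure (chart_measure (C i)) (snd (C i) ` (F n \<inter> piece i)))"
      by (rule suminf_sum) auto
    also have "\<dots> = (\<Sum>i<N. emeasure (chart_measure (C i)) (snd (C i) ` ((\<Union>n. F n) \<inter> piece i)))"
    proof (rule sum.cong[OF refl])
      fix i assume "i \<in> {..<N}"
      then have i: "i < N" by simp
      have "(\<Sum>n. emeasure (chart_measure (C i)) (snd (C i) ` (F n \<inter> piece i)))
         = emeasure (chart_measure (C i)) (\<Union>n. snd (C i) ` (F n \<inter> piece i))"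
      proof (rule suminf_emeasure)
        show "range (\<lambda>n. snd (C i) ` (F n \<inter> piece i)) \<subseteq> sets (chart_measure (C i))"
          using image_piece_borel[OF i Fb] by (auto simp: chart_measure_def)
        show "disjoint_family (\<lambda>n. snd (C i) ` (F n \<inter> piece i))"
        proof (rule disjoint_family_image[OF chart_inj[OF charts[OF C[OF i]]]])
          show "disjoint_family (\<lambda>n. F n \<inter> piece i)" using F(2) unfolding disjoint_family_on_def by blast
        qed (use piece_subset[OF i] in auto)
      qed
      also have "(\<Union>n. snd (C i) ` (F n \<inter> piece i)) = snd (C i) ` ((\<Union>n. F n) \<inter> piece i)" by auto
      finally show "(\<Sum>n. emeasure (chart_measure (C i)) (snd (C i) ` (F n \<inter> piece i)))
         = emeasure (chart_measure (C i)) (snd (C i) ` ((\<Union>n. F n) \<inter> piece i))" .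
    qed
    finally show "(\<Sum>n. \<Sum>i<N. emeasure (chart_measure (C i)) (snd (C i) ` (F n \<inter> piece i)))
      = (\<Sum>i<N. emeasure (chart_measure (C i)) (snd (C i) ` ((\<Union>n. F n) \<inter> piece i)))" .
  qed
qed

text \<open>The description under \<open>THE\<close> in \<open>volume_measure\<close>. It constrains
  only sets inside a single chart: existence therefore needs agreement on overlaps, and uniqueness
  needs the decomposition into pieces.\<close>

definition is_volume :: "'a measure \<Rightarrow> bool" where
  "is_volume \<mu> \<longleftrightarrow> space \<mu> = topspace X \<and> sets \<mu> = borels \<and>
     (\<forall>c\<in>A. \<forall>B\<in>sets \<mu>. B \<subseteq> fst c \<longrightarrow>
        emeasure \<mu> B = (\<integral>\<^sup>+ u \<in> snd c ` B. ennreal (sqrt (det (metric_coeff A g c u))) \<partial>lborel))"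

lemma dens_integral:
  "B \<subseteq> fst c \<Longrightarrow> (\<integral>\<^sup>+ u \<in> snd c ` B. ennreal (sqrt (det (metric_coeff A g c u))) \<partial>lborel)
     = (\<integral>\<^sup>+ u \<in> snd c ` B. ennreal (dens c u) \<partial>lborel)"
  by (rule nn_integral_cong) (auto simp: dens_def indicator_def)

lemma sum_pieces:
  assumes "space \<mu> = topspace X" "sets \<mu> = borels" "B \<in> borels"
  shows "emeasure \<mu> B = (\<Sum>i<N. emeasure \<mu> (B \<inter> piece i))"
proof -
  have "(\<Sum>i<N. emeasure \<mu> (B \<inter> piece i)) = emeasure \<mu> (\<Union>i<N. B \<inter> piece i)"
  proof (rule sum_emeasure)
    show "disjoint_family_on (\<lambda>i. B \<inter> piece i) {..<N}"
      using disjoint_piece unfolding disjoint_family_on_def by blast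
  qed (use assms piece_borels borels_Int in auto)
  also have "(\<Union>i<N. B \<inter> piece i) = B" using UN_piece borels_subset[OF assms(3)] by auto
  finally show ?thesis by simp
qed

lemma is_volume_vol: "is_volume vol"
  unfolding is_volume_def space_vol sets_vol
proof (intro conjI ballI impI refl)
  fix c B assume c: "c \<in> A" and B: "B \<in> borels" "B \<subseteq> fst c"
  have Bi: "B \<inter> piece i \<in> borels" "B \<inter> piece i \<subseteq> fst (C i)" "B \<inter> piece i \<subseteq> fst c" if "i < N" for i
    using borels_Int[OF B(1) piece_borels[OF that]] piece_subset[OF that] B by auto
  have "emeasure vol B = (\<Sum>i<N. emeasure (chart_measure (C i)) (snd (C i) ` (B \<inter> piece i)))"
    by (rule emeasure_vol[OF B(1)])
  also have "\<dots> = (\<Sum>i<N. emeasure (chart_measure c) (snd c ` (B \<inter> piece i)))"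
  proof (rule sum.cong[OF refl])
    fix i assume "i \<in> {..<N}"
    then have i: "i < N" by simp
    show "emeasure (chart_measure (C i)) (snd (C i) ` (B \<inter> piece i)) = emeasure (chart_measure c) (snd c ` (B \<inter> piece i))"
      using Bi[OF i] C[OF i] c
      by (simp add: emeasure_chart_measure image_borel' chart_measure_eq[of c "C i"])
  qed
  also have "\<dots> = emeasure (chart_measure c) (\<Union>i<N. snd c ` (B \<inter> piece i))"
  proof (rule sum_emeasure)
    show "(\<lambda>i. snd c ` (B \<inter> piece i)) ` {..<N} \<subseteq> sets (chart_measure c)"
      using Bi image_borel'[OF c] by (auto simp: chart_measure_def)
    show "disjoint_family_on (\<lambda>i. snd c ` (B \<inter> piece i)) {..<N}"
    proof (rule disjoint_family_image[OF chart_inj[OF charts[OF c]]])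
      show "disjoint_family_on (\<lambda>i. B \<inter> piece i) {..<N}"
        using disjoint_piece unfolding disjoint_family_on_def by blast
    qed (use B(2) in auto)
  qed simp
  also have "(\<Union>i<N. snd c ` (B \<inter> piece i)) = snd c ` (B \<inter> (\<Union>i<N. piece i))" by auto
  also have "\<dots> = snd c ` B" using borels_subset[OF B(1)] by (simp add: UN_piece Int_absorb2)
  also have "emeasure (chart_measure c) (snd c ` B) = (\<integral>\<^sup>+ u \<in> snd c ` B. ennreal (sqrt (det (metric_coeff A g c u))) \<partial>lborel)"
    using emeasure_chart_measure[OF c image_borel'[OF c B]] dens_integral[OF B(2)] by simp
  finally show "emeasure vol B = (\<integral>\<^sup>+ u \<in> snd c ` B. ennreal (sqrt (det (metric_coeff A g c u))) \<partial>lborel)" .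
qed

lemma is_volume_unique: "is_volume \<mu> \<Longrightarrow> is_volume \<nu> \<Longrightarrow> \<mu> = \<nu>"
proof (rule measure_eqI)
  assume mu: "is_volume \<mu>" and nu: "is_volume \<nu>"
  show "sets \<mu> = sets \<nu>" using mu nu by (simp add: is_volume_def)
  fix B assume "B \<in> sets \<mu>"
  then have B: "B \<in> borels" using mu by (simp add: is_volume_def)
  have e: "emeasure \<rho> (B \<inter> piece i) = (\<integral>\<^sup>+ u \<in> snd (C i) ` (B \<inter> piece i).
      ennreal (sqrt (det (metric_coeff A g (C i) u))) \<partial>lborel)" if rho: "is_volume \<rho>" and i: "i < N" for \<rho> i
  proof -
    have "B \<inter> piece i \<in> sets \<rho>" using rho borels_Int[OF B piece_borels[OF i]] by (simp add: is_volume_def)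
    moreover have "B \<inter> piece i \<subseteq> fst (C i)" using piece_subset[OF i] by auto
    ultimately show ?thesis using rho C[OF i] unfolding is_volume_def by blast
  qed
  have "emeasure \<mu> (B \<inter> piece i) = emeasure \<nu> (B \<inter> piece i)" if "i < N" for i
    using e[OF mu that] e[OF nu that] by simp
  then show "emeasure \<mu> B = emeasure \<nu> B"
    using sum_pieces[of \<mu> B] sum_pieces[of \<nu> B] mu nu B by (simp add: is_volume_def)
qed

lemma volume_measure_eq: "volume_measure X A g = vol"
proof -
  have "volume_measure X A g = (THE \<mu>. is_volume \<mu>)"
    unfolding volume_measure_def is_volume_def borels_def ..
  also have "\<dots> = vol" by (rule the_equality) (use is_volume_vol is_volume_unique in auto)
  finally show ?thesis .
qed

section \<open>Integration against the glued measure\<close>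

lemma snd_chart_measurable:
  assumes c: "c \<in> A" and B: "B \<in> borels" "B \<subseteq> fst c"
  shows "snd c \<in> borel_measurable (restrict_space vol B)"
proof (rule borel_measurableI)
  fix S :: "(real^'m) set" assume S: "open S"
  have "{x \<in> fst c. snd c x \<in> S} \<in> borels"
    by (rule openin_borels[OF chart_preimage_openin[OF charts[OF c] S]])
  then have "B \<inter> {x \<in> fst c. snd c x \<in> S} \<in> borels" by (rule borels_Int[OF B(1)])
  moreover have "snd c -` S \<inter> space (restrict_space vol B) = B \<inter> {x \<in> fst c. snd c x \<in> S}"
    using B borels_subset[OF B(1)] by (auto simp: space_restrict_space space_vol)
  ultimately show "snd c -` S \<inter> space (restrict_space vol B) \<in> sets (restrict_space vol B)"
    using B borels_subset[OF B(1)] by (subst sets_restrict_space_iff) (auto simp: space_vol sets_vol Int_absorb2)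
qed

text \<open>Identifies the image of the volume under a chart with the Lebesgue measure weighted by
  \<open>dens\<close>. Image and density rules then turn integrals over a piece into integrals over
  a subset of \<open>real^'m\<close>.\<close>

lemma restrict_vol:
  assumes c: "c \<in> A" and B: "B \<in> borels" "B \<subseteq> fst c"
  defines "D \<equiv> density (restrict_space lborel (snd c ` B)) (\<lambda>u. ennreal (dens c u))"
  shows "distr (restrict_space vol B) (restrict_space borel (snd c ` B)) (snd c) = D"
proof (rule measure_eqI)
  have E: "snd c ` B \<in> sets borel" by (rule image_borel'[OF c B])
  show "sets (distr (restrict_space vol B) (restrict_space borel (snd c ` B)) (snd c)) = sets D"
    unfolding D_def by (simp add: sets_restrict_space)
  fix S assume "S \<in> sets (distr (restrict_space vol B) (restrict_space borel (snd c ` B)) (snd c))"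
  then have S: "S \<subseteq> snd c ` B" "S \<in> sets borel" using E by (auto simp: sets_restrict_space_iff)
  have m: "snd c \<in> restrict_space vol B \<rightarrow>\<^sub>M restrict_space borel (snd c ` B)"
    using snd_chart_measurable[OF c B] borels_subset[OF B(1)]
    by (auto intro!: measurable_restrict_space2 simp: space_restrict_space space_vol)
  let ?P = "snd c -` S \<inter> B"
  have sp: "space (restrict_space vol B) = B" using borels_subset[OF B(1)] by (auto simp: space_restrict_space space_vol)
  have P: "?P \<in> borels"
    using measurable_sets[OF snd_chart_measurable[OF c B] S(2)] B borels_subset[OF B(1)]
    by (simp add: sp sets_restrict_space_iff space_vol sets_vol Int_absorb2)
  have imP: "snd c ` ?P = S" using S by auto
  have "emeasure (distr (restrict_space vol B) (restrict_space borel (snd c ` B)) (snd c)) S = emeasure (restrict_space vol B) ?P"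
    using S E by (subst emeasure_distr[OF m]) (auto simp: sets_restrict_space_iff sp)
  also have "\<dots> = emeasure vol ?P"
    using B borels_subset[OF B(1)] by (intro emeasure_restrict_space) (auto simp: space_vol sets_vol Int_absorb2)
  also have "\<dots> = (\<integral>\<^sup>+ u \<in> S. ennreal (dens c u) \<partial>lborel)"
  proof -
    have Pc: "?P \<subseteq> fst c" using B by auto
    have "?P \<in> sets vol" by (simp only: sets_vol P)
    then have "emeasure vol ?P = (\<integral>\<^sup>+ u \<in> snd c ` ?P. ennreal (sqrt (det (metric_coeff A g c u))) \<partial>lborel)"
      using is_volume_vol c Pc unfolding is_volume_def by blast
    also have "\<dots> = (\<integral>\<^sup>+ u \<in> snd c ` ?P. ennreal (dens c u) \<partial>lborel)" by (rule dens_integral[OF Pc])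
    finally show ?thesis by (simp only: imP)
  qed
  also have "\<dots> = emeasure D S"
  proof -
    have dl: "(\<lambda>u. ennreal (dens c u)) \<in> borel_measurable (restrict_space lborel (snd c ` B))"
      by (rule measurable_restrict_space1) (use dens_measurable[OF c] in measurable)
    have "S \<in> sets (restrict_space lborel (snd c ` B))" using S E by (auto simp: sets_restrict_space_iff)
    from emeasure_density[OF dl this]
    have "emeasure D S = (\<integral>\<^sup>+ u. ennreal (dens c u) * indicator S u * indicator (snd c ` B) u \<partial>lborel)"
      unfolding D_def using E by (simp add: nn_integral_restrict_space)
    also have "\<dots> = (\<integral>\<^sup>+ u \<in> S. ennreal (dens c u) \<partial>lborel)"
      by (rule nn_integral_cong) (use S in \<open>auto simp: indicator_def\<close>)
    finally show ?thesis by simp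
  qed
  finally show "emeasure (distr (restrict_space vol B) (restrict_space borel (snd c ` B)) (snd c)) S = emeasure D S" .
qed

lemma integral_piece:
  fixes h :: "'a \<Rightarrow> real" and r :: "real^'m \<Rightarrow> real"
  assumes c: "c \<in> A" and B: "B \<in> borels" "B \<subseteq> fst c"
    and hr: "\<And>x. x \<in> B \<Longrightarrow> h x = r (snd c x)"
    and r: "r \<in> borel_measurable (restrict_space borel (snd c ` B))"
    and int: "set_integrable lborel (snd c ` B) (\<lambda>u. r u * dens c u)"
  shows "set_integrable vol B h" "(LINT x:B|vol. h x) = (LINT u:snd c ` B|lborel. r u * dens c u)"
proof -
  have E: "snd c ` B \<in> sets borel" by (rule image_borel'[OF c B])
  have BV: "B \<inter> space vol \<in> sets vol" using B borels_subset[OF B(1)] by (simp add: space_vol sets_vol Int_absorb2)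
  have sp: "space (restrict_space vol B) = B" using borels_subset[OF B(1)] by (auto simp: space_restrict_space space_vol)
  have m: "snd c \<in> restrict_space vol B \<rightarrow>\<^sub>M restrict_space borel (snd c ` B)"
    using snd_chart_measurable[OF c B] by (auto intro!: measurable_restrict_space2 simp: sp)
  have rl: "r \<in> borel_measurable (restrict_space lborel (snd c ` B))"
    using r by (simp cong: measurable_cong_sets add: sets_restrict_space)
  have dl: "dens c \<in> borel_measurable (restrict_space lborel (snd c ` B))"
    by (rule measurable_restrict_space1) (simp add: dens_measurable[OF c])
  have i1: "integrable (restrict_space lborel (snd c ` B)) (\<lambda>u. dens c u *\<^sub>R r u)"
    using int E by (subst integrable_restrict_space) (auto simp: set_integrable_def mult.commute)
  have i2: "integrable (density (restrict_space lborel (snd c ` B)) (\<lambda>u. ennreal (dens c u))) r"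
    using i1 by (subst integrable_density[OF rl dl]) (use dens_nonneg[OF c] in auto)
  then have i3: "integrable (restrict_space vol B) (\<lambda>x. r (snd c x))"
    unfolding restrict_vol[OF c B, symmetric] by (subst (asm) integrable_distr_eq[OF m r])
  then have i4: "integrable (restrict_space vol B) h"
    by (rule Bochner_Integration.integrable_cong[THEN iffD1, rotated 2]) (auto simp: sp hr)
  then show "set_integrable vol B h"
    unfolding set_integrable_def using BV by (subst (asm) integrable_restrict_space)
  have "(LINT x:B|vol. h x) = (LINT x|restrict_space vol B. h x)"
    unfolding set_lebesgue_integral_def using BV by (rule integral_restrict_space[symmetric])
  also have "\<dots> = (LINT x|restrict_space vol B. r (snd c x))"
    by (rule Bochner_Integration.integral_cong) (auto simp: sp hr)
  also have "\<dots> = (LINT u|density (restrict_space lborel (snd c ` B)) (\<lambda>u. ennreal (dens c u)). r u)"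
    unfolding restrict_vol[OF c B, symmetric] by (rule integral_distr[OF m r, symmetric])
  also have "\<dots> = (LINT u|restrict_space lborel (snd c ` B). dens c u *\<^sub>R r u)"
    by (rule integral_density[OF rl dl]) (use dens_nonneg[OF c] in auto)
  also have "\<dots> = (LINT u:snd c ` B|lborel. r u * dens c u)"
    unfolding set_lebesgue_integral_def using E by (subst integral_restrict_space) (auto simp: mult.commute)
  finally show "(LINT x:B|vol. h x) = (LINT u:snd c ` B|lborel. r u * dens c u)" .
qed

text \<open>Integrability is demanded on the pieces only: on a whole chart domain neither the
  density nor the function need be integrable.\<close>

theorem integral_volume_measure:
  fixes h :: "'a \<Rightarrow> real"
  assumes hr: "\<And>i x. i < N \<Longrightarrow> x \<in> fst (C i) \<Longrightarrow> h x = r i (snd (C i) x)"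
    and r: "\<And>i. i < N \<Longrightarrow> continuous_on (snd (C i) ` fst (C i)) (r i)"
    and int: "\<And>i. i < N \<Longrightarrow> set_integrable lborel (snd (C i) ` piece i)
        (\<lambda>u. r i u * sqrt (det (metric_coeff A g (C i) u)))"
  shows "(\<integral>x. h x \<partial>volume_measure X A g) = (\<Sum>i<N. LINT u:snd (C i) ` piece i|lborel.
        r i u * sqrt (det (metric_coeff A g (C i) u)))"
proof -
  have p: "set_integrable vol (piece i) h"
    "(LINT x:piece i|vol. h x) = (LINT u:snd (C i) ` piece i|lborel. r i u * sqrt (det (metric_coeff A g (C i) u)))"
    if i: "i < N" for i
  proof -
    have sub: "snd (C i) ` piece i \<subseteq> snd (C i) ` fst (C i)" using piece_subset[OF i] by auto
    have d: "u \<in> snd (C i) ` piece i \<Longrightarrow> dens (C i) u = sqrt (det (metric_coeff A g (C i) u))" for u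
      using sub by (auto simp: dens_def)
    have int': "set_integrable lborel (snd (C i) ` piece i) (\<lambda>u. r i u * dens (C i) u)"
      using int[OF i] by (rule set_integrable_cong[THEN iffD1, rotated 3]) (auto simp: d)
    have rm: "r i \<in> borel_measurable (restrict_space borel (snd (C i) ` piece i))"
      by (rule borel_measurable_continuous_on_restrict[OF continuous_on_subset[OF r[OF i] sub]])
    have hr': "h x = r i (snd (C i) x)" if "x \<in> piece i" for x using hr[OF i] that piece_subset[OF i] by auto
    note q = integral_piece[OF C[OF i] piece_borels[OF i] piece_subset[OF i] hr' rm int']
    show "set_integrable vol (piece i) h" by (rule q(1))
    have "(LINT u:snd (C i) ` piece i|lborel. r i u * dens (C i) u)
       = (LINT u:snd (C i) ` piece i|lborel. r i u * sqrt (det (metric_coeff A g (C i) u)))"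
      by (rule set_lebesgue_integral_cong) (use image_borel'[OF C[OF i] piece_borels[OF i] piece_subset[OF i]] d in auto)
    then show "(LINT x:piece i|vol. h x) = (LINT u:snd (C i) ` piece i|lborel. r i u * sqrt (det (metric_coeff A g (C i) u)))"
      using q(2) by simp
  qed
  have "(\<integral>x. h x \<partial>vol) = (\<integral>x. (\<Sum>i<N. indicator (piece i) x *\<^sub>R h x) \<partial>vol)"
  proof (rule Bochner_Integration.integral_cong[OF refl])
    fix x assume "x \<in> space vol"
    then have x: "x \<in> (\<Union>i<N. piece i)" by (simp add: space_vol UN_piece)
    have "(\<Sum>i<N. indicator (piece i) x :: real) = indicator (\<Union>i<N. piece i) x"
      by (rule indicator_UN_disjoint[symmetric]) (use disjoint_piece in auto)
    also have "\<dots> = 1" using x by (simp add: indicator_def)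
    finally show "h x = (\<Sum>i<N. indicator (piece i) x *\<^sub>R h x)" by (simp add: sum_distrib_right[symmetric])
  qed
  also have "\<dots> = (\<Sum>i<N. LINT x:piece i|vol. h x)"
    unfolding set_lebesgue_integral_def
    by (rule Bochner_Integration.integral_sum) (use p(1) in \<open>auto simp: set_integrable_def\<close>)
  also have "\<dots> = (\<Sum>i<N. LINT u:snd (C i) ` piece i|lborel. r i u * sqrt (det (metric_coeff A g (C i) u)))"
    using p(2) by simp
  finally show ?thesis by (simp add: volume_measure_eq)
qed

end

section \<open>Lipschitz-Killing curvatures in charts\<close>

text \<open>With counting measure on k points and \<open>\<psi> x = x\<close> this is a submanifold of \<open>R\<^sup>k\<close>; with the completed
  probability measure and \<open>\<psi> = f\<close> it is the manifold of the Gaussian process.\<close>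

locale L2_manifold = L2_space M L for M :: "'w measure" and L :: "('w \<Rightarrow> real) set" +
  fixes X :: "'a topology" and A :: "('a, 'm::finite) chart set" and g :: "('a, 'm) metric_tensor"
    and \<psi> :: "'a \<Rightarrow> 'w \<Rightarrow> real"
  assumes charts: "\<And>c. c \<in> A \<Longrightarrow> chart_of X c"
    and covers: "(\<Union>c\<in>A. fst c) = topspace X"
    and trans: "\<And>c c'. c \<in> A \<Longrightarrow> c' \<in> A \<Longrightarrow>
          twice_differentiable_on (transition c c') (snd c ` (fst c \<inter> fst c'))"
    and psi: "\<And>c. c \<in> A \<Longrightarrow> field 3 (snd c ` fst c) (\<lambda>u. \<psi> (param c u))"
    and metric: "\<And>c u. c \<in> A \<Longrightarrow> u \<in> snd c ` fst c \<Longrightarrow>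
          metric_coeff A g c u = G_of (\<lambda>u. \<psi> (param c u)) u"
    and posdef: "\<And>c u. c \<in> A \<Longrightarrow> u \<in> snd c ` fst c \<Longrightarrow> pos_def (G_of (\<lambda>u. \<psi> (param c u)) u)"
begin

definition jet :: "('a, 'm) chart \<Rightarrow> real^'m \<Rightarrow> (real^'m^'m) \<times> (real^'m^'m^'m) \<times> (real^'m^'m^'m^'m)" where
  "jet c u = (G_of (\<lambda>u. \<psi> (param c u)) u, T_of (\<lambda>u. \<psi> (param c u)) u, S_of (\<lambda>u. \<psi> (param c u)) u)"

lemma jet_continuous:
  assumes c: "c \<in> A" shows "continuous_on (snd c ` fst c) (jet c)"
proof -
  have U: "open (snd c ` fst c)" by (rule chart_open_range[OF charts[OF c]])
  have f3: "field (Suc (Suc (Suc 0))) (snd c ` fst c) (\<lambda>u. \<psi> (param c u))"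
    using psi[OF c] by (simp add: numeral_3_eq_3)
  note f2 = field_fpartial[OF U f3]
  note f1 = field_fpartial[OF U f2]
  show ?thesis
    unfolding jet_def[abs_def] G_of_def T_of_def S_of_def
    by (intro continuous_on_Pair continuous_on_vec_lambda ip_continuous_on[OF f2 f2]
        ip_continuous_on[OF f1 f2] ip_continuous_on[OF f1 f1])
qed

lemma fst_jet: "c \<in> A \<Longrightarrow> u \<in> snd c ` fst c \<Longrightarrow> metric_coeff A g c u = fst (jet c u)"
  by (simp add: jet_def metric)

lemma det_jet_pos: "c \<in> A \<Longrightarrow> u \<in> snd c ` fst c \<Longrightarrow> 0 < det (fst (jet c u))"
  using orthonormal_det_pos[OF posdef] by (simp add: jet_def)

text \<open>Here both choices of \<open>curvature_trace\<close> disappear: the curvature form is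
  given by the Gauss equation, and the trace over the chosen orthonormal basis equals
  \<open>gauss_trace\<close>.\<close>

lemma curvature_trace_jet:
  assumes c: "c \<in> A" and u: "u \<in> snd c ` fst c"
  shows "curvature_trace (metric_coeff A g c) n u = gauss_trace n (jet c u)"
proof -
  have U: "open (snd c ` fst c)" by (rule chart_open_range[OF charts[OF c]])
  have R: "riemann_form (metric_coeff A g c) u = coeff_form (gauss_coeff (G_of (\<lambda>u. \<psi> (param c u)) u)
      (T_of (\<lambda>u. \<psi> (param c u)) u) (S_of (\<lambda>u. \<psi> (param c u)) u))"
    by (rule riemann_form_field[OF U u psi[OF c] metric[OF c]])
      (use det_jet_pos[OF c] fst_jet[OF c] in force)+
  show ?thesis
    unfolding curvature_trace_def R metric[OF c u] jet_def
    by (rule df_trace_gauss[OF orthonormal_basis_works[OF posdef[OF c u]]])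
qed

lemma
  assumes c: "c \<in> A" "c' \<in> A" and u: "u \<in> snd c ` (fst c \<inter> fst c')"
  shows gauss_trace_jet_transition: "gauss_trace n (jet c u) = gauss_trace n (jet c' (transition c c' u))"
    and metric_transition: "metric_coeff A g c u = transpose (jac (transition c c') u) **
            metric_coeff A g c' (transition c c' u) ** jac (transition c c') u"
proof -
  let ?t = "transition c c'" and ?t' = "transition c' c" and ?W = "snd c ` (fst c \<inter> fst c')"
  note ch = charts[OF c(1)] charts[OF c(2)]
  have W: "open ?W" by (rule transition_domain_open[OF ch])
  have U: "open (snd c ` fst c)" "?W \<subseteq> snd c ` fst c" using chart_open_range[OF ch(1)] by auto
  have V: "open (snd c' ` fst c')" "?t ` ?W \<subseteq> snd c' ` fst c'"
    using chart_open_range[OF ch(2)] transition_in[OF ch] by auto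
  have eq: "\<psi> (param c v) = \<psi> (param c' (?t v))" if "v \<in> ?W" for v
    using param_transition[OF ch that] by simp
  have tu: "?t u \<in> snd c' ` (fst c' \<inter> fst c)" by (rule transition_in[OF ch u])
  then have tu': "?t u \<in> snd c' ` fst c'" by auto
  have d: "?t differentiable (at u)" "?t' differentiable (at (?t u))"
    using trans[OF c] trans[OF c(2,1)] u tu by (auto simp: twice_differentiable_on_def)
  have "jac ?t' (?t u) ** jac ?t u = mat 1"
    by (rule jac_inverse[OF d W u]) (rule transition_transition[OF ch])
  then have J: "jac ?t u ** jac ?t' (?t u) = mat 1" by (simp add: matrix_left_right_inverse)
  have uU: "u \<in> snd c ` fst c" using u by auto
  have det: "det (G_of (\<lambda>u. \<psi> (param c' u)) (?t u)) \<noteq> 0"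
    using det_jet_pos[OF c(2) tu'] by (simp add: jet_def)
  show "gauss_trace n (jet c u) = gauss_trace n (jet c' (?t u))"
    unfolding jet_def
    by (rule gauss_trace_invariant[OF U psi[OF c(1)] V psi[OF c(2)] W u trans[OF c] _ J posdef[OF c(1) uU] det])
      (rule eq)
  show "metric_coeff A g c u = transpose (jac ?t u) ** metric_coeff A g c' (?t u) ** jac ?t u"
    unfolding metric[OF c(1) uU] metric[OF c(2) tu']
    by (rule G_of_transform[OF U psi[OF c(1)] V psi[OF c(2)] W u trans[OF c]]) (rule eq)
qed

text \<open>Replaces the chart picked by \<open>SOME\<close> by any chart around the point, through
  invariance under transition maps.\<close>

lemma trace_curvature_power_jet:
  assumes c: "c \<in> A" and x: "x \<in> fst c"
  shows "trace_curvature_power A g n x = gauss_trace n (jet c (snd c x))"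
proof -
  define c0 where "c0 = (SOME c. c \<in> charts_at A x)"
  have "c \<in> charts_at A x" using c x by (simp add: charts_at_def)
  then have "c0 \<in> charts_at A x" unfolding c0_def by (rule someI)
  then have c0: "c0 \<in> A" "x \<in> fst c0" by (auto simp: charts_at_def)
  have "trace_curvature_power A g n x = gauss_trace n (jet c0 (snd c0 x))"
    unfolding trace_curvature_power_def Let_def c0_def[symmetric]
    by (rule curvature_trace_jet[OF c0(1)]) (use c0 in auto)
  also have "\<dots> = gauss_trace n (jet c (transition c0 c (snd c0 x)))"
    by (rule gauss_trace_jet_transition[OF c0(1) c]) (use c0 x in auto)
  also have "transition c0 c (snd c0 x) = snd c x"
    by (rule transition_chart[OF charts[OF c0(1)] charts[OF c] c0(2)])
  finally show ?thesis .
qed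

text \<open>From here on the manifold enters only through its jets on subsets \<open>E i\<close> of
  \<open>real^'m\<close>. Two manifolds parametrised over the same sets can then be compared by
  comparing jets.\<close>

theorem LKC_jet:
  fixes N j :: nat and C :: "nat \<Rightarrow> ('a, 'm) chart" and V :: "nat \<Rightarrow> 'a set"
  assumes C: "\<And>i. i < N \<Longrightarrow> C i \<in> A"
    and V: "\<And>i. i < N \<Longrightarrow> openin X (V i)" "\<And>i. i < N \<Longrightarrow> V i \<subseteq> fst (C i)"
    and cover: "(\<Union>i<N. V i) = topspace X"
  defines "E \<equiv> \<lambda>i. snd (C i) ` (V i - (\<Union>j<i. V j))" and "n \<equiv> (CARD('m) - j) div 2"
  assumes int: "\<And>i. i < N \<Longrightarrow> set_integrable lborel (E i)
     (\<lambda>u. gauss_trace n (jet (C i) u) * sqrt (det (fst (jet (C i) u))))"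
  shows "LKC X A g j = (if even (CARD('m) - j) then inverse ((- 2 * pi) ^ n) / fact n *
     (\<Sum>i<N. LINT u:E i|lborel. gauss_trace n (jet (C i) u) * sqrt (det (fst (jet (C i) u)))) else 0)"
proof -
  interpret v: volume_atlas X A g N C V
  proof
    show "transition c c' differentiable (at u)" if "c \<in> A" "c' \<in> A" "u \<in> snd c ` (fst c \<inter> fst c')" for c c' u
      using trans[OF that(1,2)] that(3) by (auto simp: twice_differentiable_on_def)
    show "continuous_on (snd c ` fst c) (\<lambda>u. det (metric_coeff A g c u))" if c: "c \<in> A" for c
    proof -
      have "continuous_on (snd c ` fst c) (\<lambda>u. det (fst (jet c u)))"
        by (intro continuous_on_det continuous_intros jet_continuous[OF c])
      then show ?thesis by (rule continuous_on_eq) (simp add: fst_jet[OF c])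
    qed
    show "0 \<le> det (metric_coeff A g c u)" if "c \<in> A" "u \<in> snd c ` fst c" for c u
      using det_jet_pos[OF that] fst_jet[OF that] by simp
  qed (use charts metric_transition C V cover in auto)
  have Ep: "E i = snd (C i) ` v.piece i" for i by (simp add: E_def v.piece_def)
  have sub: "E i \<subseteq> snd (C i) ` fst (C i)" if "i < N" for i using v.piece_subset[OF that] by (auto simp: Ep)
  have EB: "E i \<in> sets borel" if "i < N" for i
    unfolding Ep by (rule v.image_borel'[OF C[OF that] v.piece_borels[OF that] v.piece_subset[OF that]])
  have cong: "gauss_trace n (jet (C i) u) * sqrt (det (metric_coeff A g (C i) u))
      = gauss_trace n (jet (C i) u) * sqrt (det (fst (jet (C i) u)))" if "i < N" "u \<in> E i" for i u
    using fst_jet[OF C[OF that(1)]] sub[OF that(1)] that(2) by auto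
  have "(\<integral>x. trace_curvature_power A g n x \<partial>volume_measure X A g)
    = (\<Sum>i<N. LINT u:snd (C i) ` v.piece i|lborel. gauss_trace n (jet (C i) u) * sqrt (det (metric_coeff A g (C i) u)))"
  proof (rule v.integral_volume_measure)
    show "trace_curvature_power A g n x = gauss_trace n (jet (C i) (snd (C i) x))" if "i < N" "x \<in> fst (C i)" for i x
      by (rule trace_curvature_power_jet[OF C[OF that(1)] that(2)])
    show "continuous_on (snd (C i) ` fst (C i)) (\<lambda>u. gauss_trace n (jet (C i) u))" if "i < N" for i
      by (rule continuous_on_compose2[OF continuous_on_gauss_trace jet_continuous[OF C[OF that]]])
        (use det_jet_pos[OF C[OF that]] in force)
    show "set_integrable lborel (snd (C i) ` v.piece i)
        (\<lambda>u. gauss_trace n (jet (C i) u) * sqrt (det (metric_coeff A g (C i) u)))" if "i < N" for i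
      using int[OF that] unfolding Ep[symmetric] set_integrable_def
    proof (rule Bochner_Integration.integrable_cong[THEN iffD1, rotated 2])
      fix u
      show "indicator (E i) u *\<^sub>R (gauss_trace n (jet (C i) u) * sqrt (det (fst (jet (C i) u))))
        = indicator (E i) u *\<^sub>R (gauss_trace n (jet (C i) u) * sqrt (det (metric_coeff A g (C i) u)))"
        using cong[OF that, of u] by (cases "u \<in> E i") auto
    qed simp
  qed
  also have "\<dots> = (\<Sum>i<N. LINT u:E i|lborel. gauss_trace n (jet (C i) u) * sqrt (det (fst (jet (C i) u))))"
    unfolding Ep[symmetric]
    by (rule sum.cong[OF refl], rule set_lebesgue_integral_cong) (use EB cong in auto)
  finally show ?thesis unfolding LKC_def Let_def n_def by simp
qed

end

section \<open>Tangent vectors and submanifold charts\<close>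

text \<open>Like \<open>coord_vector\<close>, for an arbitrary vector of components in the chart
  \<open>c\<close> instead of a unit vector.\<close>

definition tangent_of :: "('a, 'm::finite) chart set \<Rightarrow> 'a \<Rightarrow> ('a, 'm) chart \<Rightarrow> real^'m \<Rightarrow> ('a, 'm) tangent" where
  "tangent_of A x c v = (\<lambda>c'. if c' \<in> charts_at A x
     then frechet_derivative (transition c c') (at (snd c x)) v else 0)"

lemma coord_vector_tangent_of: "coord_vector A x c i = tangent_of A x c (axis i 1)"
  by (simp add: coord_vector_def tangent_of_def)

context
  fixes X :: "'a topology" and A :: "('a, 'm::finite) chart set"
  assumes charts: "\<And>c. c \<in> A \<Longrightarrow> chart_of X c"
    and trans_diff: "\<And>c c' u. c \<in> A \<Longrightarrow> c' \<in> A \<Longrightarrow> u \<in> snd c ` (fst c \<inter> fst c') \<Longrightarrow>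
          transition c c' differentiable (at u)"
begin

lemma tangent_of_self:
  assumes c: "c \<in> charts_at A x"
  shows "tangent_of A x c v c = v"
proof -
  have cA: "c \<in> A" "x \<in> fst c" using c by (auto simp: charts_at_def)
  note ch = charts[OF cA(1)]
  have "frechet_derivative (transition c c) (at (snd c x)) = frechet_derivative (\<lambda>u. u) (at (snd c x))"
    by (rule frechet_derivative_cong_open[OF chart_open_range[OF ch]])
      (use cA chart_param[OF ch] in \<open>auto simp: transition_def param_chart[OF ch]\<close>)
  then show ?thesis using c by (simp add: tangent_of_def)
qed

text \<open>The compatibility demanded by \<open>tangent_space\<close> is the chain rule for
  transition maps between three charts, near the common point.\<close>

lemma tangent_of_in:
  assumes c: "c \<in> charts_at A x"
  shows "tangent_of A x c v \<in> tangent_space A x"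
  unfolding tangent_space_def
proof (intro CollectI conjI allI ballI impI)
  fix c1 c2 assume c12: "c1 \<in> charts_at A x" "c2 \<in> charts_at A x"
  have A: "c \<in> A" "c1 \<in> A" "c2 \<in> A" and x: "x \<in> fst c" "x \<in> fst c1" "x \<in> fst c2"
    using c c12 by (auto simp: charts_at_def)
  note ch = charts[OF A(1)] charts[OF A(2)] charts[OF A(3)]
  let ?u = "snd c x" and ?W = "snd c ` ((fst c1 \<inter> fst c2) \<inter> fst c)"
  have W: "open ?W" "?u \<in> ?W"
    using x chart_open_image[OF ch(1) openin_Int[OF chart_openin[OF ch(2)] chart_openin[OF ch(3)]]] by auto
  have t1: "transition c c1 ?u = snd c1 x" by (rule transition_chart[OF ch(1,2) x(1)])
  have d1: "(transition c c1 has_derivative frechet_derivative (transition c c1) (at ?u)) (at ?u)"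
    using trans_diff[OF A(1,2), of ?u] x by (auto simp: frechet_derivative_works[symmetric])
  have d2: "(transition c1 c2 has_derivative frechet_derivative (transition c1 c2) (at (snd c1 x))) (at (transition c c1 ?u))"
    unfolding t1 using trans_diff[OF A(2,3), of "snd c1 x"] x by (auto simp: frechet_derivative_works[symmetric])
  have "((\<lambda>u. transition c1 c2 (transition c c1 u)) has_derivative
      (\<lambda>h. frechet_derivative (transition c1 c2) (at (snd c1 x)) (frechet_derivative (transition c c1) (at ?u) h))) (at ?u)"
    by (rule has_derivative_compose[OF d1 d2])
  then have "(transition c c2 has_derivative
      (\<lambda>h. frechet_derivative (transition c1 c2) (at (snd c1 x)) (frechet_derivative (transition c c1) (at ?u) h))) (at ?u)"
    by (rule has_derivative_transform_within_open[OF _ W])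
      (auto simp: transition_def param_chart[OF ch(1)] param_chart[OF ch(2)])
  then show "tangent_of A x c v c2 = frechet_derivative (transition c1 c2) (at (snd c1 x)) (tangent_of A x c v c1)"
    using c12 by (simp add: tangent_of_def frechet_derivative_at[symmetric])
qed (simp add: tangent_of_def)

text \<open>Evaluates the derivative in any chart, although \<open>tangent_deriv\<close> uses one
  picked by \<open>SOME\<close>. Since the pick is unknown, differentiability of \<open>f\<close> is
  assumed in every chart around the point.\<close>

lemma tangent_deriv_chart:
  assumes Y: "Y \<in> tangent_space A x" and c: "c \<in> charts_at A x"
    and f: "\<And>c0. c0 \<in> charts_at A x \<Longrightarrow> (\<lambda>u. f (param c0 u)) differentiable (at (snd c0 x))"
  shows "tangent_deriv A x Y f = (\<Sum>i\<in>UNIV. Y c $ i * partial i (\<lambda>u. f (param c u)) (snd c x))"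
proof -
  define c0 where "c0 = (SOME c. c \<in> charts_at A x)"
  have c0: "c0 \<in> charts_at A x" unfolding c0_def using c by (rule someI)
  have A: "c \<in> A" "c0 \<in> A" and x: "x \<in> fst c" "x \<in> fst c0" using c c0 by (auto simp: charts_at_def)
  note ch = charts[OF A(1)] charts[OF A(2)]
  let ?t = "transition c c0" and ?u = "snd c x"
  have W: "open (snd c ` (fst c \<inter> fst c0))" "?u \<in> snd c ` (fst c \<inter> fst c0)"
    using transition_domain_open[OF ch] x by auto
  have t: "?t ?u = snd c0 x" by (rule transition_chart[OF ch x(1)])
  have dt: "?t differentiable (at ?u)" by (rule trans_diff[OF A W(2)])
  have df: "(\<lambda>u. f (param c0 u)) differentiable (at (?t ?u))" unfolding t by (rule f[OF c0])
  have p: "partial i (\<lambda>u. f (param c u)) ?u = (\<Sum>a\<in>UNIV. jac ?t ?u $ a $ i * partial a (\<lambda>u. f (param c0 u)) (?t ?u))" for i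
    by (rule partial_chain(2)[OF dt df W]) (simp add: param_transition[OF ch])
  have Yc: "Y c0 = jac ?t ?u *v Y c"
  proof -
    have "Y c0 = frechet_derivative ?t (at ?u) (Y c)" using Y c c0 unfolding tangent_space_def by blast
    also have "\<dots> = jac ?t ?u *v Y c" by (rule jac_works(2)[OF dt])
    finally show ?thesis .
  qed
  have "tangent_deriv A x Y f = (\<Sum>a\<in>UNIV. Y c0 $ a * partial a (\<lambda>u. f (param c0 u)) (?t ?u))"
    using frechet_derivative_partial_sum[OF df] by (simp add: tangent_deriv_def Let_def c0_def[symmetric] comp_def t)
  also have "\<dots> = (\<Sum>a\<in>UNIV. \<Sum>i\<in>UNIV. jac ?t ?u $ a $ i * Y c $ i * partial a (\<lambda>u. f (param c0 u)) (?t ?u))"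
    by (simp add: Yc matrix_vector_mult_def sum_distrib_right)
  also have "\<dots> = (\<Sum>i\<in>UNIV. Y c $ i * partial i (\<lambda>u. f (param c u)) ?u)"
    unfolding p by (subst sum.swap) (simp add: sum_distrib_left mult_ac)
  finally show ?thesis .
qed

end

section \<open>Charts of an embedded submanifold\<close>

lemma L2_space_count: "L2_space (count_space {..<k::nat}) UNIV"
proof
  fix Xs :: "nat \<Rightarrow> nat \<Rightarrow> real" and X
  assume "AE w in count_space {..<k}. (\<lambda>n. Xs n w) \<longlonglongrightarrow> X w"
  then have l: "\<And>w. w < k \<Longrightarrow> (\<lambda>n. Xs n w) \<longlonglongrightarrow> X w" by (simp add: AE_count_space)
  have "(\<lambda>n. \<Sum>w<k. (Xs n w - X w)\<^sup>2) \<longlonglongrightarrow> (\<Sum>w<k. (X w - X w)\<^sup>2)"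
    by (intro tendsto_intros l) simp
  then show "X \<in> UNIV \<and> (\<lambda>n. \<integral>w. (Xs n w - X w)\<^sup>2 \<partial>count_space {..<k}) \<longlonglongrightarrow> 0"
    by (simp add: lebesgue_integral_count_space_finite)
qed (auto simp: integrable_count_space)

lemma ip_count: "L2_space.ip (count_space {..<k::nat}) X Y = (\<Sum>n<k. X n * Y n)"
  by (simp add: L2_space.ip_def[OF L2_space_count] lebesgue_integral_count_space_finite)

text \<open>A homeomorphic change of coordinates \<open>\<tau>\<close> between two immersed charts is a local solution of
  \<open>\<theta> \<circ> \<tau> = \<rho>\<close> with differentiable \<open>\<rho>\<close> and a map \<open>\<theta>\<close> whose derivative at the point is the identity.\<close>

lemma has_derivative_of_left_factor:
  fixes \<theta> \<tau> \<rho> :: "'e::euclidean_space \<Rightarrow> 'e"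
  assumes \<theta>: "(\<theta> has_derivative (\<lambda>h. h)) (at (\<tau> u))" and \<rho>: "(\<rho> has_derivative D) (at u)"
    and cont: "continuous (at u) \<tau>" and W: "open W" "u \<in> W" and eq: "\<And>w. w \<in> W \<Longrightarrow> \<theta> (\<tau> w) = \<rho> w"
  shows "(\<tau> has_derivative D) (at u)"
proof -
  have bD: "bounded_linear D" using \<rho> by (rule has_derivative_bounded_linear)
  then obtain K where K: "0 < K" "\<And>h. norm (D h) \<le> norm h * K" using bounded_linear.pos_bounded by blast
  show ?thesis
    unfolding has_derivative_at_alt
  proof (intro conjI bD allI impI)
    fix e :: real assume e: "0 < e"
    \<comment> \<open>The bound \<open>1/2\<close> allows half of the increment of
      \<open>\<tau>\<close> to be absorbed, which gives the a priori estimate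
      \<open>2 * (K + 1) * norm (y - u)\<close> for that increment. The other bound makes the
      resulting error at most half of \<open>e\<close>.\<close>
    define e1 where "e1 = min (1/2) (e / (4 * (K + 1)))"
    have e1: "0 < e1" "e1 \<le> 1/2" "e1 * (2 * (K + 1)) \<le> e / 2"
    proof -
      show "0 < e1" using e K by (simp add: e1_def)
      show "e1 \<le> 1/2" unfolding e1_def by (rule min.cobounded1)
      have "e1 \<le> e / (4 * (K + 1))" by (simp add: e1_def)
      then have "e1 * (4 * (K + 1)) \<le> e" using K by (simp add: pos_le_divide_eq)
      moreover have "e1 * (4 * (K + 1)) = 2 * (e1 * (2 * (K + 1)))" by algebra
      ultimately show "e1 * (2 * (K + 1)) \<le> e / 2" by linarith
    qed
    define e2 where "e2 = min 1 (e / 2)"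
    have e2: "0 < e2" "e2 \<le> 1" "e2 \<le> e / 2" using e by (auto simp: e2_def)
    obtain d1 where d1: "0 < d1" "\<And>y. norm (y - \<tau> u) < d1 \<Longrightarrow> norm (\<theta> y - \<theta> (\<tau> u) - (y - \<tau> u)) \<le> e1 * norm (y - \<tau> u)"
      using \<theta> e1(1) unfolding has_derivative_at_alt by blast
    obtain d2 where d2: "0 < d2" "\<And>y. norm (y - u) < d2 \<Longrightarrow> norm (\<rho> y - \<rho> u - D (y - u)) \<le> e2 * norm (y - u)"
      using \<rho> e2(1) unfolding has_derivative_at_alt by blast
    obtain d3 where d3: "0 < d3" "\<And>y. norm (y - u) < d3 \<Longrightarrow> norm (\<tau> y - \<tau> u) < d1"
    proof -
      have "\<exists>d>0. \<forall>y. dist y u < d \<longrightarrow> dist (\<tau> y) (\<tau> u) < d1"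
        using cont d1(1) by (simp add: continuous_within_eps_delta)
      then show ?thesis using that by (auto simp: dist_norm)
    qed
    obtain d4 where d4: "0 < d4" "ball u d4 \<subseteq> W" using W by (meson openE)
    show "\<exists>d>0. \<forall>y. norm (y - u) < d \<longrightarrow> norm (\<tau> y - \<tau> u - D (y - u)) \<le> e * norm (y - u)"
    proof (intro exI[of _ "min d2 (min d3 d4)"] conjI allI impI)
      fix y assume y: "norm (y - u) < min d2 (min d3 d4)"
      have yW: "y \<in> W" using y d4 by (auto simp: subset_iff dist_norm norm_minus_commute)
      let ?h = "\<tau> y - \<tau> u"
      have "norm (\<theta> (\<tau> y) - \<theta> (\<tau> u) - ?h) \<le> e1 * norm ?h" by (rule d1(2)[OF d3(2)]) (use y in simp)
      then have a: "norm (\<rho> y - \<rho> u - ?h) \<le> e1 * norm ?h" by (simp only: eq[OF yW] eq[OF W(2)])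
      have b: "norm (\<rho> y - \<rho> u - D (y - u)) \<le> e2 * norm (y - u)" by (rule d2(2)) (use y in simp)
      have "norm (\<rho> y - \<rho> u) \<le> norm (\<rho> y - \<rho> u - D (y - u)) + norm (D (y - u))"
        using norm_triangle_ineq[of "\<rho> y - \<rho> u - D (y - u)" "D (y - u)"] by simp
      also have "\<dots> \<le> 1 * norm (y - u) + norm (y - u) * K"
        using b e2(2) K(2)[of "y - u"] mult_right_mono[OF e2(2) norm_ge_zero[of "y - u"]] by linarith
      finally have r: "norm (\<rho> y - \<rho> u) \<le> (K + 1) * norm (y - u)" by (simp add: algebra_simps)
      have "norm ?h \<le> norm (\<rho> y - \<rho> u) + norm (\<rho> y - \<rho> u - ?h)"
        using norm_triangle_ineq4[of "\<rho> y - \<rho> u" "\<rho> y - \<rho> u - ?h"] by simp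
      then have "norm ?h \<le> (K + 1) * norm (y - u) + 1/2 * norm ?h"
        using a r mult_right_mono[OF e1(2) norm_ge_zero[of ?h]] by linarith
      then have "norm ?h \<le> 2 * ((K + 1) * norm (y - u))" by linarith
      then have h: "norm ?h \<le> 2 * (K + 1) * norm (y - u)" by (simp only: mult.assoc)
      have "norm (?h - D (y - u)) \<le> norm (\<rho> y - \<rho> u - D (y - u)) + norm (\<rho> y - \<rho> u - ?h)"
      proof -
        have "?h - D (y - u) = (\<rho> y - \<rho> u - D (y - u)) - (\<rho> y - \<rho> u - ?h)" by (simp add: algebra_simps)
        then show ?thesis using norm_triangle_ineq4[of "\<rho> y - \<rho> u - D (y - u)" "\<rho> y - \<rho> u - ?h"]
          by (simp only:)
      qed
      also have "\<dots> \<le> e2 * norm (y - u) + e1 * (2 * (K + 1) * norm (y - u))"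
        using a b mult_left_mono[OF h, of e1] e1(1) by linarith
      also have "\<dots> \<le> e / 2 * norm (y - u) + e / 2 * norm (y - u)"
        using mult_right_mono[OF e1(3) norm_ge_zero[of "y - u"]] mult_right_mono[OF e2(3) norm_ge_zero[of "y - u"]]
        by (simp add: mult_ac)
      finally show "norm (\<tau> y - \<tau> u - D (y - u)) \<le> e * norm (y - u)" by simp
    qed (use d2 d3 d4 in auto)
  qed
qed

lemma differentiable_cong_open:
  assumes "open W" "u \<in> W" "\<And>w. w \<in> W \<Longrightarrow> f w = g w" "f differentiable (at u)"
  shows "g differentiable (at u)"
proof -
  obtain D where D: "(f has_derivative D) (at u)" using assms(4) unfolding differentiable_def by blast
  have "(g has_derivative D) (at u)"
    by (rule has_derivative_transform_within_open[OF D assms(1,2)]) (rule assms(3))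
  then show ?thesis by (rule differentiableI)
qed

lemma differentiable_compose_at:
  assumes "\<tau> differentiable (at u)" "f differentiable (at (\<tau> u))"
  shows "(\<lambda>w. f (\<tau> w)) differentiable (at u)"
  using differentiable_chain_at[OF assms] by (simp add: comp_def)

lemma (in L2_space) fpartial_cong:
  assumes "open U" "u \<in> U" "\<And>v. v \<in> U \<Longrightarrow> \<phi> v = \<phi>' v"
  shows "fpartial i \<phi> u = fpartial i \<phi>' u"
  unfolding fpartial_def[abs_def] by (rule ext, rule partial_cong_open[OF assms(1,2)]) (simp add: assms(3))

lemma (in L2_space) jet_cong:
  assumes U: "open U" "u \<in> U" and eq: "\<And>v. v \<in> U \<Longrightarrow> \<phi> v = \<phi>' v"
  shows "G_of \<phi> u = G_of \<phi>' u" "T_of \<phi> u = T_of \<phi>' u" "S_of \<phi> u = S_of \<phi>' u"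
proof -
  have 1: "fpartial i \<phi> v = fpartial i \<phi>' v" if "v \<in> U" for i v by (rule fpartial_cong[OF U(1) that eq])
  have 2: "fpartial i (fpartial j \<phi>) u = fpartial i (fpartial j \<phi>') u" for i j
    by (rule fpartial_cong[OF U 1])
  show "G_of \<phi> u = G_of \<phi>' u" "T_of \<phi> u = T_of \<phi>' u" "S_of \<phi> u = S_of \<phi>' u"
    by (simp_all add: G_of_def T_of_def S_of_def 1[OF U(2)] 2)
qed

lemma (in L2_space) pos_def_G_of:
  fixes \<phi> :: "real^'m::finite \<Rightarrow> 'w \<Rightarrow> real"
  assumes "open U" "u \<in> U" "field 3 U \<phi>" and "\<And>v. v \<noteq> 0 \<Longrightarrow> 0 < ip (tang \<phi> u v) (tang \<phi> u v)"
  shows "pos_def (G_of \<phi> u)"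
  unfolding pos_def_def
proof (intro conjI allI impI)
  show "transpose (G_of \<phi> u) = G_of \<phi> u" by (simp add: G_of_def transpose_def vec_eq_iff ip_commute)
  note L = first_partial_L[OF assms(1-3)] tang_L[OF assms(1-3)]
  fix v :: "real^'m" assume "v \<noteq> 0"
  have "ip (fpartial i \<phi> u) (tang \<phi> u v) = (G_of \<phi> u *v v) $ i" for i
    by (subst ip_commute, subst ip_tang[OF assms(1-3) L(1)])
      (simp add: matrix_vector_mult_def G_of_def ip_commute[of "fpartial i \<phi> u"] mult.commute)
  then have "ip (tang \<phi> u v) (tang \<phi> u v) = metric_inner (G_of \<phi> u) v v"
    by (subst ip_tang[OF assms(1-3) L(2)]) (simp add: inner_vec_def metric_inner_def)
  then show "0 < metric_inner (G_of \<phi> u) v v" using assms(4)[OF \<open>v \<noteq> 0\<close>] by simp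
qed

context
  fixes k :: nat and S :: "(nat \<Rightarrow> real) set" and c :: "(nat \<Rightarrow> real, 'm::finite) chart"
  assumes c: "c \<in> submanifold_atlas k S"
begin

interpretation L2_space "count_space {..<k}" UNIV by (rule L2_space_count)

lemma submanifold_chart: "chart_of (subtopology (Euclidean_space k) S) c"
  using c by (simp add: submanifold_atlas_def)

lemma submanifold_param_C3: "n < k \<Longrightarrow> Ck_on 3 (\<lambda>u. param c u n) (snd c ` fst c)"
  using c by (simp add: submanifold_atlas_def)

lemma submanifold_field: "field 3 (snd c ` fst c) (param c)"
  using submanifold_param_C3 by (simp add: field_def AE_count_space)

text \<open>An immersion has a nonzero derivative in some coordinate \<open>n\<close>, whose square
  already makes the sum of squares positive.\<close>

lemma submanifold_posdef:
  assumes u: "u \<in> snd c ` fst c"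
  shows "pos_def (G_of (param c) u)"
proof (rule pos_def_G_of[OF chart_open_range[OF submanifold_chart] u submanifold_field])
  fix v :: "real^'m" assume "v \<noteq> 0"
  then obtain n where n: "n < k" "frechet_derivative (\<lambda>u. param c u n) (at u) v \<noteq> 0"
    using c u \<open>v \<noteq> 0\<close> unfolding submanifold_atlas_def by blast
  have "(\<lambda>u. param c u n) differentiable (at u)"
    by (rule Ck_on_differentiable[OF submanifold_param_C3[OF n(1)] _ u]) simp
  then have "tang (param c) u v n \<noteq> 0"
    using n(2) by (simp add: frechet_derivative_partial_sum tang_def fpartial_def)
  then have "0 < (tang (param c) u v n)\<^sup>2" by simp
  also have "\<dots> \<le> (\<Sum>n<k. (tang (param c) u v n)\<^sup>2)" by (rule member_le_sum) (use n in auto)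
  finally show "0 < ip (tang (param c) u v) (tang (param c) u v)" by (simp add: ip_count power2_eq_square)
qed

end

context
  fixes k :: nat and S :: "(nat \<Rightarrow> real) set" and c c' :: "(nat \<Rightarrow> real, 'm::finite) chart"
  assumes c: "c \<in> submanifold_atlas k S" and c': "c' \<in> submanifold_atlas k S"
begin

interpretation L2_space "count_space {..<k}" UNIV by (rule L2_space_count)

lemma transition_continuous: "continuous_on (snd c ` (fst c \<inter> fst c')) (transition c c')"
proof -
  note ch = submanifold_chart[OF c] submanifold_chart[OF c']
  have "open (transition c c' -` B \<inter> snd c ` (fst c \<inter> fst c'))" if "open B" for B
  proof -
    have "open (snd c ` ({x \<in> fst c'. snd c' x \<in> B} \<inter> fst c))"
      by (rule chart_open_image[OF ch(1) chart_preimage_openin[OF ch(2) that]])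
    also have "snd c ` ({x \<in> fst c'. snd c' x \<in> B} \<inter> fst c) = transition c c' -` B \<inter> snd c ` (fst c \<inter> fst c')"
      using transition_chart[OF ch] by auto
    finally show ?thesis .
  qed
  then show ?thesis using continuous_on_open_vimage[OF transition_domain_open[OF ch]] by blast
qed

text \<open>The witness \<open>lin\<close> is the left inverse of the derivative of
  \<open>param c'\<close> at \<open>v\<close>: the transposed derivative followed by the inverse
  Gram matrix. So \<open>lin\<close> after \<open>param c'\<close> has the identity as derivative at
  \<open>v\<close>, while composed with the transition map it is \<open>lin\<close> after
  \<open>param c\<close>, and \<open>has_derivative_of_left_factor\<close> applies.\<close>

lemma transition_has_derivative:
  assumes u: "u \<in> snd c ` (fst c \<inter> fst c')"
  defines "v \<equiv> transition c c' u"
  defines "J \<equiv> (\<chi> a i. \<Sum>b\<in>UNIV. matrix_inv (G_of (param c') v) $ a $ b *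
     (\<Sum>n<k. fpartial b (param c') v n * fpartial i (param c) u n))"
  shows "(transition c c' has_derivative (*v) J) (at u)"
proof -
  note ch = submanifold_chart[OF c] submanifold_chart[OF c']
  let ?W = "snd c ` (fst c \<inter> fst c')"
  have W: "open ?W" by (rule transition_domain_open[OF ch])
  have uU: "u \<in> snd c ` fst c" and vU: "v \<in> snd c' ` fst c'" using u transition_in[OF ch u] by (auto simp: v_def)
  let ?I = "matrix_inv (G_of (param c') v)"
  define lin where "lin y = (\<chi> a. \<Sum>b\<in>UNIV. ?I $ a $ b * (\<Sum>n<k. fpartial b (param c') v n * y n))" for y :: "nat \<Rightarrow> real"
  have D: "((\<lambda>w. lin (\<lambda>n. f w n)) has_derivative (\<lambda>h. lin (\<lambda>n. \<Sum>i\<in>UNIV. h $ i * partial i (\<lambda>w. f w n) z))) (at z)"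
    if "\<And>n. n < k \<Longrightarrow> (\<lambda>w. f w n) differentiable (at z)" for f :: "real^'m \<Rightarrow> nat \<Rightarrow> real" and z
  proof (rule has_derivative_vecI)
    fix a
    have "((\<lambda>w. \<Sum>b\<in>UNIV. ?I $ a $ b * (\<Sum>n<k. fpartial b (param c') v n * f w n)) has_derivative
       (\<lambda>h. \<Sum>b\<in>UNIV. ?I $ a $ b * (\<Sum>n<k. fpartial b (param c') v n * (\<Sum>i\<in>UNIV. h $ i * partial i (\<lambda>w. f w n) z)))) (at z)"
      by (intro has_derivative_sum has_derivative_mult_right has_derivative_partials that) simp
    then show "((\<lambda>w. lin (\<lambda>n. f w n) $ a) has_derivative
       (\<lambda>h. lin (\<lambda>n. \<Sum>i\<in>UNIV. h $ i * partial i (\<lambda>w. f w n) z) $ a)) (at z)" by (simp add: lin_def)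
  qed
  have d: "(\<lambda>w. param c w n) differentiable (at u)" if "n < k" for n
    by (rule Ck_on_differentiable[OF submanifold_param_C3[OF c that] _ uU]) simp
  have d': "(\<lambda>w. param c' w n) differentiable (at v)" if "n < k" for n
    by (rule Ck_on_differentiable[OF submanifold_param_C3[OF c' that] _ vU]) simp
  have det: "det (G_of (param c') v) \<noteq> 0"
    using orthonormal_det_pos[OF submanifold_posdef[OF c' vU]] by simp
  have id: "lin (\<lambda>n. \<Sum>i\<in>UNIV. h $ i * partial i (\<lambda>w. param c' w n) v) = h" for h
  proof -
    have "(\<Sum>n<k. fpartial b (param c') v n * (\<Sum>i\<in>UNIV. h $ i * partial i (\<lambda>w. param c' w n) v)) = (G_of (param c') v *v h) $ b" for b
    proof -
      have "(\<Sum>n<k. fpartial b (param c') v n * (\<Sum>i\<in>UNIV. h $ i * partial i (\<lambda>w. param c' w n) v))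
        = (\<Sum>n<k. \<Sum>i\<in>UNIV. fpartial b (param c') v n * fpartial i (param c') v n * h $ i)"
        by (simp add: fpartial_def sum_distrib_left mult_ac)
      also have "\<dots> = (\<Sum>i\<in>UNIV. \<Sum>n<k. fpartial b (param c') v n * fpartial i (param c') v n * h $ i)" by (rule sum.swap)
      also have "\<dots> = (G_of (param c') v *v h) $ b"
        by (simp add: matrix_vector_mult_def G_of_def ip_count sum_distrib_right)
      finally show ?thesis .
    qed
    then have "lin (\<lambda>n. \<Sum>i\<in>UNIV. h $ i * partial i (\<lambda>w. param c' w n) v) = ?I *v (G_of (param c') v *v h)"
      by (simp add: lin_def matrix_vector_mult_def vec_eq_iff)
    also have "\<dots> = h" by (simp add: matrix_vector_mul_assoc matrix_inv_left_det[OF det])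
    finally show ?thesis .
  qed
  have Jv: "lin (\<lambda>n. \<Sum>i\<in>UNIV. h $ i * partial i (\<lambda>w. param c w n) u) = J *v h" for h
  proof -
    have "(\<Sum>n<k. fpartial b (param c') v n * (\<Sum>i\<in>UNIV. h $ i * partial i (\<lambda>w. param c w n) u))
       = (\<Sum>i\<in>UNIV. (\<Sum>n<k. fpartial b (param c') v n * fpartial i (param c) u n) * h $ i)" for b
    proof -
      have "(\<Sum>n<k. fpartial b (param c') v n * (\<Sum>i\<in>UNIV. h $ i * partial i (\<lambda>w. param c w n) u))
        = (\<Sum>n<k. \<Sum>i\<in>UNIV. fpartial b (param c') v n * fpartial i (param c) u n * h $ i)"
        by (simp add: fpartial_def sum_distrib_left mult_ac)
      also have "\<dots> = (\<Sum>i\<in>UNIV. \<Sum>n<k. fpartial b (param c') v n * fpartial i (param c) u n * h $ i)" by (rule sum.swap)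
      finally show ?thesis by (simp add: sum_distrib_right)
    qed
    then have "lin (\<lambda>n. \<Sum>i\<in>UNIV. h $ i * partial i (\<lambda>w. param c w n) u) $ a
       = (\<Sum>b\<in>UNIV. \<Sum>i\<in>UNIV. ?I $ a $ b * ((\<Sum>n<k. fpartial b (param c') v n * fpartial i (param c) u n) * h $ i))" for a
      by (simp add: lin_def sum_distrib_left)
    also have "(\<Sum>b\<in>UNIV. \<Sum>i\<in>UNIV. ?I $ a $ b * ((\<Sum>n<k. fpartial b (param c') v n * fpartial i (param c) u n) * h $ i))
       = (J *v h) $ a" for a
      by (subst sum.swap) (simp add: J_def matrix_vector_mult_def sum_distrib_right mult.assoc)
    finally show ?thesis by (simp add: vec_eq_iff)
  qed
  show ?thesis
  proof (rule has_derivative_of_left_factor)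
    show "((\<lambda>w. lin (\<lambda>n. param c' w n)) has_derivative (\<lambda>h. h)) (at (transition c c' u))"
      using D[of "param c'" v, OF d'] unfolding id v_def[symmetric] by simp
    show "((\<lambda>w. lin (\<lambda>n. param c w n)) has_derivative (*v) J) (at u)"
      using D[of "param c" u, OF d] unfolding Jv by simp
    show "continuous (at u) (transition c c')"
      using transition_continuous u continuous_on_eq_continuous_at[OF W] by blast
    show "lin (\<lambda>n. param c' (transition c c' w) n) = lin (\<lambda>n. param c w n)" if "w \<in> ?W" for w
      using param_transition[OF ch that] by simp
  qed (use W u in auto)
qed

text \<open>The formula for the Jacobian found above holds at every point of the overlap. It is
  built from first partials of C3 maps, an inverse Gram matrix and the transition map itself, all
  differentiable, so it can be differentiated once more.\<close>

lemma submanifold_transition: "twice_differentiable_on (transition c c') (snd c ` (fst c \<inter> fst c'))"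
  unfolding twice_differentiable_on_def
proof (intro ballI conjI allI)
  note ch = submanifold_chart[OF c] submanifold_chart[OF c']
  let ?t = "transition c c'" and ?W = "snd c ` (fst c \<inter> fst c')"
  have W: "open ?W" by (rule transition_domain_open[OF ch])
  fix u assume u: "u \<in> ?W"
  show d: "?t differentiable (at u)" using transition_has_derivative[OF u] by (rule differentiableI)
  have uU: "u \<in> snd c ` fst c" and vU: "?t u \<in> snd c' ` fst c'" using u transition_in[OF ch u] by auto
  fix a i
  have p: "(\<lambda>w. fpartial i (param d) w n) differentiable (at z)"
    if "d \<in> submanifold_atlas k S" "z \<in> snd d ` fst d" "n < k" for d :: "(nat \<Rightarrow> real, 'm) chart" and z n i
    unfolding fpartial_def
    by (rule Ck_on_differentiable[OF Ck_on_partial[of 2] _ that(2)])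
      (use submanifold_param_C3[OF that(1,3)] in \<open>simp_all add: numeral_3_eq_3 numeral_2_eq_2\<close>)
  have G: "(\<lambda>w. G_of (param c') w $ a $ b) differentiable (at (?t u))" for a b
    unfolding G_of_def ip_count by (auto intro!: differentiable_sum differentiable_mult p[OF c' vU])
  have "(\<lambda>w. matrix_inv (G_of (param c') w) $ a $ b) differentiable (at (?t u))" for b
    by (rule differentiable_matrix_inv[OF G chart_open_range[OF ch(2)] vU])
      (use orthonormal_det_pos[OF submanifold_posdef[OF c']] in force)
  note Id = differentiable_compose_at[OF d this]
  have "(\<lambda>w. \<Sum>b\<in>UNIV. matrix_inv (G_of (param c') (?t w)) $ a $ b *
     (\<Sum>n<k. fpartial b (param c') (?t w) n * fpartial i (param c) w n)) differentiable (at u)"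
    by (auto intro!: differentiable_sum differentiable_mult Id p[OF c uU] differentiable_compose_at[OF d p[OF c' vU]])
  moreover have "(\<Sum>b\<in>UNIV. matrix_inv (G_of (param c') (?t w)) $ a $ b *
     (\<Sum>n<k. fpartial b (param c') (?t w) n * fpartial i (param c) w n)) = jac ?t w $ a $ i" if "w \<in> ?W" for w
    unfolding jac_def frechet_derivative_at[OF transition_has_derivative[OF that], symmetric]
    by (simp only: matrix_of_matrix_vector_mul vec_lambda_beta)
  ultimately show "(\<lambda>w. jac ?t w $ a $ i) differentiable (at u)"
    by (rule differentiable_cong_open[OF W u, rotated])
qed

end

text \<open>Tangential derivatives of the coordinate functions of Euclidean space are the partials
  of the parametrisation, so the induced metric is their Gram matrix, an \<open>ip\<close> for
  counting measure.\<close>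

lemma submanifold_metric:
  fixes c :: "(nat \<Rightarrow> real, 'm::finite) chart"
  assumes c: "c \<in> submanifold_atlas k S" and u: "u \<in> snd c ` fst c"
  shows "metric_coeff (submanifold_atlas k S) (induced_metric k (submanifold_atlas k S)) c u
     = L2_space.G_of (count_space {..<k}) (param c) u"
proof -
  interpret L2_space "count_space {..<k}" UNIV by (rule L2_space_count)
  let ?A = "submanifold_atlas k S :: (nat \<Rightarrow> real, 'm) chart set"
  note ch = submanifold_chart
  have td: "transition c c' differentiable (at u)" if "c \<in> ?A" "c' \<in> ?A" "u \<in> snd c ` (fst c \<inter> fst c')" for c c' u
    using submanifold_transition[OF that(1,2)] that(3) by (auto simp: twice_differentiable_on_def)
  let ?x = "param c u"
  have cx: "c \<in> charts_at ?A ?x" and su: "snd c ?x = u"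
    using c u param_in[OF ch[OF c] u] chart_param[OF ch[OF c] u] by (auto simp: charts_at_def)
  have t: "tangent_deriv ?A ?x (coord_vector ?A ?x c i) (\<lambda>y. y n) = fpartial i (param c) u n" if n: "n < k" for i n
  proof -
    have "tangent_deriv ?A ?x (coord_vector ?A ?x c i) (\<lambda>y. y n)
      = (\<Sum>a\<in>UNIV. coord_vector ?A ?x c i c $ a * partial a (\<lambda>u. param c u n) (snd c ?x))"
    proof (rule tangent_deriv_chart[OF ch td])
      show "coord_vector ?A ?x c i \<in> tangent_space ?A ?x"
        unfolding coord_vector_tangent_of by (rule tangent_of_in[OF ch td cx])
      show "(\<lambda>u. param c0 u n) differentiable (at (snd c0 ?x))" if "c0 \<in> charts_at ?A ?x" for c0
        by (rule Ck_on_differentiable[OF submanifold_param_C3[of c0 k S, OF _ n]])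
          (use that in \<open>auto simp: charts_at_def\<close>)
    qed (use cx in auto)
    also have "coord_vector ?A ?x c i c = axis i 1"
      unfolding coord_vector_tangent_of by (rule tangent_of_self[OF ch td cx])
    finally show ?thesis
      by (simp add: su fpartial_def axis_def if_distrib[where f = "\<lambda>z. z * _"] cong: if_cong)
  qed
  show ?thesis
    by (simp add: metric_coeff_def induced_metric_def G_of_def ip_count vec_eq_iff t)
qed

lemma L2_manifold_submanifold:
  assumes "(\<Union>c\<in>(submanifold_atlas k S :: (nat \<Rightarrow> real, 'm::finite) chart set). fst c) = topspace (subtopology (Euclidean_space k) S)"
  shows "L2_manifold (count_space {..<k}) UNIV (subtopology (Euclidean_space k) S)
    (submanifold_atlas k S :: (nat \<Rightarrow> real, 'm) chart set) (induced_metric k (submanifold_atlas k S)) (\<lambda>x. x)"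
  by (intro L2_manifold.intro L2_manifold_axioms.intro L2_space_count submanifold_chart submanifold_transition
      submanifold_field submanifold_metric submanifold_posdef assms)

definition (in L2_space) field_jet :: "(real^'m::finite \<Rightarrow> 'w \<Rightarrow> real) \<Rightarrow> real^'m \<Rightarrow>
    (real^'m^'m) \<times> (real^'m^'m^'m) \<times> (real^'m^'m^'m^'m)" where
  "field_jet \<phi> u = (G_of \<phi> u, T_of \<phi> u, S_of \<phi> u)"

lemma (in L2_manifold) jet_field_jet: "jet c u = field_jet (\<lambda>u. \<psi> (param c u)) u"
  by (simp add: jet_def field_jet_def)

lemma (in L2_space) field_jet_cong:
  assumes "open U" "u \<in> U" "\<And>v. v \<in> U \<Longrightarrow> \<phi> v = \<phi>' v"
  shows "field_jet \<phi> u = field_jet \<phi>' u"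
  unfolding field_jet_def by (simp only: jet_cong[OF assms])

section \<open>Transport of charts along an embedding\<close>

definition push_chart :: "'a topology \<Rightarrow> ('a \<Rightarrow> 'b) \<Rightarrow> ('a, 'm::finite) chart \<Rightarrow> ('b, 'm) chart" where
  "push_chart M h c = (h ` fst c, snd c \<circ> inv_into (topspace M) h)"

context
  fixes M :: "'a topology" and A :: "('a, 'm::finite) chart set" and k :: nat and h :: "'a \<Rightarrow> nat \<Rightarrow> real"
  assumes charts: "\<And>c. c \<in> A \<Longrightarrow> chart_of M c"
    and trans_diff: "\<And>c c' u. c \<in> A \<Longrightarrow> c' \<in> A \<Longrightarrow> u \<in> snd c ` (fst c \<inter> fst c') \<Longrightarrow>
          transition c c' differentiable (at u)"
    and emb: "C3_embedding M A k h"
begin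

abbreviation "XS \<equiv> subtopology (Euclidean_space k) (h ` topspace M)"

lemma embedding_homeo: "homeomorphic_map M XS h"
  using emb by (simp add: C3_embedding_def embedding_map_def)

lemma embedding_inj: "inj_on h (topspace M)"
  by (rule homeomorphic_imp_injective_map[OF embedding_homeo])

lemma inv_embedding: "x \<in> topspace M \<Longrightarrow> inv_into (topspace M) h (h x) = x"
  by (rule inv_into_f_f[OF embedding_inj])

lemma topspace_XS: "topspace XS = h ` topspace M"
  by (rule homeomorphic_imp_surjective_map[OF embedding_homeo, symmetric])

lemma push_chart_image: "V \<subseteq> topspace M \<Longrightarrow> snd (push_chart M h c) ` (h ` V) = snd c ` V"
  using inv_embedding by (auto simp: push_chart_def image_image subset_iff)

lemma openin_push: "openin M V \<Longrightarrow> openin XS (h ` V)"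
  using homeomorphic_imp_open_map[OF embedding_homeo] by (simp add: open_map_def)

lemma chart_of_push:
  assumes c: "c \<in> A"
  shows "chart_of XS (push_chart M h c)"
proof -
  note ch = charts[OF c]
  have sub: "fst c \<subseteq> topspace M" by (rule chart_subset[OF ch])
  have im: "snd (push_chart M h c) ` fst (push_chart M h c) = snd c ` fst c"
    using push_chart_image[OF sub] by (simp add: push_chart_def)
  have r: "homeomorphic_map (subtopology M (fst c)) (subtopology XS (h ` fst c)) h"
    by (rule homeomorphic_map_subtopologies[OF embedding_homeo], unfold topspace_XS) (use sub in blast)
  then obtain g where g: "homeomorphic_maps (subtopology M (fst c)) (subtopology XS (h ` fst c)) h g"
    by (auto simp: homeomorphic_map_maps)
  then have gm: "homeomorphic_map (subtopology XS (h ` fst c)) (subtopology M (fst c)) g"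
    and gh: "\<And>x. x \<in> fst c \<Longrightarrow> g (h x) = x"
    using sub by (auto simp: homeomorphic_maps_map)
  have "homeomorphic_map (subtopology XS (h ` fst c)) (top_of_set (snd c ` fst c)) (snd c \<circ> g)"
    by (rule homeomorphic_map_compose[OF gm chart_homeo[OF ch]])
  then have "homeomorphic_map (subtopology XS (h ` fst c)) (top_of_set (snd c ` fst c)) (snd (push_chart M h c))"
    by (rule homeomorphic_map_eq) (use gh sub inv_embedding in \<open>auto simp: push_chart_def subset_iff\<close>)
  then show ?thesis
    unfolding chart_of_def im
    using chart_open_range[OF ch] openin_push[OF chart_openin[OF ch]] by (simp add: push_chart_def)
qed

lemma param_push:
  assumes c: "c \<in> A" and u: "u \<in> snd c ` fst c"
  shows "param (push_chart M h c) u = h (param c u)"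
proof -
  note ch = charts[OF c]
  have p: "param c u \<in> fst c" "snd c (param c u) = u" by (rule param_in[OF ch u], rule chart_param[OF ch u])
  then have "param c u \<in> topspace M" using chart_subset[OF ch] by auto
  then have "snd (push_chart M h c) (h (param c u)) = u" using p by (simp add: push_chart_def inv_embedding)
  moreover have "h (param c u) \<in> fst (push_chart M h c)" using p by (simp add: push_chart_def)
  ultimately show ?thesis using param_chart[OF chart_of_push[OF c]] by metis
qed

text \<open>Immersivity is assumed for tangent vectors of the abstract manifold;
  \<open>tangent_of\<close> converts a nonzero coordinate vector into one of these.\<close>

lemma push_chart_in_atlas:
  assumes c: "c \<in> A"
  shows "push_chart M h c \<in> submanifold_atlas k (h ` topspace M)"
proof -
  note ch = charts[OF c]
  let ?U = "snd c ` fst c" and ?p = "push_chart M h c"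
  have U: "open ?U" by (rule chart_open_range[OF ch])
  have im: "snd ?p ` fst ?p = ?U"
    using push_chart_image[OF chart_subset[OF ch]] by (simp add: push_chart_def)
  have C3h: "Ck_on 3 (\<lambda>u. h (param d u) i) (snd d ` fst d)" if "d \<in> A" "i < k" for d i
    using emb that by (auto simp: C3_embedding_def C3_fun_def comp_def)
  have C3: "Ck_on 3 (\<lambda>u. param ?p u i) ?U" if "i < k" for i
    using C3h[OF c that] by (subst Ck_on_cong[OF U, where g = "\<lambda>u. h (param c u) i"]) (simp_all add: param_push[OF c])
  have imm: "\<exists>i<k. frechet_derivative (\<lambda>u. param ?p u i) (at u) v \<noteq> 0" if u: "u \<in> ?U" and v: "v \<noteq> 0" for u v
  proof -
    let ?x = "param c u"
    have x: "?x \<in> fst c" "snd c ?x = u" by (rule param_in[OF ch u], rule chart_param[OF ch u])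
    have xM: "?x \<in> topspace M" using x chart_subset[OF ch] by auto
    have cx: "c \<in> charts_at A ?x" using c x by (simp add: charts_at_def)
    let ?Y = "tangent_of A ?x c v"
    have Yc: "?Y c = v" by (rule tangent_of_self[OF charts trans_diff cx])
    have Y: "?Y \<in> tangent_space A ?x" by (rule tangent_of_in[OF charts trans_diff cx])
    have "?Y \<noteq> (\<lambda>_. 0)" using Yc v by auto
    then obtain i where i: "i < k" "tangent_deriv A ?x ?Y (\<lambda>x. h x i) \<noteq> 0"
      using emb xM Y unfolding C3_embedding_def by blast
    have d: "(\<lambda>u. h (param c0 u) i) differentiable (at (snd c0 ?x))" if "c0 \<in> charts_at A ?x" for c0
      by (rule Ck_on_differentiable[OF C3h[of c0, OF _ i(1)]]) (use that in \<open>auto simp: charts_at_def\<close>)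
    have "tangent_deriv A ?x ?Y (\<lambda>x. h x i) = (\<Sum>a\<in>UNIV. ?Y c $ a * partial a (\<lambda>u. h (param c u) i) (snd c ?x))"
      by (rule tangent_deriv_chart[OF charts trans_diff Y cx d])
    also have "\<dots> = frechet_derivative (\<lambda>u. h (param c u) i) (at u) v"
      using frechet_derivative_partial_sum[of "\<lambda>u. h (param c u) i" u v] d[OF cx] by (simp add: x Yc)
    also have "frechet_derivative (\<lambda>u. h (param c u) i) (at u) = frechet_derivative (\<lambda>u. param ?p u i) (at u)"
      by (rule frechet_derivative_cong_open[OF U u]) (simp add: param_push[OF c])
    finally show ?thesis using i by auto
  qed
  show ?thesis
    unfolding submanifold_atlas_def mem_Collect_eq im using chart_of_push[OF c] C3 imm by blast
qed

text \<open>Pushing charts forward leaves their images in \<open>real^'m\<close> unchanged, so the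
  sets \<open>E i\<close> are built from the cover of \<open>M\<close> alone and are the same for
  every embedding \<open>h\<close>. Injectivity of \<open>h\<close> keeps the differences of the
  cover sets intact.\<close>

theorem LKC_submanifold_embedding:
  fixes N j :: nat and C :: "nat \<Rightarrow> ('a, 'm) chart" and V :: "nat \<Rightarrow> 'a set"
  assumes C: "\<And>i. i < N \<Longrightarrow> C i \<in> A"
    and V: "\<And>i. i < N \<Longrightarrow> openin M (V i)" "\<And>i. i < N \<Longrightarrow> V i \<subseteq> fst (C i)"
    and cover: "(\<Union>i<N. V i) = topspace M"
  defines "E \<equiv> \<lambda>i. snd (C i) ` (V i - (\<Union>j<i. V j))" and "n \<equiv> (CARD('m) - j) div 2"
    and "J \<equiv> \<lambda>i. L2_space.field_jet (count_space {..<k}) (\<lambda>u. h (param (C i) u))"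
  assumes int: "\<And>i. i < N \<Longrightarrow> set_integrable lborel (E i) (\<lambda>u. gauss_trace n (J i u) * sqrt (det (fst (J i u))))"
  shows "LKC_submanifold TYPE('m) k (h ` topspace M) j = (if even (CARD('m) - j) then inverse ((- 2 * pi) ^ n) / fact n *
     (\<Sum>i<N. LINT u:E i|lborel. gauss_trace n (J i u) * sqrt (det (fst (J i u)))) else 0)"
proof -
  let ?S = "h ` topspace M" and ?C = "\<lambda>i. push_chart M h (C i)" and ?V = "\<lambda>i. h ` V i"
  let ?A = "submanifold_atlas k ?S :: (nat \<Rightarrow> real, 'm) chart set"
  have VM: "V i \<subseteq> topspace M" if "i < N" for i using V(1)[OF that] by (rule openin_subset)
  have CA: "?C i \<in> ?A" if "i < N" for i by (rule push_chart_in_atlas[OF C[OF that]])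
  have fC: "fst (?C i) = h ` fst (C i)" for i by (simp add: push_chart_def)
  have "(\<Union>i<N. ?V i) = h ` (\<Union>i<N. V i)" by (simp only: image_UN)
  then have cov: "(\<Union>i<N. ?V i) = topspace XS" by (simp only: topspace_XS cover)
  have "(\<Union>c\<in>?A. fst c) = topspace XS"
  proof
    show "(\<Union>c\<in>?A. fst c) \<subseteq> topspace XS" by (rule UN_least) (rule chart_subset[OF submanifold_chart])
    show "topspace XS \<subseteq> (\<Union>c\<in>?A. fst c)" unfolding cov[symmetric]
    proof (rule UN_least)
      fix i assume "i \<in> {..<N}"
      then have i: "i < N" by simp
      have "?V i \<subseteq> fst (?C i)" unfolding fC using V(2)[OF i] by (rule image_mono)
      also have "\<dots> \<subseteq> (\<Union>c\<in>?A. fst c)" using CA[OF i] by (rule UN_upper)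
      finally show "?V i \<subseteq> (\<Union>c\<in>?A. fst c)" .
    qed
  qed
  then interpret S: L2_manifold "count_space {..<k}" UNIV XS ?A "induced_metric k ?A" "\<lambda>x. x"
    by (rule L2_manifold_submanifold)
  have EE: "snd (?C i) ` (?V i - (\<Union>j<i. ?V j)) = E i" if i: "i < N" for i
  proof -
    have "?V i - (\<Union>j<i. ?V j) = h ` (V i - (\<Union>j<i. V j))"
    proof -
      have "(\<Union>j<i. V j) \<subseteq> topspace M" using VM i by (meson UN_least lessThan_iff less_trans)
      then show ?thesis
        using inj_on_image_set_diff[OF embedding_inj, of "V i" "\<Union>j<i. V j"] VM[OF i] by (auto simp: image_UN)
    qed
    moreover have "V i - (\<Union>j<i. V j) \<subseteq> topspace M" using VM[OF i] by blast
    ultimately show ?thesis unfolding E_def by (simp only: push_chart_image)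
  qed
  have sub: "E i \<subseteq> snd (C i) ` fst (C i)" if "i < N" for i using V(2)[OF that] by (auto simp: E_def)
  have jet: "S.jet (?C i) u = J i u" if i: "i < N" and u: "u \<in> E i" for i u
    unfolding S.jet_field_jet J_def
    by (rule S.field_jet_cong[OF chart_open_range[OF charts[OF C[OF i]]]])
      (use sub[OF i] u param_push[OF C[OF i]] in auto)
  have int': "set_integrable lborel (snd (?C i) ` (?V i - (\<Union>j<i. ?V j)))
     (\<lambda>u. gauss_trace ((CARD('m) - j) div 2) (S.jet (?C i) u) * sqrt (det (fst (S.jet (?C i) u))))" if i: "i < N" for i
    using int[OF i] unfolding EE[OF i] set_integrable_def n_def
  proof (rule Bochner_Integration.integrable_cong[THEN iffD1, rotated 2])
    fix u
    show "indicator (E i) u *\<^sub>R (gauss_trace ((CARD('m) - j) div 2) (J i u) * sqrt (det (fst (J i u))))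
      = indicator (E i) u *\<^sub>R (gauss_trace ((CARD('m) - j) div 2) (S.jet (?C i) u) * sqrt (det (fst (S.jet (?C i) u))))"
      using jet[OF i, of u] by (cases "u \<in> E i") auto
  qed simp
  have "LKC XS ?A (induced_metric k ?A) j = (if even (CARD('m) - j) then inverse ((- 2 * pi) ^ n) / fact n *
     (\<Sum>i<N. LINT u:snd (?C i) ` (?V i - (\<Union>j<i. ?V j))|lborel. gauss_trace n (S.jet (?C i) u) * sqrt (det (fst (S.jet (?C i) u)))) else 0)"
    unfolding n_def
  proof (rule S.LKC_jet[of N ?C ?V j, OF CA _ _ cov int'])
    show "openin XS (?V i)" if "i < N" for i by (rule openin_push[OF V(1)[OF that]])
    show "?V i \<subseteq> fst (?C i)" if "i < N" for i using V(2)[OF that] by (auto simp: fC)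
  qed
  also have "(\<Sum>i<N. LINT u:snd (?C i) ` (?V i - (\<Union>j<i. ?V j))|lborel. gauss_trace n (S.jet (?C i) u) * sqrt (det (fst (S.jet (?C i) u))))
    = (\<Sum>i<N. LINT u:E i|lborel. gauss_trace n (J i u) * sqrt (det (fst (J i u))))"
  proof (rule sum.cong[OF refl])
    fix i assume "i \<in> {..<N}"
    then have i: "i < N" by simp
    show "(LINT u:snd (?C i) ` (?V i - (\<Union>j<i. ?V j))|lborel. gauss_trace n (S.jet (?C i) u) * sqrt (det (fst (S.jet (?C i) u))))
      = (LINT u:E i|lborel. gauss_trace n (J i u) * sqrt (det (fst (J i u))))"
      unfolding EE[OF i] set_lebesgue_integral_def
    proof (rule Bochner_Integration.integral_cong[OF refl])
      fix u
      show "indicator (E i) u *\<^sub>R (gauss_trace n (S.jet (?C i) u) * sqrt (det (fst (S.jet (?C i) u))))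
        = indicator (E i) u *\<^sub>R (gauss_trace n (J i u) * sqrt (det (fst (J i u))))"
        using jet[OF i, of u] by (cases "u \<in> E i") auto
    qed
  qed
  finally show ?thesis unfolding LKC_submanifold_def Let_def .
qed

end

section \<open>The manifold of the Gaussian process\<close>

primrec partials :: "'m::finite list \<Rightarrow> (real^'m \<Rightarrow> real) \<Rightarrow> real^'m \<Rightarrow> real" where
  "partials [] f = f"
| "partials (i # \<alpha>) f = partial i (partials \<alpha> f)"

lemma Ck_on_partials: "Ck_on (k + length \<alpha>) f U \<Longrightarrow> Ck_on k (partials \<alpha> f) U"
proof (induction \<alpha> arbitrary: k)
  case (Cons i \<alpha>)
  have "Ck_on (Suc k) (partials \<alpha> f) U" by (rule Cons.IH) (use Cons.prems in \<open>simp del: Ck_on.simps\<close>)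
  then show ?case unfolding partials.simps by (rule Ck_on_partial)
qed (simp del: Ck_on.simps)

lemma partials_cong:
  assumes "open U" "\<And>w. w \<in> U \<Longrightarrow> f w = g w" "u \<in> U"
  shows "partials \<alpha> f u = partials \<alpha> g u"
  using assms(3)
proof (induction \<alpha> arbitrary: u)
  case (Cons i \<alpha>)
  show ?case unfolding partials.simps by (rule partial_cong_open[OF assms(1) Cons.prems Cons.IH])
qed (simp add: assms(2))

lemma partials_cmult:
  assumes U: "open U" and "Ck_on (length \<alpha>) f U" "u \<in> U"
  shows "partials \<alpha> (\<lambda>v. c * f v) u = c * partials \<alpha> f u"
  using assms(2,3)
proof (induction \<alpha> arbitrary: u)
  case (Cons i \<alpha>)
  have C: "Ck_on (length \<alpha>) f U" using Cons.prems(1) by (rule Ck_on_mono) simp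
  have "Ck_on 1 (partials \<alpha> f) U" by (rule Ck_on_partials) (use Cons.prems(1) in \<open>simp del: Ck_on.simps\<close>)
  then have d: "partials \<alpha> f differentiable (at u)" by (rule Ck_on_differentiable[OF _ _ Cons.prems(2)]) simp
  have "partials (i # \<alpha>) (\<lambda>v. c * f v) u = partial i (\<lambda>v. c * partials \<alpha> f v) u"
    unfolding partials.simps by (rule partial_cong_open[OF U Cons.prems(2) Cons.IH[OF C]])
  also have "\<dots> = c * partial i (partials \<alpha> f) u"
    unfolding partial_def[of i "partials \<alpha> f"]
    by (rule has_derivative_partial[OF has_derivative_mult_right]) (use d in \<open>simp add: frechet_derivative_works\<close>)
  finally show ?case by simp
qed simp

text \<open>Limits of difference quotients are measurable functions of the path, which partial derivatives
  of the path are not; the two agree on smooth paths.\<close>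

definition diff_quot_lim :: "'m::finite \<Rightarrow> (real^'m \<Rightarrow> 'x \<Rightarrow> real) \<Rightarrow> real^'m \<Rightarrow> 'x \<Rightarrow> real" where
  "diff_quot_lim i \<phi> u p = lim (\<lambda>n. real (Suc n) * (\<phi> (u + inverse (real (Suc n)) *\<^sub>R axis i 1) p - \<phi> u p))"

primrec diff_quot_lims :: "'m::finite list \<Rightarrow> (real^'m \<Rightarrow> 'x \<Rightarrow> real) \<Rightarrow> real^'m \<Rightarrow> 'x \<Rightarrow> real" where
  "diff_quot_lims [] \<phi> = \<phi>"
| "diff_quot_lims (i # \<alpha>) \<phi> = diff_quot_lim i (diff_quot_lims \<alpha> \<phi>)"

lemma diff_quot_lim_partial:
  assumes "(\<lambda>v. \<phi> v p) differentiable (at u)"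
  shows "diff_quot_lim i \<phi> u p = partial i (\<lambda>v. \<phi> v p) u"
proof -
  let ?f = "\<lambda>v. \<phi> v p"
  have "((\<lambda>s. ?f (u + s *\<^sub>R axis i 1)) has_real_derivative partial i ?f u) (at 0)"
    using partial_along_line[of ?f u 0 i] assms by simp
  then have "((\<lambda>h. (?f (u + (0 + h) *\<^sub>R axis i 1) - ?f (u + 0 *\<^sub>R axis i 1)) / h) \<longlongrightarrow> partial i ?f u) (at 0)"
    by (rule DERIV_D)
  then have "(\<lambda>n. (?f (u + (0 + inverse (real (Suc n))) *\<^sub>R axis i 1) - ?f (u + 0 *\<^sub>R axis i 1)) / inverse (real (Suc n)))
     \<longlonglongrightarrow> partial i ?f u"
    unfolding tendsto_at_iff_sequentially comp_def by (elim allE impE) (use LIMSEQ_inverse_real_of_nat in auto)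
  then have "(\<lambda>n. real (Suc n) * (?f (u + inverse (real (Suc n)) *\<^sub>R axis i 1) - ?f u)) \<longlonglongrightarrow> partial i ?f u"
    by (simp add: field_simps)
  then show ?thesis unfolding diff_quot_lim_def by (rule limI)
qed

lemma diff_quot_lims_measurable:
  "(\<And>u. \<phi> u \<in> borel_measurable N) \<Longrightarrow> diff_quot_lims \<alpha> \<phi> u \<in> borel_measurable N"
proof (induction \<alpha> arbitrary: u)
  case (Cons i \<alpha>)
  note [measurable] = Cons.IH[OF Cons.prems]
  show ?case unfolding diff_quot_lims.simps diff_quot_lim_def[abs_def] by measurable
qed simp

lemma diff_quot_lims_partials:
  assumes U: "open U" and "Ck_on (length \<alpha>) (\<lambda>v. \<phi> v p) U" "u \<in> U"
  shows "diff_quot_lims \<alpha> \<phi> u p = partials \<alpha> (\<lambda>v. \<phi> v p) u"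
  using assms(2,3)
proof (induction \<alpha> arbitrary: u)
  case (Cons i \<alpha>)
  have C: "Ck_on (length \<alpha>) (\<lambda>v. \<phi> v p) U" using Cons.prems(1) by (rule Ck_on_mono) simp
  note IH = Cons.IH[OF C]
  have "Ck_on 1 (partials \<alpha> (\<lambda>v. \<phi> v p)) U" by (rule Ck_on_partials) (use Cons.prems(1) in \<open>simp del: Ck_on.simps\<close>)
  then have d: "partials \<alpha> (\<lambda>v. \<phi> v p) differentiable (at u)" by (rule Ck_on_differentiable[OF _ _ Cons.prems(2)]) simp
  have "(\<lambda>v. diff_quot_lims \<alpha> \<phi> v p) differentiable (at u)"
    by (rule differentiable_cong_open[OF U Cons.prems(2) IH[symmetric] d])
  then have "diff_quot_lims (i # \<alpha>) \<phi> u p = partial i (\<lambda>v. diff_quot_lims \<alpha> \<phi> v p) u" unfolding diff_quot_lims.simps by (rule diff_quot_lim_partial)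
  also have "\<dots> = partials (i # \<alpha>) (\<lambda>v. \<phi> v p) u"
    unfolding partials.simps by (rule partial_cong_open[OF U Cons.prems(2) IH])
  finally show ?case .
qed simp

definition fpartials :: "'m::finite list \<Rightarrow> (real^'m \<Rightarrow> 'w \<Rightarrow> real) \<Rightarrow> real^'m \<Rightarrow> 'w \<Rightarrow> real" where
  "fpartials \<alpha> \<phi> u = (\<lambda>w. partials \<alpha> (\<lambda>v. \<phi> v w) u)"

lemma (in L2_space) fpartials_simps: "fpartials [] \<phi> = \<phi>" "fpartials (i # \<alpha>) \<phi> = fpartial i (fpartials \<alpha> \<phi>)"
  by (auto simp: fpartials_def fpartial_def fun_eq_iff)

lemma (in L2_space) field_fpartials: "open U \<Longrightarrow> field (k + length \<alpha>) U \<phi> \<Longrightarrow> field k U (fpartials \<alpha> \<phi>)"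
proof (induction \<alpha> arbitrary: k)
  case (Cons i \<alpha>)
  have "field (Suc k) U (fpartials \<alpha> \<phi>)" by (rule Cons.IH[OF Cons.prems(1)]) (use Cons.prems(2) in simp)
  then show ?case unfolding fpartials_simps by (rule field_fpartial[OF Cons.prems(1)])
qed (simp add: fpartials_simps)

text \<open>The product increment is split into two terms, each a factor times an increment. The
  arithmetic-geometric mean inequality is weighted by \<open>r\<close>, the expected size of the
  increments, so that both resulting terms have the same order.\<close>

lemma product_increment_le:
  fixes x y x' y' r :: real
  assumes r: "0 < r"
  shows "\<bar>x * y - x' * y'\<bar> ^ p \<le> 2 ^ p * (r ^ p / 2) *
    ((x ^ (2 * p) + (y - y') ^ (2 * p) / r ^ (2 * p)) + (y' ^ (2 * p) + (x - x') ^ (2 * p) / r ^ (2 * p)))"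
proof -
  have am: "\<bar>a\<bar> ^ p * \<bar>b\<bar> ^ p \<le> (r ^ p / 2) * (a ^ (2 * p) + b ^ (2 * p) / r ^ (2 * p))" for a b :: real
  proof -
    let ?A = "\<bar>a\<bar> ^ p" and ?B = "\<bar>b\<bar> ^ p / r ^ p"
    have "0 \<le> (?A - ?B)\<^sup>2" by simp
    then have "?A * ?B \<le> (?A\<^sup>2 + ?B\<^sup>2) / 2" by (simp add: power2_eq_square algebra_simps)
    moreover have "?A\<^sup>2 = a ^ (2 * p)" "?B\<^sup>2 = b ^ (2 * p) / r ^ (2 * p)"
      by (simp_all add: power_divide power_mult[symmetric] mult.commute[of p] power_even_abs)
    ultimately have "r ^ p * (?A * ?B) \<le> r ^ p * ((a ^ (2 * p) + b ^ (2 * p) / r ^ (2 * p)) / 2)"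
      using r by (intro mult_left_mono) auto
    then show ?thesis using r by simp
  qed
  let ?a = "\<bar>x\<bar> * \<bar>y - y'\<bar>" and ?b = "\<bar>y'\<bar> * \<bar>x - x'\<bar>"
  have "x * y - x' * y' = x * (y - y') + y' * (x - x')" by (simp add: algebra_simps)
  then have "\<bar>x * y - x' * y'\<bar> \<le> ?a + ?b" by (metis abs_triangle_ineq abs_mult)
  also have "\<dots> \<le> 2 * max ?a ?b" by linarith
  finally have "\<bar>x * y - x' * y'\<bar> ^ p \<le> (2 * max ?a ?b) ^ p" by (rule power_mono) simp
  also have "\<dots> = 2 ^ p * (max ?a ?b) ^ p" by (simp add: power_mult_distrib)
  also have "\<dots> \<le> 2 ^ p * (?a ^ p + ?b ^ p)" by (intro mult_left_mono) (auto simp: max_def)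
  also have "\<dots> \<le> 2 ^ p * ((r ^ p / 2) * (x ^ (2 * p) + (y - y') ^ (2 * p) / r ^ (2 * p)) +
     (r ^ p / 2) * (y' ^ (2 * p) + (x - x') ^ (2 * p) / r ^ (2 * p)))"
    unfolding power_mult_distrib by (intro mult_left_mono add_mono am) simp
  finally show ?thesis by (simp only: distrib_left mult.assoc)
qed

context gaussian_family
begin

lemma gclosure_moment_le:
  assumes "X \<in> gclosure" "ip X X \<le> B"
  shows "(\<integral>w. X w ^ (2 * q) \<partial>M) \<le> B ^ q * (fact (2 * q) / (2 ^ q * fact q))"
  unfolding gclosure_moment(2)[OF assms(1)]
  by (intro mult_right_mono power_mono assms(2) ip_nonneg) auto

text \<open>For normal variables the even moments are powers of the variance times
  \<open>fact (2 * p) / (2 ^ p * fact p)\<close>, so variance bounds on the factors and their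
  increments control every moment. The constant collects four equal terms and the factor
  \<open>2 ^ p / 2\<close> from \<open>product_increment_le\<close>.\<close>

lemma product_increment_moment:
  assumes L: "X \<in> gclosure" "X' \<in> gclosure" "Y \<in> gclosure" "Y' \<in> gclosure" and r: "0 < r"
    and b: "ip X X \<le> B" "ip Y' Y' \<le> B" "ip (\<lambda>w. X w - X' w) (\<lambda>w. X w - X' w) \<le> B * r\<^sup>2"
      "ip (\<lambda>w. Y w - Y' w) (\<lambda>w. Y w - Y' w) \<le> B * r\<^sup>2"
  shows "integrable M (\<lambda>w. \<bar>X w * Y w - X' w * Y' w\<bar> ^ p)"
    and "(\<integral>w. \<bar>X w * Y w - X' w * Y' w\<bar> ^ p \<partial>M) \<le> 2 ^ p * 2 * B ^ p * (fact (2 * p) / (2 ^ p * fact p)) * r ^ p"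
proof -
  let ?c = "fact (2 * p) / (2 ^ p * fact p) :: real"
  let ?D = "\<lambda>w. 2 ^ p * (r ^ p / 2) *
    ((X w ^ (2 * p) + (Y w - Y' w) ^ (2 * p) / r ^ (2 * p)) + (Y' w ^ (2 * p) + (X w - X' w) ^ (2 * p) / r ^ (2 * p)))"
  note dL = L_diff[OF L(1,2)] L_diff[OF L(3,4)]
  note i = gclosure_moment(1)[OF L(1)] gclosure_moment(1)[OF L(4)] gclosure_moment(1)[OF dL(1)] gclosure_moment(1)[OF dL(2)]
  have D: "integrable M ?D"
    by (intro integrable_mult_right Bochner_Integration.integrable_add integrable_divide i)
  note [measurable] = L[THEN L_meas]
  show int: "integrable M (\<lambda>w. \<bar>X w * Y w - X' w * Y' w\<bar> ^ p)"
  proof (rule Bochner_Integration.integrable_bound[OF D _ AE_I2])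
    fix w
    have "norm (\<bar>X w * Y w - X' w * Y' w\<bar> ^ p) = \<bar>X w * Y w - X' w * Y' w\<bar> ^ p" by simp
    also have "\<dots> \<le> ?D w" by (rule product_increment_le[OF r])
    also have "\<dots> \<le> norm (?D w)" unfolding real_norm_def by (rule abs_ge_self)
    finally show "norm (\<bar>X w * Y w - X' w * Y' w\<bar> ^ p) \<le> norm (?D w)" .
  qed measurable
  have m: "(\<integral>w. (X w - X' w) ^ (2 * p) \<partial>M) / r ^ (2 * p) \<le> B ^ p * ?c"
     "(\<integral>w. (Y w - Y' w) ^ (2 * p) \<partial>M) / r ^ (2 * p) \<le> B ^ p * ?c"
    using gclosure_moment_le[OF dL(1) b(3), of p] gclosure_moment_le[OF dL(2) b(4), of p] r
    by (simp_all add: divide_le_eq power_mult_distrib power_mult[symmetric] mult_ac)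
  have "(\<integral>w. \<bar>X w * Y w - X' w * Y' w\<bar> ^ p \<partial>M) \<le> (\<integral>w. ?D w \<partial>M)"
    by (rule integral_mono[OF int D product_increment_le[OF r]])
  also have "\<dots> = 2 ^ p * (r ^ p / 2) *
    (((\<integral>w. X w ^ (2 * p) \<partial>M) + (\<integral>w. (Y w - Y' w) ^ (2 * p) \<partial>M) / r ^ (2 * p)) +
     ((\<integral>w. Y' w ^ (2 * p) \<partial>M) + (\<integral>w. (X w - X' w) ^ (2 * p) \<partial>M) / r ^ (2 * p)))"
    using i by (simp add: Bochner_Integration.integral_add)
  also have "\<dots> \<le> 2 ^ p * (r ^ p / 2) * ((B ^ p * ?c + B ^ p * ?c) + (B ^ p * ?c + B ^ p * ?c))"
    using r by (intro mult_left_mono add_mono gclosure_moment_le L b m) auto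
  finally show "(\<integral>w. \<bar>X w * Y w - X' w * Y' w\<bar> ^ p \<partial>M) \<le> 2 ^ p * 2 * B ^ p * ?c * r ^ p" by (simp add: mult_ac)
qed

text \<open>The product is dominated by the mean of the eighth powers, whose constant is the eighth
  moment of the standard normal distribution.\<close>

lemma product_fourth_moment:
  assumes L: "X \<in> gclosure" "Y \<in> gclosure" and b: "ip X X \<le> B" "ip Y Y \<le> B"
  shows "integrable M (\<lambda>w. (X w * Y w) ^ 4)"
    and "(\<integral>w. (X w * Y w) ^ 4 \<partial>M) \<le> B ^ 4 * (fact 8 / (2 ^ 4 * fact 4))"
proof -
  note i = gclosure_moment(1)[OF L(1), of 8] gclosure_moment(1)[OF L(2), of 8]
  have le: "(x * y) ^ 4 \<le> (x ^ 8 + y ^ 8) / 2" for x y :: real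
  proof -
    have "0 \<le> (x ^ 4 - y ^ 4)\<^sup>2" by simp
    then show ?thesis by (simp add: power2_eq_square algebra_simps power_mult_distrib flip: power_add)
  qed
  have D: "integrable M (\<lambda>w. (X w ^ 8 + Y w ^ 8) / 2)"
    by (intro integrable_divide Bochner_Integration.integrable_add i)
  note [measurable] = L[THEN L_meas]
  show int: "integrable M (\<lambda>w. (X w * Y w) ^ 4)"
    by (rule Bochner_Integration.integrable_bound[OF D]) (use le in \<open>auto simp: zero_le_even_power intro: order_trans\<close>)
  have "(\<integral>w. (X w * Y w) ^ 4 \<partial>M) \<le> (\<integral>w. (X w ^ 8 + Y w ^ 8) / 2 \<partial>M)" by (rule integral_mono[OF int D le])
  also have "\<dots> = ((\<integral>w. X w ^ 8 \<partial>M) + (\<integral>w. Y w ^ 8 \<partial>M)) / 2" using i by simp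
  also have "\<dots> \<le> B ^ 4 * (fact 8 / (2 ^ 4 * fact 4))"
  proof -
    have h: "2 * 4 = (8::nat)" by simp
    have mean: "(x + y) / 2 \<le> z" if "x \<le> z" "y \<le> z" for x y z :: real using that by simp
    show ?thesis
      by (rule mean) (use gclosure_moment_le[OF L(1) b(1), of 4] gclosure_moment_le[OF L(2) b(2), of 4] in \<open>unfold h\<close>)
  qed
  finally show "(\<integral>w. (X w * Y w) ^ 4 \<partial>M) \<le> B ^ 4 * (fact 8 / (2 ^ 4 * fact 4))" .
qed

end

locale gaussian_manifold =
  fixes M :: "'a topology" and A :: "('a, 'm::finite) chart set" and g :: "('a, 'm) metric_tensor"
    and P :: "'v measure" and f :: "'a \<Rightarrow> 'v \<Rightarrow> real"
  assumes C3_mfd: "C3_manifold M A" and riem: "riemannian_metric M A g" and prob_P: "prob_space P"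
    and process: "gaussian_process P (topspace M) f"
    and mean: "\<And>x. x \<in> topspace M \<Longrightarrow> (\<integral>\<omega>. f x \<omega> \<partial>P) = 0"
    and paths: "AE \<omega> in P. C3_fun A (\<lambda>x. f x \<omega>)"
    and induces: "induces_metric P M A f g"
begin

text \<open>Gaussianity is assumed only for combinations of point values. Derivatives of the process
  enter through the closure of this space under almost sure limits.\<close>

definition combinations :: "('v \<Rightarrow> real) set" where
  "combinations = {X. \<exists>J a. finite J \<and> J \<subseteq> topspace M \<and> X = (\<lambda>\<omega>. \<Sum>x\<in>J. a x * f x \<omega>)}"

lemma point_in_combinations: "x \<in> topspace M \<Longrightarrow> f x \<in> combinations"
  unfolding combinations_def by (auto intro!: exI[of _ "{x}"] exI[of _ "\<lambda>_. 1"])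

lemma combination_gaussian: "X \<in> combinations \<Longrightarrow> gaussian_rv P X"
  using process unfolding combinations_def gaussian_process_def by blast

lemma point_integrable:
  assumes "x \<in> topspace M" shows "integrable P (f x)"
proof -
  interpret prob_space P by (rule prob_P)
  show ?thesis by (rule gaussian_rv_centered_normal(1)[OF combination_gaussian[OF point_in_combinations[OF assms]] mean[OF assms]])
qed

lemma combination_mean: "X \<in> combinations \<Longrightarrow> (\<integral>\<omega>. X \<omega> \<partial>P) = 0"
  unfolding combinations_def using point_integrable mean by (auto simp: subset_iff)

lemma combination_normal: "X \<in> combinations \<Longrightarrow> \<exists>s. centered_normal (completion P) s X"
proof -
  interpret prob_space P by (rule prob_P)
  assume X: "X \<in> combinations"
  obtain s where s: "centered_normal P s X"
    using gaussian_rv_centered_normal(2)[OF combination_gaussian[OF X] combination_mean[OF X]] by blast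
  then have [measurable]: "X \<in> borel_measurable P" by (simp add: centered_normal_def)
  have "(CLINT w|completion P. iexp (t * X w)) = (CLINT w|P. iexp (t * X w))" for t
    by (rule integral_completion) measurable
  then have "centered_normal (completion P) s X"
    using s unfolding centered_normal_def by (simp only: measurable_completion simp_thms)
  then show ?thesis by blast
qed

lemma combinations_lin:
  assumes "X \<in> combinations" "Y \<in> combinations"
  shows "(\<lambda>w. a * X w + b * Y w) \<in> combinations"
proof -
  obtain J c K d where J: "finite J" "J \<subseteq> topspace M" "X = (\<lambda>w. \<Sum>x\<in>J. c x * f x w)"
    and K: "finite K" "K \<subseteq> topspace M" "Y = (\<lambda>w. \<Sum>x\<in>K. d x * f x w)"
    using assms unfolding combinations_def by blast
  have ext: "(\<Sum>x\<in>S. e x * f x w) = (\<Sum>x\<in>J \<union> K. (if x \<in> S then e x else 0) * f x w)" if "S \<subseteq> J \<union> K" for S e w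
    using that J(1) K(1) by (intro sum.mono_neutral_cong_left) auto
  let ?e = "\<lambda>x. a * (if x \<in> J then c x else 0) + b * (if x \<in> K then d x else 0)"
  have "a * X w + b * Y w = (\<Sum>x\<in>J \<union> K. ?e x * f x w)" for w
    unfolding J(3) K(3) ext[OF Un_upper1] ext[OF Un_upper2] sum_distrib_left sum.distrib[symmetric]
    by (rule sum.cong) (simp_all add: algebra_simps)
  then show ?thesis unfolding combinations_def using J K
    by (auto intro!: exI[of _ "J \<union> K"] exI[of _ ?e])
qed

sublocale gaussian_family "completion P" combinations
proof (intro gaussian_family.intro complete_prob_space.intro gaussian_family_axioms.intro)
  show "prob_space (completion P)" by (rule prob_space.prob_space_completion[OF prob_P])
  show "complete_measure (completion P)" by (rule completion.complete_measure_axioms)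
  show "(\<lambda>_. 0) \<in> combinations" unfolding combinations_def by (auto intro!: exI[of _ "{}"])
qed (use combinations_lin combination_normal in auto)

lemma atlas:
  shows charts: "c \<in> A \<Longrightarrow> chart_of M c" and covers: "(\<Union>c\<in>A. fst c) = topspace M"
    and trans: "c \<in> A \<Longrightarrow> c' \<in> A \<Longrightarrow> twice_differentiable_on (transition c c') (snd c ` (fst c \<inter> fst c'))"
proof -
  have A: "C3_atlas M A" using C3_mfd by (simp add: C3_manifold_def)
  then show "c \<in> A \<Longrightarrow> chart_of M c" "(\<Union>c\<in>A. fst c) = topspace M" by (auto simp: C3_atlas_def)
  assume "c \<in> A" "c' \<in> A"
  then have "Ck_on 3 (transition c c') (snd c ` (fst c \<inter> fst c'))" using A by (auto simp: C3_atlas_def)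
  then have "Ck_on 2 (transition c c') (snd c ` (fst c \<inter> fst c'))" by (rule Ck_on_mono) simp
  then show "twice_differentiable_on (transition c c') (snd c ` (fst c \<inter> fst c'))" by (rule Ck_on_twice_differentiable)
qed

lemma trans_diff: "c \<in> A \<Longrightarrow> c' \<in> A \<Longrightarrow> u \<in> snd c ` (fst c \<inter> fst c') \<Longrightarrow> transition c c' differentiable (at u)"
  using trans unfolding twice_differentiable_on_def by blast

lemma param_topspace: "c \<in> A \<Longrightarrow> u \<in> snd c ` fst c \<Longrightarrow> param c u \<in> topspace M"
  using param_in[OF charts] chart_subset[OF charts] by blast

abbreviation chart_field :: "('a, 'm) chart \<Rightarrow> real^'m \<Rightarrow> 'v \<Rightarrow> real" where
  "chart_field c \<equiv> \<lambda>u. f (param c u)"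

lemma field_chart:
  assumes c: "c \<in> A" shows "field 3 (snd c ` fst c) (chart_field c)"
  unfolding field_def
proof (intro conjI ballI)
  show "chart_field c u \<in> gclosure" if "u \<in> snd c ` fst c" for u
    by (rule L0_gclosure[OF point_in_combinations[OF param_topspace[OF c that]]])
  show "AE w in completion P. Ck_on 3 (\<lambda>u. f (param c u) w) (snd c ` fst c)"
    using AE_completion[OF paths] by eventually_elim (use c in \<open>auto simp: C3_fun_def comp_def simp del: Ck_on.simps\<close>)
qed

text \<open>The derivative along a tangent vector is known to be measurable only because it agrees
  almost surely with \<open>tang\<close>, a member of the closed space, and the measure has been
  completed.\<close>

lemma metric_tangent_of:
  assumes c: "c \<in> A" and u: "u \<in> snd c ` fst c"
  shows "g (param c u) (tangent_of A (param c u) c v) (tangent_of A (param c u) c w)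
    = ip (tang (chart_field c) u v) (tang (chart_field c) u w)"
proof -
  let ?x = "param c u" and ?T = "tangent_of A (param c u) c"
  note ch = charts[OF c]
  have U: "open (snd c ` fst c)" by (rule chart_open_range[OF ch])
  have cx: "c \<in> charts_at A ?x" using c param_in[OF ch u] by (simp add: charts_at_def)
  have T: "?T y \<in> tangent_space A ?x" for y by (rule tangent_of_in[OF charts trans_diff cx])
  have ae: "AE \<omega> in completion P. tangent_deriv A ?x (?T y) (\<lambda>z. f z \<omega>) = tang (chart_field c) u y \<omega>" for y
    using AE_completion[OF paths]
  proof eventually_elim
    fix \<omega> assume p: "C3_fun A (\<lambda>x. f x \<omega>)"
    have "(\<lambda>u. f (param c0 u) \<omega>) differentiable (at (snd c0 ?x))" if "c0 \<in> charts_at A ?x" for c0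
    proof (rule Ck_on_differentiable[of 3])
      show "Ck_on 3 (\<lambda>u. f (param c0 u) \<omega>) (snd c0 ` fst c0)"
        using p that by (simp add: C3_fun_def charts_at_def comp_def del: Ck_on.simps)
    qed (use that in \<open>auto simp: charts_at_def\<close>)
    from tangent_deriv_chart[OF charts trans_diff T cx this, of y]
    show "tangent_deriv A ?x (?T y) (\<lambda>z. f z \<omega>) = tang (chart_field c) u y \<omega>"
      by (simp add: tangent_of_self[OF charts trans_diff cx] chart_param[OF ch u] tang_def fpartial_def)
  qed
  have m[measurable]: "tang (chart_field c) u y \<in> borel_measurable (completion P)" for y
    by (rule L_meas[OF tang_L[OF U u field_chart[OF c]]])
  have [measurable]: "(\<lambda>\<omega>. tangent_deriv A ?x (?T y) (\<lambda>z. f z \<omega>)) \<in> borel_measurable (completion P)" for y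
    by (rule completion.borel_measurable_AE_lim[where Xs = "\<lambda>_. tang (chart_field c) u y"], rule m)
      (use ae[of y] in \<open>auto elim!: eventually_mono\<close>)
  have "g ?x (?T v) (?T w) = (\<integral>\<omega>. tangent_deriv A ?x (?T v) (\<lambda>y. f y \<omega>) * tangent_deriv A ?x (?T w) (\<lambda>y. f y \<omega>) \<partial>completion P)"
    using induces T param_topspace[OF c u] unfolding induces_metric_def by blast
  also have "\<dots> = ip (tang (chart_field c) u v) (tang (chart_field c) u w)"
    unfolding ip_def
  proof (rule integral_cong_AE)
    show "AE \<omega> in completion P. tangent_deriv A ?x (?T v) (\<lambda>y. f y \<omega>) * tangent_deriv A ?x (?T w) (\<lambda>y. f y \<omega>)
      = tang (chart_field c) u v \<omega> * tang (chart_field c) u w \<omega>"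
      using ae[of v] ae[of w] by eventually_elim simp
  qed measurable
  finally show ?thesis .
qed

text \<open>The metric coefficients are identified through \<open>induces_metric\<close>; positivity
  of the Gram matrix is inherited from \<open>g\<close> being a Riemannian metric.\<close>

sublocale mfd: L2_manifold "completion P" gclosure M A g f
proof (intro L2_manifold.intro L2_manifold_axioms.intro)
  show "L2_space (completion P) gclosure" ..
  fix c u assume c: "c \<in> A" and u: "u \<in> snd c ` fst c"
  note ch = charts[OF c]
  have U: "open (snd c ` fst c)" by (rule chart_open_range[OF ch])
  have "tang (chart_field c) u (axis i 1) = fpartial i (chart_field c) u" for i
    by (simp add: tang_def fun_eq_iff axis_def if_distrib[where f = "\<lambda>z. z * _"] cong: if_cong)
  then show "metric_coeff A g c u = G_of (chart_field c) u"
    by (simp add: metric_coeff_def G_of_def coord_vector_tangent_of metric_tangent_of[OF c u])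
  show "pos_def (G_of (chart_field c) u)"
  proof (rule pos_def_G_of[OF U u field_chart[OF c]])
    fix v :: "real^'m" assume v: "v \<noteq> 0"
    let ?x = "param c u"
    have cx: "c \<in> charts_at A ?x" using c param_in[OF ch u] by (simp add: charts_at_def)
    have "tangent_of A ?x c v c = v" by (rule tangent_of_self[OF charts trans_diff cx])
    then have "tangent_of A ?x c v \<noteq> (\<lambda>_. 0)" using v by auto
    moreover have "tangent_of A ?x c v \<in> tangent_space A ?x" by (rule tangent_of_in[OF charts trans_diff cx])
    ultimately have "0 < g ?x (tangent_of A ?x c v) (tangent_of A ?x c v)"
      using riem param_topspace[OF c u] unfolding riemannian_metric_def by blast
    then show "0 < ip (tang (chart_field c) u v) (tang (chart_field c) u v)" by (simp add: metric_tangent_of[OF c u])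
  qed
qed (use charts covers trans field_chart in auto)

section \<open>Derivatives as functionals of the path law\<close>

abbreviation "path_space \<equiv> PiM (topspace M) (\<lambda>_. borel :: real measure)"
abbreviation "path_law \<equiv> distr P path_space (random_path (topspace M) f)"

text \<open>The value 0 outside the coordinate domain makes the field measurable at every
  \<open>u\<close>, as the difference quotient limits and the chaining locale require.\<close>

definition path_field :: "('a, 'm) chart \<Rightarrow> real^'m \<Rightarrow> ('a \<Rightarrow> real) \<Rightarrow> real" where
  "path_field c u p = (if u \<in> snd c ` fst c then p (param c u) else 0)"

lemma path_field_measurable:
  assumes "c \<in> A" shows "path_field c u \<in> borel_measurable path_space"
proof (cases "u \<in> snd c ` fst c")
  case True
  then show ?thesis unfolding path_field_def[abs_def]
    using measurable_component_singleton[OF param_topspace[OF assms True], of "\<lambda>_. borel :: real measure"] by simp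
qed (simp add: path_field_def[abs_def])

lemma diff_quot_lims_random_path:
  assumes "C3_fun A (\<lambda>x. F x w)" and c: "c \<in> A" and u: "u \<in> snd c ` fst c" and "length \<alpha> \<le> 3"
  shows "diff_quot_lims \<alpha> (path_field c) u (random_path (topspace M) F w) = partials \<alpha> (\<lambda>v. F (param c v) w) u"
proof -
  let ?U = "snd c ` fst c" and ?p = "random_path (topspace M) F w"
  have U: "open ?U" by (rule chart_open_range[OF charts[OF c]])
  have eq: "path_field c v ?p = F (param c v) w" if "v \<in> ?U" for v
    using that param_topspace[OF c that] by (simp add: path_field_def random_path_def)
  have "Ck_on 3 (\<lambda>v. F (param c v) w) ?U" using assms(1) c by (simp add: C3_fun_def comp_def del: Ck_on.simps)
  then have "Ck_on 3 (\<lambda>v. path_field c v ?p) ?U" by (subst Ck_on_cong[OF U eq])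
  then have "Ck_on (length \<alpha>) (\<lambda>v. path_field c v ?p) ?U" by (rule Ck_on_mono) (rule assms(4))
  from diff_quot_lims_partials[OF U, where \<phi> = "path_field c" and p = ?p, OF this u] show ?thesis by (simp only: partials_cong[OF U eq u])
qed

lemma random_path_measurable: "random_path (topspace M) f \<in> P \<rightarrow>\<^sub>M path_space"
  unfolding random_path_def[abs_def]
proof (rule measurable_restrict)
  fix x assume "x \<in> topspace M"
  then show "f x \<in> borel_measurable P" by (rule borel_measurable_integrable[OF point_integrable])
qed

text \<open>Carries integrals of derivatives of \<open>f\<close>, which make sense on the completed
  space, to the law of the path. That law is the only thing the copies have in common with
  \<open>f\<close> besides smoothness.\<close>

lemma path_law_transfer:
  fixes G :: "('a \<Rightarrow> real) \<Rightarrow> real" and W :: "'v \<Rightarrow> real"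
  assumes G[measurable]: "G \<in> borel_measurable path_space"
    and ae: "AE \<omega> in completion P. G (random_path (topspace M) f \<omega>) = W \<omega>"
  shows "integrable path_law G \<longleftrightarrow> integrable (completion P) W" "(\<integral>p. G p \<partial>path_law) = (\<integral>\<omega>. W \<omega> \<partial>completion P)"
proof -
  note [measurable] = random_path_measurable
  let ?V = "\<lambda>\<omega>. G (random_path (topspace M) f \<omega>)"
  have V: "?V \<in> borel_measurable P" by measurable
  have V'[measurable]: "?V \<in> borel_measurable (completion P)" by (rule measurable_completion[OF V])
  have [measurable]: "W \<in> borel_measurable (completion P)"
    by (rule completion.borel_measurable_AE_lim[where Xs = "\<lambda>_. ?V"], rule V') (use ae in \<open>auto elim!: eventually_mono\<close>)
  have "integrable path_law G \<longleftrightarrow> integrable (completion P) ?V"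
    by (simp add: integrable_distr_eq integrable_completion V)
  also have "\<dots> \<longleftrightarrow> integrable (completion P) W" by (rule integrable_cong_AE) (use ae in simp_all)
  finally show "integrable path_law G \<longleftrightarrow> integrable (completion P) W" .
  have "(\<integral>p. G p \<partial>path_law) = (\<integral>\<omega>. ?V \<omega> \<partial>completion P)" by (simp add: integral_distr integral_completion V)
  also have "\<dots> = (\<integral>\<omega>. W \<omega> \<partial>completion P)" by (rule integral_cong_AE) (use ae in simp_all)
  finally show "(\<integral>p. G p \<partial>path_law) = (\<integral>\<omega>. W \<omega> \<partial>completion P)" .
qed

definition jet_functional :: "('a, 'm) chart \<Rightarrow> 'm list \<Rightarrow> 'm list \<Rightarrow> real^'m \<Rightarrow> ('a \<Rightarrow> real) \<Rightarrow> real" where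
  "jet_functional c \<alpha> \<beta> u p = diff_quot_lims \<alpha> (path_field c) u p * diff_quot_lims \<beta> (path_field c) u p"

lemma jet_functional_measurable:
  assumes c: "c \<in> A" shows "jet_functional c \<alpha> \<beta> u \<in> borel_measurable path_space"
  unfolding jet_functional_def[abs_def]
  by (intro borel_measurable_times diff_quot_lims_measurable path_field_measurable[OF c])

lemma jet_functional_AE:
  assumes c: "c \<in> A" and u: "u \<in> snd c ` fst c" and "length \<alpha> \<le> 3" "length \<beta> \<le> 3"
  shows "AE \<omega> in completion P. jet_functional c \<alpha> \<beta> u (random_path (topspace M) f \<omega>)
    = fpartials \<alpha> (chart_field c) u \<omega> * fpartials \<beta> (chart_field c) u \<omega>"
  using AE_completion[OF paths]
  by eventually_elim (simp add: jet_functional_def fpartials_def diff_quot_lims_random_path[OF _ c u] assms(3,4))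

lemma jet_functional_mean:
  assumes c: "c \<in> A" and u: "u \<in> snd c ` fst c" and "length \<alpha> \<le> 3" "length \<beta> \<le> 3"
  shows "(\<integral>p. jet_functional c \<alpha> \<beta> u p \<partial>path_law) = ip (fpartials \<alpha> (chart_field c) u) (fpartials \<beta> (chart_field c) u)"
  unfolding ip_def by (rule path_law_transfer(2)[OF jet_functional_measurable[OF c] jet_functional_AE[OF assms]])

lemma field_fpartials_chart:
  assumes "c \<in> A" "k + length \<alpha> \<le> 3" shows "field k (snd c ` fst c) (fpartials \<alpha> (chart_field c))"
  by (rule field_fpartials[OF chart_open_range[OF charts[OF assms(1)]] field_mono[OF field_chart[OF assms(1)] assms(2)]])

text \<open>Variances of derivatives are continuous, hence bounded on compact sets; there are only
  finitely many index lists of length at most 3, so one bound serves all.\<close>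

lemma fpartials_bounded:
  assumes c: "c \<in> A" and K: "compact K" "K \<subseteq> snd c ` fst c"
  shows "\<exists>b. \<forall>\<alpha> u. length \<alpha> \<le> 3 \<longrightarrow> u \<in> K \<longrightarrow> ip (fpartials \<alpha> (chart_field c) u) (fpartials \<alpha> (chart_field c) u) \<le> b"
proof -
  have "\<exists>b. \<forall>u\<in>K. ip (fpartials \<alpha> (chart_field c) u) (fpartials \<alpha> (chart_field c) u) \<le> b" if "length \<alpha> \<le> 3" for \<alpha>
  proof -
    have "field 0 (snd c ` fst c) (fpartials \<alpha> (chart_field c))" by (rule field_fpartials_chart[OF c]) (use that in simp)
    from ip_continuous_on[OF this this]
    have "continuous_on K (\<lambda>u. ip (fpartials \<alpha> (chart_field c) u) (fpartials \<alpha> (chart_field c) u))"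
      by (rule continuous_on_subset) (rule K(2))
    from compact_imp_bounded[OF compact_continuous_image[OF this K(1)]] show ?thesis
      unfolding bounded_iff by (auto intro: abs_le_D1)
  qed
  then obtain b where b: "\<And>\<alpha> u. length \<alpha> \<le> 3 \<Longrightarrow> u \<in> K \<Longrightarrow> ip (fpartials \<alpha> (chart_field c) u) (fpartials \<alpha> (chart_field c) u) \<le> b \<alpha>"
    by metis
  let ?S = "{\<alpha> :: 'm list. set \<alpha> \<subseteq> UNIV \<and> length \<alpha> \<le> 3}"
  have fin: "finite ?S" by (rule finite_lists_length_le) simp
  have "ip (fpartials \<alpha> (chart_field c) u) (fpartials \<alpha> (chart_field c) u) \<le> (\<Sum>\<alpha>\<in>?S. \<bar>b \<alpha>\<bar>)" if "length \<alpha> \<le> 3" "u \<in> K" for \<alpha> u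
  proof -
    have "\<bar>b \<alpha>\<bar> \<le> (\<Sum>\<alpha>\<in>?S. \<bar>b \<alpha>\<bar>)" by (rule member_le_sum[OF _ _ fin]) (use that in auto)
    then show ?thesis using b[OF that] by linarith
  qed
  then show ?thesis by blast
qed

text \<open>Derivatives of order at most 2 have increments controlled by derivatives of order at
  most 3, via \<open>field_Lipschitz\<close> on the convex closed cube. Gaussian moments then turn
  this mean square estimate into one of order \<open>CARD('m) + 4\<close>.\<close>

theorem jet_functional_chaining:
  fixes a :: "real^'m" and s :: real
  assumes c: "c \<in> A" and s: "0 < s" and K: "cbox a (\<chi> i. a $ i + s) \<subseteq> snd c ` fst c"
    and len: "length \<alpha> \<le> 2" "length \<beta> \<le> 2"
  shows "\<exists>B C. chaining path_law (jet_functional c \<alpha> \<beta>) a s B C (CARD('m) + 4)"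
proof -
  let ?U = "snd c ` fst c" and ?K = "cbox a (\<chi> i. a $ i + s)" and ?F = "\<lambda>\<alpha>. fpartials \<alpha> (chart_field c)"
  have U: "open ?U" by (rule chart_open_range[OF charts[OF c]])
  have cube: "half_open_cube a s \<subseteq> ?K" by (auto simp: half_open_cube_def mem_box_cart less_imp_le)
  have sub: "u \<in> ?U" if "u \<in> half_open_cube a s" for u using that cube K by blast
  obtain b where b: "\<And>\<alpha> u. length \<alpha> \<le> 3 \<Longrightarrow> u \<in> ?K \<Longrightarrow> ip (?F \<alpha> u) (?F \<alpha> u) \<le> b"
    using fpartials_bounded[OF c compact_cbox K] by blast
  \<comment> \<open>\<open>D\<close> is at least 1, so its square dominates \<open>b\<close>. With
    the factor \<open>CARD('m)\<close>, the single constant \<open>B\<close> bounds both the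
    variances and the squared Lipschitz constants of the increments.\<close>
  define D where "D = 1 + \<bar>b\<bar>"
  define B where "B = (real CARD('m) * D)\<^sup>2"
  have D1: "1 \<le> D" by (simp add: D_def)
  have bD: "b \<le> D\<^sup>2"
  proof -
    have "b \<le> D" by (simp add: D_def)
    also have "\<dots> \<le> D\<^sup>2" using self_le_power[OF D1, of 2] by simp
    finally show ?thesis .
  qed
  have "1 \<le> real CARD('m)" using zero_less_card_finite[where 'a = 'm] by linarith
  then have "1 * D \<le> real CARD('m) * D" using D1 by (intro mult_right_mono) auto
  then have "D\<^sup>2 \<le> B" unfolding B_def using D1 by (intro power_mono) auto
  then have bB: "b \<le> B" using bD by linarith
  have F: "?F \<gamma> u \<in> gclosure" if "length \<gamma> \<le> 3" "u \<in> half_open_cube a s" for \<gamma> u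
    by (rule field_L[OF field_fpartials_chart[OF c, of 0] sub[OF that(2)]]) (use that in simp)
  have le: "ip (?F \<gamma> u) (?F \<gamma> u) \<le> B" if "length \<gamma> \<le> 3" "u \<in> half_open_cube a s" for \<gamma> u
    using b[OF that(1)] that(2) cube bB by (meson order_trans subsetD)
  have inc: "ip (\<lambda>w. ?F \<gamma> u w - ?F \<gamma> v w) (\<lambda>w. ?F \<gamma> u w - ?F \<gamma> v w) \<le> B * (norm (u - v))\<^sup>2"
    if g: "length \<gamma> \<le> 2" and uv: "u \<in> half_open_cube a s" "v \<in> half_open_cube a s" for \<gamma> u v
  proof -
    have f1: "field (Suc 0) ?U (?F \<gamma>)" by (rule field_fpartials_chart[OF c]) (use g in simp)
    have "ip (\<lambda>w. ?F \<gamma> u w - ?F \<gamma> v w) (\<lambda>w. ?F \<gamma> u w - ?F \<gamma> v w) \<le> (real CARD('m) * D * norm (u - v))\<^sup>2"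
    proof (rule field_Lipschitz[OF U f1 convex_box(1) K])
      show "ip (fpartial i (?F \<gamma>) w) (fpartial i (?F \<gamma>) w) \<le> D\<^sup>2" if "w \<in> ?K" for w i
        using order_trans[OF b[of "i # \<gamma>", OF _ that] bD] g by (simp add: fpartials_simps)
    qed (use D1 uv cube in auto)
    then show ?thesis by (simp add: B_def power_mult_distrib)
  qed
  let ?p = "CARD('m) + 4"
  let ?C = "2 ^ ?p * 2 * B ^ ?p * (fact (2 * ?p) / (2 ^ ?p * fact ?p))"
  have ae: "AE \<omega> in completion P. jet_functional c \<alpha> \<beta> u (random_path (topspace M) f \<omega>) = ?F \<alpha> u \<omega> * ?F \<beta> u \<omega>"
    if "u \<in> half_open_cube a s" for u
    by (rule jet_functional_AE[OF c sub[OF that]]) (use len in auto)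
  note [measurable] = jet_functional_measurable[OF c]
  have "chaining path_law (jet_functional c \<alpha> \<beta>) a s (B ^ 4 * (fact 8 / (2 ^ 4 * fact 4))) ?C ?p"
  proof (intro chaining.intro chaining_axioms.intro s refl)
    show "prob_space path_law" by (rule prob_space.prob_space_distr[OF prob_P random_path_measurable])
    show "jet_functional c \<alpha> \<beta> u \<in> borel_measurable path_law" for u by simp
    show "0 \<le> ?C" unfolding B_def by simp
    fix u assume u: "u \<in> half_open_cube a s"
    have ae4: "AE \<omega> in completion P. jet_functional c \<alpha> \<beta> u (random_path (topspace M) f \<omega>) ^ 4 = (?F \<alpha> u \<omega> * ?F \<beta> u \<omega>) ^ 4"
      using ae[OF u] by eventually_elim simp
    have m4: "(\<lambda>p. jet_functional c \<alpha> \<beta> u p ^ 4) \<in> borel_measurable path_space" by measurable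
    note l3 = order_trans[OF len(1), of 3, simplified] order_trans[OF len(2), of 3, simplified]
    note four = product_fourth_moment[OF F[OF l3(1) u] F[OF l3(2) u] le[OF l3(1) u] le[OF l3(2) u]]
    show "integrable path_law (\<lambda>p. jet_functional c \<alpha> \<beta> u p ^ 4)"
      using four(1) unfolding path_law_transfer(1)[OF m4 ae4] .
    show "(\<integral>p. jet_functional c \<alpha> \<beta> u p ^ 4 \<partial>path_law) \<le> B ^ 4 * (fact 8 / (2 ^ 4 * fact 4))"
      using four(2) unfolding path_law_transfer(2)[OF m4 ae4] .
    fix v assume v: "v \<in> half_open_cube a s"
    let ?G = "\<lambda>p. \<bar>jet_functional c \<alpha> \<beta> u p - jet_functional c \<alpha> \<beta> v p\<bar> ^ ?p"
    have aep: "AE \<omega> in completion P. ?G (random_path (topspace M) f \<omega>) = \<bar>?F \<alpha> u \<omega> * ?F \<beta> u \<omega> - ?F \<alpha> v \<omega> * ?F \<beta> v \<omega>\<bar> ^ ?p"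
      using ae[OF u] ae[OF v] by eventually_elim simp
    have mp: "?G \<in> borel_measurable path_space" by measurable
    have "integrable path_law ?G \<and> (\<integral>p. ?G p \<partial>path_law) \<le> ?C * norm (u - v) ^ ?p"
    proof (cases "u = v")
      case False
      then have "0 < norm (u - v)" by simp
      note inc' = product_increment_moment[OF F[OF l3(1) u] F[OF l3(1) v] F[OF l3(2) u] F[OF l3(2) v] this
          le[OF l3(1) u] le[OF l3(2) v] inc[OF len(1) u v] inc[OF len(2) u v], of ?p]
      show ?thesis using inc' unfolding path_law_transfer[OF mp aep] by blast
    qed (simp add: zero_power)
    then show "integrable path_law ?G" "(\<integral>p. ?G p \<partial>path_law) \<le> ?C * norm (u - v) ^ ?p" by blast+
  qed
  then show ?thesis by blast
qed

end

section \<open>Uniform limits\<close>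

lemma uniform_limit_vec:
  fixes f :: "'k \<Rightarrow> 'x \<Rightarrow> ('b::real_normed_vector)^'n::finite"
  assumes "\<And>i. uniform_limit S (\<lambda>k u. f k u $ i) (\<lambda>u. g u $ i) F"
  shows "uniform_limit S f g F"
proof (rule uniform_limitI)
  fix e :: real assume e: "0 < e"
  let ?d = "e / (real CARD('n) + 1)"
  have d: "0 < ?d" using e by (intro divide_pos_pos) auto
  have "\<forall>\<^sub>F k in F. \<forall>i\<in>UNIV. \<forall>u\<in>S. dist (f k u $ i) (g u $ i) < ?d"
    by (rule eventually_ball_finite) (use uniform_limitD[OF assms d] in auto)
  then show "\<forall>\<^sub>F k in F. \<forall>u\<in>S. dist (f k u) (g u) < e"
  proof (eventually_elim, intro ballI)
    fix k u assume *: "\<forall>i\<in>UNIV. \<forall>u\<in>S. dist (f k u $ i) (g u $ i) < ?d" and u: "u \<in> S"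
    have "dist (f k u) (g u) \<le> (\<Sum>i\<in>UNIV. dist (f k u $ i) (g u $ i))"
      unfolding dist_vec_def by (rule L2_set_le_sum) simp
    also have "\<dots> \<le> (\<Sum>i\<in>(UNIV :: 'n set). ?d)" using * u by (intro sum_mono less_imp_le) auto
    also have "\<dots> = real CARD('n) * ?d" by simp
    also have "\<dots> < e" using e by (simp add: field_simps)
    finally show "dist (f k u) (g u) < e" .
  qed
qed

text \<open>A closed neighbourhood of \<open>K\<close> of small positive radius is still compact and
  inside \<open>W\<close>, and it eventually contains all values of the approximations.\<close>

lemma uniform_limit_eventually_nbhd:
  fixes J :: "'x \<Rightarrow> 'z::heine_borel"
  assumes lim: "uniform_limit S Jk J sequentially" and S: "S \<noteq> {}"
    and K: "compact K" "J ` S \<subseteq> K" "K \<subseteq> W" "open W"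
  obtains K' where "compact K'" "K \<subseteq> K'" "K' \<subseteq> W" "\<forall>\<^sub>F k in sequentially. \<forall>u\<in>S. Jk k u \<in> K'"
proof -
  have ne: "K \<noteq> {}" using S K(2) by auto
  obtain e where e: "0 < e" "{x. infdist x K \<le> e} \<subseteq> W"
    using compact_in_open_separated[OF ne K(1,4,3)] by blast
  show ?thesis
  proof (rule that[of "{x. infdist x K \<le> e}"])
    show "compact {x. infdist x K \<le> e}" by (rule compact_infdist_le[OF ne K(1) e(1)])
    show "K \<subseteq> {x. infdist x K \<le> e}" using e by auto
    show "\<forall>\<^sub>F k in sequentially. \<forall>u\<in>S. Jk k u \<in> {x. infdist x K \<le> e}"
      using uniform_limitD[OF lim e(1)]
    proof (eventually_elim, intro ballI)
      fix k u assume *: "\<forall>u\<in>S. dist (Jk k u) (J u) < e" and u: "u \<in> S"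
      have "infdist (Jk k u) K \<le> dist (Jk k u) (J u)" by (rule infdist_le) (use u K in auto)
      then show "Jk k u \<in> {x. infdist x K \<le> e}" using * u by (auto intro: order_trans less_imp_le)
    qed
  qed (rule e(2))
qed

text \<open>On the enlarged compact set \<open>\<Psi>\<close> is bounded and uniformly continuous.
  Since \<open>Jk k\<close> takes values there only from some \<open>N\<close> on, dominated
  convergence is applied to the sequence shifted by \<open>N\<close>.\<close>

lemma set_integral_uniform_limit:
  fixes J :: "'x::euclidean_space \<Rightarrow> 'z::heine_borel" and \<Psi> :: "'z \<Rightarrow> real"
  assumes lim: "uniform_limit S Jk J sequentially"
    and K: "compact K" "J ` S \<subseteq> K" "K \<subseteq> W" "open W" and \<Psi>: "continuous_on W \<Psi>"
    and E: "E \<subseteq> S" "E \<in> sets borel" "emeasure lborel E < \<infinity>"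
    and cont: "\<And>k. continuous_on E (Jk k)" "continuous_on E J"
  shows "set_integrable lborel E (\<lambda>u. \<Psi> (J u))"
    and "\<forall>\<^sub>F k in sequentially. set_integrable lborel E (\<lambda>u. \<Psi> (Jk k u))"
    and "(\<lambda>k. LINT u:E|lborel. \<Psi> (Jk k u)) \<longlonglongrightarrow> (LINT u:E|lborel. \<Psi> (J u))"
proof -
  have "set_integrable lborel E (\<lambda>u. \<Psi> (J u)) \<and> (\<forall>\<^sub>F k in sequentially. set_integrable lborel E (\<lambda>u. \<Psi> (Jk k u)))
    \<and> (\<lambda>k. LINT u:E|lborel. \<Psi> (Jk k u)) \<longlonglongrightarrow> (LINT u:E|lborel. \<Psi> (J u))"
  proof (cases "S = {}")
    case True
    then have "E = {}" using E by auto
    then show ?thesis by (simp add: set_integrable_def set_lebesgue_integral_def)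
  next
    case False
    obtain K' where K': "compact K'" "K \<subseteq> K'" "K' \<subseteq> W" "\<forall>\<^sub>F k in sequentially. \<forall>u\<in>S. Jk k u \<in> K'"
      using uniform_limit_eventually_nbhd[OF lim False K] by blast
    have c: "continuous_on K' \<Psi>" using \<Psi> K'(3) by (rule continuous_on_subset)
    obtain B where B: "\<And>z. z \<in> K' \<Longrightarrow> \<bar>\<Psi> z\<bar> \<le> B"
      using compact_imp_bounded[OF compact_continuous_image[OF c K'(1)]] by (auto simp: bounded_iff)
    have JK: "J u \<in> K'" if "u \<in> E" for u using that E K K' by blast
    obtain N where N: "\<And>k u. N \<le> k \<Longrightarrow> u \<in> E \<Longrightarrow> Jk k u \<in> K'"
      using K'(4) E unfolding eventually_sequentially by blast
    have i: "integrable lborel (\<lambda>u. indicator E u *\<^sub>R \<Psi> (f u))"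
      and m: "(\<lambda>u. indicator E u *\<^sub>R \<Psi> (f u)) \<in> borel_measurable lborel"
      if f: "continuous_on E f" "\<And>u. u \<in> E \<Longrightarrow> f u \<in> K'" for f
    proof -
      have "continuous_on E (\<lambda>u. \<Psi> (f u))" by (rule continuous_on_compose2[OF c f(1)]) (use f in auto)
      from borel_measurable_continuous_on_indicator[OF E(2) this]
      show m: "(\<lambda>u. indicator E u *\<^sub>R \<Psi> (f u)) \<in> borel_measurable lborel" by simp
      show "integrable lborel (\<lambda>u. indicator E u *\<^sub>R \<Psi> (f u))"
        by (rule integrableI_bounded_set[where A = E and B = B])
          (use E m f B in \<open>auto simp: indicator_def\<close>)
    qed
    have ul: "uniform_limit S (\<lambda>k u. \<Psi> (Jk k u)) (\<lambda>u. \<Psi> (J u)) sequentially"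
      by (rule uniform_limit_compose_uniformly_continuous_on[OF lim compact_uniformly_continuous[OF c K'(1)] K'(4) compact_imp_closed[OF K'(1)]])
    have pt: "(\<lambda>k. \<Psi> (Jk k u)) \<longlonglongrightarrow> \<Psi> (J u)" if "u \<in> E" for u
      by (rule tendsto_uniform_limitI[OF ul subsetD[OF E(1) that]])
    have "(\<lambda>k. \<integral>u. indicator E u *\<^sub>R \<Psi> (Jk (k + N) u) \<partial>lborel) \<longlonglongrightarrow> (\<integral>u. indicator E u *\<^sub>R \<Psi> (J u) \<partial>lborel)"
    proof (rule integral_dominated_convergence[where w = "\<lambda>u. indicator E u * \<bar>B\<bar>"])
      show "integrable lborel (\<lambda>u. indicator E u * \<bar>B\<bar>)" using E by (intro integrable_mult_left) simp
      show "AE u in lborel. (\<lambda>k. indicator E u *\<^sub>R \<Psi> (Jk (k + N) u)) \<longlonglongrightarrow> indicator E u *\<^sub>R \<Psi> (J u)"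
      proof (rule AE_I2)
        fix u show "(\<lambda>k. indicator E u *\<^sub>R \<Psi> (Jk (k + N) u)) \<longlonglongrightarrow> indicator E u *\<^sub>R \<Psi> (J u)"
          using LIMSEQ_ignore_initial_segment[OF pt, of u N] by (cases "u \<in> E") auto
      qed
      show "AE u in lborel. norm (indicator E u *\<^sub>R \<Psi> (Jk (k + N) u)) \<le> indicator E u * \<bar>B\<bar>" for k
      proof (rule AE_I2)
        fix u show "norm (indicator E u *\<^sub>R \<Psi> (Jk (k + N) u)) \<le> indicator E u * \<bar>B\<bar>"
          using B[OF N[of "k + N" u]] by (cases "u \<in> E") auto
      qed
      show "(\<lambda>u. indicator E u *\<^sub>R \<Psi> (J u)) \<in> borel_measurable lborel" by (rule m[OF cont(2) JK])
      show "(\<lambda>u. indicator E u *\<^sub>R \<Psi> (Jk (k + N) u)) \<in> borel_measurable lborel" for k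
        by (rule m[OF cont(1) N]) auto
    qed
    then have "(\<lambda>k. LINT u:E|lborel. \<Psi> (Jk k u)) \<longlonglongrightarrow> (LINT u:E|lborel. \<Psi> (J u))"
      unfolding set_lebesgue_integral_def by (rule LIMSEQ_offset)
    moreover have "\<forall>\<^sub>F k in sequentially. set_integrable lborel E (\<lambda>u. \<Psi> (Jk k u))"
      unfolding eventually_sequentially set_integrable_def using i[OF cont(1) N] by blast
    moreover have "set_integrable lborel E (\<lambda>u. \<Psi> (J u))"
      unfolding set_integrable_def by (rule i[OF cont(2) JK])
    ultimately show ?thesis by blast
  qed
  then show "set_integrable lborel E (\<lambda>u. \<Psi> (J u))"
    and "\<forall>\<^sub>F k in sequentially. set_integrable lborel E (\<lambda>u. \<Psi> (Jk k u))"
    and "(\<lambda>k. LINT u:E|lborel. \<Psi> (Jk k u)) \<longlonglongrightarrow> (LINT u:E|lborel. \<Psi> (J u))" by blast+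
qed

lemma metric_inner_sum: "metric_inner B v w = (\<Sum>i\<in>UNIV. \<Sum>j\<in>UNIV. v $ i * B $ i $ j * w $ j)"
  by (simp add: metric_inner_def inner_vec_def matrix_vector_mult_def sum_distrib_left mult.assoc)

lemma metric_inner_le_norm:
  fixes B :: "real^'m::finite^'m"
  shows "\<bar>metric_inner B v v\<bar> \<le> (real CARD('m))\<^sup>2 * norm B * (norm v)\<^sup>2"
proof -
  have e: "\<bar>v $ i * B $ i $ j * v $ j\<bar> \<le> norm B * (norm v)\<^sup>2" for i j
  proof -
    have "\<bar>B $ i $ j\<bar> \<le> norm B" by (rule order_trans[OF component_le_norm_cart Finite_Cartesian_Product.norm_nth_le])
    then have "\<bar>v $ i\<bar> * \<bar>B $ i $ j\<bar> * \<bar>v $ j\<bar> \<le> norm v * norm B * norm v"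
      by (intro mult_mono component_le_norm_cart) auto
    then show ?thesis by (simp add: abs_mult power2_eq_square mult_ac)
  qed
  have "\<bar>metric_inner B v v\<bar> \<le> (\<Sum>i\<in>UNIV. \<Sum>j\<in>UNIV. \<bar>v $ i * B $ i $ j * v $ j\<bar>)"
    unfolding metric_inner_sum by (rule order_trans[OF sum_abs sum_mono]) (rule sum_abs)
  also have "\<dots> \<le> (\<Sum>i\<in>(UNIV :: 'm set). \<Sum>j\<in>(UNIV :: 'm set). norm B * (norm v)\<^sup>2)" by (intro sum_mono e)
  finally show ?thesis by (simp add: power2_eq_square mult_ac)
qed

lemma metric_inner_diff: "metric_inner (B - C) v w = metric_inner B v w - metric_inner C v w"
  by (simp add: metric_inner_sum sum_subtractf algebra_simps)

text \<open>The constant is the minimum of the quadratic form over the compact product of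
  \<open>K\<close> and the unit sphere; homogeneity extends it to all vectors.\<close>

lemma pos_def_uniform:
  fixes G :: "'x::metric_space \<Rightarrow> real^'m::finite^'m"
  assumes K: "compact K" and G: "continuous_on K G" and pd: "\<And>u. u \<in> K \<Longrightarrow> pos_def (G u)"
  obtains l where "0 < l" "\<And>u v. u \<in> K \<Longrightarrow> l * (norm v)\<^sup>2 \<le> metric_inner (G u) v v"
proof (cases "K = {}")
  case True
  then show ?thesis using that[of 1] by simp
next
  case False
  let ?S = "K \<times> sphere (0 :: real^'m) 1"
  have "axis undefined 1 \<in> sphere (0 :: real^'m) 1" by (simp add: norm_axis_1)
  then have ne: "?S \<noteq> {}" using False by blast
  have c: "continuous_on ?S (\<lambda>z. metric_inner (G (fst z)) (snd z) (snd z))"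
    unfolding metric_inner_sum
    by (intro continuous_intros continuous_on_compose2[OF G]) auto
  obtain z where z: "z \<in> ?S" "\<And>y. y \<in> ?S \<Longrightarrow> metric_inner (G (fst z)) (snd z) (snd z) \<le> metric_inner (G (fst y)) (snd y) (snd y)"
    using continuous_attains_inf[OF compact_Times[OF K compact_sphere] ne c] by blast
  let ?l = "metric_inner (G (fst z)) (snd z) (snd z)"
  show ?thesis
  proof (rule that)
    have "snd z \<noteq> 0" using z(1) by auto
    then show "0 < ?l" using pd[of "fst z"] z(1) by (auto simp: pos_def_def)
    fix u v assume u: "u \<in> K"
    show "?l * (norm v)\<^sup>2 \<le> metric_inner (G u) v v"
    proof (cases "v = 0")
      case False
      let ?w = "v /\<^sub>R norm v"
      have "?l \<le> metric_inner (G u) ?w ?w" using z(2)[of "(u, ?w)"] u False by simp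
      also have "\<dots> = metric_inner (G u) v v / (norm v)\<^sup>2"
        by (simp add: metric_inner_sum power2_eq_square divide_inverse sum_distrib_left sum_distrib_right mult_ac)
      finally show ?thesis using False by (simp add: le_divide_eq)
    qed (simp add: metric_inner_def)
  qed
qed

lemma Ck_on_cmult:
  fixes f :: "real^'m::finite \<Rightarrow> real"
  assumes "open U" "Ck_on k f U"
  shows "Ck_on k (\<lambda>u. c * f u) U"
  using assms(2)
proof (induction k arbitrary: f)
  case 0
  then show ?case by (simp add: continuous_on_mult_left)
next
  case (Suc k)
  have d: "f differentiable (at u)" if "u \<in> U" for u using Suc.prems that by simp
  have fr: "frechet_derivative (\<lambda>u. c * f u) (at u) v = c * frechet_derivative f (at u) v" if u: "u \<in> U" for u v
  proof -
    have "((\<lambda>u. c * f u) has_derivative (\<lambda>v. c * frechet_derivative f (at u) v)) (at u)"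
      by (rule has_derivative_mult_right) (use d[OF u] in \<open>simp add: frechet_derivative_works\<close>)
    then show ?thesis by (simp add: frechet_derivative_at[symmetric])
  qed
  have "Ck_on k (\<lambda>u. frechet_derivative (\<lambda>u. c * f u) (at u) v) U" for v
    by (rule iffD2[OF Ck_on_cong[OF assms(1) fr] Suc.IH]) (use Suc.prems in simp_all)
  then show ?case using d by (auto intro!: differentiable_mult)
qed

text \<open>If \<open>H u = H v\<close>, Rolle's theorem for \<open>t \<mapsto> \<langle>H (u + t w), DH(u) w\<rangle>\<close> with \<open>w = v - u\<close> gives a \<open>t\<close> with
  \<open>DH(u + t w) w\<close> orthogonal to \<open>DH(u) w\<close>, which the bound on second derivatives excludes for small \<open>w\<close>.\<close>

lemma immersion_locally_injective:
  fixes H :: "real^'m::finite \<Rightarrow> nat \<Rightarrow> real"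
  assumes U: "open U" and S: "convex S" "S \<subseteq> U" and C3: "\<And>n. n < k \<Longrightarrow> Ck_on 3 (\<lambda>u. H u n) U"
    and lower: "\<And>u w. u \<in> S \<Longrightarrow> l * (norm w)\<^sup>2 \<le> (\<Sum>n<k. (\<Sum>i\<in>UNIV. w $ i * partial i (\<lambda>u. H u n) u)\<^sup>2)"
    and C: "0 \<le> C" "\<And>u i j. u \<in> S \<Longrightarrow> (\<Sum>n<k. (partial i (partial j (\<lambda>u. H u n)) u)\<^sup>2) \<le> C\<^sup>2"
    and uv: "u \<in> S" "v \<in> S" and small: "real CARD('m) ^ 3 * C\<^sup>2 * (norm (v - u))\<^sup>2 < l"
    and eq: "\<And>n. n < k \<Longrightarrow> H u n = H v n"
  shows "u = v"
proof (rule ccontr)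
  assume ne: "u \<noteq> v"
  interpret L2_space "count_space {..<k}" UNIV by (rule L2_space_count)
  let ?w = "v - u"
  let ?T = "\<lambda>x n. \<Sum>i\<in>UNIV. ?w $ i * partial i (\<lambda>u. H u n) x"
  have seg: "u + t *\<^sub>R ?w \<in> S" if "0 \<le> t" "t \<le> 1" for t
  proof -
    have "u + t *\<^sub>R ?w = (1 - t) *\<^sub>R u + t *\<^sub>R v" by (simp add: algebra_simps)
    then show ?thesis using convexD_alt[OF S(1) uv that] by simp
  qed
  have d: "((\<lambda>t. H (u + t *\<^sub>R ?w) n) has_derivative (\<lambda>h. h * ?T (u + t *\<^sub>R ?w) n)) (at t)"
    if "n < k" "0 \<le> t" "t \<le> 1" for n t
  proof -
    have "(\<lambda>u. H u n) differentiable (at (u + t *\<^sub>R ?w))"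
      by (rule Ck_on_differentiable[OF C3[OF that(1)]]) (use seg[OF that(2,3)] S in auto)
    from has_derivative_partials[OF this]
    have D: "((\<lambda>u. H u n) has_derivative (\<lambda>z. \<Sum>i\<in>UNIV. z $ i * partial i (\<lambda>u. H u n) (u + t *\<^sub>R ?w))) (at (u + t *\<^sub>R ?w))" .
    have l: "((\<lambda>t. u + t *\<^sub>R ?w) has_derivative (\<lambda>h. h *\<^sub>R ?w)) (at t)" by (auto intro!: derivative_eq_intros)
    show ?thesis using has_derivative_compose[OF l D] by (simp add: sum_distrib_left mult.assoc)
  qed
  let ?\<psi> = "\<lambda>t. \<Sum>n<k. H (u + t *\<^sub>R ?w) n * ?T u n"
  have d\<psi>: "(?\<psi> has_derivative (\<lambda>h. \<Sum>n<k. (h * ?T (u + t *\<^sub>R ?w) n) * ?T u n)) (at t)" if "0 \<le> t" "t \<le> 1" for t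
    by (intro has_derivative_sum has_derivative_mult_left d that) simp
  have "\<exists>t. 0 < t \<and> t < 1 \<and> (\<lambda>h. \<Sum>n<k. (h * ?T (u + t *\<^sub>R ?w) n) * ?T u n) = (\<lambda>v. 0)"
  proof (rule Rolle_deriv)
    show "?\<psi> 0 = ?\<psi> 1" using eq by simp
    show "continuous_on {0..1} ?\<psi>"
      by (rule has_derivative_continuous_on, rule has_derivative_at_withinI, rule d\<psi>) auto
  qed (use d\<psi> in auto)
  then obtain t where t: "0 < t" "t < 1" and t0: "(\<lambda>h. \<Sum>n<k. (h * ?T (u + t *\<^sub>R ?w) n) * ?T u n) = (\<lambda>v. 0)" by blast
  let ?x = "u + t *\<^sub>R ?w"
  have xS: "?x \<in> S" by (rule seg) (use t in auto)
  have z: "(\<Sum>n<k. ?T ?x n * ?T u n) = 0" using fun_cong[OF t0, of 1] by simp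
  let ?D = "\<lambda>i n. partial i (\<lambda>u. H u n) ?x - partial i (\<lambda>u. H u n) u"
  \<comment> \<open>The two tangent vectors are orthogonal by \<open>z\<close>, so by Pythagoras
    each is at most as long as their difference.\<close>
  have "(\<Sum>n<k. (?T u n)\<^sup>2) \<le> (\<Sum>n<k. (?T ?x n - ?T u n)\<^sup>2)"
  proof -
    have "(\<Sum>n<k. (?T ?x n - ?T u n)\<^sup>2) = (\<Sum>n<k. (?T ?x n)\<^sup>2) - 2 * (\<Sum>n<k. ?T ?x n * ?T u n) + (\<Sum>n<k. (?T u n)\<^sup>2)"
      by (simp add: power2_diff sum.distrib sum_subtractf sum_distrib_left mult_ac)
    moreover have "0 \<le> (\<Sum>n<k. (?T ?x n)\<^sup>2)" by (intro sum_nonneg) simp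
    ultimately show ?thesis unfolding z by linarith
  qed
  also have "\<dots> \<le> (\<Sum>n<k. (norm ?w)\<^sup>2 * (\<Sum>i\<in>UNIV. (?D i n)\<^sup>2))"
  proof (rule sum_mono)
    fix n
    have "?T ?x n - ?T u n = ?w \<bullet> (\<chi> i. ?D i n)"
      by (simp add: inner_vec_def sum_subtractf[symmetric] right_diff_distrib)
    then have "(?T ?x n - ?T u n)\<^sup>2 \<le> (?w \<bullet> ?w) * ((\<chi> i. ?D i n) \<bullet> (\<chi> i. ?D i n))" by (simp only: Cauchy_Schwarz_ineq)
    moreover have "?w \<bullet> ?w = (norm ?w)\<^sup>2" by (rule dot_square_norm)
    moreover have "(\<chi> i. ?D i n) \<bullet> (\<chi> i. ?D i n) = (\<Sum>i\<in>UNIV. (?D i n)\<^sup>2)" by (simp add: inner_vec_def power2_eq_square)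
    ultimately show "(?T ?x n - ?T u n)\<^sup>2 \<le> (norm ?w)\<^sup>2 * (\<Sum>i\<in>UNIV. (?D i n)\<^sup>2)" by (simp only:)
  qed
  also have "\<dots> = (norm ?w)\<^sup>2 * (\<Sum>i\<in>UNIV. \<Sum>n<k. (?D i n)\<^sup>2)"
    by (subst sum.swap) (simp add: sum_distrib_left)
  \<comment> \<open>Each first partial varies at most by \<open>CARD('m) * C\<close> times the
    distance. Squared and summed over \<open>i\<close>, this produces the cube of
    \<open>CARD('m)\<close> in the smallness hypothesis.\<close>
  also have "\<dots> \<le> (norm ?w)\<^sup>2 * (\<Sum>i\<in>(UNIV :: 'm set). (real CARD('m) * C * norm ?w)\<^sup>2)"
  proof (intro mult_left_mono sum_mono)
    fix i
    have f: "field 3 U H" using C3 by (simp add: field_def AE_count_space del: Ck_on.simps)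
    have f1: "field (Suc 1) U (fpartial i H)" using field_fpartial[OF U, of 2 H i] f by (simp add: numeral_3_eq_3 numeral_2_eq_2)
    have "ip (\<lambda>n. fpartial i H ?x n - fpartial i H u n) (\<lambda>n. fpartial i H ?x n - fpartial i H u n) \<le> (real CARD('m) * C * norm (?x - u))\<^sup>2"
      by (rule field_Lipschitz[OF U f1 S C(1) _ uv(1) xS])
        (use C(2) in \<open>simp add: ip_count fpartial_def power2_eq_square\<close>)
    then have "(\<Sum>n<k. (?D i n)\<^sup>2) \<le> (real CARD('m) * C * norm (?x - u))\<^sup>2"
      by (simp add: ip_count fpartial_def power2_eq_square)
    also have "\<dots> \<le> (real CARD('m) * C * norm ?w)\<^sup>2"
      using t C(1) by (intro power_mono mult_left_mono) (auto simp: mult_left_le_one_le)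
    finally show "(\<Sum>n<k. (?D i n)\<^sup>2) \<le> (real CARD('m) * C * norm ?w)\<^sup>2" .
  qed simp
  also have "\<dots> = (norm ?w)\<^sup>2 * (real CARD('m) ^ 3 * C\<^sup>2 * (norm ?w)\<^sup>2)"
    by (simp add: power_mult_distrib power3_eq_cube power2_eq_square)
  also have "\<dots> < (norm ?w)\<^sup>2 * l" using small ne by (intro mult_strict_left_mono) auto
  finally show False using lower[OF uv(1), of ?w] by (simp add: mult.commute)
qed

section \<open>Uniform laws of large numbers for the jets\<close>

lemma uniform_limit_Pair:
  assumes "uniform_limit S f1 g1 F" "uniform_limit S f2 g2 F"
  shows "uniform_limit S (\<lambda>k u. (f1 k u, f2 k u)) (\<lambda>u. (g1 u, g2 u)) F"
proof (rule uniform_limitI)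
  fix e :: real assume "0 < e"
  then have e: "0 < e / 2" by simp
  show "\<forall>\<^sub>F k in F. \<forall>u\<in>S. dist (f1 k u, f2 k u) (g1 u, g2 u) < e"
    using uniform_limitD[OF assms(1) e] uniform_limitD[OF assms(2) e]
  proof (eventually_elim, intro ballI)
    fix k u assume *: "\<forall>u\<in>S. dist (f1 k u) (g1 u) < e / 2" "\<forall>u\<in>S. dist (f2 k u) (g2 u) < e / 2" and u: "u \<in> S"
    have "dist (f1 k u, f2 k u) (g1 u, g2 u) \<le> dist (f1 k u) (g1 u) + dist (f2 k u) (g2 u)"
      unfolding dist_Pair_Pair using sqrt_sum_squares_le_sum_abs[of "dist (f1 k u) (g1 u)" "dist (f2 k u) (g2 u)"] by simp
    also have "\<dots> < e" using *(1)[rule_format, OF u] *(2)[rule_format, OF u] by linarith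
    finally show "dist (f1 k u, f2 k u) (g1 u, g2 u) < e" .
  qed
qed

lemma (in L2_space) field_jet_continuous:
  assumes U: "open U" and f: "field 3 U \<phi>"
  shows "continuous_on U (field_jet \<phi>)"
proof -
  have f3: "field (Suc (Suc (Suc 0))) U \<phi>" using f by (simp add: numeral_3_eq_3)
  note f2 = field_fpartial[OF U f3]
  note f1 = field_fpartial[OF U f2]
  show ?thesis
    unfolding field_jet_def[abs_def] G_of_def T_of_def S_of_def
    by (intro continuous_on_Pair continuous_on_vec_lambda ip_continuous_on[OF f2 f2]
        ip_continuous_on[OF f1 f2] ip_continuous_on[OF f1 f1])
qed

lemma (in L2_space) jet_entries:
  "G_of \<phi> u $ i $ j = ip (fpartials [i] \<phi> u) (fpartials [j] \<phi> u)"
  "T_of \<phi> u $ i $ j $ l = ip (fpartials [i, j] \<phi> u) (fpartials [l] \<phi> u)"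
  "S_of \<phi> u $ i $ j $ l $ q = ip (fpartials [i, j] \<phi> u) (fpartials [l, q] \<phi> u)"
  by (simp_all add: fpartials_simps G_of_def T_of_def S_of_def)

lemma half_open_cube_cbox: "half_open_cube a s \<subseteq> cbox a (\<chi> i. a $ i + s)"
  by (auto simp: half_open_cube_def mem_box_cart less_imp_le)

lemma box_half_open_cube: "box a (\<chi> i. a $ i + s) \<subseteq> half_open_cube a s"
  by (auto simp: half_open_cube_def mem_box_cart less_imp_le)

lemma open_contains_cube:
  fixes u :: "real^'m::finite"
  assumes "open U" "u \<in> U"
  obtains a s where "0 < s" "u \<in> box a (\<chi> i. a $ i + s)" "cbox a (\<chi> i. a $ i + s) \<subseteq> U"
proof -
  obtain e where e: "0 < e" "cball u e \<subseteq> U" using assms open_contains_cball by blast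
  define r where "r = e / real CARD('m)"
  have r: "0 < r" "real CARD('m) * r = e" using e by (simp_all add: r_def)
  let ?a = "\<chi> i. u $ i - r"
  show ?thesis
  proof (rule that[of "2 * r" ?a])
    show "u \<in> box ?a (\<chi> i. ?a $ i + 2 * r)" using r by (simp add: mem_box_cart)
    show "cbox ?a (\<chi> i. ?a $ i + 2 * r) \<subseteq> U"
    proof
      fix v assume v: "v \<in> cbox ?a (\<chi> i. ?a $ i + 2 * r)"
      have "norm (u - v) \<le> (\<Sum>i\<in>UNIV. \<bar>(u - v) $ i\<bar>)" by (rule norm_le_l1_cart)
      also have "\<dots> \<le> (\<Sum>i\<in>(UNIV :: 'm set). r)"
      proof (rule sum_mono)
        fix i
        have "u $ i - r \<le> v $ i \<and> v $ i \<le> u $ i - r + 2 * r" using v by (simp add: mem_box_cart)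
        then show "\<bar>(u - v) $ i\<bar> \<le> r" by (simp add: abs_le_iff)
      qed
      finally show "v \<in> U" using e r by (auto simp: dist_norm)
    qed
  qed (use r in simp)
qed

text \<open>Null sets and thresholds for \<open>k\<close> may depend on the neighbourhood; a finite
  subcover leaves finitely many of each. For this the neighbourhood must be fixed before
  \<open>w\<close> is drawn.\<close>

lemma compact_space_AE_eventually:
  assumes X: "compact_space X"
    and loc: "\<And>x. x \<in> topspace X \<Longrightarrow> \<exists>W. openin X W \<and> x \<in> W \<and> (AE w in Q. \<forall>\<^sub>F k in sequentially. \<forall>z\<in>W. R k w z)"
  shows "AE w in Q. \<forall>\<^sub>F k in sequentially. \<forall>z\<in>topspace X. R k w z"
proof -
  let ?C = "{W. openin X W \<and> (AE w in Q. \<forall>\<^sub>F k in sequentially. \<forall>z\<in>W. R k w z)}"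
  have "topspace X \<subseteq> \<Union>?C" using loc by blast
  then obtain T where T: "finite T" "T \<subseteq> ?C" "topspace X \<subseteq> \<Union>T"
    using X unfolding compact_space_alt by (metis (no_types, lifting) mem_Collect_eq)
  have "AE w in Q. \<forall>W\<in>T. \<forall>\<^sub>F k in sequentially. \<forall>z\<in>W. R k w z"
    unfolding AE_ball_countable[OF countable_finite[OF T(1)]] using T(2) by blast
  then show ?thesis
  proof eventually_elim
    fix w assume "\<forall>W\<in>T. \<forall>\<^sub>F k in sequentially. \<forall>z\<in>W. R k w z"
    then have "\<forall>\<^sub>F k in sequentially. \<forall>W\<in>T. \<forall>z\<in>W. R k w z" by (rule eventually_ball_finite[OF T(1)])
    then show "\<forall>\<^sub>F k in sequentially. \<forall>z\<in>topspace X. R k w z" by eventually_elim (use T(3) in blast)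
  qed
qed

locale gaussian_copies = gaussian_manifold M A g P f
  for M :: "'a topology" and A :: "('a, 'm::finite) chart set" and g :: "('a, 'm) metric_tensor"
    and P :: "'v measure" and f :: "'a \<Rightarrow> 'v \<Rightarrow> real" +
  fixes Q :: "'w measure" and F :: "nat \<Rightarrow> 'a \<Rightarrow> 'w \<Rightarrow> real"
  assumes prob_Q: "prob_space Q" and copies: "independent_copies P f M A Q F"
    and compact_M: "compact_space M" and kernel: "positive_definite_kernel (topspace M) (covariance P f)"
begin

abbreviation "copy_path n w \<equiv> random_path (topspace M) (F n) w"

lemma copies_indep: "prob_space.indep_vars Q (\<lambda>_. path_space) (\<lambda>n. random_path (topspace M) (F n)) UNIV"
  and copies_law: "distr Q path_space (random_path (topspace M) (F n)) = path_law"
  using copies by (auto simp: independent_copies_def)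

definition regular :: "'w \<Rightarrow> bool" where "regular w \<longleftrightarrow> (\<forall>n. C3_fun A (\<lambda>x. F n x w))"

lemma AE_regular: "AE w in Q. regular w"
  using copies by (simp add: regular_def independent_copies_def AE_all_countable)

abbreviation sample :: "nat \<Rightarrow> 'w \<Rightarrow> ('a, 'm) chart \<Rightarrow> real^'m \<Rightarrow> nat \<Rightarrow> real" where
  "sample k w c \<equiv> \<lambda>u. normalized_map F k w (param c u)"

abbreviation sample_ip :: "nat \<Rightarrow> 'w \<Rightarrow> ('a, 'm) chart \<Rightarrow> 'm list \<Rightarrow> 'm list \<Rightarrow> real^'m \<Rightarrow> real" where
  "sample_ip k w c \<alpha> \<beta> u \<equiv> L2_space.ip (count_space {..<k}) (fpartials \<alpha> (sample k w c) u) (fpartials \<beta> (sample k w c) u)"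

lemma normalized_map_mult:
  "normalized_map F k w x n = (if n < k then inverse (sqrt (real k)) else 0) * F n x w"
  by (simp add: normalized_map_def divide_inverse mult.commute)

lemma copy_C3: "regular w \<Longrightarrow> c \<in> A \<Longrightarrow> Ck_on 3 (\<lambda>u. F n (param c u) w) (snd c ` fst c)"
  by (simp add: regular_def C3_fun_def comp_def del: Ck_on.simps)

lemma sample_C3: "regular w \<Longrightarrow> c \<in> A \<Longrightarrow> Ck_on 3 (\<lambda>u. sample k w c u n) (snd c ` fst c)"
  unfolding normalized_map_mult by (rule Ck_on_cmult[OF chart_open_range[OF charts] copy_C3])

lemma sample_field: "regular w \<Longrightarrow> c \<in> A \<Longrightarrow> L2_space.field (count_space {..<k}) UNIV 3 (snd c ` fst c) (sample k w c)"
  using sample_C3 by (simp add: L2_space.field_def[OF L2_space_count] AE_count_space del: Ck_on.simps)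

text \<open>Each of the two factors carries \<open>1 / sqrt k\<close>, so inner products of
  derivatives of the normalised map are exactly the averages to which the strong law
  applies.\<close>

lemma sample_ip_mean:
  assumes w: "regular w" and c: "c \<in> A" and u: "u \<in> snd c ` fst c" and len: "length \<alpha> \<le> 3" "length \<beta> \<le> 3"
  shows "sample_ip k w c \<alpha> \<beta> u = (\<Sum>n<k. jet_functional c \<alpha> \<beta> u (copy_path n w)) / real k"
proof -
  let ?U = "snd c ` fst c" and ?r = "inverse (sqrt (real k))"
  have U: "open ?U" by (rule chart_open_range[OF charts[OF c]])
  have d: "fpartials \<gamma> (sample k w c) u n = ?r * diff_quot_lims \<gamma> (path_field c) u (copy_path n w)"
    if n: "n < k" and l: "length \<gamma> \<le> 3" for \<gamma> n
  proof -
    have "fpartials \<gamma> (sample k w c) u n = partials \<gamma> (\<lambda>v. ?r * F n (param c v) w) u"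
      using n by (simp add: fpartials_def normalized_map_mult)
    also have "\<dots> = ?r * partials \<gamma> (\<lambda>v. F n (param c v) w) u"
      by (rule partials_cmult[OF U Ck_on_mono[OF copy_C3[OF w c] l] u])
    also have "partials \<gamma> (\<lambda>v. F n (param c v) w) u = diff_quot_lims \<gamma> (path_field c) u (copy_path n w)"
      by (rule diff_quot_lims_random_path[OF _ c u l, symmetric]) (use w in \<open>simp add: regular_def\<close>)
    finally show ?thesis .
  qed
  have r: "?r * ?r = inverse (real k)" by (simp flip: inverse_mult_distrib)
  have "sample_ip k w c \<alpha> \<beta> u = (\<Sum>n<k. (?r * ?r) * jet_functional c \<alpha> \<beta> u (copy_path n w))"
    unfolding ip_count by (intro sum.cong refl) (simp add: d len jet_functional_def mult_ac)
  also have "\<dots> = (\<Sum>n<k. jet_functional c \<alpha> \<beta> u (copy_path n w)) / real k"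
    unfolding r sum_distrib_left[symmetric] by (simp add: divide_inverse mult.commute)
  finally show ?thesis .
qed

section \<open>Uniform laws on one coordinate cube\<close>

definition good_cube :: "('a, 'm) chart \<Rightarrow> real^'m \<Rightarrow> real \<Rightarrow> bool" where
  "good_cube c a s \<longleftrightarrow> c \<in> A \<and> 0 < s \<and> cbox a (\<chi> i. a $ i + s) \<subseteq> snd c ` fst c"

lemma good_cube_subset: "good_cube c a s \<Longrightarrow> half_open_cube a s \<subseteq> snd c ` fst c"
  using half_open_cube_cbox unfolding good_cube_def by (rule order_trans) blast

definition cube_law :: "('a, 'm) chart \<Rightarrow> real^'m \<Rightarrow> real \<Rightarrow> 'w \<Rightarrow> bool" where
  "cube_law c a s w \<longleftrightarrow> regular w \<and> (\<forall>\<alpha> \<beta>. length \<alpha> \<le> 2 \<longrightarrow> length \<beta> \<le> 2 \<longrightarrow>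
     uniform_limit (half_open_cube a s) (\<lambda>k. sample_ip k w c \<alpha> \<beta>)
       (\<lambda>u. ip (fpartials \<alpha> (chart_field c) u) (fpartials \<beta> (chart_field c) u)) sequentially)"

lemma finite_multi_indices: "finite {\<alpha> :: 'm list. length \<alpha> \<le> r}"
  using finite_lists_length_le[of "UNIV :: 'm set" r] by simp

text \<open>The limit from the uniform strong law is an integral over the path law, identified by
  \<open>jet_functional_mean\<close>. There are finitely many index lists of length at most 2, so
  one null set serves all pairs.\<close>

theorem AE_cube_law:
  assumes good: "good_cube c a s"
  shows "AE w in Q. cube_law c a s w"
proof -
  interpret Q: prob_space Q by (rule prob_Q)
  have c: "c \<in> A" and s: "0 < s" and K: "cbox a (\<chi> i. a $ i + s) \<subseteq> snd c ` fst c"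
    using good by (auto simp: good_cube_def)
  note sub = subsetD[OF good_cube_subset[OF good]]
  let ?I = "{\<alpha> :: 'm list. length \<alpha> \<le> 2}"
  have "AE w in Q. uniform_limit (half_open_cube a s)
     (\<lambda>k u. (\<Sum>n<k. jet_functional c \<alpha> \<beta> u (copy_path n w)) / real k)
     (\<lambda>u. \<integral>p. jet_functional c \<alpha> \<beta> u p \<partial>path_law) sequentially" if ab: "\<alpha> \<in> ?I" "\<beta> \<in> ?I" for \<alpha> \<beta>
  proof -
    obtain B C where chain: "chaining path_law (jet_functional c \<alpha> \<beta>) a s B C (CARD('m) + 4)"
      using jet_functional_chaining[OF c s K] ab by blast
    show ?thesis
    proof (rule Q.uniform_strong_law[OF copies_indep copies_law chain])
      show "AE w in Q. \<forall>n. continuous_on (half_open_cube a s) (\<lambda>u. jet_functional c \<alpha> \<beta> u (copy_path n w))"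
        using AE_regular
      proof (eventually_elim, intro allI)
        fix w n assume w: "regular w"
        have cont: "continuous_on (half_open_cube a s) (partials \<gamma> (\<lambda>v. F n (param c v) w))" if "\<gamma> \<in> ?I" for \<gamma>
        proof -
          have "Ck_on (0 + length \<gamma>) (\<lambda>v. F n (param c v) w) (snd c ` fst c)"
            by (rule Ck_on_mono[OF copy_C3[OF w c]]) (use that in simp)
          from Ck_on_continuous[OF Ck_on_partials[OF this]] show ?thesis
            by (rule continuous_on_subset) (rule good_cube_subset[OF good])
        qed
        have eq: "jet_functional c \<alpha> \<beta> u (copy_path n w) = partials \<alpha> (\<lambda>v. F n (param c v) w) u * partials \<beta> (\<lambda>v. F n (param c v) w) u"
          if "u \<in> half_open_cube a s" for u
          using w ab by (simp add: jet_functional_def regular_def diff_quot_lims_random_path[OF _ c sub[OF that]])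
        show "continuous_on (half_open_cube a s) (\<lambda>u. jet_functional c \<alpha> \<beta> u (copy_path n w))"
          by (rule iffD2[OF continuous_on_cong[OF refl eq]]) (auto intro: continuous_on_mult cont[OF ab(1)] cont[OF ab(2)])
      qed
    qed
  qed
  then have "AE w in Q. \<forall>\<alpha>\<in>?I. \<forall>\<beta>\<in>?I. uniform_limit (half_open_cube a s)
     (\<lambda>k u. (\<Sum>n<k. jet_functional c \<alpha> \<beta> u (copy_path n w)) / real k)
     (\<lambda>u. \<integral>p. jet_functional c \<alpha> \<beta> u p \<partial>path_law) sequentially"
    unfolding AE_ball_countable[OF countable_finite[OF finite_multi_indices]] by blast
  then show ?thesis
    using AE_regular
  proof eventually_elim
    fix w assume law: "\<forall>\<alpha>\<in>?I. \<forall>\<beta>\<in>?I. uniform_limit (half_open_cube a s)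
       (\<lambda>k u. (\<Sum>n<k. jet_functional c \<alpha> \<beta> u (copy_path n w)) / real k)
       (\<lambda>u. \<integral>p. jet_functional c \<alpha> \<beta> u p \<partial>path_law) sequentially" and w: "regular w"
    show "cube_law c a s w"
      unfolding cube_law_def
    proof (intro conjI w allI impI)
      fix \<alpha> \<beta> :: "'m list" assume l: "length \<alpha> \<le> 2" "length \<beta> \<le> 2"
      show "uniform_limit (half_open_cube a s) (\<lambda>k. sample_ip k w c \<alpha> \<beta>)
         (\<lambda>u. ip (fpartials \<alpha> (chart_field c) u) (fpartials \<beta> (chart_field c) u)) sequentially"
      proof (rule iffD1[OF uniform_limit_cong'[OF _ _]])
        show "uniform_limit (half_open_cube a s)
           (\<lambda>k u. (\<Sum>n<k. jet_functional c \<alpha> \<beta> u (copy_path n w)) / real k)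
           (\<lambda>u. \<integral>p. jet_functional c \<alpha> \<beta> u p \<partial>path_law) sequentially" using law l by blast
      qed (use l in \<open>simp_all add: sample_ip_mean[OF w c sub] jet_functional_mean[OF c sub]\<close>)
    qed
  qed
qed

lemma jet_limit:
  assumes law: "cube_law c a s w"
  shows "uniform_limit (half_open_cube a s) (\<lambda>k. L2_space.G_of (count_space {..<k}) (sample k w c)) (G_of (chart_field c)) sequentially"
    and "uniform_limit (half_open_cube a s) (\<lambda>k. L2_space.field_jet (count_space {..<k}) (sample k w c)) (field_jet (chart_field c)) sequentially"
proof -
  have l: "uniform_limit (half_open_cube a s) (\<lambda>k. sample_ip k w c \<alpha> \<beta>)
       (\<lambda>u. ip (fpartials \<alpha> (chart_field c) u) (fpartials \<beta> (chart_field c) u)) sequentially"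
    if "length \<alpha> \<le> 2" "length \<beta> \<le> 2" for \<alpha> \<beta>
    using law that by (simp add: cube_law_def)
  note e = jet_entries L2_space.jet_entries[OF L2_space_count]
  show G: "uniform_limit (half_open_cube a s) (\<lambda>k. L2_space.G_of (count_space {..<k}) (sample k w c)) (G_of (chart_field c)) sequentially"
    by (intro uniform_limit_vec, unfold e) (rule l, simp_all)
  show "uniform_limit (half_open_cube a s) (\<lambda>k. L2_space.field_jet (count_space {..<k}) (sample k w c)) (field_jet (chart_field c)) sequentially"
    unfolding field_jet_def[abs_def] L2_space.field_jet_def[OF L2_space_count, abs_def]
  proof (intro uniform_limit_Pair G)
    show "uniform_limit (half_open_cube a s) (\<lambda>k. L2_space.T_of (count_space {..<k}) (sample k w c)) (T_of (chart_field c)) sequentially"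
      by (intro uniform_limit_vec, unfold e) (rule l, simp_all)
    show "uniform_limit (half_open_cube a s) (\<lambda>k. L2_space.S_of (count_space {..<k}) (sample k w c)) (S_of (chart_field c)) sequentially"
      by (intro uniform_limit_vec, unfold e) (rule l, simp_all)
  qed
qed

text \<open>The point is that \<open>C\<close> is independent of \<open>w\<close>: only the index
  from which the bound holds is random. The neighbourhoods used for injectivity can then be chosen
  deterministically.\<close>

lemma sample_bound:
  assumes good: "good_cube c a s"
  obtains C where "0 \<le> C" "\<And>w. cube_law c a s w \<Longrightarrow>
    \<forall>\<^sub>F k in sequentially. \<forall>\<alpha>. length \<alpha> \<le> 2 \<longrightarrow> (\<forall>u\<in>half_open_cube a s. sample_ip k w c \<alpha> \<alpha> u \<le> C\<^sup>2)"
proof -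
  have c: "c \<in> A" and K: "cbox a (\<chi> i. a $ i + s) \<subseteq> snd c ` fst c" using good by (auto simp: good_cube_def)
  obtain b where b: "\<And>\<alpha> u. length \<alpha> \<le> 3 \<Longrightarrow> u \<in> cbox a (\<chi> i. a $ i + s) \<Longrightarrow> ip (fpartials \<alpha> (chart_field c) u) (fpartials \<alpha> (chart_field c) u) \<le> b"
    using fpartials_bounded[OF c compact_cbox K] by blast
  let ?C = "1 + \<bar>b\<bar>"
  show ?thesis
  proof (rule that[of ?C])
    fix w assume law: "cube_law c a s w"
    have "\<forall>\<^sub>F k in sequentially. \<forall>\<alpha>\<in>{\<alpha> :: 'm list. length \<alpha> \<le> 2}. \<forall>u\<in>half_open_cube a s.
       dist (sample_ip k w c \<alpha> \<alpha> u) (ip (fpartials \<alpha> (chart_field c) u) (fpartials \<alpha> (chart_field c) u)) < 1"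
      by (rule eventually_ball_finite[OF finite_multi_indices])
        (use law in \<open>auto simp: cube_law_def intro!: uniform_limitD\<close>)
    then show "\<forall>\<^sub>F k in sequentially. \<forall>\<alpha>. length \<alpha> \<le> 2 \<longrightarrow> (\<forall>u\<in>half_open_cube a s. sample_ip k w c \<alpha> \<alpha> u \<le> ?C\<^sup>2)"
    proof (eventually_elim, intro allI impI ballI)
      fix k and \<alpha> :: "'m list" and u
      assume *: "\<forall>\<alpha>\<in>{\<alpha> :: 'm list. length \<alpha> \<le> 2}. \<forall>u\<in>half_open_cube a s.
         dist (sample_ip k w c \<alpha> \<alpha> u) (ip (fpartials \<alpha> (chart_field c) u) (fpartials \<alpha> (chart_field c) u)) < 1"
        and l: "length \<alpha> \<le> 2" and u: "u \<in> half_open_cube a s"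
      have "dist (sample_ip k w c \<alpha> \<alpha> u) (ip (fpartials \<alpha> (chart_field c) u) (fpartials \<alpha> (chart_field c) u)) < 1"
        using * l u by blast
      moreover have "ip (fpartials \<alpha> (chart_field c) u) (fpartials \<alpha> (chart_field c) u) \<le> b"
        by (rule b) (use l u half_open_cube_cbox in auto)
      ultimately have "sample_ip k w c \<alpha> \<alpha> u \<le> ?C" unfolding dist_real_def by linarith
      also have "\<dots> \<le> ?C\<^sup>2" using self_le_power[of ?C 2] by simp
      finally show "sample_ip k w c \<alpha> \<alpha> u \<le> ?C\<^sup>2" .
    qed
  qed simp
qed

text \<open>A perturbation of the limiting Gram matrix by less than \<open>?e\<close> changes its
  quadratic form by at most \<open>l / 2\<close> times the squared norm, so half of the
  deterministic lower bound survives.\<close>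

lemma sample_lower_bound:
  assumes good: "good_cube c a s"
  obtains l where "0 < l" "\<And>w. cube_law c a s w \<Longrightarrow>
    \<forall>\<^sub>F k in sequentially. \<forall>u\<in>half_open_cube a s. \<forall>v. l * (norm v)\<^sup>2 \<le>
      (\<Sum>n<k. (\<Sum>i\<in>UNIV. v $ i * partial i (\<lambda>u. sample k w c u n) u)\<^sup>2)"
proof -
  have c: "c \<in> A" and K: "cbox a (\<chi> i. a $ i + s) \<subseteq> snd c ` fst c" using good by (auto simp: good_cube_def)
  have "continuous_on (snd c ` fst c) (\<lambda>u. fst (mfd.jet c u))" by (rule continuous_on_fst[OF mfd.jet_continuous[OF c]])
  then have "continuous_on (cbox a (\<chi> i. a $ i + s)) (G_of (chart_field c))"
    unfolding mfd.jet_def fst_conv by (rule continuous_on_subset) (rule K)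
  then obtain l where l: "0 < l" "\<And>u v. u \<in> cbox a (\<chi> i. a $ i + s) \<Longrightarrow> l * (norm v)\<^sup>2 \<le> metric_inner (G_of (chart_field c) u) v v"
    by (rule pos_def_uniform[OF compact_cbox _ mfd.posdef[OF c subsetD[OF K]]]) blast+
  let ?m = "(real CARD('m))\<^sup>2"
  have m: "0 < ?m" by simp
  let ?e = "l / (2 * ?m)"
  have e: "0 < ?e" using l(1) m by (intro divide_pos_pos) auto
  show ?thesis
  proof (rule that[of "l / 2"])
    fix w assume law: "cube_law c a s w"
    show "\<forall>\<^sub>F k in sequentially. \<forall>u\<in>half_open_cube a s. \<forall>v. l / 2 * (norm v)\<^sup>2 \<le>
      (\<Sum>n<k. (\<Sum>i\<in>UNIV. v $ i * partial i (\<lambda>u. sample k w c u n) u)\<^sup>2)"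
      using uniform_limitD[OF jet_limit(1)[OF law] e]
    proof (eventually_elim, intro ballI allI)
      fix k u and v :: "real^'m"
      let ?B = "L2_space.G_of (count_space {..<k}) (sample k w c) u" and ?G = "G_of (chart_field c) u"
      assume *: "\<forall>u\<in>half_open_cube a s. dist (L2_space.G_of (count_space {..<k}) (sample k w c) u) (G_of (chart_field c) u) < ?e"
        and u: "u \<in> half_open_cube a s"
      have "norm (?B - ?G) \<le> ?e" using * u by (auto simp: dist_norm less_imp_le)
      then have "?m * norm (?B - ?G) * (norm v)\<^sup>2 \<le> ?m * ?e * (norm v)\<^sup>2"
        using e by (intro mult_right_mono mult_left_mono) auto
      then have "\<bar>metric_inner (?B - ?G) v v\<bar> \<le> l / 2 * (norm v)\<^sup>2"
        using metric_inner_le_norm[of "?B - ?G" v] m by simp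
      then have "l / 2 * (norm v)\<^sup>2 \<le> metric_inner ?B v v"
        using l(2)[OF subsetD[OF half_open_cube_cbox u], of v] unfolding metric_inner_diff by linarith
      also have "\<dots> = (\<Sum>i\<in>UNIV. \<Sum>j\<in>UNIV. \<Sum>n<k. (v $ i * partial i (\<lambda>u. sample k w c u n) u) * (v $ j * partial j (\<lambda>u. sample k w c u n) u))"
        unfolding metric_inner_sum L2_space.G_of_def[OF L2_space_count] ip_count L2_space.fpartial_def[OF L2_space_count]
        by (simp add: sum_distrib_left sum_distrib_right mult_ac)
      also have "\<dots> = (\<Sum>n<k. (\<Sum>i\<in>UNIV. v $ i * partial i (\<lambda>u. sample k w c u n) u)\<^sup>2)"
        unfolding power2_eq_square sum_product by (subst sum.swap, subst (2) sum.swap, subst sum.swap, rule sum.cong[OF refl], rule sum.swap)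
      finally show "l / 2 * (norm v)\<^sup>2 \<le> (\<Sum>n<k. (\<Sum>i\<in>UNIV. v $ i * partial i (\<lambda>u. sample k w c u n) u)\<^sup>2)" .
    qed
  qed (use l in simp)
qed

end

section \<open>Embedding\<close>

context gaussian_copies
begin

lemma good_cube_at:
  assumes "x \<in> topspace M"
  obtains c a s e where "good_cube c a s" "c \<in> A" "x \<in> fst c" "0 < e" "ball (snd c x) e \<subseteq> half_open_cube a s"
    "snd c x \<in> box a (\<chi> i. a $ i + s)"
proof -
  obtain c where c: "c \<in> A" "x \<in> fst c" using assms covers by blast
  obtain a s where s: "0 < s" "snd c x \<in> box a (\<chi> i. a $ i + s)" "cbox a (\<chi> i. a $ i + s) \<subseteq> snd c ` fst c"
    by (rule open_contains_cube[OF chart_open_range[OF charts[OF c(1)]] imageI[OF c(2)]])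
  obtain e where e: "0 < e" "ball (snd c x) e \<subseteq> box a (\<chi> i. a $ i + s)" by (rule openE[OF open_box s(2)])
  have good: "good_cube c a s" using c(1) s(1,3) by (simp add: good_cube_def)
  show ?thesis by (rule that[OF good c e(1) order_trans[OF e(2) box_half_open_cube] s(2)])
qed

lemma chart_ball:
  assumes "c \<in> A" "x \<in> fst c" "0 < r"
  shows "openin M {z \<in> fst c. snd c z \<in> ball (snd c x) r}" "x \<in> {z \<in> fst c. snd c z \<in> ball (snd c x) r}"
  using chart_preimage_openin[OF charts[OF assms(1)] open_ball] assms by auto

lemma sample_at: "c \<in> A \<Longrightarrow> z \<in> fst c \<Longrightarrow> sample k w c (snd c z) = normalized_map F k w z"
  by (simp add: param_chart[OF charts])

lemma separated_near:
  assumes x: "x \<in> topspace M"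
  shows "\<exists>W. openin M W \<and> x \<in> W \<and> (AE w in Q. \<forall>\<^sub>F k in sequentially. \<forall>y\<in>W. \<forall>z\<in>W.
    normalized_map F k w y = normalized_map F k w z \<longrightarrow> y = z)"
proof -
  obtain c a s e where good: "good_cube c a s" and c: "c \<in> A" "x \<in> fst c"
    and e: "0 < e" "ball (snd c x) e \<subseteq> half_open_cube a s" and "snd c x \<in> box a (\<chi> i. a $ i + s)"
    by (rule good_cube_at[OF x])
  obtain C where C: "0 \<le> C" "\<And>w. cube_law c a s w \<Longrightarrow>
    \<forall>\<^sub>F k in sequentially. \<forall>\<alpha>. length \<alpha> \<le> 2 \<longrightarrow> (\<forall>u\<in>half_open_cube a s. sample_ip k w c \<alpha> \<alpha> u \<le> C\<^sup>2)"
    using sample_bound[OF good] by blast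
  obtain l where l: "0 < l" "\<And>w. cube_law c a s w \<Longrightarrow>
    \<forall>\<^sub>F k in sequentially. \<forall>u\<in>half_open_cube a s. \<forall>v. l * (norm v)\<^sup>2 \<le>
      (\<Sum>n<k. (\<Sum>i\<in>UNIV. v $ i * partial i (\<lambda>u. sample k w c u n) u)\<^sup>2)"
    using sample_lower_bound[OF good] by blast
  define D where "D = real CARD('m) ^ 3 * C\<^sup>2"
  have D: "0 \<le> D" by (simp add: D_def)
  \<comment> \<open>With this value \<open>D\<close> times the square of \<open>\<delta>\<close>
    stays strictly below \<open>l\<close>. Points of a ball of radius at most half of
    \<open>\<delta>\<close> are then close enough for
    \<open>immersion_locally_injective\<close>.\<close>
  define \<delta> where "\<delta> = sqrt (l / (D + 1))"
  have \<delta>: "0 < \<delta>" "D * \<delta>\<^sup>2 < l"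
    using l D by (simp_all add: \<delta>_def divide_less_eq algebra_simps)
  define r where "r = min e (\<delta> / 2)"
  have r: "0 < r" "r \<le> e" "2 * r \<le> \<delta>" using e \<delta> by (auto simp: r_def)
  let ?W = "{z \<in> fst c. snd c z \<in> ball (snd c x) r}"
  have U: "open (snd c ` fst c)" by (rule chart_open_range[OF charts[OF c(1)]])
  have cube: "ball (snd c x) r \<subseteq> half_open_cube a s" using e(2) subset_ball[OF r(2)] by blast
  have sub: "ball (snd c x) r \<subseteq> snd c ` fst c" using cube good_cube_subset[OF good] by blast
  have "AE w in Q. \<forall>\<^sub>F k in sequentially. \<forall>y\<in>?W. \<forall>z\<in>?W. normalized_map F k w y = normalized_map F k w z \<longrightarrow> y = z"
    using AE_cube_law[OF good]
  proof eventually_elim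
    fix w assume law: "cube_law c a s w"
    then have w: "regular w" by (simp add: cube_law_def)
    show "\<forall>\<^sub>F k in sequentially. \<forall>y\<in>?W. \<forall>z\<in>?W. normalized_map F k w y = normalized_map F k w z \<longrightarrow> y = z"
      using C(2)[OF law] l(2)[OF law]
    proof (eventually_elim, intro ballI impI)
      fix k y z
      assume b: "\<forall>\<alpha>. length \<alpha> \<le> 2 \<longrightarrow> (\<forall>u\<in>half_open_cube a s. sample_ip k w c \<alpha> \<alpha> u \<le> C\<^sup>2)"
        and lo: "\<forall>u\<in>half_open_cube a s. \<forall>v. l * (norm v)\<^sup>2 \<le>
          (\<Sum>n<k. (\<Sum>i\<in>UNIV. v $ i * partial i (\<lambda>u. sample k w c u n) u)\<^sup>2)"
        and y: "y \<in> ?W" and z: "z \<in> ?W" and eq: "normalized_map F k w y = normalized_map F k w z"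
      have "norm (snd c z - snd c y) < 2 * r"
        using dist_triangle_less_add[of "snd c z" "snd c x" r "snd c y" r] y z by (simp add: dist_norm norm_minus_commute)
      then have "(norm (snd c z - snd c y))\<^sup>2 \<le> \<delta>\<^sup>2" using r(3) by (intro power_mono) auto
      then have small: "D * (norm (snd c z - snd c y))\<^sup>2 < l" using mult_left_mono[OF _ D] \<delta>(2) by fastforce
      have "snd c y = snd c z"
      proof (rule immersion_locally_injective[OF U convex_ball sub, where k = k and H = "sample k w c" and l = l and C = C])
        show "Ck_on 3 (\<lambda>u. sample k w c u n) (snd c ` fst c)" for n by (rule sample_C3[OF w c(1)])
        show "l * (norm v)\<^sup>2 \<le> (\<Sum>n<k. (\<Sum>i\<in>UNIV. v $ i * partial i (\<lambda>u. sample k w c u n) u)\<^sup>2)"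
          if "u \<in> ball (snd c x) r" for u v using lo that cube by blast
        show "(\<Sum>n<k. (partial i (partial j (\<lambda>u. sample k w c u n)) u)\<^sup>2) \<le> C\<^sup>2" if "u \<in> ball (snd c x) r" for u i j
        proof -
          have "sample_ip k w c [i, j] [i, j] u \<le> C\<^sup>2" using b subsetD[OF cube that] by simp
          then show ?thesis by (simp add: ip_count fpartials_def power2_eq_square)
        qed
        show "real CARD('m) ^ 3 * C\<^sup>2 * (norm (snd c z - snd c y))\<^sup>2 < l" using small by (simp add: D_def)
        show "sample k w c (snd c y) n = sample k w c (snd c z) n" for n
          using y z eq by (simp add: sample_at[OF c(1)])
      qed (use y z C in auto)
      then show "y = z" using y z inj_onD[OF chart_inj[OF charts[OF c(1)]]] by simp
    qed
  qed
  then show ?thesis using chart_ball[OF c r(1)] by blast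
qed

text \<open>The uniform bound on first derivatives is a Lipschitz constant common to all large
  \<open>k\<close>, so a neighbourhood independent of \<open>k\<close> and \<open>w\<close> can be
  chosen.\<close>

lemma sample_equicontinuous:
  assumes x: "x \<in> topspace M" and \<rho>: "0 < \<rho>"
  shows "\<exists>W. openin M W \<and> x \<in> W \<and> (AE w in Q. \<forall>\<^sub>F k in sequentially. \<forall>z\<in>W.
    (\<Sum>n<k. (normalized_map F k w z n - normalized_map F k w x n)\<^sup>2) \<le> \<rho>)"
proof -
  obtain c a s e where good: "good_cube c a s" and c: "c \<in> A" "x \<in> fst c"
    and e: "0 < e" "ball (snd c x) e \<subseteq> half_open_cube a s" and "snd c x \<in> box a (\<chi> i. a $ i + s)"
    by (rule good_cube_at[OF x])
  obtain C where C: "0 \<le> C" "\<And>w. cube_law c a s w \<Longrightarrow>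
    \<forall>\<^sub>F k in sequentially. \<forall>\<alpha>. length \<alpha> \<le> 2 \<longrightarrow> (\<forall>u\<in>half_open_cube a s. sample_ip k w c \<alpha> \<alpha> u \<le> C\<^sup>2)"
    using sample_bound[OF good] by blast
  let ?D = "real CARD('m) * C"
  have D: "0 \<le> ?D" using C by simp
  define r where "r = min e (sqrt \<rho> / (?D + 1))"
  have r: "0 < r" "r \<le> e" using e \<rho> D by (auto simp: r_def intro!: divide_pos_pos)
  have "r \<le> sqrt \<rho> / (?D + 1)" by (simp add: r_def)
  then have "(?D + 1) * r \<le> sqrt \<rho>" using D by (simp add: pos_le_divide_eq mult.commute)
  then have "?D * r \<le> sqrt \<rho>" using r by (simp add: algebra_simps)
  then have "(?D * r)\<^sup>2 \<le> (sqrt \<rho>)\<^sup>2" using D r by (intro power_mono) auto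
  then have Dr: "(?D * r)\<^sup>2 \<le> \<rho>" using \<rho> by simp
  let ?W = "{z \<in> fst c. snd c z \<in> ball (snd c x) r}"
  have U: "open (snd c ` fst c)" by (rule chart_open_range[OF charts[OF c(1)]])
  have cube: "ball (snd c x) r \<subseteq> half_open_cube a s" using e(2) subset_ball[OF r(2)] by blast
  have sub: "ball (snd c x) r \<subseteq> snd c ` fst c" using cube good_cube_subset[OF good] by blast
  have "AE w in Q. \<forall>\<^sub>F k in sequentially. \<forall>z\<in>?W. (\<Sum>n<k. (normalized_map F k w z n - normalized_map F k w x n)\<^sup>2) \<le> \<rho>"
    using AE_cube_law[OF good]
  proof eventually_elim
    fix w assume law: "cube_law c a s w"
    then have w: "regular w" by (simp add: cube_law_def)
    show "\<forall>\<^sub>F k in sequentially. \<forall>z\<in>?W. (\<Sum>n<k. (normalized_map F k w z n - normalized_map F k w x n)\<^sup>2) \<le> \<rho>"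
      using C(2)[OF law]
    proof (eventually_elim, intro ballI)
      fix k z
      assume b: "\<forall>\<alpha>. length \<alpha> \<le> 2 \<longrightarrow> (\<forall>u\<in>half_open_cube a s. sample_ip k w c \<alpha> \<alpha> u \<le> C\<^sup>2)" and z: "z \<in> ?W"
      interpret S: L2_space "count_space {..<k}" UNIV by (rule L2_space_count)
      have "S.field (Suc 2) (snd c ` fst c) (sample k w c)" using sample_field[OF w c(1)] by simp
      from S.field_Lipschitz[OF U this convex_ball sub C(1), of "snd c x" "snd c z"]
      have "(\<Sum>n<k. (sample k w c (snd c z) n - sample k w c (snd c x) n)\<^sup>2) \<le> (?D * norm (snd c z - snd c x))\<^sup>2"
      proof -
        have "S.ip (S.fpartial i (sample k w c) u) (S.fpartial i (sample k w c) u) \<le> C\<^sup>2" if "u \<in> ball (snd c x) r" for u i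
        proof -
          have "sample_ip k w c [i] [i] u \<le> C\<^sup>2" using b subsetD[OF cube that] by simp
          then show ?thesis by (simp add: S.fpartials_simps)
        qed
        from S.field_Lipschitz[OF U \<open>S.field (Suc 2) (snd c ` fst c) (sample k w c)\<close> convex_ball sub C(1) this, of "snd c x" "snd c z"]
        show ?thesis using z r by (simp add: ip_count power2_eq_square)
      qed
      also have "\<dots> \<le> (?D * r)\<^sup>2"
        using z C by (intro power_mono mult_left_mono) (auto simp: dist_norm norm_minus_commute)
      also have "\<dots> \<le> \<rho>" by (rule Dr)
      finally show "(\<Sum>n<k. (normalized_map F k w z n - normalized_map F k w x n)\<^sup>2) \<le> \<rho>"
        using z c by (simp add: sample_at[OF c(1)])
    qed
  qed
  then show ?thesis using chart_ball[OF c r(1)] by blast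
qed

text \<open>The squared distance of the image points is an average of independent copies of the
  squared difference of \<open>f x\<close> and \<open>f y\<close>. Its mean is the covariance form
  with coefficients 1 and -1, positive by hypothesis.\<close>

lemma pair_distance:
  assumes x: "x \<in> topspace M" and y: "y \<in> topspace M" and ne: "x \<noteq> y"
  shows "\<exists>\<rho>>0. AE w in Q. \<forall>\<^sub>F k in sequentially. \<rho> < (\<Sum>n<k. (normalized_map F k w x n - normalized_map F k w y n)\<^sup>2)"
proof -
  interpret Q: prob_space Q by (rule prob_Q)
  let ?X = "\<lambda>w. f x w - f y w"
  have L: "f z \<in> gclosure" if "z \<in> topspace M" for z by (rule L0_gclosure[OF point_in_combinations[OF that]])
  have X: "?X \<in> gclosure" by (rule L_diff[OF L[OF x] L[OF y]])
  have cov: "covariance P f p q = ip (f p) (f q)" if "p \<in> topspace M" "q \<in> topspace M" for p q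
    unfolding covariance_def ip_def
    by (rule integral_completion[symmetric])
      (intro borel_measurable_times borel_measurable_integrable point_integrable that)
  have "ip ?X ?X = (\<integral>w. (f x w * f x w - f x w * f y w) - (f y w * f x w - f y w * f y w) \<partial>completion P)"
    unfolding ip_def by (rule Bochner_Integration.integral_cong) (simp_all add: algebra_simps)
  also have "\<dots> = (ip (f x) (f x) - ip (f x) (f y)) - (ip (f y) (f x) - ip (f y) (f y))"
    unfolding ip_def using integrable_ip[OF L L] x y by (simp add: mult.commute)
  also have "\<dots> = (\<Sum>p\<in>{x, y}. \<Sum>q\<in>{x, y}. (if p = x then 1 else -1) * (if q = x then 1 else -1) * covariance P f p q)"
    using x y ne by (simp add: cov)
  also have "\<dots> > 0" using kernel x y unfolding positive_definite_kernel_def by (auto intro!: exI[of _ x])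
  finally have pos: "0 < ip ?X ?X" .
  let ?\<phi> = "\<lambda>p. (p x - p y)\<^sup>2 :: real"
  have \<phi>: "?\<phi> \<in> borel_measurable path_space"
    using measurable_component_singleton[of x "topspace M" "\<lambda>_. borel :: real measure"]
      measurable_component_singleton[of y "topspace M" "\<lambda>_. borel :: real measure"] x y by measurable
  have \<phi>4: "(\<lambda>p. ?\<phi> p ^ 4) \<in> borel_measurable path_space" using \<phi> by measurable
  have rp: "random_path (topspace M) f' w z = f' z w" if "z \<in> topspace M" for f' :: "'a \<Rightarrow> 'z \<Rightarrow> real" and z w
    using that by (simp add: random_path_def)
  have ae8: "AE w in completion P. (random_path (topspace M) f w x - random_path (topspace M) f w y)\<^sup>2 ^ 4 = ?X w ^ 8"
    by (simp add: rp[OF x] rp[OF y] flip: power_mult)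
  have int: "integrable path_law (\<lambda>p. ?\<phi> p ^ 4)"
    using gclosure_moment(1)[OF X, of 8] unfolding path_law_transfer(1)[OF \<phi>4 ae8] .
  have mean: "(\<integral>p. ?\<phi> p \<partial>path_law) = ip ?X ?X"
    unfolding ip_def by (rule path_law_transfer(2)[OF \<phi>]) (simp add: rp[OF x] rp[OF y] power2_eq_square)
  have eq: "(\<Sum>n<k. (normalized_map F k w x n - normalized_map F k w y n)\<^sup>2) = (\<Sum>n<k. ?\<phi> (copy_path n w)) / real k" for k w
  proof -
    have "(\<Sum>n<k. (normalized_map F k w x n - normalized_map F k w y n)\<^sup>2) = (\<Sum>n<k. (F n x w - F n y w)\<^sup>2 / real k)"
      by (intro sum.cong refl) (simp add: normalized_map_def diff_divide_distrib[symmetric] power_divide)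
    then show ?thesis by (simp add: rp[OF x] rp[OF y] sum_divide_distrib)
  qed
  have "AE w in Q. (\<lambda>k. (\<Sum>n<k. ?\<phi> (copy_path n w)) / real k) \<longlonglongrightarrow> ip ?X ?X"
    using Q.strong_law_distr[OF copies_indep copies_law \<phi> int] unfolding mean .
  then have "AE w in Q. \<forall>\<^sub>F k in sequentially. ip ?X ?X / 2 < (\<Sum>n<k. (normalized_map F k w x n - normalized_map F k w y n)\<^sup>2)"
    unfolding eq by eventually_elim (rule order_tendstoD(1), use pos in auto)
  then show ?thesis using pos by (intro exI[of _ "ip ?X ?X / 2"]) simp
qed

lemma separated_apart:
  assumes x: "x \<in> topspace M" and y: "y \<in> topspace M" and ne: "x \<noteq> y"
  shows "\<exists>W W'. openin M W \<and> x \<in> W \<and> openin M W' \<and> y \<in> W' \<and>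
    (AE w in Q. \<forall>\<^sub>F k in sequentially. \<forall>x'\<in>W. \<forall>y'\<in>W'. normalized_map F k w x' \<noteq> normalized_map F k w y')"
proof -
  obtain \<rho> where \<rho>: "0 < \<rho>" and far: "AE w in Q. \<forall>\<^sub>F k in sequentially.
      \<rho> < (\<Sum>n<k. (normalized_map F k w x n - normalized_map F k w y n)\<^sup>2)" using pair_distance[OF assms] by blast
  \<comment> \<open>A common image would make the squared distance at most
    \<open>2 * (\<rho> / 4) + 2 * (\<rho> / 4) = \<rho>\<close>, while it exceeds
    \<open>\<rho>\<close>.\<close>
  have \<rho>4: "0 < \<rho> / 4" using \<rho> by simp
  obtain W where W: "openin M W" "x \<in> W" "AE w in Q. \<forall>\<^sub>F k in sequentially. \<forall>z\<in>W.
    (\<Sum>n<k. (normalized_map F k w z n - normalized_map F k w x n)\<^sup>2) \<le> \<rho> / 4" using sample_equicontinuous[OF x \<rho>4] by blast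
  obtain W' where W': "openin M W'" "y \<in> W'" "AE w in Q. \<forall>\<^sub>F k in sequentially. \<forall>z\<in>W'.
    (\<Sum>n<k. (normalized_map F k w z n - normalized_map F k w y n)\<^sup>2) \<le> \<rho> / 4" using sample_equicontinuous[OF y \<rho>4] by blast
  have "AE w in Q. \<forall>\<^sub>F k in sequentially. \<forall>x'\<in>W. \<forall>y'\<in>W'. normalized_map F k w x' \<noteq> normalized_map F k w y'"
    using far W(3) W'(3)
  proof eventually_elim
    fix w
    assume a: "\<forall>\<^sub>F k in sequentially. \<rho> < (\<Sum>n<k. (normalized_map F k w x n - normalized_map F k w y n)\<^sup>2)"
      "\<forall>\<^sub>F k in sequentially. \<forall>z\<in>W. (\<Sum>n<k. (normalized_map F k w z n - normalized_map F k w x n)\<^sup>2) \<le> \<rho> / 4"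
      "\<forall>\<^sub>F k in sequentially. \<forall>z\<in>W'. (\<Sum>n<k. (normalized_map F k w z n - normalized_map F k w y n)\<^sup>2) \<le> \<rho> / 4"
    show "\<forall>\<^sub>F k in sequentially. \<forall>x'\<in>W. \<forall>y'\<in>W'. normalized_map F k w x' \<noteq> normalized_map F k w y'"
      using a
    proof (eventually_elim, intro ballI notI)
      fix k x' y'
      let ?h = "normalized_map F k w"
      assume a: "\<rho> < (\<Sum>n<k. (?h x n - ?h y n)\<^sup>2)" "\<forall>z\<in>W. (\<Sum>n<k. (?h z n - ?h x n)\<^sup>2) \<le> \<rho> / 4"
        "\<forall>z\<in>W'. (\<Sum>n<k. (?h z n - ?h y n)\<^sup>2) \<le> \<rho> / 4" and z: "x' \<in> W" "y' \<in> W'" and eq: "?h x' = ?h y'"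
      have "(?h x n - ?h y n)\<^sup>2 \<le> 2 * (?h x' n - ?h x n)\<^sup>2 + 2 * (?h y' n - ?h y n)\<^sup>2" for n
      proof -
        have "0 \<le> ((?h x' n - ?h x n) + (?h y' n - ?h y n))\<^sup>2" by simp
        then show ?thesis unfolding eq by (simp add: power2_eq_square algebra_simps)
      qed
      then have "(\<Sum>n<k. (?h x n - ?h y n)\<^sup>2) \<le> 2 * (\<Sum>n<k. (?h x' n - ?h x n)\<^sup>2) + 2 * (\<Sum>n<k. (?h y' n - ?h y n)\<^sup>2)"
        unfolding sum_distrib_left sum.distrib[symmetric] by (intro sum_mono)
      then show False using a(1) a(2)[rule_format, OF z(1)] a(3)[rule_format, OF z(2)] by linarith
    qed
  qed
  then show ?thesis using W(1,2) W'(1,2) by blast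
qed

text \<open>Compactness is used on the product of \<open>M\<close> with itself: near the diagonal
  local injectivity applies, and around every other pair the images are separated.\<close>

lemma AE_eventually_inj:
  "AE w in Q. \<forall>\<^sub>F k in sequentially. inj_on (normalized_map F k w) (topspace M)"
proof -
  have "AE w in Q. \<forall>\<^sub>F k in sequentially. \<forall>z\<in>topspace (prod_topology M M).
    normalized_map F k w (fst z) = normalized_map F k w (snd z) \<longrightarrow> fst z = snd z"
  proof (rule compact_space_AE_eventually)
    show "compact_space (prod_topology M M)" using compact_M by (simp add: compact_space_prod_topology)
    fix p assume "p \<in> topspace (prod_topology M M)"
    then obtain x y where p: "p = (x, y)" "x \<in> topspace M" "y \<in> topspace M" by auto
    have "\<exists>W W'. openin M W \<and> x \<in> W \<and> openin M W' \<and> y \<in> W' \<and> (AE w in Q. \<forall>\<^sub>F k in sequentially.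
      \<forall>x'\<in>W. \<forall>y'\<in>W'. normalized_map F k w x' = normalized_map F k w y' \<longrightarrow> x' = y')"
    proof (cases "x = y")
      case True
      then show ?thesis using separated_near[OF p(2)] by blast
    next
      case False
      obtain W W' where W: "openin M W" "x \<in> W" "openin M W'" "y \<in> W'"
        and ae: "AE w in Q. \<forall>\<^sub>F k in sequentially. \<forall>x'\<in>W. \<forall>y'\<in>W'. normalized_map F k w x' \<noteq> normalized_map F k w y'"
        using separated_apart[OF p(2,3) False] by blast
      have "AE w in Q. \<forall>\<^sub>F k in sequentially. \<forall>x'\<in>W. \<forall>y'\<in>W'. normalized_map F k w x' = normalized_map F k w y' \<longrightarrow> x' = y'"
        using ae by eventually_elim (auto elim!: eventually_mono)
      then show ?thesis using W by blast
    qed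
    then obtain W W' where W: "openin M W" "x \<in> W" "openin M W'" "y \<in> W'"
      and ae: "AE w in Q. \<forall>\<^sub>F k in sequentially. \<forall>x'\<in>W. \<forall>y'\<in>W'. normalized_map F k w x' = normalized_map F k w y' \<longrightarrow> x' = y'"
      by blast
    show "\<exists>V. openin (prod_topology M M) V \<and> p \<in> V \<and> (AE w in Q. \<forall>\<^sub>F k in sequentially. \<forall>z\<in>V.
      normalized_map F k w (fst z) = normalized_map F k w (snd z) \<longrightarrow> fst z = snd z)"
    proof (intro exI[of _ "W \<times> W'"] conjI)
      show "openin (prod_topology M M) (W \<times> W')" using W by (simp add: openin_prod_Times_iff)
      show "AE w in Q. \<forall>\<^sub>F k in sequentially. \<forall>z\<in>W \<times> W'.
        normalized_map F k w (fst z) = normalized_map F k w (snd z) \<longrightarrow> fst z = snd z"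
        using ae by eventually_elim (auto elim!: eventually_mono)
    qed (use W p in simp)
  qed
  then show ?thesis by eventually_elim (auto elim!: eventually_mono simp: inj_on_def)
qed

lemma C3_fun_continuous_map:
  assumes "C3_fun A \<phi>" shows "continuous_map M euclideanreal \<phi>"
  unfolding continuous_map_def
proof (intro conjI allI impI)
  fix B :: "real set" assume "openin euclideanreal B"
  then have B: "open B" by simp
  let ?O = "\<lambda>c. (\<lambda>u. \<phi> (param c u)) -` B \<inter> snd c ` fst c"
  have o: "open (?O c)" if c: "c \<in> A" for c
  proof -
    have "continuous_on (snd c ` fst c) (\<lambda>u. \<phi> (param c u))"
      using assms c by (intro Ck_on_continuous[of 3]) (simp add: C3_fun_def comp_def del: Ck_on.simps)
    then show ?thesis using B continuous_on_open_vimage[OF chart_open_range[OF charts[OF c]]] by blast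
  qed
  have eq: "{x \<in> fst c. \<phi> x \<in> B} = {x \<in> fst c. snd c x \<in> ?O c}" if "c \<in> A" for c
  proof -
    have "snd c x \<in> ?O c \<longleftrightarrow> \<phi> x \<in> B" if "x \<in> fst c" for x using that param_chart[OF charts[OF \<open>c \<in> A\<close>]] by simp
    then show ?thesis by blast
  qed
  have "{x \<in> topspace M. \<phi> x \<in> B} = (\<Union>c\<in>A. {x \<in> fst c. \<phi> x \<in> B})" using covers by auto
  also have "openin M \<dots>"
  proof (rule openin_Union, elim imageE)
    fix S c assume S: "S = {x \<in> fst c. \<phi> x \<in> B}" "c \<in> A"
    show "openin M S" unfolding S(1) eq[OF S(2)] by (rule chart_preimage_openin[OF charts[OF S(2)] o[OF S(2)]])
  qed
  finally show "openin M {x \<in> topspace M. \<phi> x \<in> B}" .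
qed simp

lemma AE_eventually_immersion:
  "AE w in Q. \<forall>\<^sub>F k in sequentially. \<forall>x\<in>topspace M. \<forall>X\<in>tangent_space A x. X \<noteq> (\<lambda>_. 0) \<longrightarrow>
    (\<exists>i<k. tangent_deriv A x X (\<lambda>x. normalized_map F k w x i) \<noteq> 0)"
proof (rule compact_space_AE_eventually[OF compact_M])
  fix x assume x: "x \<in> topspace M"
  obtain c a s e where good: "good_cube c a s" and c: "c \<in> A" "x \<in> fst c"
    and e: "0 < e" "ball (snd c x) e \<subseteq> half_open_cube a s" and "snd c x \<in> box a (\<chi> i. a $ i + s)"
    by (rule good_cube_at[OF x])
  obtain l where l: "0 < l" "\<And>w. cube_law c a s w \<Longrightarrow>
    \<forall>\<^sub>F k in sequentially. \<forall>u\<in>half_open_cube a s. \<forall>v. l * (norm v)\<^sup>2 \<le>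
      (\<Sum>n<k. (\<Sum>i\<in>UNIV. v $ i * partial i (\<lambda>u. sample k w c u n) u)\<^sup>2)"
    using sample_lower_bound[OF good] by blast
  let ?W = "{z \<in> fst c. snd c z \<in> ball (snd c x) e}"
  have "AE w in Q. \<forall>\<^sub>F k in sequentially. \<forall>z\<in>?W. \<forall>X\<in>tangent_space A z. X \<noteq> (\<lambda>_. 0) \<longrightarrow>
    (\<exists>i<k. tangent_deriv A z X (\<lambda>x. normalized_map F k w x i) \<noteq> 0)"
    using AE_cube_law[OF good]
  proof eventually_elim
    fix w assume law: "cube_law c a s w"
    then have w: "regular w" by (simp add: cube_law_def)
    show "\<forall>\<^sub>F k in sequentially. \<forall>z\<in>?W. \<forall>X\<in>tangent_space A z. X \<noteq> (\<lambda>_. 0) \<longrightarrow>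
      (\<exists>i<k. tangent_deriv A z X (\<lambda>x. normalized_map F k w x i) \<noteq> 0)"
      using l(2)[OF law]
    proof (eventually_elim, intro ballI impI)
      fix k z X
      assume lo: "\<forall>u\<in>half_open_cube a s. \<forall>v. l * (norm v)\<^sup>2 \<le>
          (\<Sum>n<k. (\<Sum>i\<in>UNIV. v $ i * partial i (\<lambda>u. sample k w c u n) u)\<^sup>2)"
        and z: "z \<in> ?W" and X: "X \<in> tangent_space A z" and ne: "X \<noteq> (\<lambda>_. 0)"
      have cz: "c \<in> charts_at A z" using c z by (simp add: charts_at_def)
      \<comment> \<open>A tangent vector is determined by its component in one chart, since the
        other components are linear images of it.\<close>
      have "X c \<noteq> 0"
      proof
        assume Xc: "X c = 0"
        have "X c' = 0" for c'
        proof (cases "c' \<in> charts_at A z")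
          case True
          have "\<forall>c\<in>charts_at A z. \<forall>c'\<in>charts_at A z. X c' = frechet_derivative (transition c c') (at (snd c z)) (X c)"
            using X unfolding tangent_space_def mem_Collect_eq by (rule conjunct2)
          from this[rule_format, OF cz True] have e: "X c' = frechet_derivative (transition c c') (at (snd c z)) 0"
            by (simp only: Xc)
          have "transition c c' differentiable (at (snd c z))"
            by (rule trans_diff) (use True cz in \<open>auto simp: charts_at_def\<close>)
          from linear_0[OF frechet_derivative_linear[OF this]] show ?thesis by (simp only: e)
        next
          case False
          then show ?thesis using X unfolding tangent_space_def by blast
        qed
        then have "X = (\<lambda>_. 0)" by (rule ext)
        with ne show False by contradiction
      qed
      then have "0 < l * (norm (X c))\<^sup>2" using l(1) by simp
      also have "\<dots> \<le> (\<Sum>n<k. (\<Sum>i\<in>UNIV. X c $ i * partial i (\<lambda>u. sample k w c u n) (snd c z))\<^sup>2)"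
        using lo z e(2) by blast
      finally obtain n where n: "n < k" "(\<Sum>i\<in>UNIV. X c $ i * partial i (\<lambda>u. sample k w c u n) (snd c z)) \<noteq> 0"
      proof -
        assume pos: "0 < (\<Sum>n<k. (\<Sum>i\<in>UNIV. X c $ i * partial i (\<lambda>u. sample k w c u n) (snd c z))\<^sup>2)"
        have "\<not> (\<forall>n\<in>{..<k}. (\<Sum>i\<in>UNIV. X c $ i * partial i (\<lambda>u. sample k w c u n) (snd c z)) = 0)"
        proof
          assume "\<forall>n\<in>{..<k}. (\<Sum>i\<in>UNIV. X c $ i * partial i (\<lambda>u. sample k w c u n) (snd c z)) = 0"
          then have "(\<Sum>n<k. (\<Sum>i\<in>UNIV. X c $ i * partial i (\<lambda>u. sample k w c u n) (snd c z))\<^sup>2) = 0"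
            by (intro sum.neutral) simp
          with pos show False by (simp only: less_irrefl)
        qed
        then show ?thesis using that by blast
      qed
      have "tangent_deriv A z X (\<lambda>x. normalized_map F k w x n) = (\<Sum>i\<in>UNIV. X c $ i * partial i (\<lambda>u. sample k w c u n) (snd c z))"
      proof (rule tangent_deriv_chart[OF charts trans_diff X cz])
        show "(\<lambda>u. normalized_map F k w (param c0 u) n) differentiable (at (snd c0 z))" if "c0 \<in> charts_at A z" for c0
          by (rule Ck_on_differentiable[OF sample_C3[OF w]]) (use that in \<open>auto simp: charts_at_def\<close>)
      qed
      then show "\<exists>i<k. tangent_deriv A z X (\<lambda>x. normalized_map F k w x i) \<noteq> 0" using n by auto
    qed
  qed
  then show "\<exists>W. openin M W \<and> x \<in> W \<and> (AE w in Q. \<forall>\<^sub>F k in sequentially. \<forall>z\<in>W. \<forall>X\<in>tangent_space A z. X \<noteq> (\<lambda>_. 0) \<longrightarrow>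
    (\<exists>i<k. tangent_deriv A z X (\<lambda>x. normalized_map F k w x i) \<noteq> 0))" using chart_ball[OF c e(1)] by blast
qed

text \<open>A continuous injection of a compact space into a Hausdorff space is closed, hence a
  topological embedding; immersivity was obtained separately.\<close>

theorem AE_eventually_embedding:
  "AE w in Q. \<forall>\<^sub>F k in sequentially. C3_embedding M A k (normalized_map F k w)"
  using AE_eventually_inj AE_eventually_immersion AE_regular
proof eventually_elim
  fix w
  assume a: "\<forall>\<^sub>F k in sequentially. inj_on (normalized_map F k w) (topspace M)"
    "\<forall>\<^sub>F k in sequentially. \<forall>x\<in>topspace M. \<forall>X\<in>tangent_space A x. X \<noteq> (\<lambda>_. 0) \<longrightarrow>
       (\<exists>i<k. tangent_deriv A x X (\<lambda>x. normalized_map F k w x i) \<noteq> 0)" and w: "regular w"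
  show "\<forall>\<^sub>F k in sequentially. C3_embedding M A k (normalized_map F k w)"
    using a
  proof eventually_elim
    fix k
    let ?h = "normalized_map F k w"
    assume inj: "inj_on ?h (topspace M)" and imm: "\<forall>x\<in>topspace M. \<forall>X\<in>tangent_space A x. X \<noteq> (\<lambda>_. 0) \<longrightarrow>
       (\<exists>i<k. tangent_deriv A x X (\<lambda>x. ?h x i) \<noteq> 0)"
    have C3: "C3_fun A (\<lambda>x. ?h x i)" for i using sample_C3[OF w] by (simp add: C3_fun_def comp_def del: Ck_on.simps)
    have "continuous_map M (Euclidean_space k) ?h"
      unfolding Euclidean_space_def continuous_map_in_subtopology continuous_map_componentwise_UNIV
      using C3_fun_continuous_map[OF C3] by (auto simp: normalized_map_def)
    then have "embedding_map M (Euclidean_space k) ?h"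
      by (intro injective_closed_imp_embedding_map inj T1_Spaces.continuous_imp_closed_map compact_M Hausdorff_Euclidean_space)
    then show "C3_embedding M A k ?h" using C3 imm by (simp add: C3_embedding_def)
  qed
qed

end

section \<open>Convergence\<close>

context gaussian_copies
begin

text \<open>Open boxes provide the cover, while the closed cubes around them still lie in the chart
  images; the latter supplies compactness for bounds and for the range of the limiting jet.\<close>

lemma finite_cube_cover:
  obtains N :: nat and C a s where "\<And>i. i < N \<Longrightarrow> good_cube (C i) (a i) (s i)"
    "(\<Union>i<N. {x \<in> fst (C i). snd (C i) x \<in> box (a i) (\<chi> l. a i $ l + s i)}) = topspace M"
proof -
  let ?V = "\<lambda>(c, a, s). {x \<in> fst c. snd c x \<in> box a (\<chi> l. a $ l + s)}"
  let ?I = "{(c, a, s). good_cube c a s}"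
  have cov: "topspace M \<subseteq> \<Union>(?V ` ?I)"
  proof
    fix x assume x: "x \<in> topspace M"
    obtain c a s e where "good_cube c a s" "c \<in> A" "x \<in> fst c" "0 < e" "ball (snd c x) e \<subseteq> half_open_cube a s"
      "snd c x \<in> box a (\<chi> i. a $ i + s)" by (rule good_cube_at[OF x])
    then show "x \<in> \<Union>(?V ` ?I)" by (intro UN_I[of "(c, a, s)"]) auto
  qed
  have op: "openin M (?V t)" if "t \<in> ?I" for t
  proof -
    obtain c a s where t: "t = (c, a, s)" by (rule prod_cases3)
    then have c: "c \<in> A" using that by (simp add: good_cube_def)
    show ?thesis unfolding t case_prod_conv by (rule chart_preimage_openin[OF charts[OF c] open_box])
  qed
  have "\<exists>\<F>. finite \<F> \<and> \<F> \<subseteq> ?V ` ?I \<and> topspace M \<subseteq> \<Union>\<F>"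
    by (rule compact_M[unfolded compact_space_alt, rule_format]) (use cov op in blast)
  then obtain T where T: "T \<subseteq> ?I" "finite T" "topspace M \<subseteq> \<Union>(?V ` T)"
    by (elim exE conjE) (drule (1) finite_subset_image, blast)
  obtain h where h: "bij_betw h {0..<card T} T" using ex_bij_betw_nat_finite[OF T(2)] by blast
  then have hT: "h ` {..<card T} = T" by (simp add: bij_betw_def atLeast0LessThan)
  show ?thesis
  proof (rule that[of "card T" "\<lambda>i. fst (h i)" "\<lambda>i. fst (snd (h i))" "\<lambda>i. snd (snd (h i))"])
    show "good_cube (fst (h i)) (fst (snd (h i))) (snd (snd (h i)))" if "i < card T" for i
    proof -
      have "h i \<in> T" using imageI[of i "{..<card T}" h] that unfolding hT by simp
      with T(1) have "h i \<in> ?I" by (rule subsetD)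
      then show ?thesis by (simp add: case_prod_beta)
    qed
    have "(\<Union>i<card T. {x \<in> fst (fst (h i)). snd (fst (h i)) x \<in> box (fst (snd (h i))) (\<chi> l. fst (snd (h i)) $ l + snd (snd (h i)))})
      = \<Union>(?V ` h ` {..<card T})" by (simp add: case_prod_beta image_image)
    also have "\<dots> = topspace M"
      unfolding hT using T(3) op[THEN openin_subset] T(1) by (intro antisym UN_least) blast+
    finally show "(\<Union>i<card T. {x \<in> fst (fst (h i)). snd (fst (h i)) x \<in> box (fst (snd (h i))) (\<chi> l. fst (snd (h i)) $ l + snd (snd (h i)))})
      = topspace M" .
  qed
qed

text \<open>The cover and the sets \<open>E i\<close> are fixed before sampling, so both sides
  become finite sums of integrals of the same function \<open>\<Psi>\<close> over the same sets;
  only the jets vary with \<open>k\<close>.\<close>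

theorem AE_LKC_tendsto:
  "AE w in Q. (\<lambda>k. LKC_submanifold TYPE('m) k (normalized_map F k w ` topspace M) j) \<longlonglongrightarrow> LKC M A g j"
proof -
  obtain N :: nat and C a s where good: "\<And>i. i < N \<Longrightarrow> good_cube (C i) (a i) (s i)"
    and cover: "(\<Union>i<N. {x \<in> fst (C i). snd (C i) x \<in> box (a i) (\<chi> l. a i $ l + s i)}) = topspace M"
    by (rule finite_cube_cover) blast
  define V where "V i = {x \<in> fst (C i). snd (C i) x \<in> box (a i) (\<chi> l. a i $ l + s i)}" for i
  define E where "E i = snd (C i) ` (V i - (\<Union>j<i. V j))" for i
  define n where "n = (CARD('m) - j) div 2"
  define \<Psi> where "\<Psi> \<theta> = gauss_trace n \<theta> * sqrt (det (fst \<theta>))" for \<theta> :: "(real^'m^'m) \<times> (real^'m^'m^'m) \<times> (real^'m^'m^'m^'m)"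
  define J where "J i = field_jet (chart_field (C i))" for i
  define Jk where "Jk k w i = L2_space.field_jet (count_space {..<k}) (sample k w (C i))" for k w i
  let ?D = "{\<theta> :: (real^'m^'m) \<times> (real^'m^'m^'m) \<times> (real^'m^'m^'m^'m). det (fst \<theta>) \<noteq> 0}"
  have CA: "C i \<in> A" if "i < N" for i using good[OF that] by (simp add: good_cube_def)
  have U: "open (snd (C i) ` fst (C i))" if "i < N" for i by (rule chart_open_range[OF charts[OF CA[OF that]]])
  have K: "cbox (a i) (\<chi> l. a i $ l + s i) \<subseteq> snd (C i) ` fst (C i)" if "i < N" for i
    using good[OF that] by (simp add: good_cube_def)
  have Vo: "openin M (V i)" if "i < N" for i
    unfolding V_def by (rule chart_preimage_openin[OF charts[OF CA[OF that]] open_box])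
  have Vs: "V i \<subseteq> fst (C i)" for i by (auto simp: V_def)
  have Vc: "(\<Union>i<N. V i) = topspace M" using cover by (simp add: V_def)
  have detc: "continuous_on UNIV (\<lambda>\<theta> :: (real^'m^'m) \<times> (real^'m^'m^'m) \<times> (real^'m^'m^'m^'m). det (fst \<theta>))"
    by (intro continuous_on_det continuous_intros)
  have D: "open ?D" using detc by (intro open_Collect_neq) (auto intro: continuous_intros)
  have \<Psi>: "continuous_on ?D \<Psi>"
    unfolding \<Psi>_def
    by (intro continuous_on_mult continuous_on_gauss_trace continuous_on_real_sqrt continuous_on_subset[OF detc]) auto
  have Ebox: "E i \<subseteq> box (a i) (\<chi> l. a i $ l + s i)" for i by (auto simp: E_def V_def)
  have Ecube: "E i \<subseteq> half_open_cube (a i) (s i)" for i by (rule order_trans[OF Ebox box_half_open_cube])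
  have EU: "E i \<subseteq> snd (C i) ` fst (C i)" for i using Vs[of i] by (auto simp: E_def)
  have Eb: "E i \<in> sets borel" if i: "i < N" for i
  proof -
    note ch = charts[OF CA[OF i]]
    have Wo: "openin M (\<Union>j<i. V j)" using Vo i by (intro openin_Union) auto
    have "E i = snd (C i) ` ((V i \<inter> fst (C i)) - ((\<Union>j<i. V j) \<inter> fst (C i)))"
      using Vs[of i] unfolding E_def by (intro arg_cong[where f = "image (snd (C i))"]) blast
    also have "\<dots> = snd (C i) ` (V i \<inter> fst (C i)) - snd (C i) ` ((\<Union>j<i. V j) \<inter> fst (C i))"
      by (rule inj_on_image_set_diff[OF chart_inj[OF ch]]) auto
    finally show ?thesis
      using chart_open_image[OF ch Vo[OF i]] chart_open_image[OF ch Wo] by (metis borel_open sets.Diff)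
  qed
  have Ef: "emeasure lborel (E i) < \<infinity>" if i: "i < N" for i
  proof -
    have "emeasure lborel (E i) \<le> emeasure lborel (cbox (a i) (\<chi> l. a i $ l + s i))"
      by (rule emeasure_mono) (use Ebox[of i] box_subset_cbox in auto)
    also have "\<dots> < \<infinity>" by (rule emeasure_lborel_cbox_finite)
    finally show ?thesis .
  qed
  have Jcont: "continuous_on (snd (C i) ` fst (C i)) (J i)" if i: "i < N" for i
    unfolding J_def by (rule field_jet_continuous[OF U[OF i] field_chart[OF CA[OF i]]])
  have KJ: "compact (J i ` cbox (a i) (\<chi> l. a i $ l + s i))" if i: "i < N" for i
    by (rule compact_continuous_image[OF continuous_on_subset[OF Jcont[OF i] K[OF i]] compact_cbox])
  have jet: "mfd.jet (C i) u = J i u" for i u by (simp add: mfd.jet_field_jet J_def)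
  have JD: "J i ` cbox (a i) (\<chi> l. a i $ l + s i) \<subseteq> ?D" if i: "i < N" for i
    using mfd.det_jet_pos[OF CA[OF i]] K[OF i] unfolding jet by (force simp: subset_iff)
  have laws: "AE w in Q. \<forall>i\<in>{..<N}. cube_law (C i) (a i) (s i) w"
    unfolding AE_ball_countable[OF countable_finite[OF finite_lessThan]] using AE_cube_law good by auto
  show ?thesis
    using laws AE_eventually_embedding
  proof eventually_elim
    fix w assume law: "\<forall>i\<in>{..<N}. cube_law (C i) (a i) (s i) w"
      and emb: "\<forall>\<^sub>F k in sequentially. C3_embedding M A k (normalized_map F k w)"
    let ?Kc = "inverse ((- 2 * pi) ^ n) / fact n :: real"
    have lim: "set_integrable lborel (E i) (\<lambda>u. \<Psi> (J i u))
       \<and> (\<forall>\<^sub>F k in sequentially. set_integrable lborel (E i) (\<lambda>u. \<Psi> (Jk k w i u)))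
       \<and> (\<lambda>k. LINT u:E i|lborel. \<Psi> (Jk k w i u)) \<longlonglongrightarrow> (LINT u:E i|lborel. \<Psi> (J i u))" if i: "i < N" for i
    proof -
      have l: "cube_law (C i) (a i) (s i) w" using law i by simp
      then have w: "regular w" by (simp add: cube_law_def)
      have Jkc: "continuous_on (E i) (Jk k w i)" for k
        unfolding Jk_def
        by (rule continuous_on_subset[OF L2_space.field_jet_continuous[OF L2_space_count U[OF i] sample_field[OF w CA[OF i]]] EU])
      have sub: "J i ` half_open_cube (a i) (s i) \<subseteq> J i ` cbox (a i) (\<chi> l. a i $ l + s i)"
        by (rule image_mono[OF half_open_cube_cbox])
      have ul: "uniform_limit (half_open_cube (a i) (s i)) (\<lambda>k. Jk k w i) (J i) sequentially"
        unfolding Jk_def J_def by (rule jet_limit(2)[OF l])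
      note S = set_integral_uniform_limit[OF ul KJ[OF i] sub JD[OF i] D \<Psi> Ecube Eb[OF i] Ef[OF i] Jkc
          continuous_on_subset[OF Jcont[OF i] EU]]
      show ?thesis by (intro conjI S)
    qed
    have M: "LKC M A g j = (if even (CARD('m) - j) then ?Kc * (\<Sum>i<N. LINT u:E i|lborel. \<Psi> (J i u)) else 0)"
      using mfd.LKC_jet[of N C V j, OF CA Vo Vs Vc] lim
      unfolding E_def[symmetric] n_def[symmetric] jet \<Psi>_def[symmetric] by blast
    have int: "\<forall>\<^sub>F k in sequentially. \<forall>i\<in>{..<N}. set_integrable lborel (E i) (\<lambda>u. \<Psi> (Jk k w i u))"
      by (rule eventually_ball_finite) (use lim in auto)
    \<comment> \<open>The integral formula holds only for those large \<open>k\<close> for which the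
      map is an embedding and the integrands are integrable, which suffices for the limit.\<close>
    have ev: "\<forall>\<^sub>F k in sequentially. (if even (CARD('m) - j) then ?Kc * (\<Sum>i<N. LINT u:E i|lborel. \<Psi> (Jk k w i u)) else 0)
      = LKC_submanifold TYPE('m) k (normalized_map F k w ` topspace M) j"
      using emb int
    proof eventually_elim
      fix k assume e: "C3_embedding M A k (normalized_map F k w)"
        and int: "\<forall>i\<in>{..<N}. set_integrable lborel (E i) (\<lambda>u. \<Psi> (Jk k w i u))"
      show "(if even (CARD('m) - j) then ?Kc * (\<Sum>i<N. LINT u:E i|lborel. \<Psi> (Jk k w i u)) else 0)
        = LKC_submanifold TYPE('m) k (normalized_map F k w ` topspace M) j"
        using LKC_submanifold_embedding[of A M k "normalized_map F k w" N C V j, OF charts trans_diff e CA Vo Vs Vc] int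
        unfolding E_def[symmetric] n_def[symmetric] Jk_def[symmetric] \<Psi>_def[symmetric] by simp
    qed
    have "(\<lambda>k. if even (CARD('m) - j) then ?Kc * (\<Sum>i<N. LINT u:E i|lborel. \<Psi> (Jk k w i u)) else 0) \<longlonglongrightarrow> LKC M A g j"
      unfolding M using lim by (cases "even (CARD('m) - j)") (auto intro!: tendsto_intros)
    then show "(\<lambda>k. LKC_submanifold TYPE('m) k (normalized_map F k w ` topspace M) j) \<longlonglongrightarrow> LKC M A g j"
      by (rule Lim_transform_eventually[OF _ ev])
  qed
qed

end

theorem mainTheorem3:
  fixes M :: "'a topology"
    and A :: "('a, 'm::finite) chart set"
    and g :: "('a, 'm) metric_tensor"
    and P :: "'v measure" and f :: "'a \<Rightarrow> 'v \<Rightarrow> real"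
    and Q :: "'w measure" and F :: "nat \<Rightarrow> 'a \<Rightarrow> 'w \<Rightarrow> real"
  assumes "C3_manifold M A" and "compact_space M" and "connected_space M" and "orientable M A"
    and "riemannian_metric M A g"
    and "prob_space P"
    and "gaussian_process P (topspace M) f"
    and "\<And>x. x \<in> topspace M \<Longrightarrow> (\<integral>\<omega>. f x \<omega> \<partial>P) = 0"
    and "\<And>x. x \<in> topspace M \<Longrightarrow> covariance P f x x = 1"
    and "positive_definite_kernel (topspace M) (covariance P f)"
    and "AE \<omega> in P. C3_fun A (\<lambda>x. f x \<omega>)"
    and "nondegenerate_jets P A f"
    and "induces_metric P M A f g"
    and "prob_space Q"
    and "independent_copies P f M A Q F"
  shows "(AE \<omega> in Q. \<forall>\<^sub>F k in sequentially. C3_embedding M A k (normalized_map F k \<omega>)) \<and>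
    (\<forall>j\<le>CARD('m). AE \<omega> in Q.
      (\<lambda>k. LKC_submanifold TYPE('m) k (normalized_map F k \<omega> ` topspace M) j) \<longlonglongrightarrow> LKC M A g j)"
proof -
  have gm: "gaussian_manifold M A g P f" by (rule gaussian_manifold.intro) (fact assms)+
  interpret gaussian_copies M A g P f Q F
    by (rule gaussian_copies.intro[OF gm], rule gaussian_copies_axioms.intro) (fact assms)+
  show ?thesis using AE_eventually_embedding AE_LKC_tendsto by blast
qed

end
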